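(* Let $p \in (4,6)$ and let $g \in L^{6/(6-p)}(\mathbb{R}^3)$ be such that $g \geq 0$ and $\Omega := \{x \in \mathbb{R}^3 : g(x) > 0\}$ is a nonempty open subset of $\mathbb{R}^3$. Then for every $m \in \mathbb{N}$ there is $\lambda_m > 0$ such that for all $\lambda \geq \lambda_m$ the equation $$- \Delta u + \left( \frac{1}{4\pi |x|} \ast u^2 \right) u = \lambda g(x) |u|^{p-2} u + |u|^{6-2} u, \qquad u \in \mathcal{D}^{1,2}(\mathbb{R}^3),$$ has $m$ pairs of solutions $\pm u_1, \dots, \pm u_m$ (distinct pairs) with positive energy, i.e. $\Phi(u_j) > 0$ for $j=1,\dots,m$.
   Context: The Coulomb--Sobolev space is $$E = E(\mathbb{R}^3) = \left\{ u \in \mathcal{D}^{1,2}(\mathbb{R}^3) : \iint_{\mathbb{R}^3\times\mathbb{R}^3} \frac{u^2(x)u^2(y)}{|x-y|}\,dx\,dy < \infty \right\},$$ with the norm $$\|u\| = \left[ \int_{\mathbb{R}^3} |\nabla u|^2\,dx + \left( \iint \frac{u^2(x)u^2(y)}{|x-y|}\,dx\,dy \right)^{1/2} \right]^{1/2}.$$ The energy functional $\Phi : E \to \mathbb{R}$ is $$\Phi(u) = \frac12 \int_{\mathbb{R}^3} |\nabla u|^2\,dx + \frac{1}{16\pi} \iint \frac{u^2(x)u^2(y)}{|x-y|}\,dx\,dy - \frac{\lambda}{p} \int_{\mathbb{R}^3} g|u|^p\,dx - \frac16 \int_{\mathbb{R}^3} |u|^6\,dx,$$ which is of class $C^1$ on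 $E$. A solution of the equation means a (weak) solution $u\in E$, i.e. a critical point of $\Phi$: for all $v \in E$, $$\int \nabla u\cdot\nabla v + \frac{1}{4\pi}\iint \frac{u^2(x)u(y)v(y)}{|x-y|}\,dx\,dy - \lambda \int g|u|^{p-2}uv - \int |u|^{4}uv = 0.$$ The energy of a solution $u$ is $\Phi(u)$. Since $\Phi$ is even, solutions come in pairs $\pm u$. *)

theory Defs
  imports "HOL-Analysis.Analysis"
begin

text \<open>Elements of the function spaces below are represented by Lebesgue measurable functions, not
  by classes modulo null sets; equality in these spaces is therefore equality almost everywhere.\<close>

definition Lp :: "real \<Rightarrow> (real^3 \<Rightarrow> 'b::euclidean_space) set" where
  "Lp q = {f \<in> borel_measurable lebesgue. integrable lebesgue (\<lambda>x. norm (f x) powr q)}"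

definition partial_deriv :: "3 \<Rightarrow> (real^3 \<Rightarrow> real) \<Rightarrow> real^3 \<Rightarrow> real" where
  "partial_deriv i f x = frechet_derivative f (at x) (axis i 1)"

primrec Ck :: "nat \<Rightarrow> (real^3 \<Rightarrow> real) \<Rightarrow> bool" where
  "Ck 0 f \<longleftrightarrow> continuous_on UNIV f"
| "Ck (Suc k) f \<longleftrightarrow> f differentiable_on UNIV \<and> (\<forall>i. Ck k (partial_deriv i f))"

definition test_functions :: "(real^3 \<Rightarrow> real) set" where
  "test_functions = {\<phi>. (\<forall>k. Ck k \<phi>) \<and> compact (closure {x. \<phi> x \<noteq> 0})}"

definition locally_integrable :: "(real^3 \<Rightarrow> 'b::euclidean_space) \<Rightarrow> bool" where
  "locally_integrable f \<longleftrightarrow> (\<forall>K. compact K \<longrightarrow> f absolutely_integrable_on K)"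

definition has_weak_gradient :: "(real^3 \<Rightarrow> real) \<Rightarrow> (real^3 \<Rightarrow> real^3) \<Rightarrow> bool" where
  "has_weak_gradient u G \<longleftrightarrow>
     locally_integrable u \<and> locally_integrable G \<and>
     (\<forall>\<phi>\<in>test_functions. \<forall>i.
        (LINT x|lebesgue. u x * partial_deriv i \<phi> x) = - (LINT x|lebesgue. G x $ i * \<phi> x))"

text \<open>A weak gradient is unique up to null sets, so the integrals in which it occurs below do not
  depend on the choice.\<close>

definition weak_grad :: "(real^3 \<Rightarrow> real) \<Rightarrow> real^3 \<Rightarrow> real^3" where
  "weak_grad u = (SOME G. has_weak_gradient u G)"

text \<open>The homogeneous Sobolev space, realised as a space of functions: by Sobolev's inequality the
  completion of the test functions in the norm \<open>\<parallel>\<nabla>u\<parallel>\<^sub>2\<close> embeds into \<open>L\<^sup>6\<close>, with this image.\<close>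

definition D12 :: "(real^3 \<Rightarrow> real) set" where
  "D12 = {u \<in> Lp 6. (\<exists>G. has_weak_gradient u G) \<and> weak_grad u \<in> Lp 2}"

text \<open>The convention \<open>a / 0 = 0\<close> affects the kernel only on the diagonal, a null set.\<close>

definition coulomb_energy_density :: "(real^3 \<Rightarrow> real) \<Rightarrow> (real^3) \<times> (real^3) \<Rightarrow> real" where
  "coulomb_energy_density u = (\<lambda>(x, y). (u x)\<^sup>2 * (u y)\<^sup>2 / norm (x - y))"

definition E :: "(real^3 \<Rightarrow> real) set" where
  "E = {u \<in> D12. integrable (lebesgue \<Otimes>\<^sub>M lebesgue) (coulomb_energy_density u)}"

definition Phi :: "real \<Rightarrow> real \<Rightarrow> (real^3 \<Rightarrow> real) \<Rightarrow> (real^3 \<Rightarrow> real) \<Rightarrow> real" where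
  "Phi p lam g u =
     1 / 2 * (LINT x|lebesgue. (norm (weak_grad u x))\<^sup>2)
     + 1 / (16 * pi) * (LINT z|(lebesgue \<Otimes>\<^sub>M lebesgue). coulomb_energy_density u z)
     - lam / p * (LINT x|lebesgue. g x * \<bar>u x\<bar> powr p)
     - 1 / 6 * (LINT x|lebesgue. \<bar>u x\<bar> ^ 6)"

definition is_solution :: "real \<Rightarrow> real \<Rightarrow> (real^3 \<Rightarrow> real) \<Rightarrow> (real^3 \<Rightarrow> real) \<Rightarrow> bool" where
  "is_solution p lam g u \<longleftrightarrow> u \<in> E \<and>
     (\<forall>v\<in>E.
        (LINT x|lebesgue. weak_grad u x \<bullet> weak_grad v x)
        + 1 / (4 * pi) *
          (LINT (x, y)|(lebesgue \<Otimes>\<^sub>M lebesgue). (u x)\<^sup>2 * u y * v y / norm (x - y))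
        - lam * (LINT x|lebesgue. g x * \<bar>u x\<bar> powr (p - 2) * u x * v x)
        - (LINT x|lebesgue. \<bar>u x\<bar> ^ 4 * u x * v x) = 0)"

definition same_pair :: "(real^3 \<Rightarrow> real) \<Rightarrow> (real^3 \<Rightarrow> real) \<Rightarrow> bool" where
  "same_pair u v \<longleftrightarrow> (AE x in lebesgue. u x = v x) \<or> (AE x in lebesgue. u x = - v x)"

end

theory Submission
 imports Defs "HOL-Homology.Invariance_of_Domain" "HOL-Probability.Distributions"
  "HOL-Library.Diagonal_Subsequence" "HOL-Library.Function_Algebras"
begin

text \<open>The solutions are critical points of \<open>\<Phi>\<close> on the Nehari manifold. Each \<open>u \<in> E\<close> with a nonzero gradient
has exactly one positive multiple on it, and on it \<open>\<Phi>\<close> is at least a quarter of the gradient energy.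
Below a fixed level the gradient is therefore small and, by the Sobolev inequality, so is the critical
term; since the Coulomb term is monotone and the subcritical term is locally compact, bounded
Palais--Smale sequences converge. Combinations of \<open>m + 1\<close> disjoint bumps supported in \<open>{g > 0}\<close> give an odd
map from \<open>S\<^sup>m\<close> to the manifold, which lies below this level as soon as \<open>\<lambda>\<close> is large. If there were only \<open>k \<le> m\<close>
pairs \<open>\<plusminus>u\<^sub>i\<close> of critical points, an odd discrete descent would move each trajectory of this sphere to some
\<open>\<plusminus>u\<^sub>i\<close>, and no trajectory can visit both signs. The differences of the times spent near \<open>u\<^sub>i\<close> and near \<open>- u\<^sub>i\<close>
would be \<open>k\<close> odd functions on \<open>S\<^sup>m\<close> without a common zero, contradicting the Borsuk--Ulam theorem.

The Sobolev inequality comes from the Loomis--Whitney inequality for the averages over dyadic cells,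
positivity of the Coulomb energy from writing its kernel as a superposition of heat kernels, and
Borsuk--Ulam from the degree of odd maps by induction on the dimension.\<close>

text \<open>Each of the four terms of the energy is treated as a convex homogeneous functional, of
  degree 2, 4, \<open>p\<close> or 6, and given by its derivative form; boundedness, Lipschitz
  estimates and continuity of the derivative all come from one inequality of Young type. The degree
  4 of the Coulomb term is why \<open>p > 4\<close> matters: it gives the energy a single maximum on
  each ray and lets a large lambda push that maximum below any prescribed level. Pseudo-gradients
  are built as maps on the parameter sphere, whose compactness permits finite partitions of unity
  and a fixed number of steps of fixed length. The obstacle is loss of compactness at the exponent
  6. The level 1/40000 is chosen against the explicit Sobolev constant 262144 = 2^18 so that, in the
  difference of two derivatives, the critical term takes at most half of the gradient term; the
  level is fixed before lambda, since the same sphere of bumps serves all large lambda. Functions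
  agreeing almost everywhere are not identified, so the norm is a seminorm and distinct pairs are
  pairs at positive distance.\<close>

type_synonym fn = "real^3 => real"
type_synonym enn = ennreal
abbreviation "pd == partial_deriv"
abbreviation "wgrad == has_weak_gradient"
abbreviation "loc_int == locally_integrable"
abbreviation "ind == indicator"
abbreviation "enn == ennreal"
lemmas Lintegrable_bound = Bochner_Integration.integrable_bound
 and Lintegrable_add = Bochner_Integration.integrable_add
 and Lintegrable_diff = Bochner_Integration.integrable_diff
 and Lintegral_add = Bochner_Integration.integral_add
 and Lintegral_diff = Bochner_Integration.integral_diff
abbreviation leb :: "'a::euclidean_space measure" where "leb == lebesgue"
abbreviation "bmeas == borel_measurable leb"
abbreviation "integ == integrable leb"
abbreviation "LI == integral\<^sup>L leb"
abbreviation "NL == nn_integral leb"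
abbreviation "NB == nn_integral lborel"
abbreviation "NC == nn_integral (count_space UNIV)"
notation scaleR (infixr "*R" 75)
abbreviation "l1 n x y == \<Sum>i\<le>n. abs (x i - y i :: real)"
notation tendsto (infixr "--->" 55)
abbreviation iffa (infixr "<->" 25) where "A <-> B == A = (B :: bool)"
notation LIMSEQ ("((_)/ ----> (_))" [60, 60] 60)

section \<open>Odd maps of spheres\<close>

text \<open>The unit sphere of R^(n+1), encoded as in \<open>nsphere\<close> by sequences that
  vanish beyond index \<open>n\<close>; with this encoding \<open>SS n\<close> is literally the
  equator of \<open>SS (Suc n)\<close>, which the induction on the dimension exploits.\<close>

definition SS :: "nat => (nat => real) set" where
 "SS n = {x. (\<Sum>i\<le>n. (x i)^2) = 1 & (ALL i>n. x i = 0)}"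

text \<open>Radial projection to the sphere. Coordinates beyond \<open>n\<close> are ignored, so
  maps into the sphere can be given and deformed by their first \<open>n + 1\<close> coordinates
  only.\<close>

definition nrm :: "nat => (nat => real) => nat => real" where
 "nrm n y = (%i. if i <= n then y i / sqrt (\<Sum>j\<le>n. (y j)^2) else 0)"

lemma nsphere_SS: "nsphere n = top_of_set (SS n)" by(simp add: nsphere SS_def euclidean_product_topology)

lemma topspace_SS: "topspace (nsphere n) = SS n" by(simp add: nsphere_SS)

lemma coord_cont [continuous_intros]: "continuous_on A (%x::nat => real. x i)" by(rule continuous_on_subset[OF continuous_on_product_coordinates]) auto

lemma SS_neg: "x : SS n ==> (%i. - x i) : SS n" by(simp add: SS_def)

lemma SS_le1: assumes "x : SS n" shows "abs (x i) <= 1"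
proof (cases "i <= n")
 case True
 have "(x i)^2 <= (\<Sum>i\<le>n. (x i)^2)" using True by(intro member_le_sum) auto
 thus ?thesis using assms by(simp add: SS_def abs_square_le_1)
qed (use assms in \<open>auto simp: SS_def\<close>)

lemma SS_mono: "SS n \<subseteq> SS (Suc n)"
proof
 fix x assume "x : SS n"
 thus "x : SS (Suc n)" by(auto simp: SS_def)
qed

lemma SS_equator: "x : SS (Suc n) ==> x (Suc n) = 0 ==> x : SS n" by(auto simp: SS_def) (metis Suc_lessI)

lemma SS_compact: "compact (SS n)"
proof -
 let ?C = "PiE UNIV (%i::nat. {-1..1::real})"
 have "compactin (product_topology (%i::nat. euclideanreal) UNIV) ?C" by(subst compactin_PiE) (simp add: compactin_euclidean_iff)
 hence C: "compact ?C" by(simp add: euclidean_product_topology compactin_euclidean_iff)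
 have "closed {x::nat=>real. (\<Sum>i\<le>n. (x i)^2) = 1}" by(intro closed_Collect_eq continuous_intros)
 moreover have "closed {x::nat=>real. ALL i>n. x i = 0}" by(intro closed_Collect_all closed_Collect_imp closed_Collect_eq continuous_intros) simp
 ultimately have "closed (SS n)" by(simp add: SS_def Collect_conj_eq closed_Int)
 moreover have "SS n \<subseteq> ?C" using SS_le1 by(fastforce simp: abs_le_iff)
 ultimately show ?thesis using C compact_Int_closed by(metis inf.absorb_iff2)
qed

lemma SS_nonempty: "SS n ~= {}" using in_topspace_nsphere topspace_SS by blast

lemma nrm_in: assumes "EX i<=n. y i ~= 0" shows "nrm n y : SS n"
proof -
 have "(\<Sum>j\<le>n. (y j)^2) > 0" using assms by(metis (mono_tags) atMost_iff finite_atMost sum_pos2 zero_le_power2 zero_less_power2)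
 thus ?thesis unfolding SS_def nrm_def by(simp add: power_divide sum_nonneg flip: sum_divide_distrib)
qed

lemma nrm_cont:
 fixes f :: "'a::topological_space => nat => real"
 assumes "!!i. i <= n ==> continuous_on A (%x. f x i)"
  and "!!x. x : A ==> EX i<=n. f x i ~= 0"
 shows "continuous_on A (%x. nrm n (f x))"
proof (rule continuous_on_coordinatewise_then_product)
 fix i
 have "(\<Sum>j\<le>n. (f x j)^2) ~= 0" if "x : A" for x using assms(2)[OF that] by(auto simp: sum_nonneg_eq_0_iff)
 thus "continuous_on A (%x. nrm n (f x) i)" unfolding nrm_def using assms(1) by(cases "i <= n") (auto intro!: continuous_intros)
qed

section \<open>Degrees of odd maps and the Borsuk--Ulam theorem\<close>

definition Deg :: "nat => ((nat => real) => nat => real) => int" where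
 "Deg n f = Brouwer_degree2 n (%x. nrm n (f x))"

lemma Deg_homotopy:
 assumes H: "!!i. i <= n ==> continuous_on ({0..1} \<times> SS n) (%p. H (fst p) (snd p) i)"
  and nz: "!!t x. 0 <= t ==> t <= 1 ==> x : SS n ==> EX i<=n. H t x i ~= 0"
 shows "Deg n (H (0::real)) = Deg n (H 1)" unfolding Deg_def
proof (rule Brouwer_degree2_homotopic)
 let ?h = "%p. nrm n (H (fst p) (snd p))"
 have c: "continuous_on ({0..1} \<times> SS n) ?h" by(rule nrm_cont) (use H nz in auto)
 have "?h ` ({0..1} \<times> SS n) \<subseteq> SS n" using nz nrm_in by auto
 hence cm: "continuous_map (prod_topology (top_of_set {0..1}) (nsphere n)) (nsphere n) ?h" using c by(auto simp: nsphere_SS)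
 show "homotopic_with (%x. True) (nsphere n) (nsphere n) (%x. nrm n (H 0 x)) (%x. nrm n (H 1 x))" unfolding homotopic_with_def by(rule exI[of _ ?h]) (use cm in auto)
qed

lemma Deg_cong: "(!!x i. x : SS n ==> i <= n ==> f x i = g x i) ==> Deg n f = Deg n g" unfolding Deg_def by(rule Brouwer_degree2_eq) (auto simp: topspace_SS nrm_def)

text \<open>Stone--Weierstrass applied to the ring of functions that are Lipschitz for the l1
  distance; replacing \<open>h\<close> by its odd part keeps the error and the Lipschitz constant.
  Lipschitz maps are wanted because the counting argument in \<open>direction_missed\<close> fails
  for merely continuous ones.\<close>

lemma lipschitz_approx:
 fixes f :: "(nat => real) => real"
 assumes f: "continuous_on (SS n) f" and odd: "!!x. x : SS n ==> f (%i. - x i) = - f x"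
  and e: "e > 0"
 obtains g L where "continuous_on (SS n) g" "!!x. x : SS n ==> g (%i. - x i) = - g x"
  "!!x. x : SS n ==> abs (f x - g x) < e" "L >= 0"
  "!!x y. x : SS n ==> y : SS n ==> abs (g x - g y) <= L * l1 n x y"
proof -
 define R where "R = {h::(nat => real) => real. continuous_on (SS n) h & (EX L>=0. ALL x:SS n. ALL y:SS n. abs (h x - h y) <= L * l1 n x y)}"
 interpret function_ring_on R "SS n"
 proof
  show "compact (SS n)" by(rule SS_compact)
  show "!!f. f : R ==> continuous_on (SS n) f" by(simp add: R_def)
  show "(%x. f x + g x) : R" if fg: "f : R" "g : R" for f g
  proof -
   from fg obtain L1 L2 where c: "continuous_on (SS n) f" "continuous_on (SS n) g" and L: "L1 >= 0" "L2 >= 0"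
     "!!x y. x:SS n ==> y:SS n ==> abs (f x - f y) <= L1 * l1 n x y"
     "!!x y. x:SS n ==> y:SS n ==> abs (g x - g y) <= L2 * l1 n x y" unfolding R_def by blast
   have "abs (f x + g x - (f y + g y)) <= (L1 + L2) * l1 n x y" if "x:SS n" "y:SS n" for x y using L(3)[OF that] L(4)[OF that] by(simp add: algebra_simps)
   thus ?thesis unfolding R_def using c L by(auto intro!: continuous_intros exI[of _ "L1+L2"])
  qed
  show "(%x. f x * g x) : R" if fg: "f : R" "g : R" for f g
  proof -
   from fg obtain L1 L2 where c: "continuous_on (SS n) f" "continuous_on (SS n) g" and L: "L1 >= 0" "L2 >= 0"
     "!!x y. x:SS n ==> y:SS n ==> abs (f x - f y) <= L1 * l1 n x y"
     "!!x y. x:SS n ==> y:SS n ==> abs (g x - g y) <= L2 * l1 n x y" unfolding R_def by blast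
   have "bounded (f ` SS n)" "bounded (g ` SS n)" using c SS_compact by(meson compact_continuous_image compact_imp_bounded)+
   then obtain M1 M2 where M: "!!x. x : SS n ==> abs (f x) <= M1" "!!x. x : SS n ==> abs (g x) <= M2" unfolding bounded_iff by auto
   have M0: "M1 >= 0" "M2 >= 0" using M SS_nonempty by(force)+
   have "abs (f x * g x - f y * g y) <= (M1 * L2 + M2 * L1) * l1 n x y" if xy: "x:SS n" "y:SS n" for x y
   proof -
    have "abs (f x * g x - f y * g y) = abs (f x * (g x - g y) + g y * (f x - f y))" by(simp add: algebra_simps)
    also have "... <= abs (f x) * abs (g x - g y) + abs (g y) * abs (f x - f y)" by(metis abs_mult abs_triangle_ineq)
    also have "... <= M1 * (L2 * l1 n x y) + M2 * (L1 * l1 n x y)" using xy M M0 L by(intro add_mono mult_mono) auto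
    finally show ?thesis by(simp add: algebra_simps)
   qed
   thus ?thesis unfolding R_def using c L M0 by(auto intro!: continuous_intros exI[of _ "M1 * L2 + M2 * L1"])
  qed
  show "(%_. c) : R" for c by(auto simp: R_def intro!: exI[of _ 0])
  show "EX f:R. f x ~= f y" if xy: "x : SS n" "y : SS n" "x ~= y" for x y
  proof -
   obtain i where i: "x i ~= y i" using xy by auto
   hence "i <= n" using xy by(metis (mono_tags, lifting) SS_def mem_Collect_eq not_le)
   hence "abs (x i - y i) <= 1 * l1 n x y" for x y :: "nat => real" using member_le_sum[of i "{..n}" "%i. abs (x i - y i)"] by simp
   hence "(%x. x i) : R" unfolding R_def by(auto intro!: continuous_intros exI[of _ 1])
   thus ?thesis using i by(intro bexI[of _ "%x. x i"])
  qed
 qed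
 obtain h where h: "h : R" "!!x. x : SS n ==> abs (f x - h x) < e" using Stone_Weierstrass_basic[OF f e] by auto
 then obtain L where L: "L >= 0" "continuous_on (SS n) h"
   "!!x y. x:SS n ==> y:SS n ==> abs (h x - h y) <= L * l1 n x y" unfolding R_def by blast
 define g where "g x = (h x - h (%i. - x i)) / 2" for x
 have cn: "continuous_on (SS n) (%x. h (%i. - x i))" by(rule continuous_on_compose2[OF L(2)])
    (auto intro!: SS_neg continuous_on_coordinatewise_then_product continuous_intros)
 have aux: "abs (a - b) < e ==> abs (- a - c) < e ==> abs (a - (b - c) / 2) < e"
  "abs (b - b') <= e' ==> abs (c - c') <= e' ==> abs ((b - c) / 2 - (b' - c') / 2) <= e'" for a b b' c c' e' :: real by(simp_all add: abs_less_iff abs_le_iff field_simps)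
 show ?thesis
 proof (rule that[of g L])
  show "continuous_on (SS n) g" unfolding g_def using L cn by(intro continuous_intros) auto
  show "g (%i. - x i) = - g x" for x by(simp add: g_def field_simps)
  show "abs (f x - g x) < e" if "x : SS n" for x
  proof -
   have "abs (- f x - h (%i. - x i)) < e" using h(2)[OF SS_neg[OF that]] odd[OF that] by simp
   with h(2)[OF that] show ?thesis unfolding g_def by(rule aux(1))
  qed
  show "abs (g x - g y) <= L * l1 n x y" if "x : SS n" "y : SS n" for x y
  proof -
   have "abs (h (%i. - x i) - h (%i. - y i)) <= L * l1 n x y" using L(3)[OF SS_neg[OF that(1)] SS_neg[OF that(2)]] by(simp add: abs_minus_commute)
   with L(3)[OF that] show ?thesis unfolding g_def by(rule aux(2))
  qed
 qed (use L in auto)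
qed

text \<open>A Lipschitz odd map of the \<open>n\<close>-sphere into R^(n+2) cannot meet every line
  through the origin, by counting: extended homogeneously it is a Lipschitz map from R^(n+1), and a
  number of small cubes of order N^(n+1) cannot serve N^(n+2) separated targets. The missed line is
  spanned by \<open>(y, 1)\<close>.\<close>

lemma direction_missed:
 fixes g :: "(nat => real) => nat => real"
 assumes odd: "!!x i. x : SS n ==> i <= Suc n ==> g (%i. - x i) i = - g x i"
  and L: "L >= 0" "!!x y i. x : SS n ==> y : SS n ==> i <= Suc n ==> abs (g x i - g y i) <= L * l1 n x y"
  and M: "!!x i. x : SS n ==> i <= Suc n ==> abs (g x i) <= M"
  and nu: "nu > 0" "!!x. x : SS n ==> EX i<=Suc n. abs (g x i) >= nu"
 obtains y where "!!x. x : SS n ==> EX i<=n. g x i ~= g x (Suc n) * y i"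
proof (rule ccontr)
 assume "~ thesis"
 hence hit: "EX x:SS n. ALL i<=n. g x i = g x (Suc n) * y i" for y using that by blast
 have M0: "M >= 0" using SS_nonempty M[of _ 0] by(metis abs_ge_zero all_not_in_conv order_trans zero_le)
 \<comment> \<open>\<open>La\<close> is an l1 Lipschitz constant for the homogeneous extension,
   which takes \<open>c x\<close> to \<open>c g x\<close>. Cubes of side 1 / (N k0) have l1 diameter
   at most (n + 1) / (N k0), so by the choice of \<open>k0\<close> their images have diameter below
   1 / N. \<open>r0\<close> bounds the radius \<open>c\<close>, and \<open>N\<close> exceeds
   \<open>q ^ (n + 1)\<close> to make the final count contradictory.\<close>
 define La where "La = M + L * (n + 2)"
 have Lam0: "La >= 0" using M0 L by(simp add: La_def)
 obtain k1 :: nat where k1: "La < k1" using reals_Archimedean2 by blast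
 obtain r0 :: nat where r0: "2 / nu < r0" using reals_Archimedean2 by blast
 define k0 where "k0 = k1 * (n + 1)"
 have k0: "La * (n + 1) < k0" using mult_strict_right_mono[OF k1, of "real (n + 1)"] unfolding k0_def of_nat_mult by simp
 define q where "q = 2 * k0 * r0 + 1"
 define N where "N = q ^ (n + 1) + 1"
 have N0: "N > 0" by(simp add: N_def)
 \<comment> \<open>The targets have last coordinate in [1, 2), hence lie on lines of the form
   \<open>(y, 1)\<close>; distinct indices \<open>a\<close> give targets that differ by at least 1 /
   N in some coordinate.\<close>
 define Y where "Y a i = (if i <= n then real (a i) / N else 1 + real (a i) / N)" for a :: "nat => nat" and i
 define A where "A = PiE {..Suc n} (%_. {..<N})"
 have hitY: "EX c x. c > 0 & x : SS n & (ALL i<=Suc n. c * g x i = Y a i)" for a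
 proof -
  obtain x where x: "x : SS n" "!!i. i <= n ==> g x i = g x (Suc n) * (Y a i / Y a (Suc n))" using hit[of "%i. Y a i / Y a (Suc n)"] by blast
  have Yp: "Y a (Suc n) > 0" by(simp add: Y_def add_pos_nonneg)
  have nz: "g x (Suc n) ~= 0"
  proof
   assume z: "g x (Suc n) = 0"
   hence "g x i = 0" if "i <= Suc n" for i using x(2)[of i] that by(cases "i = Suc n") auto
   thus False using nu(2)[OF x(1)] nu(1) by auto
  qed
  define c where "c = Y a (Suc n) / g x (Suc n)"
  have c: "c * g x i = Y a i" if "i <= Suc n" for i using x(2)[of i] that nz Yp by(cases "i = Suc n") (auto simp: c_def)
  show ?thesis
  proof (cases "c > 0")
   case True thus ?thesis using c x(1) by blast
  next
   case False
   hence "- c > 0" using nz Yp by(auto simp: c_def zero_less_divide_iff divide_less_0_iff)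
   moreover have "- c * g (%i. - x i) i = Y a i" if "i <= Suc n" for i using odd[OF x(1) that] c[OF that] by simp
   ultimately show ?thesis using SS_neg[OF x(1)] by blast
  qed
 qed
 then obtain c x where cx: "!!a. c a > 0" "!!a. x a : SS n" "!!a i. i <= Suc n ==> c a * g (x a) i = Y a i" by metis
 have cR: "c a < r0" if a: "a : A" for a
 proof -
  obtain i where i: "i <= Suc n" "abs (g (x a) i) >= nu" using nu(2) cx(2) by blast
  have "a i < N" using a i by(auto simp: A_def PiE_def Pi_def)
  hence "abs (Y a i) <= 2" using N0 by(auto simp: Y_def field_simps)
  hence "c a * abs (g (x a) i) <= 2" using cx(3)[OF i(1), of a] cx(1)[of a] by(metis abs_mult abs_of_pos)
  moreover have "c a * nu <= c a * abs (g (x a) i)" using i cx(1)[of a] by simp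
  ultimately have "c a * nu <= 2" by linarith
  hence "c a <= 2 / nu" using nu(1) by(simp add: field_simps)
  thus ?thesis using r0 by linarith
 qed
 define K where "K = real (N * k0)"
 have k0p: "k0 > 0" using k0 Lam0 by(metis gr0I less_le_not_le mult_nonneg_nonneg of_nat_0 of_nat_0_le_iff)
 have K0: "K > 0" using N0 k0p by(simp add: K_def)
 define cell where "cell a = restrict (%j. floor (K * (c a * x a j))) {..n}" for a
 define B where "B = int (N * k0 * r0)"
 have "cell a : PiE {..n} (%_. {-B..B})" if a: "a : A" for a
 proof -
  have "floor (K * (c a * x a j)) : {-B..B}" for j
  proof -
   have "abs (c a * x a j) <= r0"
   proof -
    have "abs (c a * x a j) = c a * abs (x a j)" using cx(1)[of a] by(simp add: abs_mult)
    also have "... <= c a * 1" using cx(1)[of a] SS_le1[OF cx(2)] by(intro mult_left_mono) auto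
    also have "... <= r0" using cR[OF a] by simp
    finally show ?thesis .
   qed
   hence "abs (K * (c a * x a j)) <= K * r0" using K0 by(simp add: abs_mult mult_left_mono)
   hence "abs (K * (c a * x a j)) <= of_int B" by(simp add: K_def B_def)
   thus ?thesis by(simp add: le_floor_iff floor_le_iff) linarith
  qed
  thus ?thesis by(auto simp: cell_def)
 qed
 moreover have "inj_on cell A"
 proof (rule inj_onI)
  fix a b assume ab: "a : A" "b : A" and eq: "cell a = cell b"
  define z where "z j = c a * x a j" for j
  define w where "w j = c b * x b j" for j
  define sg where "sg = l1 n z w"
  have zw: "abs (z j - w j) <= 1 / K" if "j <= n" for j
  proof -
   have "floor (K * z j) = floor (K * w j)" using fun_cong[OF eq, of j] that by(simp add: cell_def z_def w_def)
   hence "abs (K * z j - K * w j) <= 1" by(smt (verit) floor_correct of_int_floor_le real_of_int_floor_add_one_gt)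
   hence "K * abs (z j - w j) <= 1" using K0 by(metis abs_mult abs_of_pos right_diff_distrib)
   thus ?thesis using K0 by(simp add: field_simps)
  qed
  have "sg <= (\<Sum>j\<le>n. 1 / K)" unfolding sg_def by(intro sum_mono zw) auto
  hence sK: "sg <= (n + 1) / K" by simp
  have s0: "sg >= 0" by(simp add: sg_def sum_nonneg)
  have nz: "(\<Sum>j\<le>n. (z j)^2) = (c a)^2" "(\<Sum>j\<le>n. (w j)^2) = (c b)^2"
   using cx(2)[of a] cx(2)[of b] by(simp_all add: z_def w_def power_mult_distrib SS_def flip: sum_distrib_left)
  have zle: "abs (z j) <= c a" "abs (w j) <= c b" for j using SS_le1[OF cx(2)] cx(1) by(simp_all add: z_def w_def abs_mult mult_left_le less_imp_le)
  \<comment> \<open>\<open>c a\<close> and \<open>c b\<close> are the Euclidean norms of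
    \<open>z\<close> and \<open>w\<close>, because \<open>x a\<close> and \<open>x b\<close> lie on
    the sphere; hence they differ by at most the l1 distance \<open>sg\<close>.\<close>
  have "(c a)^2 - (c b)^2 = (\<Sum>j\<le>n. (z j - w j) * (z j + w j))" unfolding nz[symmetric] sum_subtractf[symmetric]
   by(intro sum.cong) (auto simp: power2_eq_square algebra_simps)
  hence "abs ((c a)^2 - (c b)^2) = abs (\<Sum>j\<le>n. (z j - w j) * (z j + w j))" by simp
  also have "... <= (\<Sum>j\<le>n. abs ((z j - w j) * (z j + w j)))" by(rule sum_abs)
  also have "... <= (\<Sum>j\<le>n. abs (z j - w j) * (c a + c b))"
   unfolding abs_mult using zle by(intro sum_mono mult_left_mono) (auto intro: order_trans[OF abs_triangle_ineq add_mono])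
  also have "... = sg * (c a + c b)" by(simp add: sg_def sum_distrib_right)
  finally have "abs (c a - c b) * (c a + c b) <= sg * (c a + c b)" using cx(1)[of a] cx(1)[of b]
   by(metis abs_mult abs_of_pos add_pos_pos mult.commute power2_eq_square square_diff_square_factored)
  hence cd: "abs (c a - c b) <= sg" using cx(1)[of a] cx(1)[of b] by(simp add: add_pos_pos)
  have xy: "c b * (\<Sum>j\<le>n. abs (x a j - x b j)) <= sg * (n + 2)"
  proof -
   have "c b * (\<Sum>j\<le>n. abs (x a j - x b j)) = (\<Sum>j\<le>n. abs (c b * x a j - c b * x b j))"
    using cx(1)[of b] by(simp add: sum_distrib_left abs_mult right_diff_distrib[symmetric])
   also have "... <= (\<Sum>j\<le>n. abs (z j - w j) + sg)"
   proof (rule sum_mono)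
    fix j
    have "abs (c b * x a j - z j) = abs (c a - c b) * abs (x a j)" by(simp add: z_def left_diff_distrib[symmetric] abs_mult abs_minus_commute)
    also have "... <= sg * 1" using cd s0 SS_le1[OF cx(2)] by(intro mult_mono) auto
    finally show "abs (c b * x a j - c b * x b j) <= abs (z j - w j) + sg" unfolding w_def by linarith
   qed
   also have "... = sg * (n + 2)" by(simp add: sum.distrib sg_def[symmetric] algebra_simps)
   finally show ?thesis .
  qed
  have "a i = b i" if i: "i <= Suc n" for i
  proof -
   have "abs (Y a i - Y b i) = abs ((c a - c b) * g (x a) i + c b * (g (x a) i - g (x b) i))" using cx(3)[OF i, of a] cx(3)[OF i, of b] by(simp add: algebra_simps)
   also have "... <= abs (c a - c b) * abs (g (x a) i) + c b * abs (g (x a) i - g (x b) i)" using cx(1)[of b] by(metis abs_mult abs_of_pos abs_triangle_ineq)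
   also have "... <= sg * M + c b * (L * (\<Sum>j\<le>n. abs (x a j - x b j)))" using cd s0 M[OF cx(2) i] L(2)[OF cx(2) cx(2) i] cx(1)[of b]
    by(intro add_mono mult_mono) (auto simp: less_imp_le)
   also have "... <= sg * M + L * (sg * (n + 2))" using mult_left_mono[OF xy L(1)] by(simp add: mult.left_commute)
   also have "... = sg * La" by(simp add: La_def algebra_simps)
   also have "... <= (n + 1) / K * La" using sK Lam0 by(rule mult_right_mono)
   also have "... < 1 / N"
   proof -
    have "La * (n + 1) / k0 < 1" using k0 k0p by simp
    hence "(La * (n + 1) / k0) / N < 1 / N" by(rule divide_strict_right_mono) (use N0 in simp)
    thus ?thesis by(simp add: K_def mult.commute)
   qed
   finally have *: "abs (Y a i - Y b i) < 1 / N" .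
   have "Y a i - Y b i = (real (a i) - real (b i)) / N" by(simp add: Y_def diff_divide_distrib)
   with * have "abs (real (a i) - real (b i)) < 1" using N0 by(simp add: abs_divide divide_less_cancel)
   thus ?thesis by linarith
  qed
  thus "a = b" using ab by(intro PiE_ext[of a "{..Suc n}" "%_. {..<N}"]) (auto simp: A_def)
 qed
 \<comment> \<open>Pigeonhole: an injection from the N^(n+2) targets into at most (N q)^(n+1)
   cubes.\<close>
 ultimately have "card A <= card (PiE {..n} (%_. {-B..B}))" by(intro card_inj_on_le[of cell]) (auto intro!: finite_PiE)
 hence "N ^ (n + 2) <= (nat (2 * B + 1)) ^ (n + 1)" by(simp add: A_def card_PiE)
 also have "nat (2 * B + 1) = 2 * (N * k0 * r0) + 1" by(simp add: B_def nat_add_distrib nat_mult_distrib)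
 also have "(2 * (N * k0 * r0) + 1) ^ (n + 1) <= (N * q) ^ (n + 1)" using N0 by(intro power_mono) (auto simp: q_def algebra_simps)
 also have "... = N ^ (n + 1) * q ^ (n + 1)" by(simp add: power_mult_distrib)
 also have "... < N ^ (n + 1) * N" using N0 by(simp add: N_def)
 finally show False by simp
qed

lemma SS_coord_bound:
 fixes f :: "(nat => real) => nat => real"
 assumes c: "!!i. i <= k ==> continuous_on (SS n) (%x. f x i)"
  and nz: "!!x. x : SS n ==> EX i<=k. f x i ~= 0"
 obtains nu where "nu > 0" "!!x. x : SS n ==> EX i<=k. abs (f x i) >= nu"
proof -
 have "continuous_on (SS n) (%x. \<Sum>i\<le>k. abs (f x i))" using c by(intro continuous_intros) auto
 then obtain x0 where x0: "x0 : SS n" "!!x. x : SS n ==> (\<Sum>i\<le>k. abs (f x0 i)) <= (\<Sum>i\<le>k. abs (f x i))"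
  using continuous_attains_inf[OF SS_compact SS_nonempty] by blast
 obtain i0 where i0: "i0 <= k" "f x0 i0 ~= 0" using nz[OF x0(1)] by blast
 have p: "(\<Sum>i\<le>k. abs (f x0 i)) > 0" by(rule sum_pos2[of _ i0]) (use i0 in auto)
 define nu where "nu = (\<Sum>i\<le>k. abs (f x0 i)) / (k + 1)"
 show ?thesis
 proof (rule that[of nu])
  show "nu > 0" using p by(simp add: nu_def)
  show "EX i<=k. abs (f x i) >= nu" if x: "x : SS n" for x
  proof (rule ccontr)
   assume "~ ?thesis"
   hence "abs (f x i) < nu" if "i <= k" for i using that by(meson not_le)
   hence "(\<Sum>i\<le>k. abs (f x i)) < (\<Sum>i\<le>k. nu)" by(intro sum_strict_mono) auto
   also have "... = (\<Sum>i\<le>k. abs (f x0 i))" by(simp add: nu_def field_simps)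
   finally show False using x0(2)[OF x] by simp
  qed
 qed
qed

text \<open>Induction on the dimension: deformations away from 0 lead to an odd map that sends the
  equator to the equator, and its degree has the parity of the degree of its restriction there
  (\<open>Borsuk_odd_mapping_degree_step\<close>). In dimension 0 the map is the identity or the
  reflection of two points.\<close>

theorem odd_map_odd_degree:
 assumes "!!i. i <= n ==> continuous_on (SS n) (%x. f x i)"
  and "!!x i. x : SS n ==> i <= n ==> f (%i. - x i) i = - f x i"
  and "!!x. x : SS n ==> EX i<=n. f x i ~= 0"
 shows "odd (Deg n f)" using assms
proof (induction n arbitrary: f)
 case 0
 define p :: "nat => real" where "p = (%i. if i = 0 then 1 else 0)"
 have S0: "x = p | x = (%i. - p i)" if "x : SS 0" for x using that by(auto simp: SS_def p_def power2_eq_1_iff fun_eq_iff)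
 have p0: "p : SS 0" by(simp add: SS_def p_def)
 have fp: "f p 0 ~= 0" "f (%i. - p i) 0 = - f p 0" using 0(2,3)[OF p0] by auto
 have pi: "p 0 = 1" "!!i. i > 0 ==> p i = 0" by(auto simp: p_def)
 show ?case
 proof (cases "f p 0 > 0")
  case True
  have "nrm 0 (f x) = id x" if "x : SS 0" for x using S0[OF that] True fp pi by(elim disjE) (auto simp: nrm_def simp del: fun_upd_apply intro!: ext)
  hence "Deg 0 f = 1" unfolding Deg_def using Brouwer_degree2_eq[of 0 "%x. nrm 0 (f x)" id] by(simp add: topspace_SS)
  thus ?thesis by simp
 next
  case False
  have "nrm 0 (f x) = (%i. if i = 0 then - x i else x i)" if "x : SS 0" for x using S0[OF that] False fp pi by(elim disjE) (auto simp: nrm_def intro!: ext)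
  hence "Deg 0 f = -1" unfolding Deg_def using Brouwer_degree2_eq[of 0 "%x. nrm 0 (f x)" "%x i. if i = 0 then - x i else x i"]
   by(simp add: topspace_SS Brouwer_degree2_reflection)
  thus ?thesis by simp
 qed
next
 case (Suc n)
 note [simp del] = sum.atMost_Suc
 note fc = Suc.prems(1) and fo = Suc.prems(2) and fz = Suc.prems(3)
 obtain nu where nu: "nu > 0" "!!x. x : SS (Suc n) ==> EX i<=Suc n. abs (f x i) >= nu" using SS_coord_bound[of "Suc n" "Suc n" f] fc fz by metis
 define P where "P i g L <-> continuous_on (SS (Suc n)) g & (ALL x:SS (Suc n). g (%i. - x i) = - g x)
   & (ALL x:SS (Suc n). abs (f x i - g x) < nu / 2) & L >= 0
   & (ALL x:SS (Suc n). ALL y:SS (Suc n). abs (g x - g y) <= L * l1 (Suc n) x y)" for i g L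
 have "EX g L. P i g L" if "i <= Suc n" for i
 proof (rule lipschitz_approx[of "Suc n" "%x. f x i" "nu / 2"])
  show "continuous_on (SS (Suc n)) (%x. f x i)" by(rule fc[OF that])
  show "f (%i. - x i) i = - f x i" if "x : SS (Suc n)" for x by(rule fo) fact+
  show "nu / 2 > 0" using nu(1) by simp
 qed (unfold P_def, blast)
 hence "ALL i. EX g L. i <= Suc n --> P i g L" by blast
 then obtain g0 L where P: "!!i. i <= Suc n ==> P i (g0 i) (L i)" unfolding choice_iff by blast
 have g0: "!!i. i <= Suc n ==> continuous_on (SS (Suc n)) (g0 i)"
  "!!i x. i <= Suc n ==> x : SS (Suc n) ==> g0 i (%i. - x i) = - g0 i x"
  "!!i x. i <= Suc n ==> x : SS (Suc n) ==> abs (f x i - g0 i x) < nu / 2"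
  "!!i. i <= Suc n ==> L i >= 0"
  "!!i x y. i <= Suc n ==> x : SS (Suc n) ==> y : SS (Suc n) ==> abs (g0 i x - g0 i y) <= L i * l1 (Suc n) x y" using P unfolding P_def by blast+
 define g where "g x i = g0 i x" for x i
 define LL where "LL = (\<Sum>i\<le>Suc n. L i)"
 have LL: "LL >= 0" "!!i. i <= Suc n ==> L i <= LL" using g0(4) by(auto simp: LL_def intro!: sum_nonneg member_le_sum)
 have glow: "EX i<=Suc n. abs ((1 - t) * f x i + t * g x i) >= nu / 2" if x: "x : SS (Suc n)" and t: "0 <= t" "t <= 1" for x and t :: real
 proof -
  obtain i where i: "i <= Suc n" "abs (f x i) >= nu" using nu(2)[OF x] by blast
  have "abs (t * (f x i - g x i)) <= 1 * (nu / 2)" unfolding abs_mult using t g0(3)[OF i(1) x] by(intro mult_mono) (auto simp: g_def)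
  moreover have "(1 - t) * f x i + t * g x i = f x i - t * (f x i - g x i)" by(simp add: algebra_simps)
  moreover have "abs (f x i) - abs (t * (f x i - g x i)) <= abs (f x i - t * (f x i - g x i))" by(rule abs_triangle_ineq2)
  ultimately have "nu / 2 <= abs ((1 - t) * f x i + t * g x i)" using i(2) by simp
  thus ?thesis using i(1) by blast
 qed
 have gc: "i <= Suc n ==> continuous_on (SS (Suc n)) (%x. g x i)" for i using g0(1) by(simp add: g_def)
 have go: "x : SS (Suc n) ==> i <= Suc n ==> g (%i. - x i) i = - g x i" for x i using g0(2) by(simp add: g_def)
 have gl: "abs (g x i - g y i) <= LL * l1 n x y" if "x : SS n" "y : SS n" "i <= Suc n" for x y i
 proof -
  have "abs (g x i - g y i) <= L i * l1 (Suc n) x y" using g0(5)[OF that(3), of x y] that SS_mono by(auto simp: g_def)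
  also have "... <= LL * l1 (Suc n) x y" using LL(2)[OF that(3)] by(intro mult_right_mono sum_nonneg) auto
  also have "l1 (Suc n) x y = l1 n x y" using that by(simp add: SS_def sum.atMost_Suc)
  finally show ?thesis .
 qed
 have "bounded ((%x. \<Sum>i\<le>Suc n. abs (g x i)) ` SS (Suc n))" using gc by(intro compact_imp_bounded compact_continuous_image SS_compact continuous_intros) auto
 then obtain M where M: "!!x. x : SS (Suc n) ==> abs (\<Sum>i\<le>Suc n. abs (g x i)) <= M" unfolding bounded_iff by auto
 have gM: "abs (g x i) <= M" if "x : SS n" "i <= Suc n" for x i
 proof -
  have "abs (g x i) <= (\<Sum>i\<le>Suc n. abs (g x i))" using that(2) by(intro member_le_sum) auto
  thus ?thesis using M[of x] that(1) SS_mono by fastforce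
 qed
 obtain y where y: "!!x. x : SS n ==> EX i<=n. g x i ~= g x (Suc n) * y i"
 proof (rule direction_missed[of n g LL M "nu / 2"])
  show "EX i<=Suc n. nu / 2 <= abs (g x i)" if "x : SS n" for x using glow[of x 1] that SS_mono by auto
  show "g (%i. - x i) i = - g x i" if "x : SS n" "i <= Suc n" for x i using go[of x i] that SS_mono by blast
  show "nu / 2 > 0" using nu(1) by simp
 qed (use gl gM LL that in blast)+
 have gnz: "EX i<=Suc n. g x i ~= 0" if x: "x : SS (Suc n)" for x using glow[OF x, of 1] nu(1) by force
 have fst_snd: "continuous_on ({0..1::real} \<times> SS (Suc n)) (%p. h (snd p))"
  if "continuous_on (SS (Suc n)) h" for h :: "(nat => real) => real" by(rule continuous_on_compose2[OF that continuous_on_snd[OF continuous_on_id]]) auto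
 have "Deg (Suc n) (%x i. (1 - 0) * f x i + 0 * g x i) = Deg (Suc n) (%x i. (1 - 1) * f x i + 1 * g x i)"
 proof (rule Deg_homotopy[where H="%t x i. (1 - t) * f x i + t * g x i"])
  show "EX i<=Suc n. (1 - t) * f x i + t * g x i ~= 0" if "0 <= t" "t <= 1" "x : SS (Suc n)" for t x using glow[OF that(3,1,2)] nu(1) by force
 qed (auto intro!: continuous_intros fst_snd fc gc)
 hence D1: "Deg (Suc n) f = Deg (Suc n) g" by simp
 \<comment> \<open>A shear that carries the missed line through \<open>(y, 1)\<close> to the last
   coordinate axis; afterwards the first \<open>n + 1\<close> coordinates have no common zero on the
   equator.\<close>
 define H2 where "H2 t x i = (if i <= n then g x i - t * (g x (Suc n) * y i) else g x (Suc n))" for t :: real and x i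
 have "Deg (Suc n) (H2 0) = Deg (Suc n) (H2 1)"
 proof (rule Deg_homotopy)
  show "continuous_on ({0..1} \<times> SS (Suc n)) (%p. H2 (fst p) (snd p) i)" if "i <= Suc n" for i
   unfolding H2_def by(cases "i <= n") (auto intro!: continuous_intros fst_snd gc)
  show "EX i<=Suc n. H2 t x i ~= 0" if x: "x : SS (Suc n)" for t x
  proof (cases "g x (Suc n) = 0")
   case True
   obtain i where "i <= Suc n" "g x i ~= 0" using gnz[OF x] by blast
   thus ?thesis using True by(intro exI[of _ i]) (auto simp: H2_def le_Suc_eq)
  qed (auto simp: H2_def intro!: exI[of _ "Suc n"])
 qed
 moreover have "Deg (Suc n) (H2 0) = Deg (Suc n) g" by(rule Deg_cong) (auto simp: H2_def le_Suc_eq)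
 ultimately have D2: "Deg (Suc n) g = Deg (Suc n) (H2 1)" by simp
 \<comment> \<open>Multiplying the last coordinate by the even function
   \<open>abs (x (Suc n))\<close> keeps the map odd and sends the equator into the equator. No zero
   arises on the way: off the equator the factor is nonzero, on it the first coordinates
   suffice.\<close>
 define H3 where "H3 t x i = (if i <= n then H2 1 x i else (1 - t + t * abs (x (Suc n))) * g x (Suc n))" for t :: real and x i
 have H3nz: "EX i<=Suc n. H3 t x i ~= 0" if x: "x : SS (Suc n)" and t: "0 <= t" "t <= 1" for t x
 proof (cases "x (Suc n) = 0")
  case True
  hence "x : SS n" using x SS_equator by blast
  then obtain i where "i <= n" "g x i ~= g x (Suc n) * y i" using y by blast
  thus ?thesis by(intro exI[of _ i]) (auto simp: H3_def H2_def)
 next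
  case False
  have p: "1 - t + t * abs (x (Suc n)) ~= 0"
  proof (cases "t = 1")
   case True thus ?thesis using False by simp
  next
   case tn: False
   hence "1 - t > 0" using t by simp
   moreover have "t * abs (x (Suc n)) >= 0" using t by simp
   ultimately show ?thesis by linarith
  qed
  show ?thesis
  proof (cases "g x (Suc n) = 0")
   case True
   obtain i where "i <= Suc n" "g x i ~= 0" using gnz[OF x] by blast
   thus ?thesis using True by(intro exI[of _ i]) (auto simp: H3_def H2_def le_Suc_eq)
  qed (use p in \<open>auto simp: H3_def intro!: exI[of _ "Suc n"]\<close>)
 qed
 have "Deg (Suc n) (H3 0) = Deg (Suc n) (H3 1)"
 proof (rule Deg_homotopy)
  show "continuous_on ({0..1} \<times> SS (Suc n)) (%p. H3 (fst p) (snd p) i)" if "i <= Suc n" for i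
   unfolding H3_def H2_def by(cases "i <= n") (auto intro!: continuous_intros fst_snd gc)
 qed (use H3nz in auto)
 moreover have "Deg (Suc n) (H3 0) = Deg (Suc n) (H2 1)" by(rule Deg_cong) (auto simp: H3_def H2_def le_Suc_eq)
 ultimately have D3: "Deg (Suc n) f = Deg (Suc n) (H3 1)" using D1 D2 by simp
 define h where "h = H3 1"
 have hc: "continuous_on (SS (Suc n)) (%x. h x i)" if "i <= Suc n" for i unfolding h_def H3_def H2_def using that by(cases "i <= n") (auto intro!: continuous_intros gc)
 have hnz: "EX i<=Suc n. h x i ~= 0" if "x : SS (Suc n)" for x using H3nz[OF that, of 1] by(simp add: h_def)
 have ho: "h (%i. - x i) i = - h x i" if "x : SS (Suc n)" "i <= Suc n" for x i using go[OF that(1)] that by(auto simp: h_def H3_def H2_def algebra_simps)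
 have hq: "h x (Suc n) = 0" if "x : SS n" for x using that by(simp add: h_def H3_def SS_def)
 have hnz': "EX i<=n. h x i ~= 0" if "x : SS n" for x using hnz[of x] hq[OF that] that SS_mono by(metis le_Suc_eq subsetD)
 have nr: "nrm (Suc n) (h x) = nrm n (h x)" if "x : SS n" for x using hq[OF that] by(auto simp: nrm_def fun_eq_iff le_Suc_eq sum.atMost_Suc)
 have IH: "odd (Deg n h)"
 proof (rule Suc.IH)
  show "continuous_on (SS n) (%x. h x i)" if "i <= n" for i by(rule continuous_on_subset[OF hc SS_mono]) (use that in simp)
  show "h (%i. - x i) i = - h x i" if "x : SS n" "i <= n" for x i by(rule ho) (use that SS_mono in auto)
 qed (rule hnz')
 have ev: "even (Brouwer_degree2 (Suc n) (%x. nrm (Suc n) (h x)) - Brouwer_degree2 (Suc n - Suc 0) (%x. nrm (Suc n) (h x)))"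
 proof (rule Borsuk_odd_mapping_degree_step)
  have "continuous_on (SS (Suc n)) (%x. nrm (Suc n) (h x))" by(rule nrm_cont) (use hc hnz in auto)
  thus "continuous_map (nsphere (Suc n)) (nsphere (Suc n)) (%x. nrm (Suc n) (h x))" unfolding nsphere_SS using nrm_in[OF hnz] by auto
  show "((%x. nrm (Suc n) (h x)) \<circ> (%x i. - x i)) u = ((%x i. - x i) \<circ> (%x. nrm (Suc n) (h x))) u"
   if "u : topspace (nsphere (Suc n))" for u using ho[of u] that unfolding topspace_SS by(auto simp: nrm_def fun_eq_iff)
  show "(%x. nrm (Suc n) (h x)) : topspace (nsphere (Suc n - Suc 0)) \<rightarrow> topspace (nsphere (Suc n - Suc 0))" using nr nrm_in[OF hnz'] by(auto simp: topspace_SS)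
 qed
 have "Brouwer_degree2 n (%x. nrm (Suc n) (h x)) = Deg n h" unfolding Deg_def by(rule Brouwer_degree2_eq) (use nr in \<open>auto simp: topspace_SS\<close>)
 hence "odd (Deg (Suc n) h)" using ev IH by(simp add: Deg_def[of "Suc n"])
 thus ?case by(simp add: D3 h_def)
qed

text \<open>Padding the \<open>k\<close> functions with zeros gives an odd map into R^(n+1) whose
  last coordinate vanishes, as \<open>k <= n\<close>. Without a common zero it would have odd
  degree, yet its normalisation misses the pole \<open>q\<close> and so has degree 0.\<close>

corollary borsuk_ulam_common_zero:
 fixes f :: "nat => (nat => real) => real"
 assumes k: "k <= n"
  and c: "!!i. i < k ==> continuous_on (SS n) (f i)"
  and o: "!!i x. i < k ==> x : SS n ==> f i (%i. - x i) = - f i x"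
 shows "EX x:SS n. ALL i<k. f i x = 0"
proof (rule ccontr)
 assume "~ ?thesis"
 hence nz: "EX i<k. f i x ~= 0" if "x : SS n" for x using that by blast
 define F where "F x i = (if i < k then f i x else 0)" for x i
 have Fc: "continuous_on (SS n) (%x. F x i)" for i using c by(cases "i < k") (auto simp: F_def)
 have Fnz: "EX i<=n. F x i ~= 0" if "x : SS n" for x using nz[OF that] k by(auto simp: F_def intro: less_imp_le less_le_trans)
 have "odd (Deg n F)" by(rule odd_map_odd_degree) (use Fc Fnz o in \<open>auto simp: F_def\<close>)
 moreover have "Deg n F = 0" unfolding Deg_def
 proof (rule Brouwer_degree2_nonsurjective)
  have "continuous_on (SS n) (%x. nrm n (F x))" by(rule nrm_cont) (use Fc Fnz in auto)
  thus "continuous_map (nsphere n) (nsphere n) (%x. nrm n (F x))" unfolding nsphere_SS using nrm_in[OF Fnz] by auto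
  define q :: "nat => real" where "q = (%i. if i = n then 1 else 0)"
  have "q : SS n" by(auto simp: SS_def q_def if_distrib[of "%x. x^2"] cong: if_cong)
  moreover have "nrm n (F x) ~= q" for x using k by(auto simp: nrm_def F_def q_def fun_eq_iff intro!: exI[of _ n])
  ultimately show "(%x. nrm n (F x)) ` topspace (nsphere n) ~= topspace (nsphere n)" by(metis imageE topspace_SS)
 qed
 ultimately show False by simp
qed

text \<open>Bernoulli's inequality for real exponents, from Young's inequality with conjugate
  exponents \<open>a\<close> and \<open>a / (a - 1)\<close>.\<close>

lemma powr_ge_linear:
 fixes x a :: real assumes "x > 0" "a >= 1" shows "x powr a >= 1 + a * (x - 1)"
proof (cases "a = 1")
 case True thus ?thesis using assms by simp
next
 case False
 hence a: "a > 1" using assms by simp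
 have "x * 1 <= x powr a / a + 1 powr (a / (a - 1)) / (a / (a - 1))" using a assms by(intro Youngs_inequality) (auto simp: field_simps)
 hence "x <= x powr a / a + (a - 1) / a" using a by simp
 hence "a * x <= a * (x powr a / a + (a - 1) / a)" using a by(intro mult_left_mono) auto
 also have "... = x powr a + (a - 1)" using a by(simp add: distrib_left)
 finally show ?thesis by(simp add: algebra_simps)
qed

section \<open>Descent on a Nehari manifold\<close>

text \<open>The elements will be functions, and functions agreeing almost everywhere are at distance
  0 without being equal. Convergence and continuity with respect to \<open>N\<close> are therefore
  introduced by hand as \<open>Ntends\<close> and \<open>ncont\<close>.\<close>

locale seminormed_carrier =
 fixes E :: "'v::real_vector set" and N :: "'v => real"
 assumes E_subspace: "subspace E"
  and N_tri: "u : E ==> v : E ==> N (u + v) <= N u + N v"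
  and N_scale: "u : E ==> N (t *R u) = abs t * N u"
begin

lemma E_0 [simp]: "0 : E" and E_add [simp]: "u : E ==> v : E ==> u + v : E"
 and E_scale [simp]: "u : E ==> t *R u : E" and E_diff [simp]: "u : E ==> v : E ==> u - v : E"
 and E_neg [simp]: "u : E ==> - u : E" and E_sum [simp]: "(!!i. i : A ==> f i : E) ==> sum f A : E"
 using E_subspace by(auto simp: subspace_0 subspace_add subspace_scale subspace_diff subspace_neg subspace_sum)

lemma N_0 [simp]: "N 0 = 0" using N_scale[of 0 0] by simp

lemma N_neg [simp]: "u : E ==> N (- u) = N u" using N_scale[of u "-1"] by simp

lemma N_nonneg [simp]: "u : E ==> N u >= 0" using N_tri[of u "- u"] by simp

lemma N_minus_commute: "u : E ==> v : E ==> N (u - v) = N (v - u)" using N_neg[of "u - v"] by simp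

lemma N_diff_le: "u : E ==> v : E ==> N (u - v) <= N u + N v" using N_tri[of u "- v"] by simp

lemma N_tri_diff: "u : E ==> v : E ==> w : E ==> N (u - w) <= N (u - v) + N (v - w)" using N_tri[of "u - v" "v - w"] by simp

lemma N_abs_diff: "u : E ==> v : E ==> abs (N u - N v) <= N (u - v)" using N_tri[of "u - v" v] N_tri[of "v - u" u] N_minus_commute[of u v] by simp

lemma N_sum_le: "(!!i. i : A ==> f i : E) ==> N (sum f A) <= (\<Sum>i\<in>A. N (f i))"
proof (induction A rule: infinite_finite_induct)
 case (insert x A)
 thus ?case using N_tri[of "f x" "sum f A"] by simp
qed auto

definition Ntends :: "('c => 'v) => 'v => 'c filter => bool" where
 "Ntends h u F <-> eventually (%x. h x : E) F & u : E & ((%x. N (h x - u)) ---> 0) F"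

lemma Ntends_const: "u : E ==> Ntends (%x. u) u F" by(simp add: Ntends_def)

lemma Ntends_N_diff: assumes "Ntends h u F" "w : E" shows "((%x. N (h x - w)) ---> N (u - w)) F"
proof -
 have "((%x. N (h x - w) - N (u - w)) ---> 0) F"
 proof (rule Lim_null_comparison)
  show "eventually (%x. norm (N (h x - w) - N (u - w)) <= N (h x - u)) F" using assms unfolding Ntends_def
   by(auto elim!: eventually_mono) (metis E_diff N_abs_diff diff_diff_eq2 diff_add_cancel)
 qed (use assms in \<open>auto simp: Ntends_def\<close>)
 thus ?thesis by(simp add: LIM_zero_iff)
qed

lemma Ntends_add: assumes "Ntends h u F" "Ntends k v F" shows "Ntends (%x. h x + k x) (u + v) F"
proof -
 have "((%x. N (h x + k x - (u + v))) ---> 0) F"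
 proof (rule Lim_null_comparison)
  show "((%x. N (h x - u) + N (k x - v)) ---> 0) F" using assms tendsto_add[of _ 0 _ _ 0] by(auto simp: Ntends_def)
  have "eventually (%x. h x : E & k x : E) F" using assms by(auto simp: Ntends_def eventually_conj_iff)
  thus "eventually (%x. norm (N (h x + k x - (u + v))) <= N (h x - u) + N (k x - v)) F"
  proof eventually_elim
   case (elim x)
   thus ?case using assms N_tri[of "h x - u" "k x - v"] by(simp add: Ntends_def algebra_simps)
  qed
 qed
 thus ?thesis using assms by(auto simp: Ntends_def eventually_conj_iff elim: eventually_elim2)
qed

lemma Ntends_scale: assumes "(f ---> (t::real)) F" "Ntends h u F" shows "Ntends (%x. f x *R h x) (t *R u) F"
proof -
 have "((%x. N (f x *R h x - t *R u)) ---> 0) F"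
 proof (rule Lim_null_comparison)
  have "((%x. abs (f x) * N (h x - u) + abs (f x - t) * N u) ---> abs t * 0 + abs (t - t) * N u) F" using assms by(intro tendsto_intros) (auto simp: Ntends_def)
  thus "((%x. abs (f x) * N (h x - u) + abs (f x - t) * N u) ---> 0) F" by simp
  have "eventually (%x. h x : E) F" using assms by(auto simp: Ntends_def)
  thus "eventually (%x. norm (N (f x *R h x - t *R u)) <= abs (f x) * N (h x - u) + abs (f x - t) * N u) F"
  proof eventually_elim
   case (elim x)
   have "f x *R h x - t *R u = f x *R (h x - u) + (f x - t) *R u" by(simp add: algebra_simps)
   moreover have "u : E" using assms by(simp add: Ntends_def)
   ultimately show ?case using elim N_tri[of "f x *R (h x - u)" "(f x - t) *R u"] by(simp add: N_scale del: scaleR_diff_right scaleR_left_diff_distrib)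
  qed
 qed
 thus ?thesis using assms by(auto simp: Ntends_def elim: eventually_mono)
qed

lemma Ntends_diff: assumes "Ntends h u F" "Ntends k v F" shows "Ntends (%x. h x - k x) (u - v) F"
 using Ntends_add[OF assms(1) Ntends_scale[OF tendsto_const[of "-1"] assms(2)]] by simp

lemma Ntends_sum: "(!!i. i : A ==> Ntends (h i) (u i) F) ==> Ntends (%x. \<Sum>i\<in>A. h i x) (\<Sum>i\<in>A. u i) F"
 by(induction A rule: infinite_finite_induct) (auto intro: Ntends_add Ntends_const)

definition ncont :: "'c::topological_space set => ('c => 'v) => bool" where
 "ncont S h <-> (ALL x:S. h x : E & Ntends h (h x) (at x within S))"

lemma ncont_E: "ncont S h ==> x : S ==> h x : E" by(simp add: ncont_def)

lemma ncont_N_diff: "ncont S h ==> w : E ==> continuous_on S (%x. N (h x - w))" unfolding continuous_on_def ncont_def using Ntends_N_diff by blast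

lemma ncont_const: "w : E ==> ncont S (%x. w)" by(simp add: ncont_def Ntends_const)

lemma ncont_scale: "continuous_on S f ==> ncont S h ==> ncont S (%x. f x *R h x)" unfolding continuous_on_def ncont_def using Ntends_scale by fastforce

lemma ncont_diff: "ncont S k ==> ncont S h ==> ncont S (%x. k x - h x)" unfolding ncont_def using Ntends_diff by fastforce

lemma ncont_sum: "(!!i. i : A ==> ncont S (h i)) ==> ncont S (%x. \<Sum>i\<in>A. h i x)" unfolding ncont_def by(auto intro!: Ntends_sum)

lemma ncont_compose:
 assumes "ncont S h" "continuous_on S g" "!!x. x : S ==> g x : S"
 shows "ncont S (%x. h (g x))" unfolding ncont_def
proof (intro ballI conjI)
 fix x assume x: "x : S"
 show "h (g x) : E" using assms x by(simp add: ncont_def)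
 have T: "Ntends h (h (g x)) (at (g x) within S)" using assms x by(simp add: ncont_def)
 have "((%y. N (h (g y) - h (g x))) ---> 0) (at x within S)"
 proof -
  have "continuous_on S (%z. N (h z - h (g x)))" using assms x by(intro ncont_N_diff) (auto simp: ncont_def)
  hence "continuous_on S (%y. N (h (g y) - h (g x)))" by(rule continuous_on_compose2) (use assms in auto)
  thus ?thesis using x by(simp add: continuous_on_def) (metis N_0 diff_self)
 qed
 moreover have "eventually (%y. h (g y) : E) (at x within S)" using assms by(auto simp: ncont_def eventually_at_topological)
 ultimately show "Ntends (%x. h (g x)) (h (g x)) (at x within S)" using \<open>h (g x) : E\<close> by(simp add: Ntends_def)
qed

end

section \<open>Derivatives of convex homogeneous functionals\<close>

text \<open>\<open>f u\<close> plays the role of 1/k times the derivative at \<open>u\<close> of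
  F(u) = \<open>f u u\<close>. By homogeneity \<open>f_young\<close> is the tangent inequality F(w)
  >= F(u) + k f(u, w - u), that is, convexity. Continuity is assumed only along lines
  (\<open>f_line\<close>); the other bounds and limits follow from convexity and
  \<open>f_growth\<close>.\<close>

locale convex_homogeneous = seminormed_carrier E N
 for E :: "'v::real_vector set" and N +
 fixes k :: real and f :: "'v => 'v => real"
 assumes k: "k > 1"
  and f_add: "u : E ==> v : E ==> w : E ==> f u (v + w) = f u v + f u w"
  and f_scale: "u : E ==> v : E ==> f u (t *R v) = t * f u v"
  and f_hom: "u : E ==> v : E ==> t > 0 ==> f (t *R u) v = t powr (k - 1) * f u v"
  and f_odd: "u : E ==> v : E ==> f (- u) v = - f u v"
  and f_young: "u : E ==> w : E ==> k * f u w <= (k - 1) * f u u + f w w"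
  and f_nonneg: "u : E ==> f u u >= 0"
  and f_growth: "EX M>=0. ALL u:E. f u u <= M * N u powr k"
  and f_line: "u : E ==> v : E ==> ((%t. f (u + t *R v) v) ---> f u v) (at_right 0)"
begin

lemma f_neg: "u : E ==> v : E ==> f u (- v) = - f u v" using f_scale[of u v "-1"] by simp

lemma f_diff: "u : E ==> v : E ==> w : E ==> f u (v - w) = f u v - f u w" using f_add[of u v "- w"] by(simp add: f_neg)

lemma f_0: "u : E ==> f u 0 = 0" using f_scale[of u 0 0] by simp

lemma f_sum: "u : E ==> (!!i. i : A ==> v i : E) ==> f u (\<Sum>i\<in>A. c i *R v i) = (\<Sum>i\<in>A. c i * f u (v i))"
 by(induction A rule: infinite_finite_induct) (auto simp: f_0 f_add f_scale)

lemma F_hom: assumes "u : E" "t > 0" shows "f (t *R u) (t *R u) = t powr k * f u u"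
proof -
 have "t powr (k - 1) * t = t powr k" using assms(2) powr_add[of t "k - 1" 1] by simp
 thus ?thesis using assms by(simp add: f_hom f_scale mult.assoc[symmetric] mult.commute mult.left_commute)
qed

lemma F_neg: "u : E ==> f (- u) (- u) = f u u" by(simp add: f_odd f_neg)

text \<open>Young's inequality for \<open>v\<close> scaled to norm 1 bounds \<open>f u v\<close>. If
  \<open>N v = 0\<close>, the same bound holds for all positive multiples of \<open>v\<close>, which
  forces \<open>f u v <= 0\<close>.\<close>

lemma f_bound: "EX K>=0. ALL u:E. ALL v:E. N u <= R --> abs (f u v) <= K * N v"
proof -
 obtain M where M: "M >= 0" "!!u. u : E ==> f u u <= M * N u powr k" using f_growth by blast
 define K where "K = M * ((k - 1) * abs R powr k + 1)"
 have K0: "K >= 0" using M k by(simp add: K_def)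
 have *: "f u v <= K * N v" if u: "u : E" and v: "v : E" and R: "N u <= R" for u v
 proof -
  have "N u powr k <= abs R powr k" using k R u by(intro powr_mono2) auto
  hence "f u u <= M * abs R powr k" using M(2)[OF u] M(1) by(meson mult_left_mono order_trans)
  hence Fu: "(k - 1) * f u u <= (k - 1) * (M * abs R powr k)" using k by(intro mult_left_mono) auto
  have s: "k * (s * f u v) <= (k - 1) * (M * abs R powr k) + M * (s * N v) powr k" if "s > 0" for s
   using f_young[of u "s *R v"] M(2)[of "s *R v"] Fu u v that by(simp add: f_scale N_scale)
  show ?thesis
  proof (cases "N v = 0")
   case True
   have "f u v <= 0"
   proof (rule ccontr)
    assume "~ f u v <= 0"
    hence p: "f u v > 0" by simp
    define B where "B = (k - 1) * (M * abs R powr k)"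
    have B0: "B >= 0" using M k by(simp add: B_def)
    define s where "s = (B + 1) / (k * f u v)"
    have "s > 0" using p k B0 by(simp add: s_def add_nonneg_pos)
    from s[OF this] have "k * (s * f u v) <= B" using True k by(simp add: B_def)
    moreover have "k * (s * f u v) = B + 1" using p k by(simp add: s_def)
    ultimately show False by simp
   qed
   thus ?thesis using True by simp
  next
   case False
   hence Np: "N v > 0" using N_nonneg[OF v] by simp
   have "k * (f u v / N v) <= K" using s[of "1 / N v"] Np by(simp add: K_def algebra_simps)
   moreover have "f u v / N v <= k * (f u v / N v) | f u v <= 0" using k Np by(cases "f u v <= 0") (auto simp: mult_le_cancel_right1 divide_right_mono mult_right_mono)
   ultimately show ?thesis using Np K0 by(auto simp: field_simps intro: order_trans mult_nonneg_nonneg)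
  qed
 qed
 have "abs (f u v) <= K * N v" if "u : E" "v : E" "N u <= R" for u v using *[of u v] *[of u "- v"] that by(simp add: f_neg abs_le_iff)
 thus ?thesis using K0 by blast
qed

lemma F_convex: assumes "u : E" "w : E" shows "f w w >= f u u + k * f u (w - u)" using f_young[OF assms] assms by(simp add: f_diff algebra_simps)

lemma F_lipschitz: "EX K>=0. ALL u:E. ALL w:E. N u <= R --> N w <= R --> abs (f w w - f u u) <= K * N (w - u)"
proof -
 obtain K where K: "K >= 0" "!!u v. u : E ==> v : E ==> N u <= R ==> abs (f u v) <= K * N v" using f_bound[of R] by blast
 have *: "f w w - f u u <= k * K * N (w - u)" if "u : E" "w : E" "N u <= R" "N w <= R" for u w
 proof -
  have "f w w - f u u <= k * f w (w - u)" using F_convex[of w u] f_neg[of w "w - u"] that by simp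
  also have "... <= k * (K * N (w - u))" using K(2)[of w "w - u"] that k by(intro mult_left_mono) (auto simp: abs_le_iff)
  finally show ?thesis by simp
 qed
 have "abs (f w w - f u u) <= k * K * N (w - u)" if "u : E" "w : E" "N u <= R" "N w <= R" for u w
  using *[of u w] *[of w u] that N_minus_commute[of u w] by(simp add: abs_le_iff)
 thus ?thesis using K(1) k by(intro exI[of _ "k * K"]) auto
qed

lemma F_tendsto: assumes h: "Ntends h u F" shows "((%x. f (h x) (h x)) ---> f u u) F"
proof -
 have u: "u : E" using h by(simp add: Ntends_def)
 obtain K where K: "K >= 0" "!!u' w. u' : E ==> w : E ==> N u' <= N u + 1 ==> N w <= N u + 1 ==> abs (f w w - f u' u') <= K * N (w - u')"
  using F_lipschitz[of "N u + 1"] by blast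
 have "((%x. f (h x) (h x) - f u u) ---> 0) F"
 proof (rule Lim_null_comparison)
  show "((%x. K * N (h x - u)) ---> 0) F" using h tendsto_mult_right_zero by(auto simp: Ntends_def)
  have "eventually (%x. N (h x - u) < 1) F" using h order_tendstoD(2)[of "%x. N (h x - u)" 0 F 1] by(auto simp: Ntends_def)
  moreover have "eventually (%x. h x : E) F" using h by(simp add: Ntends_def)
  ultimately show "eventually (%x. norm (f (h x) (h x) - f u u) <= K * N (h x - u)) F"
  proof eventually_elim
   case (elim x)
   have "N (h x) <= N u + 1" using N_abs_diff[of "h x" u] u elim by(simp add: abs_le_iff)
   thus ?case using K(2)[of u "h x"] u elim by simp
  qed
 qed
 thus ?thesis by(simp add: LIM_zero_iff)
qed

text \<open>Derivatives of convex functions lie below their difference quotients. The quotient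
  \<open>Q\<close> with a fixed increment \<open>t\<close> is continuous in the base point, and by
  \<open>f_line\<close> a small \<open>t\<close> makes it close to the derivative at
  \<open>u\<close>. The reverse bound follows with \<open>- v\<close>.\<close>

lemma f_tendsto_upper:
 assumes h: "Ntends h u F" and v: "v : E" and e: "e > 0"
 shows "eventually (%x. f (h x) v < f u v + e) F"
proof -
 have u: "u : E" using h by(simp add: Ntends_def)
 have "eventually (%t. f (u + t *R v) v < f u v + e / 2) (at_right 0)" using f_line[OF u v] e by(intro order_tendstoD(2)) auto
 hence "eventually (%t. t > 0 & f (u + t *R v) v < f u v + e / 2) (at_right 0)" using eventually_at_right_less[of 0] by(simp add: eventually_conj_iff)
 then obtain t where t: "t > 0" "f (u + t *R v) v < f u v + e / 2" using eventually_happens[of _ "at_right (0::real)"] by(auto simp: trivial_limit_at_right_real)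
 define Q where "Q w = (f (w + t *R v) (w + t *R v) - f w w) / (k * t)" for w
 have "((%x. Q (h x)) ---> Q u) F" unfolding Q_def using k t h v by(intro tendsto_intros F_tendsto Ntends_add Ntends_const) auto
 moreover have "Q u <= f (u + t *R v) v" using F_convex[of "u + t *R v" u] u v k t f_neg[of "u + t *R v" "t *R v"] by(simp add: Q_def f_scale divide_le_eq algebra_simps)
 ultimately have "eventually (%x. Q (h x) < f u v + e) F" using t e by(intro order_tendstoD(2)) auto
 moreover have "eventually (%x. h x : E) F" using h by(simp add: Ntends_def)
 ultimately show ?thesis
 proof eventually_elim
  case (elim x)
  have "f (h x) v <= Q (h x)" using F_convex[of "h x" "h x + t *R v"] elim v k t by(simp add: Q_def f_scale le_divide_eq algebra_simps)
  thus ?case using elim by simp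
 qed
qed

lemma f_tendsto:
 assumes h: "Ntends h u F" and v: "v : E"
 shows "((%x. f (h x) v) ---> f u v) F"
proof (rule tendstoI)
 fix e :: real assume e: "e > 0"
 have u: "u : E" and hE: "eventually (%x. h x : E) F" using h by(simp_all add: Ntends_def)
 show "eventually (%x. dist (f (h x) v) (f u v) < e) F" using f_tendsto_upper[OF h v e] f_tendsto_upper[OF h E_neg[OF v] e] hE
  by eventually_elim (use u v in \<open>auto simp: f_neg dist_real_def abs_less_iff\<close>)
qed

lemma f_continuous_on: "ncont S h ==> v : E ==> continuous_on S (%x. f (h x) v)" unfolding continuous_on_def ncont_def using f_tendsto by blast

end

section \<open>The Nehari manifold\<close>

text \<open>\<open>a\<close>, \<open>b\<close>, \<open>g\<close>, \<open>c\<close> stand for the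
  gradient, Coulomb, subcritical and critical terms, \<open>c1\<close> for the energy level and
  \<open>K\<close> for a Sobolev constant. The quadratic remainder \<open>taylor\<close> is asked of
  \<open>a\<close> and \<open>b\<close> only: the other two enter the energy with a minus sign,
  where convexity already gives the upper bound.\<close>

locale nehari = seminormed_carrier E N
 + A: convex_homogeneous E N 2 a + B: convex_homogeneous E N 4 b
 + G: convex_homogeneous E N p g + C: convex_homogeneous E N 6 c
 for E :: "'v::real_vector set" and N and a b g c :: "'v => 'v => real" and p :: real +
 fixes c1 K :: real
 assumes p: "4 < p" "p < 6"
  and taylor: "EX Q>=0. ALL u:E. ALL h:E. N u <= R --> N h <= 1 -->
    a (u + h) (u + h) / 2 + b (u + h) (u + h) / 4
     <= a u u / 2 + b u u / 4 + a u h + b u h + Q * (N h)^2"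
  and N_le: "EX R'. ALL u:E. a u u <= R --> b u u <= R --> N u <= R'"
  and sobolev: "u : E ==> c u u <= K * (a u u) ^ 3" "u : E ==> g u u <= K * a u u powr (p / 2)"
  and K_nonneg: "K >= 0"
  and c_zero: "u : E ==> c u u = 0 ==> a u u = 0"
begin

definition DI where "DI u v = a u v + b u v - g u v - c u v"
definition I where "I u = a u u / 2 + b u u / 4 - g u u / p - c u u / 6"
definition Neh where "Neh = {u:E. a u u > 0 & DI u u = 0}"
definition Sub where "Sub = {u:Neh. I u <= c1}"
text \<open>The derivative of \<open>I (t *R w)\<close> in \<open>t\<close>, divided by t^3. As
  \<open>p > 4\<close>, no term increases and the first one strictly decreases when
  \<open>a w w > 0\<close>, so each such ray meets the manifold exactly once, at
  \<open>tau w\<close>.\<close>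

definition phi where "phi w t = a w w * t powr (-2) + b w w - g w w * t powr (p - 4) - c w w * t powr 2" for t :: real
definition tau where "tau w = (THE t. t > 0 & phi w t = 0)"

lemma DI_add: "u : E ==> v : E ==> w : E ==> DI u (v + w) = DI u v + DI u w" by(simp add: DI_def A.f_add B.f_add G.f_add C.f_add)

lemma DI_scale: "u : E ==> v : E ==> DI u (t *R v) = t * DI u v" by(simp add: DI_def A.f_scale B.f_scale G.f_scale C.f_scale algebra_simps)

lemma DI_neg: "u : E ==> v : E ==> DI u (- v) = - DI u v" using DI_scale[of u v "-1"] by simp

lemma DI_odd: "u : E ==> v : E ==> DI (- u) v = - DI u v" by(simp add: DI_def A.f_odd B.f_odd G.f_odd C.f_odd)

lemma DI_sum: "u : E ==> (!!i. i : S ==> v i : E) ==> DI u (\<Sum>i\<in>S. t i *R v i) = (\<Sum>i\<in>S. t i * DI u (v i))"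
 by(simp add: DI_def A.f_sum B.f_sum G.f_sum C.f_sum sum.distrib sum_subtractf algebra_simps)

lemma I_neg: "u : E ==> I (- u) = I u" by(simp add: I_def A.F_neg B.F_neg G.F_neg C.F_neg)

lemma DI_bound: "EX K>=0. ALL u:E. ALL v:E. N u <= R -->
  abs (a u v) <= K * N v & abs (b u v) <= K * N v & abs (g u v) <= K * N v & abs (c u v) <= K * N v"
proof -
 obtain Ka Kb Kg Kc where K: "Ka >= 0" "Kb >= 0" "Kg >= 0" "Kc >= 0"
  "ALL u:E. ALL v:E. N u <= R --> abs (a u v) <= Ka * N v" "ALL u:E. ALL v:E. N u <= R --> abs (b u v) <= Kb * N v"
  "ALL u:E. ALL v:E. N u <= R --> abs (g u v) <= Kg * N v" "ALL u:E. ALL v:E. N u <= R --> abs (c u v) <= Kc * N v"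
  using A.f_bound[of R] B.f_bound[of R] G.f_bound[of R] C.f_bound[of R] by auto
 define S where "S = Ka + Kb + Kg + Kc"
 have S: "X * N v <= S * N v" if "X : {Ka, Kb, Kg, Kc}" "v : E" for X v using that K by(intro mult_right_mono) (auto simp: S_def)
 have "abs (a u v) <= S * N v & abs (b u v) <= S * N v & abs (g u v) <= S * N v & abs (c u v) <= S * N v"
  if that: "u : E" "v : E" "N u <= R" for u v using S[of Ka v] S[of Kb v] S[of Kg v] S[of Kc v] that
   K(5)[rule_format, OF that] K(6)[rule_format, OF that] K(7)[rule_format, OF that] K(8)[rule_format, OF that] by auto
 moreover have "S >= 0" using K by(simp add: S_def)
 ultimately show ?thesis by blast
qed

lemma lipschitz: "EX K>=0. ALL u:E. ALL w:E. N u <= R --> N w <= R -->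
  abs (a w w - a u u) <= K * N (w - u) & abs (b w w - b u u) <= K * N (w - u)
  & abs (g w w - g u u) <= K * N (w - u) & abs (c w w - c u u) <= K * N (w - u)"
proof -
 obtain Ka Kb Kg Kc where K: "Ka >= 0" "Kb >= 0" "Kg >= 0" "Kc >= 0"
  "ALL u:E. ALL w:E. N u <= R --> N w <= R --> abs (a w w - a u u) <= Ka * N (w - u)"
  "ALL u:E. ALL w:E. N u <= R --> N w <= R --> abs (b w w - b u u) <= Kb * N (w - u)"
  "ALL u:E. ALL w:E. N u <= R --> N w <= R --> abs (g w w - g u u) <= Kg * N (w - u)"
  "ALL u:E. ALL w:E. N u <= R --> N w <= R --> abs (c w w - c u u) <= Kc * N (w - u)"
  using A.F_lipschitz[of R] B.F_lipschitz[of R] G.F_lipschitz[of R] C.F_lipschitz[of R] by auto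
 define S where "S = Ka + Kb + Kg + Kc"
 have S: "X * N v <= S * N v" if "X : {Ka, Kb, Kg, Kc}" "v : E" for X v using that K by(intro mult_right_mono) (auto simp: S_def)
 have "abs (a w w - a u u) <= S * N (w - u) & abs (b w w - b u u) <= S * N (w - u)
   & abs (g w w - g u u) <= S * N (w - u) & abs (c w w - c u u) <= S * N (w - u)"
  if that: "u : E" "w : E" "N u <= R" "N w <= R" for u w using S[of Ka "w - u"] S[of Kb "w - u"] S[of Kg "w - u"] S[of Kc "w - u"] that
   K(5)[rule_format, OF that] K(6)[rule_format, OF that] K(7)[rule_format, OF that] K(8)[rule_format, OF that] by auto
 moreover have "S >= 0" using K by(simp add: S_def)
 ultimately show ?thesis by blast
qed

lemma DI_tendsto: "Ntends h u F ==> v : E ==> ((%x. DI (h x) v) ---> DI u v) F" unfolding DI_def by(intro tendsto_intros A.f_tendsto B.f_tendsto G.f_tendsto C.f_tendsto)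

lemma DI_continuous_on: "ncont S h ==> v : E ==> continuous_on S (%x. DI (h x) v)" unfolding DI_def
 by(intro continuous_intros A.f_continuous_on B.f_continuous_on G.f_continuous_on C.f_continuous_on)

lemma I_tendsto: "Ntends h u F ==> ((%x. I (h x)) ---> I u) F" unfolding I_def using p by(intro tendsto_intros A.F_tendsto B.F_tendsto G.F_tendsto C.F_tendsto) auto

lemma c_pos: "u : E ==> a u u > 0 ==> c u u > 0" using c_zero[of u] C.f_nonneg[of u] by force

lemma DI_phi: assumes "u : E" "t > 0" shows "DI (t *R u) (t *R u) = t powr 4 * phi u t"
proof -
 have "t powr 4 * t powr (-2) = t powr 2" "t powr 4 * t powr (p - 4) = t powr p" "t powr 4 * t powr 2 = t powr 6"
  using assms by(simp_all add: powr_add[symmetric] del: powr_numeral)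
 thus ?thesis unfolding DI_def phi_def using assms by(simp add: A.F_hom B.F_hom G.F_hom C.F_hom algebra_simps)
qed

lemma phi_strict: assumes u: "u : E" "a u u > 0" and t: "0 < s" "s < t" shows "phi u t < phi u s"
proof -
 have "t powr (-2) < s powr (-2)" using t by(intro powr_less_mono2_neg) auto
 hence 1: "a u u * t powr (-2) < a u u * s powr (-2)" using u by simp
 have 2: "g u u * s powr (p - 4) <= g u u * t powr (p - 4)" "c u u * s powr 2 <= c u u * t powr 2"
  using t p G.f_nonneg[OF u(1)] C.f_nonneg[OF u(1)] by(auto intro!: powr_mono2 mult_left_mono)
 show ?thesis unfolding phi_def using 1 2 by linarith
qed

lemma phi_continuous: "continuous_on {0<..} (phi u)" unfolding phi_def by(intro continuous_intros) auto

lemma phi_root: assumes u: "u : E" "a u u > 0" shows "EX! t. t > 0 & phi u t = 0"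
proof -
 have c: "c u u > 0" and g: "g u u >= 0" and b: "b u u >= 0" using c_pos[OF u] G.f_nonneg[OF u(1)] B.f_nonneg[OF u(1)] by auto
 \<comment> \<open>Both endpoints are explicit: \<open>s <= 1\<close> with s^2 <= a / (g + c) lets
   the singular term dominate, and \<open>t >= 1\<close> with t^2 >= (a + b) / c lets the critical
   term dominate.\<close>
 define s where "s = min 1 (sqrt (a u u / (g u u + c u u)) )"
 have s: "0 < s" "s <= 1" using u c g by(auto simp: s_def)
 have "s^2 <= (sqrt (a u u / (g u u + c u u)))^2" using s by(intro power_mono) (auto simp: s_def)
 also have "... = a u u / (g u u + c u u)" using u c g by simp
 finally have s2: "g u u + c u u <= a u u / s^2" using c g s u by(simp add: field_simps)
 have m2: "t powr (-2) = 1 / t^2" "t powr 2 = t^2" if "t > 0" for t :: real using that by(simp_all add: powr_minus_divide)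
 have "phi u s >= 0"
 proof -
  have "g u u * s powr (p - 4) <= g u u * 1" "c u u * s powr 2 <= c u u * 1" using s p g c by(intro mult_left_mono powr_le1; simp)+
  thus ?thesis unfolding phi_def using s2 b s by(simp add: m2)
 qed
 define t where "t = max 1 (sqrt ((a u u + b u u) / c u u))"
 have t: "t >= 1" by(simp add: t_def)
 have "(sqrt ((a u u + b u u) / c u u))^2 <= t^2" using u b c by(intro power_mono) (auto simp: t_def)
 hence t2: "a u u + b u u <= c u u * t^2" using u b c by(simp add: field_simps)
 have "phi u t <= 0"
 proof -
  have "a u u * (1 / t^2) <= a u u * 1" using t u by(intro mult_left_mono) auto
  moreover have "g u u * t powr (p - 4) >= 0" using g by simp
  ultimately show ?thesis unfolding phi_def using t2 t by(simp add: m2)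
 qed
 have "EX r>=s. r <= t & phi u r = 0" using s t \<open>phi u s >= 0\<close> \<open>phi u t <= 0\<close>
  by(intro IVT2') (auto intro: continuous_on_subset[OF phi_continuous])
 then obtain r where r: "r > 0" "phi u r = 0" using s(1) by(meson less_le_trans)
 show ?thesis
 proof (rule ex1I[of _ r])
  fix q assume q: "0 < q & phi u q = 0"
  show "q = r" using phi_strict[OF u, of q r] phi_strict[OF u, of r q] q r by(cases q r rule: linorder_cases) auto
 qed (use r in auto)
qed

lemma tau: assumes u: "u : E" "a u u > 0" shows "tau u > 0" "phi u (tau u) = 0" using theI'[OF phi_root[OF u]] by(auto simp: tau_def)

lemma tau_less: assumes u: "u : E" "a u u > 0" and t: "t > 0" "phi u t < 0" shows "tau u < t"
 using phi_strict[OF u, of t "tau u"] tau[OF u] t by(cases t "tau u" rule: linorder_cases) auto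

lemma tau_greater: assumes u: "u : E" "a u u > 0" and t: "t > 0" "phi u t > 0" shows "tau u > t"
 using phi_strict[OF u, of "tau u" t] tau[OF u] t by(cases t "tau u" rule: linorder_cases) auto

lemma tau_Neh: assumes u: "u : E" "a u u > 0" shows "tau u *R u : Neh" using tau[OF u] u DI_phi[OF u(1) tau(1)[OF u]] by(simp add: Neh_def A.F_hom)

lemma tau_neg: "u : E ==> tau (- u) = tau u" by(simp add: tau_def phi_def A.F_neg B.F_neg G.F_neg C.F_neg)

lemma Neh_phi: "u : Neh ==> phi u 1 = 0" using DI_phi[of u 1] by(simp add: Neh_def)

lemma Neh_E: "u : Neh ==> u : E" and Neh_a: "u : Neh ==> a u u > 0" by(auto simp: Neh_def)

lemma Neh_eq: "u : Neh ==> a u u + b u u = g u u + c u u" by(simp add: Neh_def DI_def)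

text \<open>Eliminating \<open>b\<close> by the Nehari identity leaves only nonnegative
  coefficients, because \<open>p > 4\<close>. Hence the energy is positive on the manifold, and four
  times the energy bounds \<open>a u u\<close>.\<close>

lemma Neh_I: assumes "u : Neh" shows "I u = a u u / 4 + g u u * (1 / 4 - 1 / p) + c u u / 12"
proof -
 have "b u u = g u u + c u u - a u u" using Neh_eq[OF assms] by simp
 thus ?thesis unfolding I_def by(simp add: algebra_simps)
qed

lemma I_hom: assumes "u : E" "t > 0"
 shows "I (t *R u) = a u u * (t^2 / 2) + b u u * (t ^ 4 / 4) - g u u * (t powr p / p) - c u u * (t ^ 6 / 6)"
 unfolding I_def using assms by(simp add: A.F_hom B.F_hom G.F_hom C.F_hom mult.commute)

text \<open>After elimination of \<open>b\<close> the difference \<open>I u - I (t *R u)\<close> is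
  a combination of \<open>a\<close>, \<open>g\<close>, \<open>c\<close> with nonnegative factors:
  two are explicit multiples of (1 - t^2)^2, and the one for \<open>g\<close> is Bernoulli's
  inequality for t^4 with exponent p / 4.\<close>

lemma Neh_fibre_max: assumes u: "u : Neh" and t: "t > 0" shows "I (t *R u) <= I u"
proof -
 have E: "u : E" using u Neh_E by blast
 have bb: "b u u = g u u + c u u - a u u" using Neh_eq[OF u] by simp
 have 1: "0 <= a u u * ((1/2 - t^2/2) - (1/4 - t^4/4))"
 proof -
  have eq: "(1/2 - t^2/2) - (1/4 - t^4/4) = (1 - t^2)^2 / 4" by(simp add: power2_eq_square field_simps power4_eq_xxxx)
  show ?thesis unfolding eq using A.f_nonneg[OF E] by simp
 qed
 have 2: "0 <= g u u * ((1/4 - t^4/4) - (1/p - t powr p / p))"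
 proof -
  have "(t powr 4) powr (p / 4) >= 1 + (p / 4) * (t powr 4 - 1)" using t p by(intro powr_ge_linear) auto
  moreover have "(t powr 4) powr (p / 4) = t powr p" by(simp add: powr_powr del: powr_numeral)
  ultimately have "t powr p >= 1 + (p / 4) * (t ^ 4 - 1)" using t by simp
  hence "t powr p / p >= (1 + (p / 4) * (t ^ 4 - 1)) / p" using p by(intro divide_right_mono) auto
  moreover have "(1 + (p / 4) * (t ^ 4 - 1)) / p = 1 / p + (t ^ 4 - 1) / 4" using p by(simp add: field_simps)
  ultimately have "(1/4 - t^4/4) - (1/p - t powr p / p) >= 0" by(simp add: diff_divide_distrib)
  thus ?thesis using G.f_nonneg[OF E] by(intro mult_nonneg_nonneg)
 qed
 have 3: "0 <= c u u * ((1/4 - t^4/4) - (1/6 - t^6/6))"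
 proof -
  have eq: "(1/4 - t^4/4) - (1/6 - t^6/6) = (1 - t^2)^2 * (1 + 2 * t^2) / 12" by(simp add: power2_eq_square field_simps power4_eq_xxxx eval_nat_numeral)
  show ?thesis unfolding eq using C.f_nonneg[OF E] by simp
 qed
 have "I u - I (t *R u) = a u u * ((1/2 - t^2/2) - (1/4 - t^4/4)) + g u u * ((1/4 - t^4/4) - (1/p - t powr p / p))
   + c u u * ((1/4 - t^4/4) - (1/6 - t^6/6))" unfolding I_hom[OF E t] unfolding I_def[of u] bb by(simp add: algebra_simps add_divide_distrib diff_divide_distrib)
 thus ?thesis using 1 2 3 by linarith
qed

text \<open>\<open>Neh_I\<close> bounds \<open>a\<close>, \<open>g\<close> and \<open>c\<close> on
  the sublevel set, and the Nehari identity then bounds \<open>b\<close>.\<close>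

lemma Sub_bounds: "EX R>0. ALL u:Sub. N u <= R"
proof -
 define q where "q = 1 / 4 - 1 / p"
 have q: "q > 0" using p by(simp add: q_def field_simps)
 define R0 where "R0 = abs (4 * c1) + abs c1 / q + abs (12 * c1)"
 obtain R' where R': "!!u. u : E ==> a u u <= R0 ==> b u u <= R0 ==> N u <= R'" using N_le by blast
 have "N u <= R'" if u: "u : Sub" for u
 proof -
  have E: "u : E" and n: "u : Neh" and i: "I u <= c1" using u by(auto simp: Sub_def Neh_def)
  have nn: "a u u >= 0" "g u u >= 0" "c u u >= 0" using A.f_nonneg[OF E] G.f_nonneg[OF E] C.f_nonneg[OF E] by auto
  have e: "a u u / 4 + g u u * q + c u u / 12 <= c1" using Neh_I[OF n] i by(simp add: q_def)
  have gq: "g u u * q >= 0" using nn q by simp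
  have 1: "a u u <= 4 * c1" "c u u <= 12 * c1" "g u u * q <= c1" using e gq nn by linarith+
  have 2: "g u u <= c1 / q" using 1(3) q by(simp add: field_simps)
  have 3: "c1 >= 0" using e gq nn by linarith
  have 4: "c1 / q >= 0" using 3 q by simp
  have "a u u <= R0" "b u u <= R0" using 1 2 3 4 Neh_eq[OF n] nn by(simp_all add: R0_def)
  thus ?thesis using R'[OF E] by blast
 qed
 thus ?thesis by(intro exI[of _ "abs R' + 1"]) force
qed

text \<open>For \<open>a <= 1\<close> the Sobolev bounds give a <= g + c <= 2 K a^2, which keeps
  \<open>a\<close> away from 0. So limits of points of the manifold keep a nonzero gradient.\<close>

lemma Neh_lower: "EX a0>0. ALL u:Neh. a u u >= a0"
proof -
 have "a u u >= min 1 (1 / (2 * K + 1))" if u: "u : Neh" for u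
 proof (cases "a u u <= 1")
  case True
  have E: "u : E" and ap: "a u u > 0" using u by(auto simp: Neh_def)
  have "a u u powr (p / 2) <= a u u powr 2" using True ap p by(intro powr_mono') auto
  hence 1: "a u u powr (p / 2) <= (a u u)^2" using ap by simp
  have 2: "(a u u) ^ 3 <= (a u u)^2" using True ap by(intro power_decreasing) auto
  have "a u u <= g u u + c u u" using Neh_eq[OF u] B.f_nonneg[OF E] by simp
  also have "... <= K * (a u u)^2 + K * (a u u)^2" using sobolev[OF E] 1 2 K_nonneg by(meson add_mono mult_left_mono order_trans)
  finally have "a u u * 1 <= a u u * (2 * K * a u u)" by(simp add: power2_eq_square algebra_simps)
  hence "1 <= 2 * K * a u u" using ap by(simp only: mult_le_cancel_left_pos)
  hence "1 <= (2 * K + 1) * a u u" using ap by(simp add: algebra_simps)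
  thus ?thesis using K_nonneg by(simp add: field_simps min_le_iff_disj)
 qed auto
 thus ?thesis using K_nonneg by(intro exI[of _ "min 1 (1 / (2 * K + 1))"]) auto
qed

end

section \<open>Quantitative descent along the manifold\<close>

text \<open>Serves the degrees 1, 3, \<open>p - 1\<close> and 5 of the four derivatives at once: the
  deviation from 1 is largest for exponent 5, and t^5 - 1 is t - 1 times a cofactor that stays below
  14 for \<open>t <= 3/2\<close>.\<close>

lemma abs_powr_minus_one_le:
 fixes t q :: real
 assumes t: "1 / 2 <= t" "t <= 3 / 2" and q: "1 <= q" "q <= 5"
 shows "abs (t powr q - 1) <= 14 * abs (t - 1)"
proof -
 have t0: "t > 0" using t by simp
 have p5: "t powr 5 = t ^ 5" using t0 by simp
 have fac: "t ^ 5 - 1 = (t - 1) * (1 + t + t^2 + t^3 + t^4)" by(simp add: algebra_simps eval_nat_numeral)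
 have le: "1 + t + t^2 + t^3 + t^4 <= 14"
 proof -
  have "t^2 <= (3/2)^2" "t^3 <= (3/2)^3" "t^4 <= (3/2)^4" using t by(intro power_mono; simp)+
  thus ?thesis using t by(simp add: power2_eq_square eval_nat_numeral)
 qed
 have ge: "1 + t + t^2 + t^3 + t^4 >= 0" using t0 by(intro add_nonneg_nonneg) auto
 have "abs (t powr q - 1) <= abs (t ^ 5 - 1)"
 proof (cases "t >= 1")
  case True
  have "t powr q <= t powr 5" using True q by(intro powr_mono) auto
  moreover have "t powr q >= 1" using True q by(intro ge_one_powr_ge_zero) auto
  ultimately show ?thesis using p5 by simp
 next
  case False
  have "t powr 5 <= t powr q" using False t0 q by(intro powr_mono') auto
  moreover have "t powr q <= 1" using False q t0 by(intro powr_le1) auto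
  ultimately show ?thesis using p5 by simp
 qed
 also have "... = abs (t - 1) * (1 + t + t^2 + t^3 + t^4)" unfolding fac abs_mult using ge by simp
 also have "... <= abs (t - 1) * 14" using le by(intro mult_left_mono) auto
 finally show ?thesis by simp
qed

context nehari
begin

text \<open>One step of the descent moves from \<open>u\<close> to \<open>u - h\<close> and returns
  to the manifold along the ray. The factor \<open>tau (u - h)\<close> is 1 + O(N h), as
  \<open>phi\<close> is steep at its zero, uniformly on the manifold. Expanding about
  \<open>t *R u\<close> instead of \<open>u\<close> makes the return free of cost, because
  \<open>u\<close> is the maximum on its own ray.\<close>

lemma step:
 obtains s0 ka Q where "s0 > 0" "ka > 0" "Q > 0"
  "!!u h. u : Sub ==> h : E ==> N h <= s0 ==> DI u h >= 0 ==>
    a (u - h) (u - h) > 0 & N (tau (u - h) *R (u - h) - u) <= ka * N h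
    & I (tau (u - h) *R (u - h)) <= I u - DI u h / 2 + Q * (N h)^2"
proof -
 obtain R where R: "R > 0" "!!u. u : Sub ==> N u <= R" using Sub_bounds by blast
 obtain a0 where a0: "a0 > 0" "!!u. u : Neh ==> a u u >= a0" using Neh_lower by blast
 obtain M1 where M1: "M1 >= 0" "!!u w. u : E ==> w : E ==> N u <= R + 1 ==> N w <= R + 1 ==>
   abs (a w w - a u u) <= M1 * N (w - u) & abs (b w w - b u u) <= M1 * N (w - u)
  & abs (g w w - g u u) <= M1 * N (w - u) & abs (c w w - c u u) <= M1 * N (w - u)" using lipschitz[of "R + 1"] by blast
 define M where "M = M1 + 1"
 have M: "M > 0" using M1 by(simp add: M_def)
 obtain P where P: "P >= 0" "!!u v. u : E ==> v : E ==> N u <= R ==>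
   abs (a u v) <= P * N v & abs (b u v) <= P * N v & abs (g u v) <= P * N v & abs (c u v) <= P * N v" using DI_bound[of R] by blast
 obtain Q0 where Q0: "Q0 >= 0" "!!u h. u : E ==> h : E ==> N u <= 2 * R ==> N h <= 1 ==>
    a (u + h) (u + h) / 2 + b (u + h) (u + h) / 4
     <= a u u / 2 + b u u / 4 + a u h + b u h + Q0 * (N h)^2" using taylor[of "2 * R"] by blast
 \<comment> \<open>Passing from \<open>u\<close> to \<open>u - h\<close> changes \<open>phi\<close>
   by at most 10 M N(h), while moving \<open>t\<close> from 1 to 1 + ep or 1 - ep changes
   \<open>phi u\<close> by at least a0 ep / 2; the zero therefore moves by at most 20 M / a0 times
   \<open>N h\<close>.\<close>
 define ka0 where "ka0 = 20 * M / a0"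
 have k0: "ka0 > 0" using M a0 by(simp add: ka0_def)
 \<comment> \<open>The three bounds keep the scaled increment below norm 1, \<open>tau\<close>
   within 1/4 of 1, and \<open>a\<close> positive at \<open>u - h\<close>.\<close>
 define s0 where "s0 = min (1 / 2) (min (1 / (4 * ka0)) (a0 / (2 * M)))"
 have s0: "s0 > 0" "s0 <= 1 / 2" "s0 <= 1 / (4 * ka0)" "s0 <= a0 / (2 * M)" using k0 a0 M by(auto simp: s0_def)
 \<comment> \<open>9/4 is the square of the bound 3/2 on \<open>t\<close>; 84 is 3/2 times 4 times
   14, with 14 from \<open>abs_powr_minus_one_le\<close> for each of the four terms.\<close>
 define Q where "Q = Q0 * (9 / 4) + 84 * ka0 * P + 1"
 show ?thesis
 proof (rule that[of s0 "ka0 * R + 3 / 2" Q])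
  show "ka0 * R + 3 / 2 > 0" using k0 R by(simp add: add_pos_pos)
  show "Q > 0" using Q0 k0 P by(simp add: Q_def add_nonneg_pos)
  fix u h assume u: "u : Sub" and h: "h : E" and hs: "N h <= s0" and D0: "DI u h >= 0"
  have n: "u : Neh" using u by(simp add: Sub_def)
  have E: "u : E" using n Neh_E by blast
  have Nh0: "N h >= 0" using h by simp
  define w where "w = u - h"
  have wE: "w : E" using E h by(simp add: w_def)
  have wu: "N (w - u) = N h" using h by(simp add: w_def)
  have Nw: "N w <= R + 1" using N_diff_le[OF E h] R(2)[OF u] hs s0 by(simp add: w_def)
  have L: "abs (a w w - a u u) <= M * N h" "abs (b w w - b u u) <= M * N h"
   "abs (g w w - g u u) <= M * N h" "abs (c w w - c u u) <= M * N h" using M1(2)[OF E wE _ Nw] R(2)[OF u] wu Nh0 by(auto simp: M_def distrib_right)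
  have au: "a u u >= a0" using a0 n by blast
  have "M * N h <= M * (a0 / (2 * M))" using hs s0 M by(intro mult_left_mono) auto
  hence "M * N h <= a0 / 2" using M by simp
  hence aw: "a w w > 0" using L(1) au a0 by(simp add: abs_le_iff)
  have phi_diff: "abs (phi w t - phi u t) <= M * N h * 10" if t: "1 / 2 <= t" "t <= 3 / 2" for t
  proof -
   have t2: "t powr (-2) = 1 / t^2" "t powr 2 = t^2" using t by(simp_all add: powr_minus_divide)
   have "(1 / 2)^2 <= t^2" "t^2 <= (3 / 2)^2" using t by(intro power_mono; simp)+
   hence b2: "1 / t^2 <= 4" "t^2 <= 9 / 4" by(simp_all add: power2_eq_square field_simps)
   have b3: "t powr (p - 4) <= 9 / 4"
   proof (cases "t <= 1")
    case True
    have "t powr (p - 4) <= 1" using True t p by(intro powr_le1) auto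
    thus ?thesis by simp
   next
    case False
    have "t powr (p - 4) <= t powr 2" using False p by(intro powr_mono) auto
    thus ?thesis using b2 t2 by simp
   qed
   have "phi w t - phi u t = (a w w - a u u) * (1 / t^2) + (b w w - b u u) * 1
     - (g w w - g u u) * t powr (p - 4) - (c w w - c u u) * t^2" unfolding phi_def t2 by(simp add: algebra_simps diff_divide_distrib)
   also have "abs (...) <= abs ((a w w - a u u) * (1 / t^2)) + abs ((b w w - b u u) * 1)
     + abs ((g w w - g u u) * t powr (p - 4)) + abs ((c w w - c u u) * t^2)" by linarith
   also have "... <= M * N h * 4 + M * N h * 1 + M * N h * (9/4) + M * N h * (9/4)" unfolding abs_mult using L b2 b3 M Nh0 by(intro add_mono mult_mono) auto
   also have "... <= M * N h * 10" using M Nh0 by simp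
   finally show ?thesis .
  qed
  have tau1: "abs (tau w - 1) < ep" if e: "ka0 * N h < ep" "ep <= 1 / 2" for ep
  proof -
   have e0: "ep > 0" using e k0 Nh0 by(meson less_le_trans less_eq_real_def mult_nonneg_nonneg order_le_less_trans)
   have key: "M * N h * 10 < a0 * ep / 2" using e a0 by(simp add: ka0_def field_simps)
   have p1: "phi u 1 = 0" using Neh_phi[OF n] .
   have p1': "a u u + b u u - g u u - c u u = 0" using p1 by(simp add: phi_def)
   have gc: "g u u >= 0" "c u u >= 0" using G.f_nonneg[OF E] C.f_nonneg[OF E] by auto
   have up: "phi w (1 + ep) < 0"
   proof -
    have "phi u (1 + ep) <= - (a0 * ep / 2)"
    proof -
     have 1: "1 - (1 + ep) powr (-2) >= ep / 2"
     proof -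
      have "(1 + ep)^2 <= 1 + 5/2 * ep" using e e0 mult_right_mono[of ep "1/2" ep] by(simp add: power2_eq_square algebra_simps)
      have "(1 - ep / 2) * (1 + ep)^2 >= 1"
      proof -
       have "(1 - ep / 2) * (1 + ep)^2 = 1 + ep * (3 / 2 - ep^2 / 2)" by(simp add: power2_eq_square field_simps)
       moreover have "ep^2 <= 1" using e e0 by(intro power_le_one) auto
       ultimately show ?thesis using e0 by simp
      qed
      hence "1 / (1 + ep)^2 <= 1 - ep / 2" using e0 by(simp add: divide_le_eq)
      thus ?thesis using e0 by(simp add: powr_minus_divide)
     qed
     have "a u u * (1 - (1 + ep) powr (-2)) >= a0 * (ep / 2)" using au a0 1 e0 by(intro mult_mono) auto
     moreover have "g u u * (1 + ep) powr (p - 4) >= g u u * 1" "c u u * (1 + ep) powr 2 >= c u u * 1" using gc e0 p by(intro mult_left_mono ge_one_powr_ge_zero; simp)+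
     ultimately show ?thesis using p1' unfolding phi_def by(simp add: algebra_simps)
    qed
    moreover have "abs (phi w (1 + ep) - phi u (1 + ep)) <= M * N h * 10" using e e0 by(intro phi_diff) auto
    ultimately show ?thesis using key by(simp add: abs_le_iff)
   qed
   have lo: "phi w (1 - ep) > 0"
   proof -
    have "phi u (1 - ep) >= a0 * ep / 2"
    proof -
     have 1: "(1 - ep) powr (-2) - 1 >= ep / 2"
     proof -
      have "(1 + ep / 2) * (1 - ep)^2 <= (1 + ep / 2) * (1 - ep)" using e e0 by(intro mult_left_mono) (auto simp: power2_eq_square mult_left_le)
      also have "... <= 1" using e0 by(simp add: algebra_simps)
      finally have "(1 + ep / 2) <= 1 / (1 - ep)^2" using e by(simp add: le_divide_eq)
      thus ?thesis using e by(simp add: powr_minus_divide)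
     qed
     have "a u u * ((1 - ep) powr (-2) - 1) >= a0 * (ep / 2)" using au a0 1 e0 by(intro mult_mono) auto
     moreover have "g u u * (1 - ep) powr (p - 4) <= g u u * 1" "c u u * (1 - ep) powr 2 <= c u u * 1" using gc e0 e p by(intro mult_left_mono powr_le1; simp)+
     ultimately show ?thesis using p1' unfolding phi_def by(simp add: algebra_simps)
    qed
    moreover have "abs (phi w (1 - ep) - phi u (1 - ep)) <= M * N h * 10" using e e0 by(intro phi_diff) auto
    ultimately show ?thesis using key by(simp add: abs_le_iff)
   qed
   show ?thesis using tau_less[OF wE aw _ up] tau_greater[OF wE aw _ lo] e e0 by(simp add: abs_less_iff)
  qed
  have kh: "ka0 * N h <= 1 / 4"
  proof -
   have "ka0 * N h <= ka0 * (1 / (4 * ka0))" using hs s0 k0 by(intro mult_left_mono) auto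
   thus ?thesis using k0 by simp
  qed
  have tk: "abs (tau w - 1) <= ka0 * N h"
  proof (rule ccontr)
   assume "~ ?thesis"
   hence "ka0 * N h < abs (tau w - 1)" by simp
   moreover have "abs (tau w - 1) < 1 / 2" using tau1[of "1 / 2"] kh by simp
   ultimately show False using tau1[of "abs (tau w - 1)"] by simp
  qed
  define t where "t = tau w"
  have t: "1 / 2 <= t" "t <= 3 / 2" using tk kh by(simp_all add: t_def abs_le_iff)
  have t0: "t > 0" using t by simp
  have teq: "t *R w = t *R u + (- t) *R h" by(simp add: w_def algebra_simps)
  have "N (t *R w - u) <= (ka0 * R + 3 / 2) * N h"
  proof -
   have "t *R w - u = (t - 1) *R u + (- t) *R h" by(simp add: w_def algebra_simps)
   hence "N (t *R w - u) <= abs (t - 1) * N u + t * N h" using N_tri[of "(t - 1) *R u" "(- t) *R h"] E h t0 by(simp add: N_scale)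
   also have "... <= ka0 * N h * R + 3 / 2 * N h" using tk R(2)[OF u] t E Nh0 k0 by(intro add_mono mult_mono) (auto simp: t_def)
   finally show ?thesis by(simp add: algebra_simps)
  qed
  moreover have "I (t *R w) <= I u - DI u h / 2 + Q * (N h)^2"
  proof -
   let ?U = "t *R u" and ?H = "(- t) *R h"
   have UE: "?U : E" "?H : E" "t *R w : E" using E h wE by auto
   have NU: "N ?U <= 2 * R" using mult_mono[of t 2 "N u" R] t R(2)[OF u] E R(1) by(simp add: N_scale)
   have NH: "N ?H = t * N h" using h t0 by(simp add: N_scale)
   have "t * N h <= 3 / 2 * (1 / 2)" using t hs s0 Nh0 by(intro mult_mono) auto
   hence NH1: "N ?H <= 1" using NH by simp
   have T: "a (t *R w) (t *R w) / 2 + b (t *R w) (t *R w) / 4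
     <= a ?U ?U / 2 + b ?U ?U / 4 + a ?U ?H + b ?U ?H + Q0 * (t * N h)^2" using Q0(2)[OF UE(1,2) NU NH1] unfolding teq NH .
   have gg: "g (t *R w) (t *R w) >= g ?U ?U + p * g ?U ?H" using G.F_convex[OF UE(1,3)] by(simp add: teq)
   have cc: "c (t *R w) (t *R w) >= c ?U ?U + 6 * c ?U ?H" using C.F_convex[OF UE(1,3)] by(simp add: teq)
   have gg': "g (t *R w) (t *R w) / p >= g ?U ?U / p + g ?U ?H" using divide_right_mono[OF gg, of p] p by(simp add: add_divide_distrib)
   have cc': "c (t *R w) (t *R w) / 6 >= c ?U ?U / 6 + c ?U ?H" using cc by simp
   have "I (t *R w) <= I ?U + DI ?U ?H + Q0 * (t * N h)^2" using T gg' cc' unfolding I_def DI_def by linarith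
   also have "DI ?U ?H = - t * DI ?U h" by(rule DI_scale[OF UE(1) h])
   also have "I ?U <= I u" using Neh_fibre_max[OF n t0] .
   finally have 1: "I (t *R w) <= I u - t * DI ?U h + Q0 * (t * N h)^2" by simp
   have "DI ?U h - DI u h = (t powr 1 - 1) * a u h + (t powr 3 - 1) * b u h - (t powr (p - 1) - 1) * g u h - (t powr 5 - 1) * c u h" unfolding DI_def using E h t0
    by(simp add: A.f_hom B.f_hom G.f_hom C.f_hom algebra_simps del: powr_numeral)
   also have "abs (...) <= abs ((t powr 1 - 1) * a u h) + abs ((t powr 3 - 1) * b u h) + abs ((t powr (p - 1) - 1) * g u h) + abs ((t powr 5 - 1) * c u h)" by linarith
   also have "... <= 14 * abs (t - 1) * (P * N h) + 14 * abs (t - 1) * (P * N h) + 14 * abs (t - 1) * (P * N h) + 14 * abs (t - 1) * (P * N h)"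
    unfolding abs_mult using P(2)[OF E h R(2)[OF u]] p by(intro add_mono mult_mono abs_powr_minus_one_le[OF t]) auto
   also have "... = 56 * abs (t - 1) * (P * N h)" by simp
   also have "... <= 56 * (ka0 * N h) * (P * N h)" using tk P Nh0 by(intro mult_right_mono) (auto simp: t_def)
   finally have "DI u h - 56 * ka0 * P * (N h)^2 <= DI ?U h" by(simp add: abs_le_iff power2_eq_square algebra_simps)
   hence "t * (DI u h - 56 * ka0 * P * (N h)^2) <= t * DI ?U h" using t0 by(intro mult_left_mono) auto
   moreover have "DI u h / 2 <= t * DI u h" using mult_right_mono[OF t(1) D0] by simp
   moreover have "t * (56 * ka0 * P * (N h)^2) <= 3/2 * (56 * ka0 * P * (N h)^2)" using t k0 P by(intro mult_right_mono) auto
   ultimately have 2: "t * DI ?U h >= DI u h / 2 - 84 * ka0 * P * (N h)^2" by(simp only: right_diff_distrib)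
   have "(t * N h)^2 <= (3 / 2 * N h)^2" using t Nh0 by(intro power_mono mult_right_mono) auto
   hence "Q0 * (t * N h)^2 <= Q0 * (9 / 4 * (N h)^2)" using Q0(1) by(intro mult_left_mono) (auto simp: power2_eq_square)
   moreover have "Q * (N h)^2 = Q0 * (9 / 4 * (N h)^2) + 84 * ka0 * P * (N h)^2 + (N h)^2" by(simp add: Q_def algebra_simps)
   moreover have "(N h)^2 >= 0" by simp
   ultimately show ?thesis using 1 2 by linarith
  qed
  ultimately show "a (u - h) (u - h) > 0 & N (tau (u - h) *R (u - h) - u) <= (ka0 * R + 3 / 2) * N h
    & I (tau (u - h) *R (u - h)) <= I u - DI u h / 2 + Q * (N h)^2" using aw by(simp add: w_def t_def)
 qed (use s0 in auto)
qed

end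

lemma finite_pos_lower_bound:
 fixes f :: "'a => real"
 assumes "finite A" "!!x. x : A ==> f x > 0"
 obtains e where "e > 0" "!!x. x : A ==> e <= f x"
proof (cases "A = {}")
 case True thus ?thesis using that[of 1] by simp
next
 case False
 show ?thesis
 proof (rule that[of "Min (f ` A)"])
  show "Min (f ` A) > 0" using assms False by simp
  show "Min (f ` A) <= f x" if "x : A" for x using assms that by simp
 qed
qed

context nehari
begin

text \<open>\<open>phi\<close> is strictly decreasing in \<open>t\<close>, so a strict sign of
  \<open>phi\<close> at one fixed \<open>t\<close> bounds \<open>tau\<close> on one side, and such a
  sign persists nearby.\<close>

lemma tau_continuous:
 assumes w: "ncont S w" and p: "!!x. x : S ==> a (w x) (w x) > 0"
 shows "continuous_on S (%x. tau (w x))" unfolding continuous_on_def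
proof
 fix x assume x: "x : S"
 have E: "w x : E" using w x by(simp add: ncont_def)
 have lim: "((%y. phi (w y) t) ---> phi (w x) t) (at x within S)" for t unfolding phi_def using w x
  by(intro tendsto_intros A.F_tendsto B.F_tendsto G.F_tendsto C.F_tendsto) (auto simp: ncont_def)
 have yS: "eventually (%y. y : S) (at x within S)" by(simp add: eventually_at_filter)
 show "((%y. tau (w y)) ---> tau (w x)) (at x within S)"
 proof (rule order_tendstoI)
  fix l assume l: "l < tau (w x)"
  obtain t where t: "max l 0 < t" "t < tau (w x)" using l tau(1)[OF E p[OF x]] dense by(metis max_less_iff_conj)
  have "phi (w x) t > 0" using phi_strict[OF E p[OF x], of t "tau (w x)"] t tau(2)[OF E p[OF x]] by simp
  hence "eventually (%y. phi (w y) t > 0) (at x within S)" using lim by(rule order_tendstoD(1)[rotated])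
  with yS show "eventually (%y. l < tau (w y)) (at x within S)"
  proof eventually_elim
   case (elim y)
   thus ?case using tau_greater[of "w y" t] t p[of y] ncont_E[OF w, of y] by simp
  qed
 next
  fix l assume l: "tau (w x) < l"
  have l0: "l > 0" using l tau(1)[OF E p[OF x]] by simp
  have "phi (w x) l < 0" using phi_strict[OF E p[OF x], of "tau (w x)" l] l tau[OF E p[OF x]] by simp
  hence "eventually (%y. phi (w y) l < 0) (at x within S)" using lim by(rule order_tendstoD(2)[rotated])
  with yS show "eventually (%y. tau (w y) < l) (at x within S)"
  proof eventually_elim
   case (elim y)
   thus ?case using tau_less[of "w y" l] l0 p[of y] ncont_E[OF w, of y] by simp
  qed
 qed
qed

definition critical where "critical w <-> w : E & a w w > 0 & (ALL v:E. DI w v = 0)"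

end

section \<open>Deformations in the presence of finitely many critical pairs\<close>

text \<open>The situation to be refuted: up to sign and distance 0, the \<open>k\<close> elements
  \<open>us\<close> exhaust the critical points with nonzero gradient. The Palais--Smale property is
  asked for gradient terms up to \<open>4 * c1\<close>, a bound that \<open>Neh_I\<close> guarantees
  on \<open>Sub\<close>.\<close>

locale nehari_descent = nehari E N a b g c p c1 K
 for E :: "'v::real_vector set" and N and a b g c :: "'v => 'v => real" and p c1 K :: real +
 fixes us :: "nat => 'v" and k :: nat
 assumes palais_smale: "(!!n. u n : E) ==> EX R. ALL n. N (u n) <= R ==> (!!n. a (u n) (u n) <= 4 * c1) ==>
   e ----> 0 ==> (!!n v. v : E ==> abs (DI (u n) v) <= e n * N v) ==>
   EX r w. strict_mono (r :: nat => nat) & w : E & (%n. N (u (r n) - w)) ----> 0"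
  and us_E [simp]: "!!i. i < k ==> us i : E"
  and us_all: "!!w. critical w ==> EX i<k. N (w - us i) = 0 | N (w + us i) = 0"
  and us_pos: "!!i. i < k ==> N (us i) > 0"
  and us_apart: "!!i j. i < k ==> j < k ==> i ~= j ==> N (us i - us j) > 0 & N (us i + us j) > 0"
begin

definition far where "far r u <-> (ALL i<k. N (u - us i) >= r & N (u + us i) >= r)"

text \<open>A continuous even substitute for not being \<open>far\<close>, positive exactly there;
  it serves as a weight in partitions of unity.\<close>

definition near where "near r u = (\<Sum>i<k. max 0 (r - N (u - us i)) + max 0 (r - N (u + us i)))"

lemma near_pos_iff: "near r u > 0 <-> ~ far r u"
proof
 assume "near r u > 0"
 show "~ far r u"
 proof
  assume "far r u"
  hence "near r u = 0" unfolding near_def far_def by(intro sum.neutral) auto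
  thus False using \<open>near r u > 0\<close> by simp
 qed
next
 assume "~ far r u"
 then obtain i where i: "i < k" "N (u - us i) < r | N (u + us i) < r" by(auto simp: far_def not_le)
 show "near r u > 0" unfolding near_def
 proof (rule sum_pos2[of _ i])
  show "0 < max 0 (r - N (u - us i)) + max 0 (r - N (u + us i))" using i by(auto intro: add_pos_nonneg add_nonneg_pos)
 qed (use i in auto)
qed

lemma near_nonneg: "near r u >= 0" unfolding near_def by(intro sum_nonneg) auto

lemma far_mono: "far r u ==> s <= r ==> far s u" unfolding far_def by force

lemma far_neg: assumes "u : E" shows "far r (- u) <-> far r u"
proof -
 have "N (- u - us i) = N (u + us i)" "N (- u + us i) = N (u - us i)" if "i < k" for i using N_neg[of "u + us i"] N_neg[of "u - us i"] assms that by simp_all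
 thus ?thesis unfolding far_def by auto
qed

lemma near_continuous_on: assumes "ncont S h" shows "continuous_on S (%x. near r (h x))"
proof -
 have "continuous_on S (%x. N (h x + us i))" if "i < k" for i using ncont_N_diff[OF assms, of "- us i"] that by simp
 thus ?thesis unfolding near_def using assms by(intro continuous_intros ncont_N_diff) auto
qed

text \<open>Otherwise some sequence in \<open>Sub\<close> has derivatives tending to 0 and stays at
  distance \<open>r\<close> from all \<open>us i\<close> and \<open>- us i\<close>. Its
  Palais--Smale limit is critical, with nonzero gradient by \<open>Neh_lower\<close>, and
  contradicts \<open>us_all\<close>.\<close>

lemma gradient_bound:
 assumes r: "r > 0"
 obtains dl where "dl > 0" "!!u. u : Sub ==> far r u ==> EX v:E. N v <= 1 & DI u v > dl"
proof (rule ccontr)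
 assume "~ thesis"
 hence no: "!!dl. dl > 0 ==> EX u:Sub. far r u & (ALL v:E. N v <= 1 --> DI u v <= dl)" using that by(meson not_le)
 have "EX u:Sub. far r u & (ALL v:E. N v <= 1 --> DI u v <= 1 / real (Suc n))" for n by(rule no) simp
 then obtain u where u: "!!n. u n : Sub" "!!n. far r (u n)"
  "!!n v. v : E ==> N v <= 1 ==> DI (u n) v <= 1 / real (Suc n)" by metis
 have uE: "u n : E" for n using u(1)[of n] by(simp add: Sub_def Neh_def)
 have "DI (u n) v <= 1 / real (Suc n) * N v" if v: "v : E" for n v
 proof (cases "N v = 0")
  case True
  have "DI (u n) v <= 0"
  proof (rule ccontr)
   assume "~ ?thesis"
   hence d: "DI (u n) v > 0" by simp
   have "DI (u n) ((2 / DI (u n) v) *R v) <= 1 / real (Suc n)" using True v by(intro u(3)) (auto simp: N_scale)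
   hence "2 <= 1 / real (Suc n)" using d v uE by(simp add: DI_scale)
   thus False by(simp add: field_simps)
  qed
  thus ?thesis using True by simp
 next
  case False
  hence Np: "N v > 0" using N_nonneg[OF v] by linarith
  have "DI (u n) ((1 / N v) *R v) <= 1 / real (Suc n)" using Np v by(intro u(3)) (auto simp: N_scale)
  thus ?thesis using Np v uE by(simp add: DI_scale field_simps)
 qed
 hence D: "abs (DI (u n) v) <= 1 / real (Suc n) * N v" if "v : E" for n v using that DI_neg[OF uE that, of n] N_neg[OF that] E_neg[OF that] by(metis abs_le_iff)
 have "EX R. ALL n. N (u n) <= R" using Sub_bounds u(1) by blast
 moreover have "a (u n) (u n) <= 4 * c1" for n
 proof -
  have n: "u n : Neh" "I (u n) <= c1" using u(1)[of n] by(auto simp: Sub_def)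
  have "g (u n) (u n) * (1 / 4 - 1 / p) >= 0" using G.f_nonneg[OF uE[of n]] p by(intro mult_nonneg_nonneg) (auto simp: field_simps)
  thus ?thesis using Neh_I[OF n(1)] n(2) C.f_nonneg[OF uE[of n]] by linarith
 qed
 moreover have "(%n. 1 / real (Suc n)) ----> 0" by(rule LIMSEQ_Suc[OF lim_1_over_n])
 ultimately obtain q w where q: "strict_mono (q :: nat => nat)" "w : E" "(%n. N (u (q n) - w)) ----> 0" using palais_smale[of u "%n. 1 / real (Suc n)"] uE D by blast
 have T: "Ntends (%n. u (q n)) w sequentially" using q uE by(simp add: Ntends_def)
 have crit: "critical w"
 proof -
  obtain a0 where a0: "a0 > 0" "!!u. u : Neh ==> a u u >= a0" using Neh_lower by blast
  have "a0 <= a w w" by(rule tendsto_lowerbound[OF A.F_tendsto[OF T]]) (use a0 u(1) in \<open>auto simp: Sub_def\<close>)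
  moreover have "DI w v = 0" if v: "v : E" for v
  proof -
   have "(%n. DI (u (q n)) v) ----> 0"
   proof (rule Lim_null_comparison)
    show "eventually (%n. norm (DI (u (q n)) v) <= 1 / real (Suc (q n)) * N v) sequentially" using D[OF v] by(auto intro!: always_eventually)
    have "(%n. 1 / real (Suc (q n))) ----> 0" using LIMSEQ_subseq_LIMSEQ[OF LIMSEQ_Suc[OF lim_1_over_n] q(1)] by(simp add: o_def)
    thus "(%n. 1 / real (Suc (q n)) * N v) ----> 0" by(rule tendsto_mult_left_zero)
   qed
   thus ?thesis using DI_tendsto[OF T v] LIMSEQ_unique by blast
  qed
  ultimately show ?thesis using q(2) a0(1) by(auto simp: critical_def)
 qed
 then obtain i where i: "i < k" "N (w - us i) = 0 | N (w + us i) = 0" using us_all by blast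
 have "eventually (%n. N (u (q n) - w) < r) sequentially" using q(3) r by(rule order_tendstoD(2))
 then obtain n where n: "N (u (q n) - w) < r" by(auto simp: eventually_sequentially)
 have "N (u (q n) - us i) >= r" "N (u (q n) + us i) >= r" using u(2)[of "q n"] i(1) by(auto simp: far_def)
 moreover have "N (u (q n) - us i) <= N (u (q n) - w) + N (w - us i)" using uE q(2) i(1) by(intro N_tri_diff) auto
 moreover have "N (u (q n) + us i) <= N (u (q n) - w) + N (w + us i)" using uE q(2) i(1) N_tri_diff[of "u (q n)" w "- us i"] by simp
 ultimately show False using n i(2) by linarith
qed

text \<open>A descent direction at two scales: slope \<open>dl1\<close> outside the balls of radius
  \<open>2 * r\<close>, the smaller slope \<open>dl2\<close> outside the tiny balls of radius
  \<open>2 * rh\<close>, and inside these only a slope proportional to the length, so that 0 is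
  allowed. All conditions are convex in \<open>v\<close> and survive averaging.\<close>

definition admissible where
 "admissible r rh dl1 dl2 u v <-> v : E & N v <= 1 & DI u v >= dl2 * N v
   & (far (2 * rh) u --> DI u v >= dl2) & (far (2 * r) u --> DI u v >= dl1)"

lemma admissible_sum:
 assumes u: "u : E" and F: "finite F" and t: "!!x. x : F ==> th x >= 0" "(\<Sum>x\<in>F. th x) = 1"
  and v: "!!x. x : F ==> v x : E" "!!x. x : F ==> th x > 0 ==> admissible r rh dl1 dl2 u (v x)" and d: "dl2 >= 0"
 shows "admissible r rh dl1 dl2 u (\<Sum>x\<in>F. th x *R v x)"
proof -
 let ?V = "\<Sum>x\<in>F. th x *R v x"
 have D: "DI u ?V = (\<Sum>x\<in>F. th x * DI u (v x))" by(rule DI_sum[OF u v(1)])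
 have NV: "N ?V <= (\<Sum>x\<in>F. th x * N (v x))" using N_sum_le[of F "%x. th x *R v x"] v t by(simp add: N_scale)
 have low: "m <= DI u ?V" if "!!x. x : F ==> th x > 0 ==> m <= DI u (v x)" for m
 proof -
  have "m = (\<Sum>x\<in>F. th x * m)" using t(2) by(simp add: sum_distrib_right[symmetric])
  also have "... <= DI u ?V" unfolding D
  proof (rule sum_mono)
   fix x assume x: "x : F"
   show "th x * m <= th x * DI u (v x)" using t(1)[OF x] that[OF x] by(cases "th x = 0") (auto intro: mult_left_mono)
  qed
  finally show ?thesis .
 qed
 have "N ?V <= 1"
 proof -
  have "(\<Sum>x\<in>F. th x * N (v x)) <= (\<Sum>x\<in>F. th x)"
  proof (rule sum_mono)
   fix x assume x: "x : F"
   show "th x * N (v x) <= th x" using t(1)[OF x] v(2)[OF x] by(cases "th x = 0") (auto simp: admissible_def mult_left_le)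
  qed
  thus ?thesis using NV t by simp
 qed
 moreover have "dl2 * N ?V <= DI u ?V"
 proof -
  have "dl2 * N ?V <= dl2 * (\<Sum>x\<in>F. th x * N (v x))" using NV d by(rule mult_left_mono)
  also have "... = (\<Sum>x\<in>F. th x * (dl2 * N (v x)))" by(simp add: sum_distrib_left mult.left_commute)
  also have "... <= DI u ?V" unfolding D
  proof (rule sum_mono)
   fix x assume x: "x : F"
   show "th x * (dl2 * N (v x)) <= th x * DI u (v x)" using t(1)[OF x] v(2)[OF x] by(cases "th x = 0") (auto simp: admissible_def intro: mult_left_mono)
  qed
  finally show ?thesis .
 qed
 ultimately show ?thesis unfolding admissible_def using v low[of dl1] low[of dl2] by(auto simp: admissible_def)
qed

lemma admissible_odd:
 assumes u: "u : E" and v: "admissible r rh dl1 dl2 u v" and w: "admissible r rh dl1 dl2 (- u) w" and d: "dl2 >= 0"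
 shows "admissible r rh dl1 dl2 u ((1/2) *R (v - w))"
proof -
 have E: "v : E" "w : E" using v w by(auto simp: admissible_def)
 have D: "DI u ((1/2) *R (v - w)) = (DI u v + DI (- u) w) / 2" using u E DI_add[of u v "- w"] by(simp add: DI_scale DI_odd DI_neg)
 have n: "N ((1/2) *R (v - w)) <= (N v + N w) / 2" using N_diff_le[OF E] E by(simp add: N_scale)
 hence "dl2 * N ((1/2) *R (v - w)) <= dl2 * ((N v + N w) / 2)" using d by(rule mult_left_mono)
 hence n2: "dl2 * N ((1/2) *R (v - w)) <= (dl2 * N v + dl2 * N w) / 2" by(simp add: distrib_left)
 note f = far_neg[OF u, of "2 * rh"] far_neg[OF u, of "2 * r"]
 have V: "N v <= 1" "DI u v >= dl2 * N v" "far (2 * rh) u ==> DI u v >= dl2" "far (2 * r) u ==> DI u v >= dl1" using v by(auto simp: admissible_def)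
 have W: "N w <= 1" "DI (- u) w >= dl2 * N w" "far (2 * rh) u ==> DI (- u) w >= dl2" "far (2 * r) u ==> DI (- u) w >= dl1" using w f by(auto simp: admissible_def)
 show ?thesis unfolding admissible_def D
 proof (intro conjI impI)
  show "(1/2) *R (v - w) : E" using E by simp
  show "N ((1/2) *R (v - w)) <= 1" using n V(1) W(1) by simp
  show "dl2 * N ((1/2) *R (v - w)) <= (DI u v + DI (- u) w) / 2" using n2 V(2) W(2) by simp
  show "dl2 <= (DI u v + DI (- u) w) / 2" if "far (2 * rh) u" using V(3)[OF that] W(3)[OF that] by simp
  show "dl1 <= (DI u v + DI (- u) w) / 2" if "far (2 * r) u" using V(4)[OF that] W(4)[OF that] by simp
 qed
qed

definition good where
 "good n h <-> ncont (SS n) h & (ALL x:SS n. h x : Sub & h (%i. - x i) = - h x)"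

lemma Sub_E: "u : Sub ==> u : E" by(simp add: Sub_def Neh_def)

text \<open>The field lives on the compact sphere rather than on the manifold: each parameter has
  one direction that stays admissible nearby, finitely many neighbourhoods suffice, and the weighted
  mean is made odd at the end by antisymmetrising.\<close>

lemma pseudo_gradient:
 assumes h: "good n h" and r: "0 < rh" "rh <= r" and d: "0 < dl2" "dl2 <= dl1"
  and d1: "!!u. u : Sub ==> far r u ==> EX v:E. N v <= 1 & DI u v > dl1"
  and d2: "!!u. u : Sub ==> far rh u ==> EX v:E. N v <= 1 & DI u v > dl2"
 obtains V where "ncont (SS n) V" "!!x. x : SS n ==> admissible r rh dl1 dl2 (h x) (V x)"
  "!!x. x : SS n ==> V (%i. - x i) = - V x"
proof -
 let ?P = "admissible r rh dl1 dl2"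
 have hc: "ncont (SS n) h" and hS: "!!x. x : SS n ==> h x : Sub"
  and ho: "!!x. x : SS n ==> h (%i. - x i) = - h x" using h by(auto simp: good_def)
 have hE: "!!x. x : SS n ==> h x : E" using hS Sub_E by blast
 define PP where "PP x v om <-> v : E & continuous_on (SS n) om & om x > 0 & (ALL y:SS n. om y >= 0) & (ALL y:SS n. om y > 0 --> ?P (h y) v)"
  for x v and om :: "(nat => real) => real"
 have "EX v om. PP x v om"
  if x: "x : SS n" for x
 proof -
  consider "far r (h x)" | "~ far r (h x)" "far rh (h x)" | "~ far rh (h x)" by blast
  thus ?thesis
  proof cases
   case 1
   then obtain v where v: "v : E" "N v <= 1" "DI (h x) v > dl1" using d1 hS[OF x] by blast
   have P: "?P (h y) v" if "DI (h y) v > dl1" for y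
   proof -
    have "dl2 * N v <= dl2" using v d by(simp add: mult_left_le)
    hence "dl2 * N v <= DI (h y) v" using that d by linarith
    thus ?thesis using v that d by(auto simp: admissible_def)
   qed
   define om where "om y = max 0 (DI (h y) v - dl1)" for y
   have "continuous_on (SS n) om" unfolding om_def by(intro continuous_intros DI_continuous_on hc v(1))
   moreover have "om x > 0" "!!y. om y >= 0" using v by(auto simp: om_def)
   moreover have "?P (h y) v" if "om y > 0" for y using that P[of y] by(auto simp: om_def less_max_iff_disj)
   ultimately show ?thesis using v(1)  unfolding PP_def by(intro exI[of _ v], intro exI[of _ om]) auto
  next
   case 2
   then obtain v where v: "v : E" "N v <= 1" "DI (h x) v > dl2" using d2 hS[OF x] by blast
   have P: "?P (h y) v" if "DI (h y) v > dl2" "near (2 * r) (h y) > 0" for y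
   proof -
    have "dl2 * N v <= dl2" using v d by(simp add: mult_left_le)
    hence "dl2 * N v <= DI (h y) v" using that d by linarith
    thus ?thesis using v that d by(auto simp: admissible_def near_pos_iff)
   qed
   \<comment> \<open>The factor \<open>near\<close> removes the points outside the large balls,
     where a slope of only \<open>dl2\<close> would not be admissible.\<close>
   define om where "om y = max 0 (DI (h y) v - dl2) * near (2 * r) (h y)" for y
   have "continuous_on (SS n) om" unfolding om_def by(intro continuous_intros DI_continuous_on near_continuous_on hc v(1))
   moreover have "near (2 * r) (h x) > 0" unfolding near_pos_iff using 2(1) far_mono[of "2 * r" "h x" r] r by linarith
   hence "om x > 0" using v by(simp add: om_def)
   moreover have "!!y. om y >= 0" using near_nonneg by(simp add: om_def)
   moreover have "?P (h y) v" if "om y > 0" for y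
   proof (rule P)
    show "near (2 * r) (h y) > 0" using that near_nonneg[of "2 * r" "h y"] by(cases "near (2 * r) (h y) = 0") (auto simp: om_def)
    show "DI (h y) v > dl2" using that by(auto simp: om_def max_def zero_less_mult_iff split: if_splits)
   qed
   ultimately show ?thesis using v(1) unfolding PP_def by(intro exI[of _ v], intro exI[of _ om]) auto
  next
   case 3
   have P: "?P (h y) 0" if "near (2 * rh) (h y) > 0" "y : SS n" for y
   proof -
    have "DI (h y) 0 = 0" using DI_scale[OF hE[OF that(2)] E_0, of 0] by simp
    moreover have "~ far (2 * rh) (h y)" using that near_pos_iff by blast
    moreover have "~ far (2 * r) (h y)" using calculation(2) far_mono[of "2 * r" "h y" "2 * rh"] r by linarith
    ultimately show ?thesis by(simp add: admissible_def)
   qed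
   have "near (2 * rh) (h x) > 0" unfolding near_pos_iff using 3 far_mono[of "2 * rh" "h x" rh] r by linarith
   moreover have "continuous_on (SS n) (%y. near (2 * rh) (h y))" by(rule near_continuous_on[OF hc])
   ultimately show ?thesis using P near_nonneg E_0 unfolding PP_def by - (rule exI[of _ 0], rule exI[of _ "%y. near (2 * rh) (h y)"], auto)
  qed
 qed
 hence "ALL x. EX v om. x : SS n --> PP x v om" by blast
 then obtain v om where PP: "!!x. x : SS n ==> PP x (v x) (om x)" unfolding choice_iff by blast
 have vw: "!!x. x : SS n ==> v x : E" "!!x. x : SS n ==> continuous_on (SS n) (om x)"
  "!!x. x : SS n ==> om x x > 0" "!!x y. x : SS n ==> y : SS n ==> om x y >= 0"
  "!!x y. x : SS n ==> y : SS n ==> om x y > 0 ==> ?P (h y) (v x)" using PP unfolding PP_def by blast+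
 define U where "U x = SS n \<inter> om x -` {0<..}" for x
 have "ALL c:U ` SS n. openin (top_of_set (SS n)) c" unfolding U_def using vw(2) by(auto intro!: continuous_openin_preimage_gen)
 moreover have "SS n \<subseteq> \<Union> (U ` SS n)" using vw(3) by(auto simp: U_def)
 ultimately obtain D where D: "D \<subseteq> U ` SS n" "finite D" "SS n \<subseteq> \<Union> D" using SS_compact[of n] unfolding compact_eq_openin_cover by meson
 obtain F where F: "F \<subseteq> SS n" "finite F" "D = U ` F" using finite_subset_image[OF D(2,1)] by blast
 define W where "W y = (\<Sum>x\<in>F. om x y)" for y
 have Wpos: "W y > 0" if y: "y : SS n" for y
 proof -
  obtain x where "x : F" "y : U x" using D(3) F y by blast
  thus ?thesis unfolding W_def using F y vw(4) by(intro sum_pos2[of _ x]) (auto simp: U_def)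
 qed
 define V0 where "V0 y = (\<Sum>x\<in>F. (om x y / W y) *R v x)" for y
 have V0c: "ncont (SS n) V0"
 proof -
  have "continuous_on (SS n) W" unfolding W_def using F vw(2) by(intro continuous_on_sum) auto
  hence "continuous_on (SS n) (%y. om x y / W y)" if "x : F" for x using that F vw(2) Wpos by(intro continuous_on_divide) (auto simp: less_imp_neq[symmetric])
  hence "ncont (SS n) (%y. (om x y / W y) *R v x)" if "x : F" for x using that F vw(1) by(intro ncont_scale ncont_const) auto
  thus ?thesis unfolding V0_def by(intro ncont_sum)
 qed
 have V0P: "?P (h y) (V0 y)" if y: "y : SS n" for y unfolding V0_def
 proof (rule admissible_sum)
  show "(\<Sum>x\<in>F. om x y / W y) = 1" using Wpos[OF y] by(simp add: W_def sum_divide_distrib[symmetric])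
  show "?P (h y) (v x)" if "x : F" "om x y / W y > 0" for x using that vw(5)[of x y] F y Wpos[OF y] by(auto simp: zero_less_divide_iff)
 qed (use F vw hE y d Wpos[OF y] in auto)
 define V where "V y = (1/2) *R (V0 y - V0 (%i. - y i))" for y
 have ng: "continuous_on (SS n) (%x i. - x i)" by(rule continuous_on_coordinatewise_then_product) (intro continuous_intros)
 show ?thesis
 proof (rule that[of V])
  show "ncont (SS n) V" unfolding V_def by(intro ncont_scale ncont_diff V0c ncont_compose[OF V0c ng] continuous_intros SS_neg)
  show "?P (h x) (V x)" if "x : SS n" for x unfolding V_def using admissible_odd[OF hE[OF that] V0P[OF that]] V0P[OF SS_neg[OF that]] ho[OF that] d by simp
  show "V (%i. - x i) = - V x" for x by(simp add: V_def algebra_simps)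
 qed
qed

end

context nehari_descent
begin

lemma I_nonneg_Sub: "u : Sub ==> I u >= 0"
proof -
 assume "u : Sub"
 hence n: "u : Neh" and E: "u : E" by(auto simp: Sub_def Neh_def)
 have "g u u * (1 / 4 - 1 / p) >= 0" using G.f_nonneg[OF E] p by(intro mult_nonneg_nonneg) (auto simp: field_simps)
 thus ?thesis using Neh_I[OF n] C.f_nonneg[OF E] A.f_nonneg[OF E] by linarith
qed

text \<open>A step of fixed length \<open>s\<close> along the field, followed by \<open>tau\<close>.
  As \<open>Q * s <= dl2 / 4\<close> and the slope is at least \<open>dl2\<close> times the length
  of the field, the quadratic error uses up at most half of the linear gain.\<close>

lemma next_map:
 assumes h: "good n h" and r: "0 < rh" "rh <= r" and d: "0 < dl2" "dl2 <= dl1"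
  and d1: "!!u. u : Sub ==> far r u ==> EX v:E. N v <= 1 & DI u v > dl1"
  and d2: "!!u. u : Sub ==> far rh u ==> EX v:E. N v <= 1 & DI u v > dl2"
  and st: "!!u h. u : Sub ==> h : E ==> N h <= s0 ==> DI u h >= 0 ==>
    a (u - h) (u - h) > 0 & N (tau (u - h) *R (u - h) - u) <= ka * N h
    & I (tau (u - h) *R (u - h)) <= I u - DI u h / 2 + Q * (N h)^2"
  and s: "0 < s" "s <= s0" "Q * s <= dl2 / 4" and k0: "ka > 0" "Q > 0"
 obtains h' where "good n h'"
  "!!x. x : SS n ==> N (h' x - h x) <= ka * s"
  "!!x. x : SS n ==> I (h' x) <= I (h x)"
  "!!x. x : SS n ==> far (2 * rh) (h x) ==> I (h' x) <= I (h x) - s * dl2 / 4"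
  "!!x. x : SS n ==> far (2 * r) (h x) ==> I (h' x) <= I (h x) - s * dl1 / 4"
proof -
 obtain V where V: "ncont (SS n) V" "!!x. x : SS n ==> admissible r rh dl1 dl2 (h x) (V x)"
  "!!x. x : SS n ==> V (%i. - x i) = - V x" by(rule pseudo_gradient[OF h r d]) (use d1 d2 that in blast)+
 have hc: "ncont (SS n) h" and hS: "!!x. x : SS n ==> h x : Sub"
  and ho: "!!x. x : SS n ==> h (%i. - x i) = - h x" using h by(auto simp: good_def)
 define w where "w x = h x - s *R V x" for x
 define h' where "h' x = tau (w x) *R w x" for x
 have VE: "V x : E" if "x : SS n" for x using V(2)[OF that] by(simp add: admissible_def)
 have hE: "h x : E" if "x : SS n" for x using hS[OF that] Sub_E by blast
 have wE: "w x : E" if "x : SS n" for x using VE hE that by(simp add: w_def)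
 have main: "a (w x) (w x) > 0 & N (h' x - h x) <= ka * s & I (h' x) <= I (h x) - s * DI (h x) (V x) / 4 & DI (h x) (V x) >= 0"
  if x: "x : SS n" for x
 proof -
  have ad: "N (V x) <= 1" "DI (h x) (V x) >= dl2 * N (V x)" using V(2)[OF x] by(auto simp: admissible_def)
  have NV0: "N (V x) >= 0" using VE[OF x] by simp
  have D0: "DI (h x) (V x) >= 0" using ad(2) NV0 d by(meson mult_nonneg_nonneg order_trans less_imp_le)
  have Ns: "N (s *R V x) = s * N (V x)" using VE[OF x] s by(simp add: N_scale)
  have Ns1: "s * N (V x) <= s" using ad(1) s by(simp add: mult_left_le)
  have Ds: "DI (h x) (s *R V x) = s * DI (h x) (V x)" using hE[OF x] VE[OF x] by(simp add: DI_scale)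
  have *: "a (w x) (w x) > 0 & N (h' x - h x) <= ka * (s * N (V x))
    & I (h' x) <= I (h x) - s * DI (h x) (V x) / 2 + Q * (s * N (V x))^2" using st[OF hS[OF x], of "s *R V x"] VE[OF x] Ns Ns1 s D0 Ds by(simp add: w_def h'_def)
  have "Q * (s * N (V x))^2 <= s * DI (h x) (V x) / 4"
  proof -
   have "Q * (s * N (V x))^2 = (Q * s) * (s * (N (V x) * N (V x)))" by(simp add: power2_eq_square)
   also have "... <= (dl2 / 4) * (s * (N (V x) * 1))" using s ad(1) NV0 d k0 by(intro mult_mono mult_nonneg_nonneg) auto
   also have "... = s * (dl2 * N (V x)) / 4" by simp
   also have "... <= s * DI (h x) (V x) / 4" using ad(2) s by simp
   finally show ?thesis .
  qed
  moreover have "ka * (s * N (V x)) <= ka * s" using Ns1 k0 by(intro mult_left_mono) auto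
  ultimately show ?thesis using * D0 by auto
 qed
 have wn: "ncont (SS n) w" unfolding w_def by(intro ncont_diff hc ncont_scale V(1) continuous_intros)
 have h'n: "ncont (SS n) h'" unfolding h'_def using main by(intro ncont_scale wn tau_continuous) auto
 show ?thesis
 proof (rule that[of h'])
  have "h' x : Sub" if x: "x : SS n" for x
  proof -
   have "h' x : Neh" using tau_Neh[OF wE[OF x]] main[OF x] by(simp add: h'_def)
   moreover have "I (h x) <= c1" using hS[OF x] by(simp add: Sub_def)
   moreover have "s * DI (h x) (V x) >= 0" using main[OF x] s by simp
   ultimately show ?thesis using main[OF x] by(auto simp: Sub_def)
  qed
  moreover have "h' (%i. - x i) = - h' x" if x: "x : SS n" for x
  proof -
   have "w (%i. - x i) = - w x" using ho[OF x] V(3)[OF x] by(simp add: w_def)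
   thus ?thesis using tau_neg[OF wE[OF x]] by(simp add: h'_def)
  qed
  ultimately show "good n h'" using h'n by(simp add: good_def)
  fix x assume x: "x : SS n"
  show "N (h' x - h x) <= ka * s" using main[OF x] by blast
  have "s * DI (h x) (V x) >= 0" using main[OF x] s by simp
  thus "I (h' x) <= I (h x)" using main[OF x] by linarith
  show "I (h' x) <= I (h x) - s * dl2 / 4" if "far (2 * rh) (h x)"
  proof -
   have "s * dl2 <= s * DI (h x) (V x)" using V(2)[OF x] that s by(auto simp: admissible_def)
   thus ?thesis using main[OF x] by linarith
  qed
  show "I (h' x) <= I (h x) - s * dl1 / 4" if "far (2 * r) (h x)"
  proof -
   have "s * dl1 <= s * DI (h x) (V x)" using V(2)[OF x] that s by(auto simp: admissible_def)
   thus ?thesis using main[OF x] by linarith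
  qed
 qed
qed

text \<open>A descending trajectory that has visited a small ball around a critical point \<open>w\<close> cannot
 reach the ball around \<open>- w\<close>: crossing the annulus between radii \<open>2 * r\<close> and \<open>3 * r\<close> costs more
 energy than the oscillation of \<open>I\<close> on the two balls.\<close>

lemma no_return:
 assumes e: "!!m. e m : E"
  and w: "w : E" "2 * N w >= 8 * r" "r > 0"
  and mono: "!!m. I (e (Suc m)) <= I (e m)"
  and stp: "!!m. N (e (Suc m) - e m) <= mu" "2 * mu <= r"
  and ann: "!!m. 2 * r <= N (e m - w) ==> N (e m - w) < 3 * r ==> I (e (Suc m)) <= I (e m) - q * mu"
  and q: "q > 0"
  and osc: "!!z. z : E ==> N (z - w) < 2 * rh | N (z + w) < 2 * rh ==> abs (I z - I w) < q * r / 4"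
  and rh: "2 * rh <= r"
  and visit: "N (e m0 - w) < 2 * rh" and later: "m0 <= m1"
 shows "N (e m1 + w) >= 2 * rh"
proof (rule ccontr)
 assume "~ ?thesis"
 hence bk: "N (e m1 + w) < 2 * rh" by simp
 \<comment> \<open>Invariant: either the energy has already dropped by \<open>q * r / 2\<close>, or
   the point is still within \<open>3 * r\<close> and the drop is at least \<open>q\<close> times
   the distance reached beyond \<open>2 * r\<close>. The correction \<open>mu\<close> accounts for
   the step into the annulus, which starts inside and need not cost energy.\<close>
 have "I (e m) <= I (e m0) & (I (e m) <= I (e m0) - q * r / 2 |
   (N (e m - w) < 3 * r & I (e m) <= I (e m0) - q * (N (e m - w) - 2 * r - mu)))" if "m0 <= m" for m using that
 proof (induction m rule: dec_induct)
  case base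
  have mu0: "mu >= 0" by(rule order_trans[OF N_nonneg[OF E_diff[OF e e]] stp(1)])
  have "q * (N (e m0 - w) - 2 * r - mu) <= 0" using visit rh mu0 w(3) q by(intro mult_nonneg_nonpos) auto
  thus ?case using visit rh w(3) by auto
 next
  case (step m)
  note IH = step.IH
  have le: "I (e (Suc m)) <= I (e m0)" using mono[of m] IH by linarith
  have tri: "N (e (Suc m) - w) <= mu + N (e m - w)" using N_tri_diff[OF e e w(1), of "Suc m" m] stp(1)[of m] by simp
  show ?case
  proof (cases "I (e m) <= I (e m0) - q * r / 2")
   case True
   thus ?thesis using mono[of m] le by auto
  next
   case False
   hence b: "N (e m - w) < 3 * r" "I (e m) <= I (e m0) - q * (N (e m - w) - 2 * r - mu)" using IH by auto
   show ?thesis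
   proof (cases "N (e m - w) < 2 * r")
    case True
    have "N (e (Suc m) - w) - 2 * r - mu <= 0" using tri True by simp
    hence "q * (N (e (Suc m) - w) - 2 * r - mu) <= 0" using q by(intro mult_nonneg_nonpos) auto
    moreover have "N (e (Suc m) - w) < 3 * r" using tri True stp(2) w(3) by simp
    ultimately show ?thesis using le by auto
   next
    case ge: False
    have "I (e (Suc m)) <= I (e m) - q * mu" using ann[of m] ge b(1) by simp
    also have "... <= I (e m0) - q * (N (e m - w) + mu - 2 * r - mu)" using b(2) by(simp add: algebra_simps)
    also have "... <= I (e m0) - q * (N (e (Suc m) - w) - 2 * r - mu)" using tri q by(intro diff_left_mono mult_left_mono) auto
    finally have d: "I (e (Suc m)) <= I (e m0) - q * (N (e (Suc m) - w) - 2 * r - mu)" .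
    show ?thesis
    proof (cases "N (e (Suc m) - w) < 3 * r")
     case True thus ?thesis using d le by auto
    next
     case False
     have "q * (r / 2) <= q * (N (e (Suc m) - w) - 2 * r - mu)" using False stp(2) q by(intro mult_left_mono) auto
     thus ?thesis using d le by auto
    qed
   qed
  qed
 qed
 from this[OF later] have alt: "I (e m1) <= I (e m0) - q * r / 2 | N (e m1 - w) < 3 * r" by auto
 have "2 * N w <= N (e m1 + w) + N (e m1 - w)"
 proof -
  have "2 *R w = (e m1 + w) - (e m1 - w)" by(simp add: scaleR_2)
  hence "N (2 *R w) <= N (e m1 + w) + N (e m1 - w)" using N_diff_le[of "e m1 + w" "e m1 - w"] e w(1) by simp
  thus ?thesis using w(1) by(simp add: N_scale)
 qed
 hence "N (e m1 - w) >= 3 * r" using bk rh w(2,3) by simp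
 hence "I (e m1) <= I (e m0) - q * r / 2" using alt by simp
 moreover have "abs (I (e m1) - I w) < q * r / 4" using osc e bk by blast
 moreover have "abs (I (e m0) - I w) < q * r / 4" using osc e visit by blast
 moreover have "q * r / 2 = q * r / 4 + q * r / 4" by simp
 ultimately show False unfolding abs_less_iff by linarith
qed

text \<open>Step length and number of steps are fixed from the constants of the descent before the
  iteration starts, uniformly over the sphere. The odd functions handed to Borsuk--Ulam are
  therefore finite sums of continuous functions.\<close>

theorem too_few_critical_pairs:
 assumes kn: "k <= n"
  and h0: "ncont (SS n) h0" "!!x. x : SS n ==> a (h0 x) (h0 x) > 0"
   "!!x. x : SS n ==> h0 (%i. - x i) = - h0 x"
   "!!x t. x : SS n ==> t > 0 ==> I (t *R h0 x) <= c1"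
 shows False
proof -
 obtain s0 ka Q where S: "s0 > 0" "ka > 0" "Q > 0"
  "!!u h. u : Sub ==> h : E ==> N h <= s0 ==> DI u h >= 0 ==>
    a (u - h) (u - h) > 0 & N (tau (u - h) *R (u - h) - u) <= ka * N h
    & I (tau (u - h) *R (u - h)) <= I u - DI u h / 2 + Q * (N h)^2" using step by blast
 obtain r1 where r1: "r1 > 0" "!!i. i < k ==> r1 <= N (us i)" using finite_pos_lower_bound[of "{..<k}" "%i. N (us i)"] us_pos by auto
 obtain r2 where r2: "r2 > 0" "!!i j. i < k ==> j < k ==> i ~= j ==> r2 <= N (us i - us j) & r2 <= N (us i + us j)"
 proof (rule finite_pos_lower_bound[of "{q. fst q < k & snd q < k & fst q ~= snd q}" "%q. min (N (us (fst q) - us (snd q))) (N (us (fst q) + us (snd q)))"])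
  have "{q. fst q < k & snd q < k & fst q ~= snd q} \<subseteq> {..<k} \<times> {..<k}" by auto
  thus "finite {q. fst q < k & snd q < k & fst q ~= snd q}" by(rule finite_subset) auto
  show "0 < min (N (us (fst q) - us (snd q))) (N (us (fst q) + us (snd q)))"
   if "q : {q. fst q < k & snd q < k & fst q ~= snd q}" for q using us_apart that by auto
  fix e assume e: "e > 0" "!!q. q : {q. fst q < k & snd q < k & fst q ~= snd q} ==> e <= min (N (us (fst q) - us (snd q))) (N (us (fst q) + us (snd q)))"
  show thesis
  proof (rule that[OF e(1)])
   show "e <= N (us i - us j) & e <= N (us i + us j)" if "i < k" "j < k" "i ~= j" for i j using e(2)[of "(i, j)"] that by auto
  qed
 qed
 \<comment> \<open>The points \<open>us i\<close> and \<open>- us i\<close> are mutually at distance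
   at least \<open>8 * r\<close>; a point at distance between \<open>2 * r\<close> and
   \<open>3 * r\<close> from one of them is therefore \<open>far (2 * r)\<close> from all of
   them.\<close>
 define r where "r = min r1 r2 / 8"
 have r: "r > 0" using r1 r2 by(simp add: r_def)
 have rr: "8 * r <= r1" "8 * r <= r2" by(auto simp: r_def)
 obtain dl1 where d1: "dl1 > 0" "!!u. u : Sub ==> far r u ==> EX v:E. N v <= 1 & DI u v > dl1" using gradient_bound[OF r] by blast
 \<comment> \<open>Energy lost per unit of displacement outside the large balls: a step moves by at
   most \<open>ka * s\<close> and lowers the energy by at least \<open>s * dl1 / 4\<close>.\<close>
 define q where "q = dl1 / (4 * ka)"
 have q: "q > 0" using d1 S by(simp add: q_def)
 have crp: "q * r / 4 > 0" using q r by simp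
 \<comment> \<open>The small radius is chosen after \<open>q\<close>: on the small balls the energy
   deviates from its central value by less than \<open>q * r / 4\<close>, half the price of crossing
   the annulus.\<close>
 have "EX rh>0. ALL z:E. N (z - us i) < 2 * rh --> abs (I z - I (us i)) < q * r / 4" if i: "i < k" for i
 proof (rule ccontr)
  assume no: "~ ?thesis"
  have "EX z:E. N (z - us i) < 2 * (1 / real (Suc n)) & ~ abs (I z - I (us i)) < q * r / 4" for n
   using no by(metis of_nat_0_less_iff zero_less_Suc zero_less_divide_1_iff)
  then obtain z where z: "!!n. z n : E" "!!n. N (z n - us i) < 2 * (1 / real (Suc n))" "!!n. ~ abs (I (z n) - I (us i)) < q * r / 4" by metis
  have "(%n. N (z n - us i)) ----> 0"
  proof (rule Lim_null_comparison)
   show "eventually (%n. norm (N (z n - us i)) <= 2 * (1 / real (Suc n))) sequentially" using z(1,2) i by(auto intro!: always_eventually simp: less_imp_le)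
   show "(%n. 2 * (1 / real (Suc n))) ----> 0" using tendsto_mult_right_zero[OF LIMSEQ_Suc[OF lim_1_over_n]] by blast
  qed
  hence "Ntends z (us i) sequentially" using z(1) i by(simp add: Ntends_def)
  hence "(%n. I (z n)) ----> I (us i)" by(rule I_tendsto)
  hence "eventually (%n. dist (I (z n)) (I (us i)) < q * r / 4) sequentially" using crp by(rule tendstoD)
  thus False using z(3) by(auto simp: dist_real_def eventually_sequentially)
 qed
 then obtain rh0 where rh0: "!!i. i < k ==> rh0 i > 0"
  "!!i z. i < k ==> z : E ==> N (z - us i) < 2 * rh0 i ==> abs (I z - I (us i)) < q * r / 4" by metis
 obtain rh1 where rh1: "rh1 > 0" "!!i. i < k ==> rh1 <= rh0 i" using finite_pos_lower_bound[of "{..<k}" rh0] rh0(1) by auto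
 define rh where "rh = min rh1 (r / 2)"
 have rh: "rh > 0" "rh <= r" "2 * rh <= r" using rh1 r by(auto simp: rh_def)
 have osc: "abs (I z - I (us i)) < q * r / 4" if "i < k" "z : E" "N (z - us i) < 2 * rh | N (z + us i) < 2 * rh" for i z
 proof -
  have le: "2 * rh <= 2 * rh0 i" using rh1(2)[OF that(1)] by(simp add: rh_def)
  show ?thesis
  proof (cases "N (z - us i) < 2 * rh")
   case True thus ?thesis using rh0(2)[OF that(1,2)] le by simp
  next
   case False
   hence "N (- z - us i) < 2 * rh" using that N_neg[of "z + us i"] by simp
   thus ?thesis using rh0(2)[OF that(1), of "- z"] le that I_neg[OF that(2)] by simp
  qed
 qed
 obtain dl' where d': "dl' > 0" "!!u. u : Sub ==> far rh u ==> EX v:E. N v <= 1 & DI u v > dl'" using gradient_bound[OF rh(1)] by blast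
 define dl2 where "dl2 = min dl' dl1"
 have d2: "dl2 > 0" "dl2 <= dl1" using d' d1 by(auto simp: dl2_def)
 have d2': "EX v:E. N v <= 1 & DI u v > dl2" if "u : Sub" "far rh u" for u using d'(2)[OF that] by(auto simp: dl2_def)
 define s where "s = min s0 (min (dl2 / (4 * Q)) (r / (2 * ka)))"
 have s: "0 < s" "s <= s0" "s <= dl2 / (4 * Q)" "s <= r / (2 * ka)" using S d2 r by(auto simp: s_def)
 have s': "Q * s <= dl2 / 4" "2 * (ka * s) <= r" using s(3,4) S by(simp_all add: field_simps)
 define nxt where "nxt h h' <-> (ALL x:SS n. N (h' x - h x) <= ka * s & I (h' x) <= I (h x)
   & (far (2 * rh) (h x) --> I (h' x) <= I (h x) - s * dl2 / 4)
   & (far (2 * r) (h x) --> I (h' x) <= I (h x) - s * dl1 / 4))" for h h' :: "(nat => real) => 'v"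
 have ex: "EX h'. good n h' & nxt h h'" if "good n h" for h
 proof (rule next_map[OF that rh(1,2) d2 d1(2) d2' S(4) s(1,2) s'(1) S(2,3)])
  fix h' assume h': "good n h'" "!!x. x : SS n ==> N (h' x - h x) <= ka * s"
   "!!x. x : SS n ==> I (h' x) <= I (h x)"
   "!!x. x : SS n ==> far (2 * rh) (h x) ==> I (h' x) <= I (h x) - s * dl2 / 4"
   "!!x. x : SS n ==> far (2 * r) (h x) ==> I (h' x) <= I (h x) - s * dl1 / 4"
  have "nxt h h'" unfolding nxt_def using h'(2-5) by(intro ballI conjI impI)
  thus ?thesis using h'(1) by blast
 qed
 have h0E: "h0 x : E" if "x : SS n" for x using h0(1) that by(simp add: ncont_def)
 have "good n (%x. tau (h0 x) *R h0 x)" unfolding good_def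
 proof (intro conjI ballI)
  show "ncont (SS n) (%x. tau (h0 x) *R h0 x)" by(intro ncont_scale tau_continuous h0)
  show "tau (h0 x) *R h0 x : Sub" if x: "x : SS n" for x using tau_Neh[OF h0E[OF x] h0(2)[OF x]] h0(4)[OF x tau(1)[OF h0E[OF x] h0(2)[OF x]]] by(simp add: Sub_def)
  show "tau (h0 (%i. - x i)) *R h0 (%i. - x i) = - (tau (h0 x) *R h0 x)" if x: "x : SS n" for x using h0(3)[OF x] tau_neg[OF h0E[OF x]] by simp
 qed
 hence "EX H. ALL m. good n (H m) & nxt (H m) (H (Suc m))" using dependent_nat_choice[of "%_ h. good n h" "%_ h h'. nxt h h'"] ex by blast
 then obtain H where H: "!!m. good n (H m)" "!!m. nxt (H m) (H (Suc m))" by blast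
 have HS: "H m x : Sub" and Ho: "H m (%i. - x i) = - H m x" and HE: "H m x : E" if "x : SS n" for m x using H(1)[of m] that Sub_E by(auto simp: good_def)
 \<comment> \<open>With \<open>M\<close> steps outside the small balls the energy would become
   negative, against \<open>I_nonneg_Sub\<close>.\<close>
 obtain M :: nat where M: "c1 / (s * dl2 / 4) < M" using reals_Archimedean2 by blast
 have visit: "EX m<=M. ~ far (2 * rh) (H m x)" if x: "x : SS n" for x
 proof (rule ccontr)
  assume no: "~ ?thesis"
  have "I (H m x) <= c1 - m * (s * dl2 / 4)" if "m <= Suc M" for m using that
  proof (induction m)
   case 0
   thus ?case using HS[OF x, of 0] by(simp add: Sub_def)
  next
   case (Suc m)
   hence "far (2 * rh) (H m x)" using no by simp
   hence "I (H (Suc m) x) <= I (H m x) - s * dl2 / 4" using H(2)[of m] x by(auto simp: nxt_def)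
   moreover have "real (Suc m) * (s * dl2 / 4) = real m * (s * dl2 / 4) + s * dl2 / 4" by(simp add: distrib_right add_divide_distrib)
   moreover have "I (H m x) <= c1 - real m * (s * dl2 / 4)" using Suc by simp
   ultimately show ?case by linarith
  qed
  from this[of M] have "I (H M x) <= c1 - M * (s * dl2 / 4)" by simp
  moreover have "c1 < M * (s * dl2 / 4)" using M s d2 by(simp add: divide_less_eq)
  ultimately show False using I_nonneg_Sub[OF HS[OF x, of M]] by simp
 qed
 have nr: "N (H m1 x + sg *R us i) >= 2 * rh"
  if x: "x : SS n" and i: "i < k" and sg: "sg = 1 | sg = -1" and v: "N (H m0 x - sg *R us i) < 2 * rh" and m: "m0 <= m1"
  for x i m0 m1 and sg :: real
 proof (rule no_return[where e = "%m. H m x" and r = r and mu = "ka * s" and q = q])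
  show "sg *R us i : E" using i by simp
  show "2 * N (sg *R us i) >= 8 * r" using r1(2)[OF i] rr r sg i by(auto simp: N_scale)
  show "I (H (Suc m) x) <= I (H m x)" "N (H (Suc m) x - H m x) <= ka * s" for m using H(2)[of m] x by(auto simp: nxt_def)
  show "I (H (Suc m) x) <= I (H m x) - q * (ka * s)"
   if an: "2 * r <= N (H m x - sg *R us i)" "N (H m x - sg *R us i) < 3 * r" for m
  proof -
   have "far (2 * r) (H m x)" unfolding far_def
   proof (intro allI impI)
    fix j assume j: "j < k"
    have t: "N (us i - us j) <= N (H m x - us i) + N (H m x - us j)"
     "N (us i + us j) <= N (H m x - us i) + N (H m x + us j)"
     "N (us i + us j) <= N (H m x + us i) + N (H m x - us j)"
     "N (us i - us j) <= N (H m x + us i) + N (H m x + us j)" using N_diff_le[of "H m x - us j" "H m x - us i"] N_diff_le[of "H m x + us j" "H m x - us i"]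
      N_diff_le[of "H m x + us i" "H m x - us j"] N_diff_le[of "H m x + us i" "H m x + us j"] HE[OF x] i j by(simp_all add: algebra_simps)
    have "2 * N (us i) >= 8 * r" using r1(2)[OF i] rr r by simp
    moreover have "2 * N (us i) <= N (H m x - us i) + N (H m x + us i)"
    proof -
     have "2 *R us i = (H m x + us i) - (H m x - us i)" by(simp add: scaleR_2)
     hence "N (2 *R us i) <= N (H m x + us i) + N (H m x - us i)" using N_diff_le[of "H m x + us i" "H m x - us i"] HE[OF x] i by simp
     thus ?thesis using i by(simp add: N_scale)
    qed
    ultimately show "2 * r <= N (H m x - us j) & 2 * r <= N (H m x + us j)" using t an sg r2(2)[OF i j] rr r by(cases "i = j") auto
   qed
   hence "I (H (Suc m) x) <= I (H m x) - s * dl1 / 4" using H(2)[of m] x by(auto simp: nxt_def)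
   moreover have "q * (ka * s) = s * dl1 / 4" using S by(simp add: q_def)
   ultimately show ?thesis by linarith
  qed
  show "abs (I z - I (sg *R us i)) < q * r / 4" if "z : E" "N (z - sg *R us i) < 2 * rh | N (z + sg *R us i) < 2 * rh" for z
   using osc[OF i that(1)] that(2) sg I_neg[of "us i"] i by auto
 qed (use HE x r s' q rh v m in auto)
 \<comment> \<open>Closeness to \<open>us i\<close> minus closeness to \<open>- us i\<close>, summed
   over all times; by \<open>nr\<close> terms of only one kind can be nonzero along a
   trajectory.\<close>
 define f where "f i x = (\<Sum>m\<le>M. max 0 (2 * rh - N (H m x - us i)) - max 0 (2 * rh - N (H m x + us i)))" for i x
 have "EX x:SS n. ALL i<k. f i x = 0"
 proof (rule borsuk_ulam_common_zero[OF kn])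
  show "continuous_on (SS n) (f i)" if i: "i < k" for i
  proof -
   have "continuous_on (SS n) (%x. N (H m x + us i))" for m using ncont_N_diff[of "SS n" "H m" "- us i"] H(1)[of m] i by(simp add: good_def)
   moreover have "continuous_on (SS n) (%x. N (H m x - us i))" for m using ncont_N_diff[of "SS n" "H m" "us i"] H(1)[of m] i by(simp add: good_def)
   ultimately show ?thesis unfolding f_def by(intro continuous_intros)
  qed
  show "f i (%i. - x i) = - f i x" if i: "i < k" and x: "x : SS n" for i x
  proof -
   have "N (- H m x - us i) = N (H m x + us i)" "N (- H m x + us i) = N (H m x - us i)" for m
    using N_neg[of "H m x + us i"] N_neg[of "H m x - us i"] HE[OF x] i by simp_all
   thus ?thesis by(simp add: f_def Ho[OF x] sum_negf[symmetric])
  qed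
 qed
 then obtain x where x: "x : SS n" and z: "!!i. i < k ==> f i x = 0" by blast
 obtain m where m: "m <= M" "~ far (2 * rh) (H m x)" using visit[OF x] by blast
 then obtain i where i: "i < k" "N (H m x - us i) < 2 * rh | N (H m x + us i) < 2 * rh" by(auto simp: far_def not_le)
 have nr': "N (H m1 x + sg *R us i) >= 2 * rh" if sg: "sg = 1 | sg = -1" and v: "N (H m x - sg *R us i) < 2 * rh" for m1 and sg :: real
 proof (cases "m <= m1")
  case True thus ?thesis using nr[OF x i(1) sg v] by blast
 next
  case False
  show ?thesis
  proof (rule ccontr)
   assume "~ ?thesis"
   hence "N (H m1 x - (- sg) *R us i) < 2 * rh" by simp
   from nr[OF x i(1) _ this, of m] have "N (H m x + (- sg) *R us i) >= 2 * rh" using sg False by auto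
   thus False using v by simp
  qed
 qed
 show False
 proof (cases "N (H m x - us i) < 2 * rh")
  case True
  hence "N (H m1 x + us i) >= 2 * rh" for m1 using nr'[of 1 m1] by simp
  hence "f i x = (\<Sum>m\<le>M. max 0 (2 * rh - N (H m x - us i)))" unfolding f_def by(intro sum.cong) auto
  also have "... > 0" using True m(1) by(intro sum_pos2[of _ m]) auto
  finally show False using z[OF i(1)] by simp
 next
  case False
  hence F: "N (H m x + us i) < 2 * rh" using i(2) by simp
  hence "N (H m1 x - us i) >= 2 * rh" for m1 using nr'[of "-1" m1] by simp
  hence "f i x = - (\<Sum>m\<le>M. max 0 (2 * rh - N (H m x + us i)))" unfolding f_def sum_negf[symmetric] by(intro sum.cong) auto
  moreover have "(\<Sum>m\<le>M. max 0 (2 * rh - N (H m x + us i))) > 0" using F m(1) by(intro sum_pos2[of _ m]) auto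
  ultimately show False using z[OF i(1)] by simp
 qed
qed

end

section \<open>Test functions\<close>

text \<open>The family is closed under differentiation up to linear combinations
  (\<open>flat_deriv\<close>), so smoothness of exp(-1/y), extended by 0, follows for all orders by
  one induction.\<close>

definition flat :: "nat => real => real" where
 "flat n y = (if y > 0 then (1 / y) ^ n * exp (- (1 / y)) else 0)"

lemma flat_deriv: "(flat n has_real_derivative (flat (n + 2) y - n * flat (n + 1) y)) (at y)"
proof -
 consider "y > 0" | "y < 0" | "y = 0" by linarith
 thus ?thesis
 proof cases
  case 1
  have i: "((%y. 1 / y) has_real_derivative - 1 / y^2) (at y)" using 1 by(auto intro!: derivative_eq_intros simp: power2_eq_square)
  have e: "((%y. exp (- (1 / y))) has_real_derivative exp (- (1 / y)) * (1 / y^2)) (at y)" using 1 by(auto intro!: derivative_eq_intros simp: power2_eq_square)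
  have "((%y. (1 / y) ^ n * exp (- (1 / y))) has_real_derivative
    (n * (1 / y) ^ (n - 1) * (- 1 / y^2)) * exp (- (1 / y)) + (1 / y) ^ n * (exp (- (1 / y)) * (1 / y^2))) (at y)"
   by(rule DERIV_cong[OF DERIV_mult[OF DERIV_power[OF i, of n] e]]) (simp add: mult_ac)
  moreover have "(n * (1 / y) ^ (n - 1) * (- 1 / y^2)) * exp (- (1 / y)) + (1 / y) ^ n * (exp (- (1 / y)) * (1 / y^2))
    = flat (n + 2) y - n * flat (n + 1) y" using 1 by(cases n) (auto simp: flat_def field_simps power2_eq_square)
  ultimately have "((%y. (1 / y) ^ n * exp (- (1 / y))) has_real_derivative (flat (n + 2) y - n * flat (n + 1) y)) (at y)" by simp
  thus ?thesis by(rule DERIV_cong_ev[OF refl _ refl, THEN iffD1, rotated]) (use 1 in \<open>auto simp: flat_def eventually_nhds intro!: exI[of _ "{0<..}"]\<close>)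
 next
  case 2
  have "((%y. 0) has_real_derivative 0) (at y)" by simp
  hence "(flat n has_real_derivative 0) (at y)" by(rule DERIV_cong_ev[OF refl _ refl, THEN iffD1, rotated])
    (use 2 in \<open>auto simp: flat_def eventually_nhds intro!: exI[of _ "{..<0}"]\<close>)
  thus ?thesis using 2 by(simp add: flat_def)
 next
  case 3
  have "((%t::real. t ^ (n + 1) / exp t) ---> 0) at_top" by(rule tendsto_power_div_exp_0)
  hence "((%h. (inverse h) ^ (n + 1) / exp (inverse h)) ---> 0) (at_right (0::real))" by(rule filterlim_compose[OF _ filterlim_inverse_at_top_right])
  hence R: "((%h. flat n h / h) ---> 0) (at_right 0)" by(rule Lim_transform_eventually)
    (auto simp: flat_def eventually_at_filter exp_minus field_simps intro!: always_eventually)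
  have L: "((%h. flat n h / h) ---> 0) (at_left 0)" by(rule Lim_transform_eventually[OF tendsto_const]) (auto simp: flat_def eventually_at_filter)
  have "((%h. flat n h / h) ---> 0) (at 0)" using L R by(simp add: filterlim_split_at)
  thus ?thesis using 3 by(simp add: DERIV_def flat_def)
 qed
qed

lemma flat_nonneg: "flat n y >= 0" by(simp add: flat_def)
lemma flat_0_le: "flat 0 y <= 1" by(simp add: flat_def)

primrec smooth_upto :: "nat => (real => real) => bool" where
 "smooth_upto 0 f <-> continuous_on UNIV f"
| "smooth_upto (Suc k) f <-> (EX f'. (ALL x. (f has_real_derivative f' x) (at x)) & smooth_upto k f')"

lemma smooth_upto_continuous: "smooth_upto k f ==> continuous_on UNIV f" by(cases k) (auto intro!: continuous_at_imp_continuous_on intro: DERIV_isCont)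

lemma smooth_upto_mono: "smooth_upto (Suc k) f ==> smooth_upto k f"
proof (induction k arbitrary: f)
 case 0
 show ?case unfolding smooth_upto.simps(1) by(rule smooth_upto_continuous[OF 0])
next
 case (Suc k)
 thus ?case by(metis smooth_upto.simps(2))
qed

lemma smooth_upto_const: "smooth_upto k (%x. c)"
proof (induction k arbitrary: c)
 case (Suc k)
 show ?case unfolding smooth_upto.simps by(rule exI[of _ "%_. 0"]) (use Suc in auto)
qed simp

lemma smooth_upto_add: "smooth_upto k f ==> smooth_upto k g ==> smooth_upto k (%x. f x + g x)"
proof (induction k arbitrary: f g)
 case (Suc k)
 then obtain f' g' where "ALL x. (f has_real_derivative f' x) (at x)" "smooth_upto k f'"
  "ALL x. (g has_real_derivative g' x) (at x)" "smooth_upto k g'" by auto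
 thus ?case unfolding smooth_upto.simps by(intro exI[of _ "%x. f' x + g' x"]) (auto intro: DERIV_add Suc.IH)
qed (auto intro: continuous_intros)

lemma smooth_upto_mult: "smooth_upto k f ==> smooth_upto k g ==> smooth_upto k (%x. f x * g x)"
proof (induction k arbitrary: f g)
 case (Suc k)
 then obtain f' g' where fg: "ALL x. (f has_real_derivative f' x) (at x)" "smooth_upto k f'"
  "ALL x. (g has_real_derivative g' x) (at x)" "smooth_upto k g'" by auto
 have "smooth_upto k (%x. f' x * g x + g' x * f x)" using smooth_upto_mono[OF Suc.prems(1)] smooth_upto_mono[OF Suc.prems(2)] fg by(intro smooth_upto_add Suc.IH)
 thus ?case unfolding smooth_upto.simps using fg by(intro exI[of _ "%x. f' x * g x + g' x * f x"]) (auto intro: DERIV_mult)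
qed (auto intro: continuous_intros)

lemma smooth_upto_affine: "smooth_upto k f ==> smooth_upto k (%x. f (c * x + d))"
proof (induction k arbitrary: f)
 case 0
 thus ?case by(auto intro!: continuous_on_compose2[of UNIV f] continuous_intros)
next
 case (Suc k)
 then obtain f' where f': "!!x. (f has_real_derivative f' x) (at x)" "smooth_upto k f'" by auto
 have "((%x. f (c * x + d)) has_real_derivative c * f' (c * x + d)) (at x)" for x by(rule DERIV_cong[OF DERIV_chain2[where f=f and g="%x. c * x + d", OF f'(1)]])
   (auto intro!: derivative_eq_intros)
 moreover have "smooth_upto k (%x. c * f' (c * x + d))" by(intro smooth_upto_mult smooth_upto_const Suc.IH f'(2))
 ultimately show ?case unfolding smooth_upto.simps by(intro exI[of _ "%x. c * f' (c * x + d)"]) auto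
qed

lemma smooth_upto_flat: "smooth_upto k (flat n)"
proof (induction k arbitrary: n)
 case 0
 thus ?case using flat_deriv by(auto intro!: continuous_at_imp_continuous_on DERIV_isCont)
next
 case (Suc k)
 have "smooth_upto k (%y. flat (n + 2) y + (- real n) * flat (n + 1) y)" by(intro smooth_upto_add smooth_upto_mult smooth_upto_const Suc.IH)
 thus ?case unfolding smooth_upto.simps by(intro exI[of _ "%y. flat (n + 2) y - n * flat (n + 1) y"]) (use flat_deriv in auto)
qed

text \<open>Positive exactly on the open interval between \<open>a\<close> and \<open>b\<close>,
  whatever \<open>m\<close>; as \<open>m\<close> grows the flanks steepen and the bump tends to the
  indicator of that interval.\<close>

definition bump :: "nat => real => real => real => real" where
 "bump m a b y = flat 0 (real (Suc m) * (y - a)) * flat 0 (real (Suc m) * (b - y))"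

abbreviation "bumps m a b (x :: real^3) == \<Prod>l\<in>UNIV. bump m (a $ l) (b $ l) (x $ l)"

lemma bump_smooth: "smooth_upto k (bump m a b)"
proof -
 have "smooth_upto k (%y. flat 0 (real (Suc m) * y + (- real (Suc m) * a)) * flat 0 ((- real (Suc m)) * y + real (Suc m) * b))"
  by(intro smooth_upto_mult smooth_upto_affine smooth_upto_flat)
 thus ?thesis by(simp add: bump_def[abs_def] algebra_simps)
qed

lemma bump_range: "0 <= bump m a b y" "bump m a b y <= 1" unfolding bump_def using flat_nonneg[of 0] flat_0_le by(auto intro!: mult_le_one mult_nonneg_nonneg)

lemma bump_pos: "a < y ==> y < b ==> bump m a b y > 0" by(auto simp: bump_def flat_def zero_less_mult_iff)

lemma bump_zero: "~ (a < y & y < b) ==> bump m a b y = 0" by(auto simp: bump_def flat_def zero_less_mult_iff)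

lemma flat_tendsto: assumes "t > 0" shows "(%m. flat 0 (real (Suc m) * t)) ----> 1"
proof -
 have "(%m. exp (- (1 / real (Suc m) * (1 / t)))) ----> exp (- (0 * (1 / t)))" by(intro tendsto_intros LIMSEQ_Suc[OF lim_1_over_n])
 thus ?thesis using assms by(simp add: flat_def)
qed

lemma bump_tendsto: "(%m. bump m a b y) ----> (if a < y & y < b then 1 else 0)"
proof (cases "a < y & y < b")
 case True
 thus ?thesis unfolding bump_def using tendsto_mult[OF flat_tendsto[of "y - a"] flat_tendsto[of "b - y"]] by simp
next
 case False
 thus ?thesis using bump_zero[OF False] by auto
qed

lemma antiderivative_exists:
 assumes "continuous_on UNIV (f :: real => real)"
 obtains F where "!!x. (F has_real_derivative f x) (at x)"
proof -
 have "EX F. ALL x::real. -\<infinity> < ereal x --> ereal x < \<infinity> --> (F has_vector_derivative f x) (at x)"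
  using assms by(intro einterval_antiderivative) (auto simp: continuous_on_eq_continuous_at)
 thus ?thesis using that by(auto simp: has_real_derivative_iff_has_vector_derivative)
qed

text \<open>\<open>B\<close> is the integral of the bump over a moving window of length
  \<open>b - a\<close>. Its derivative is the bump minus its translate to the adjacent interval, and
  the window misses the bump unless its right end lies between \<open>a\<close> and
  \<open>2 * b - a\<close>. The bounds come from the mean value theorem.\<close>

lemma bump_integrated:
 assumes l: "a < b"
 obtains B where "!!k. smooth_upto k B"
  "!!y. (B has_real_derivative (bump m a b y - bump m a b (y - (b - a)))) (at y)"
  "!!y. 0 <= B y" "!!y. B y <= b - a" "!!y. ~ (a < y & y < 2 * b - a) ==> B y = 0"
proof -
 define l where "l = b - a"
 have l0: "l > 0" using assms by(simp add: l_def)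
 obtain T where T: "!!x. (T has_real_derivative bump m a b x) (at x)" using antiderivative_exists smooth_upto_continuous[OF bump_smooth[of 0 m a b]] by blast
 define B where "B y = T y - T (y - l)" for y
 have d: "(B has_real_derivative (bump m a b y - bump m a b (y - l))) (at y)" for y unfolding B_def
  by(intro DERIV_diff T, rule DERIV_cong[OF DERIV_chain2[where f=T and g="%y. y - l", OF T]])
   (auto intro!: derivative_eq_intros)
 have mv: "EX z. y - l < z & z < y & B y = l * bump m a b z" for y using MVT2[of "y - l" y T "bump m a b"] T l0 by(auto simp: B_def)
 have sm: "smooth_upto k B" for k
 proof (cases k)
  case 0
  thus ?thesis using d by(auto intro!: continuous_at_imp_continuous_on DERIV_isCont)
 next
  case (Suc j)
  have "smooth_upto j (%y. bump m a b y + (- 1) * bump m a b (1 * y + (- l)))" by(intro smooth_upto_add smooth_upto_mult smooth_upto_const smooth_upto_affine bump_smooth)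
  thus ?thesis unfolding Suc smooth_upto.simps using d by(intro exI[of _ "%y. bump m a b y - bump m a b (y - l)"]) auto
 qed
 show ?thesis
 proof (rule that[of B])
  show "0 <= B y" for y using mv[of y] bump_range l0 by auto
  show "B y <= b - a" for y using mv[of y] bump_range(2) l0 by(auto simp: l_def mult_left_le)
  show "B y = 0" if "~ (a < y & y < 2 * b - a)" for y
  proof -
   obtain z where z: "y - l < z" "z < y" "B y = l * bump m a b z" using mv by blast
   have "bump m a b z = 0" by(rule bump_zero) (use z that in \<open>auto simp: l_def\<close>)
   thus ?thesis using z by simp
  qed
 qed (use sm d in \<open>auto simp: l_def\<close>)
qed

section \<open>Smooth functions of three variables\<close>

lemma Ck_mono: "Ck (Suc k) f ==> Ck k f"
proof (induction k arbitrary: f)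
 case 0
 thus ?case by(auto intro: differentiable_imp_continuous_on)
qed auto

lemma partial_deriv_eq: "(f has_derivative D) (at x) ==> pd i f x = D (axis i 1)" by(simp add: partial_deriv_def frechet_derivative_at[symmetric])

lemma Ck_const: "Ck k (%x. c)"
proof (induction k arbitrary: c)
 case (Suc k)
 have "pd i (%x. c) = (%x. 0)" for i by(rule ext) (simp add: partial_deriv_eq[OF has_derivative_const])
 thus ?case using Suc by(simp add: differentiable_on_const)
qed simp

lemma Ck_add: "Ck k f ==> Ck k g ==> Ck k (%x. f x + g x)"
proof (induction k arbitrary: f g)
 case (Suc k)
 have "pd i (%x. f x + g x) = (%x. pd i f x + pd i g x)" for i
 proof
  fix x
  have "f differentiable at x" "g differentiable at x" using Suc.prems by(auto simp: differentiable_on_def)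
  hence "((%x. f x + g x) has_derivative (%h. frechet_derivative f (at x) h + frechet_derivative g (at x) h)) (at x)"
   by(intro has_derivative_add) (auto simp: frechet_derivative_works)
  thus "pd i (%x. f x + g x) x = pd i f x + pd i g x" by(subst partial_deriv_eq, assumption) (simp add: partial_deriv_def)
 qed
 thus ?case using Suc by(auto intro: differentiable_on_add)
qed (auto intro: continuous_intros)

lemma partial_deriv_mult:
 assumes "f differentiable at x" "g differentiable at x"
 shows "pd i (%x. f x * g x) x = f x * pd i g x + pd i f x * g x"
proof -
 have "((%x. f x * g x) has_derivative (%h. f x * frechet_derivative g (at x) h + frechet_derivative f (at x) h * g x)) (at x)"
  using assms by(intro has_derivative_mult) (auto simp: frechet_derivative_works)
 thus ?thesis by(subst partial_deriv_eq, assumption) (simp add: partial_deriv_def)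
qed

lemma Ck_mult: "Ck k f ==> Ck k g ==> Ck k (%x. f x * g x)"
proof (induction k arbitrary: f g)
 case (Suc k)
 have "pd i (%x. f x * g x) = (%x. f x * pd i g x + pd i f x * g x)" for i
  by(rule ext, rule partial_deriv_mult) (use Suc.prems in \<open>auto simp: differentiable_on_def\<close>)
 moreover have "Ck k (%x. f x * pd i g x + pd i f x * g x)" for i by(intro Ck_add Suc.IH) (use Suc.prems in \<open>auto intro: Ck_mono\<close>)
 ultimately show ?case using Suc.prems by(auto intro: differentiable_on_mult)
qed (auto intro: continuous_intros)

lemma has_derivative_coord:
 assumes "(f has_real_derivative d) (at (x $ i))"
 shows "((%x::real^3. f (x $ i)) has_derivative (%h. d * h $ i)) (at x)"
 using has_derivative_compose[OF bounded_linear_imp_has_derivative[OF bounded_linear_vec_nth] assms[unfolded has_field_derivative_def], of UNIV] by(simp add: o_def)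

lemma partial_deriv_coord:
 assumes "(f has_real_derivative d) (at (x $ i))"
 shows "pd j (%x. f (x $ i)) x = (if i = j then d else 0)" using partial_deriv_eq[OF has_derivative_coord[OF assms], of j] by(simp add: axis_def)

lemma Ck_coord: "smooth_upto k f ==> Ck k (%x. f (x $ i))"
proof (induction k arbitrary: f)
 case 0
 thus ?case by(auto intro!: continuous_on_compose2[of UNIV f] continuous_intros)
next
 case (Suc k)
 then obtain f' where f': "!!x. (f has_real_derivative f' x) (at x)" "smooth_upto k f'" by auto
 have "pd j (%x. f (x $ i)) = (%x. if i = j then f' (x $ i) else 0)" for j by(rule ext) (rule partial_deriv_coord[OF f'(1)])
 moreover have "Ck k (%x. if i = j then f' (x $ i) else 0)" for j using Suc.IH[OF f'(2)] by(cases "i = j") (auto intro: Ck_const)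
 moreover have "(%x. f (x $ i)) differentiable_on UNIV" using has_derivative_coord[OF f'(1)] by(auto simp: differentiable_on_def differentiable_def)
 ultimately show ?case by simp
qed

lemma Ck_prod: "finite A ==> (!!l. l : A ==> Ck k (f l)) ==> Ck k (%x. \<Prod>l\<in>A. f l x)" by(induction A rule: finite_induct) (auto intro: Ck_const Ck_mult)

lemma test_function_prod:
 fixes f :: "3 => real => real"
 assumes s: "!!l k. smooth_upto k (f l)" and z: "!!l y. ~ (a $ l <= y & y <= b $ l) ==> f l y = 0"
 shows "(%x::real^3. \<Prod>l\<in>UNIV. f l (x $ l)) : test_functions"
proof -
 have "{x. (\<Prod>l\<in>UNIV. f l (x $ l)) ~= 0} \<subseteq> cbox a b" using z by(auto simp: mem_box_cart) blast+
 hence "closure {x. (\<Prod>l\<in>UNIV. f l (x $ l)) ~= 0} \<subseteq> cbox a b" by(rule closure_minimal) (rule closed_cbox)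
 hence "compact (closure {x. (\<Prod>l\<in>UNIV. f l (x $ l)) ~= 0})" using bounded_subset[OF bounded_cbox] closed_closure by(simp add: compact_eq_bounded_closed)
 thus ?thesis unfolding test_functions_def by(auto intro!: Ck_prod Ck_coord s)
qed

lemma partial_deriv_prod_coord:
 fixes f :: "3 => real => real"
 assumes s: "!!l. smooth_upto 1 (f l)" and d: "(f i has_real_derivative d) (at (x $ i))"
 shows "pd i (%x. \<Prod>l\<in>UNIV. f l (x $ l)) x = d * (\<Prod>l\<in>UNIV - {i}. f l (x $ l))"
proof -
 have eq: "(%x. \<Prod>l\<in>UNIV. f l (x $ l)) = (%x. f i (x $ i) * (\<Prod>l\<in>UNIV - {i}. f l (x $ l)))" by(rule ext) (simp add: prod.remove[of UNIV i])
 define g where "g l y = (if l = i then 1 else f l y)" for l and y :: real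
 have g: "(%x::real^3. \<Prod>l\<in>UNIV - {i}. f l (x $ l)) = (%x. \<Prod>l\<in>UNIV - {i}. g l (x $ l))" by(rule ext, rule prod.cong) (auto simp: g_def)
 have z: "pd i (%x. \<Prod>l\<in>A. f l (x $ l)) x = 0 & (%x. \<Prod>l\<in>A. f l (x $ l)) differentiable at x" if "finite A" "i ~: A" for A using that
 proof (induction A rule: finite_induct)
  case empty
  thus ?case using partial_deriv_eq[OF has_derivative_const] by simp
 next
  case (insert l A)
  obtain f' where f': "!!x. (f l has_real_derivative f' x) (at x)" using s[of l] by auto
  have 1: "(%x. f l (x $ l)) differentiable at x" using has_derivative_coord[OF f'] by(auto simp: differentiable_def)
  have 2: "pd i (%x. f l (x $ l)) x = 0" using partial_deriv_coord[where i=l and j=i and x=x, OF f'] insert by auto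
  show ?case using insert partial_deriv_mult[OF 1, of "%x. \<Prod>l\<in>A. f l (x $ l)" i] 1 2 by(auto intro: differentiable_mult)
 qed
 have "(%x. f i (x $ i)) differentiable at x" using has_derivative_coord[OF d] by(auto simp: differentiable_def)
 thus ?thesis unfolding eq using z[of "UNIV - {i}"] by(subst partial_deriv_mult) (auto simp: partial_deriv_coord[OF d])
qed

lemma continuous_borel_lebesgue: "continuous_on UNIV f ==> f : bmeas" by(intro measurable_completion) (simp add: borel_measurable_continuous_onI)

lemma locally_integrable_indicator:
 fixes f :: fn
 assumes "loc_int f" "compact K"
 shows "integ (%x. ind K x * f x)" using assms by(simp add: locally_integrable_def set_integrable_def)

lemma locally_integrable_component:
 fixes G :: "real^3 => real^3"
 assumes "loc_int G"
 shows "loc_int (%x. G x $ i)" unfolding locally_integrable_def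
proof (intro allI impI)
 fix K :: "(real^3) set" assume "compact K"
 hence "G absolutely_integrable_on K" using assms by(simp add: locally_integrable_def)
 from absolutely_integrable_linear[OF this bounded_linear_vec_nth]
 show "(%x. G x $ i) absolutely_integrable_on K" by(simp add: o_def)
qed

lemma prod_zero_iff_ex: "finite A ==> l : A ==> f l = (0::real) ==> (\<Prod>l\<in>A. f l) = 0" by(meson prod_zero)

lemma bump_prod_tendsto:
 fixes a b x :: "real^3"
 shows "(%m. bumps m a b x) ----> ind (box a b) x"
proof -
 have "(%m. bumps m a b x) ----> (\<Prod>l\<in>UNIV. if a $ l < x $ l & x $ l < b $ l then 1 else (0::real))" by(intro tendsto_prod bump_tendsto)
 moreover have "(\<Prod>l\<in>UNIV. if a $ l < x $ l & x $ l < b $ l then 1 else 0) = (ind (box a b) x :: real)"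
  by(auto simp: indicator_def mem_box_cart intro!: prod_zero_iff_ex)
 ultimately show ?thesis by simp
qed

lemma bump_prod_le:
 fixes a b x :: "real^3"
 assumes "box a b \<subseteq> D"
 shows "abs (bumps m a b x) <= ind D x"
proof (cases "x : box a b")
 case True
 have "abs (bumps m a b x) <= 1" unfolding abs_prod using bump_range by(intro prod_le_1) auto
 thus ?thesis using True assms by auto
next
 case False
 then obtain l where "~ (a $ l < x $ l & x $ l < b $ l)" by(auto simp: mem_box_cart)
 hence z: "bumps m a b x = 0" by(intro prod_zero_iff_ex[of _ l]) (auto simp: bump_zero)
 show ?thesis unfolding z by simp
qed

text \<open>The weak gradient is tested with a product of \<open>B\<close> in direction
  \<open>i\<close> and bumps in the other directions: its \<open>i\<close>-th derivative tends to
  the difference of the indicators of two adjacent boxes, while the function itself stays below the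
  side length.\<close>

lemma box_difference:
 fixes a b :: "real^3" and i :: 3
 assumes wg: "wgrad u G" and ab: "!!l. a $ l < b $ l"
 defines "h == axis i (b $ i - a $ i)"
 shows "abs (LI (%x. ind (box a b) x * u x) - LI (%x. ind (box (a + h) (b + h)) x * u x))
   <= (b $ i - a $ i) * LI (%x. ind (cbox a (b + h)) x * abs (G x $ i))"
proof -
 define l where "l = b $ i - a $ i"
 have l0: "l > 0" using ab[of i] by(simp add: l_def)
 have hn: "h $ k = (if k = i then l else 0)" for k by(simp add: h_def axis_def l_def)
 define D where "D = cbox a (b + h)"
 have D: "compact D" by(simp add: D_def)
 have sub: "box a b \<subseteq> D" "box (a + h) (b + h) \<subseteq> D" using l0 unfolding D_def by(auto simp: mem_box_cart hn) (smt (verit))+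
 have "EX B. (ALL k. smooth_upto k B) &
  (ALL y. (B has_real_derivative (bump m (a $ i) (b $ i) y - bump m (a $ i) (b $ i) (y - l))) (at y)) &
  (ALL y. 0 <= B y) & (ALL y. B y <= l) & (ALL y. ~ (a $ i < y & y < 2 * b $ i - a $ i) --> B y = 0)" for m
  by(rule bump_integrated[OF ab[of i], of m]) (unfold l_def, blast)
 then obtain B where B: "!!m k. smooth_upto k (B m)"
  "!!m y. (B m has_real_derivative (bump m (a $ i) (b $ i) y - bump m (a $ i) (b $ i) (y - l))) (at y)"
  "!!m y. 0 <= B m y" "!!m y. B m y <= l" "!!m y. ~ (a $ i < y & y < 2 * b $ i - a $ i) ==> B m y = 0" by metis
 define f where "f m k = (if k = i then B m else bump m (a $ k) (b $ k))" for m and k :: 3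
 define ps where "ps m x = (\<Prod>k\<in>UNIV. f m k (x $ k))" for m and x :: "real^3"
 have fz: "f m k y = 0" if "~ (a $ k <= y & y <= (b + h) $ k)" for m k y using that B(5)[of y m] l0 by(auto simp: f_def hn l_def bump_zero)
 have test: "ps m : test_functions" for m
  unfolding ps_def by(rule test_function_prod[where a=a and b="b + h"]) (use fz in \<open>auto simp: f_def B(1) bump_smooth\<close>)
 have pd: "pd i (ps m) x = bumps m a b x - bumps m (a + h) (b + h) x" for m x
 proof -
  have "pd i (ps m) x = (bump m (a $ i) (b $ i) (x $ i) - bump m (a $ i) (b $ i) (x $ i - l)) * (\<Prod>k\<in>UNIV - {i}. f m k (x $ k))"
   unfolding ps_def by(rule partial_deriv_prod_coord) (use B(1,2) in \<open>auto simp: f_def bump_smooth simp del: smooth_upto.simps\<close>)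
  also have "(\<Prod>k\<in>UNIV - {i}. f m k (x $ k)) = (\<Prod>k\<in>UNIV - {i}. bump m (a $ k) (b $ k) (x $ k))" by(rule prod.cong) (auto simp: f_def)
  finally have 1: "pd i (ps m) x = bump m (a $ i) (b $ i) (x $ i) * (\<Prod>k\<in>UNIV - {i}. bump m (a $ k) (b $ k) (x $ k))
    - bump m (a $ i) (b $ i) (x $ i - l) * (\<Prod>k\<in>UNIV - {i}. bump m (a $ k) (b $ k) (x $ k))" by(simp add: algebra_simps)
  have sh: "bump m (a $ i) (b $ i) (x $ i - l) = bump m ((a + h) $ i) ((b + h) $ i) (x $ i)" by(simp add: bump_def hn algebra_simps)
  have 2: "(\<Prod>k\<in>UNIV - {i}. bump m (a $ k) (b $ k) (x $ k)) = (\<Prod>k\<in>UNIV - {i}. bump m ((a + h) $ k) ((b + h) $ k) (x $ k))"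
   by(rule prod.cong) (auto simp: hn)
  show ?thesis unfolding 1 sh by(subst (2) 2) (simp add: prod.remove[of UNIV i])
 qed
 have uD: "integ (%x. ind D x * u x)" using wg D by(auto simp: has_weak_gradient_def intro: locally_integrable_indicator)
 have GD: "integ (%x. ind D x * G x $ i)" using wg D by(intro locally_integrable_indicator locally_integrable_component) (auto simp: has_weak_gradient_def)
 have GD': "integ (%x. l * (ind D x * abs (G x $ i)))" using integrable_abs[OF GD] by(intro integrable_mult_right) (simp add: abs_mult)
 have bc: "(%x. bump m p q (x $ k)) : bmeas" for m p q and k :: 3
  by(intro continuous_borel_lebesgue continuous_on_compose2[OF smooth_upto_continuous[OF bump_smooth[of 0]]] continuous_intros) auto
 have pm: "(%x. pd i (ps m) x) : bmeas" for m unfolding pd by(intro borel_measurable_diff borel_measurable_prod bc)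
 have psm: "ps m : bmeas" for m
 proof -
  have "ALL k. Ck k (ps m)" using test[of m] unfolding test_functions_def by blast
  hence "Ck 0 (ps m)" by(rule spec)
  thus ?thesis by(intro continuous_borel_lebesgue) simp
 qed
 have psb: "abs (ps m x) <= l * ind D x" for m x
 proof (cases "x : D")
  case True
  have "abs (ps m x) = abs (B m (x $ i)) * abs (\<Prod>k\<in>UNIV - {i}. f m k (x $ k))" unfolding ps_def by(subst prod.remove[of UNIV i]) (auto simp: f_def abs_mult)
  also have "... <= l * 1" unfolding abs_prod using B(3,4) bump_range l0 by(intro mult_mono prod_le_1) (auto simp: f_def intro: prod_nonneg)
  finally show ?thesis using True by simp
 next
  case False
  then obtain k where "~ (a $ k <= x $ k & x $ k <= (b + h) $ k)" by(auto simp: D_def mem_box_cart)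
  hence "ps m x = 0" unfolding ps_def by(intro prod_zero_iff_ex[of _ k]) (auto simp: fz)
  thus ?thesis using False by simp
 qed
 have ident: "LI (%x. u x * pd i (ps m) x) = - LI (%x. G x $ i * ps m x)" for m using wg test[of m] by(auto simp: has_weak_gradient_def)
 let ?k = "%x. ind D x * u x * (ind (box a b) x - ind (box (a + h) (b + h)) x)" and ?R = "LI (%x. l * (ind D x * abs (G x $ i)))"
 have R: "abs (LI (%x. u x * pd i (ps m) x)) <= ?R" for m
 proof -
  have "abs (LI (%x. G x $ i * ps m x)) <= ?R"
  proof (rule order_trans[OF integral_abs_bound integral_mono_AE'[OF GD']], goal_cases)
   case 1
   show ?case
   proof (rule AE_I2)
    fix x
    have "abs (G x $ i * ps m x) <= abs (G x $ i) * (l * ind D x)" unfolding abs_mult by(intro mult_left_mono psb) auto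
    thus "abs (G x $ i * ps m x) <= l * (ind D x * abs (G x $ i))" by(simp add: mult_ac)
   qed
  qed (use l0 in auto)
  thus ?thesis unfolding ident by simp
 qed
 have lim: "(%m. LI (%x. u x * pd i (ps m) x)) ---->
   (LI (%x. ?k x))"
 proof -
  have pdz: "u x * pd i (ps m) x = ind D x * u x * pd i (ps m) x" for m x
  proof (cases "x : D")
   case False
   have "bumps m a b x = 0" using bump_prod_le[OF sub(1), of m x] unfolding indicator_simps(2)[OF False] by(simp only: abs_le_zero_iff)
   moreover have "bumps m (a + h) (b + h) x = 0" using bump_prod_le[OF sub(2), of m x] unfolding indicator_simps(2)[OF False] by(simp only: abs_le_zero_iff)
   ultimately show ?thesis by(simp only: pd) simp
  qed simp
  show ?thesis unfolding pdz
  proof (rule integral_dominated_convergence[where w="%x. 2 * abs (ind D x * u x)"])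
   show "integ (%x. 2 * abs (ind D x * u x))" by(intro integrable_mult_right integrable_abs uD)
   show "AE x in leb. (%m. ind D x * u x * pd i (ps m) x)
     ----> ?k x" unfolding pd by(intro AE_I2 tendsto_mult tendsto_const tendsto_diff bump_prod_tendsto)
   show "AE x in leb. norm (ind D x * u x * pd i (ps m) x) <= 2 * abs (ind D x * u x)" for m
   proof (rule AE_I2)
    fix x
    have "abs (pd i (ps m) x) <= 1 + 1" unfolding pd using bump_prod_le[of a b UNIV m x] bump_prod_le[of "a + h" "b + h" UNIV m x]
     by(intro order_trans[OF abs_triangle_ineq4 add_mono]) auto
    hence "abs (ind D x * u x) * abs (pd i (ps m) x) <= abs (ind D x * u x) * 2" by(intro mult_left_mono) auto
    thus "norm (ind D x * u x * pd i (ps m) x) <= 2 * abs (ind D x * u x)" by(simp add: abs_mult mult_ac)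
   qed
   show "?k : bmeas" by(intro borel_measurable_times borel_measurable_diff borel_measurable_indicator borel_measurable_integrable[OF uD]) auto
   show "(%x. ind D x * u x * pd i (ps m) x) : bmeas" for m by(intro borel_measurable_times pm borel_measurable_integrable[OF uD])
  qed
 qed
 have ib: "integ (%x. ind (box a b) x * u x)" "integ (%x. ind (box (a + h) (b + h)) x * u x)"
 proof -
  have *: "integ (%x. ind S x * u x)" if "S \<subseteq> D" "S : sets leb" for S
  proof (rule Lintegrable_bound[OF uD])
   have "(%x. ind S x * u x) = (%x. ind S x * (ind D x * u x))" using that by(auto simp: indicator_def fun_eq_iff)
   moreover have "(%x. ind S x * (ind D x * u x)) : bmeas" by(intro borel_measurable_times borel_measurable_indicator borel_measurable_integrable[OF uD] that(2))
   ultimately show "(%x. ind S x * u x) : bmeas" by simp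
  qed (use that in \<open>auto simp: indicator_def\<close>)
  show "integ (%x. ind (box a b) x * u x)" by(rule *[OF sub(1)]) simp
  show "integ (%x. ind (box (a + h) (b + h)) x * u x)" by(rule *[OF sub(2)]) simp
 qed
 have eq: "LI (%x. ?k x)
   = LI (%x. ind (box a b) x * u x) - LI (%x. ind (box (a + h) (b + h)) x * u x)" unfolding Lintegral_diff[OF ib, symmetric]
  by(rule Bochner_Integration.integral_cong) (use sub in \<open>auto simp: indicator_def\<close>)
 have "abs (LI (%x. ?k x))
   <= ?R" by(rule tendsto_upperbound[OF tendsto_rabs[OF lim]]) (use R in auto)
 thus ?thesis unfolding eq by(simp add: l_def D_def)
qed

section \<open>Averages over dyadic cells\<close>

text \<open>\<open>sg\<close> lists the reciprocal side lengths, one per direction, which allows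
  refinement of a single direction. Half-open cells given by \<open>floor\<close> partition the
  space exactly.\<close>

definition cell :: "real^3 => int^3 => (real^3) set" where
 "cell sg k = {y. ALL i. floor (sg $ i * y $ i) = k $ i}"

definition index :: "real^3 => real^3 => int^3" where
 "index sg x = (\<chi> i. floor (sg $ i * x $ i))"

definition vol :: fn where
 "vol sg = (\<Prod>i\<in>UNIV. 1 / sg $ i)"

definition avg :: "real^3 => fn => int^3 => real" where
 "avg sg u k = LI (%x. ind (cell sg k) x * u x) / vol sg"

text \<open>Conditional expectation of \<open>u\<close> with respect to the partition into
  cells.\<close>

definition proj :: "real^3 => fn => fn" where
 "proj sg u x = avg sg u (index sg x)"

definition lo :: "real^3 => int^3 => real^3" where "lo sg k = (\<chi> i. real_of_int (k $ i) / sg $ i)"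
definition hi :: "real^3 => int^3 => real^3" where "hi sg k = (\<chi> i. (real_of_int (k $ i) + 1) / sg $ i)"

lemma in_cell_iff: "x : cell sg k <-> index sg x = k" by(auto simp: cell_def index_def vec_eq_iff)

lemma vol_pos: "(!!i. sg $ i > 0) ==> vol sg > 0" by(auto simp: vol_def intro: prod_pos)


lemma cell_lborel: "cell sg k : sets borel"
proof -
 have "cell sg k = (\<Inter>i\<in>UNIV. {y. floor (sg $ i * y $ i) = k $ i})" by(auto simp: cell_def)
 moreover have "{y::real^3. floor (sg $ i * y $ i) = k $ i} : sets borel" for i
 proof -
  have "{y::real^3. floor (sg $ i * y $ i) = k $ i} = {y. real_of_int (k $ i) <= sg $ i * y $ i} \<inter> {y. sg $ i * y $ i < real_of_int (k $ i) + 1}"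
   by(auto simp: floor_eq_iff)
  moreover have "closed {y::real^3. real_of_int (k $ i) <= sg $ i * y $ i}" by(intro closed_Collect_le continuous_intros)
  moreover have "open {y::real^3. sg $ i * y $ i < real_of_int (k $ i) + 1}" by(intro open_Collect_less continuous_intros)
  ultimately show ?thesis by auto
 qed
 ultimately show ?thesis by auto
qed

lemma cell_sets [measurable]: "cell sg k : sets leb" using cell_lborel by auto

lemma cell_box:
 assumes "!!i. sg $ i > 0"
 shows "box (lo sg k) (hi sg k) \<subseteq> cell sg k" "cell sg k \<subseteq> cbox (lo sg k) (hi sg k)"
proof -
 have *: "real_of_int (k $ i) / sg $ i < t <-> real_of_int (k $ i) < sg $ i * t"
  "real_of_int (k $ i) / sg $ i <= t <-> real_of_int (k $ i) <= sg $ i * t"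
  "t < (real_of_int (k $ i) + 1) / sg $ i <-> sg $ i * t < real_of_int (k $ i) + 1"
  "t <= (real_of_int (k $ i) + 1) / sg $ i <-> sg $ i * t <= real_of_int (k $ i) + 1" for i t using assms[of i] by(simp_all add: field_simps)
 show "box (lo sg k) (hi sg k) \<subseteq> cell sg k" by(auto simp: mem_box_cart lo_def hi_def cell_def * floor_eq_iff less_imp_le)
 show "cell sg k \<subseteq> cbox (lo sg k) (hi sg k)" by(auto simp: mem_box_cart lo_def hi_def cell_def * floor_eq_iff less_imp_le)
qed

lemma AE_box_cbox: "AE x in leb. x : cbox a b --> x : box a (b :: real^3)"
proof -
 have "cbox a b - box a b : null_sets leb" using negligible_frontier_interval[of a b] by(simp add: negligible_iff_null_sets)
 thus ?thesis by(auto dest!: AE_not_in)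
qed

lemma AE_cell_box:
 assumes "!!i. sg $ i > 0"
 shows "AE x in leb. x : cell sg k <-> x : box (lo sg k) (hi sg k)" using AE_box_cbox[of "lo sg k" "hi sg k"] cell_box[OF assms, of k] by auto

lemma emeasure_cell:
 assumes "!!i. sg $ i > 0"
 shows "emeasure leb (cell sg k) = enn (vol sg)"
proof -
 have le: "lo sg k $ i <= hi sg k $ i" for i using assms[of i] by(simp add: lo_def hi_def divide_right_mono)
 have "emeasure leb (cell sg k) = emeasure leb (cbox (lo sg k) (hi sg k))" using AE_box_cbox[of "lo sg k" "hi sg k"] cell_box[OF assms, of k]
  by(intro emeasure_eq_AE) auto
 also have "... = enn (measure lborel (cbox (lo sg k) (hi sg k)))" using emeasure_lborel_cbox_finite[of "lo sg k" "hi sg k"] by(simp add: emeasure_eq_ennreal_measure)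
 also have "measure lborel (cbox (lo sg k) (hi sg k)) = vol sg"
  using le by(subst content_cbox_cart) (auto simp: interval_ne_empty_cart vol_def lo_def hi_def add_divide_distrib intro!: prod.cong)
 finally show ?thesis .
qed

lemma nn_integral_cells:
 assumes [measurable]: "f : bmeas"
 shows "NL (%x. f x) = NC (%k. NL (%x. ind (cell sg k) x * f x))"
proof -
 have "NC (%k. NL (%x. ind (cell sg k) x * f x))
   = NL (%x. NC (%k. ind (cell sg k) x * f x))" by(rule nn_integral_count_space_nn_integral[symmetric]) auto
 also have "... = NL (%x. f x)"
 proof (rule nn_integral_cong)
  fix x
  have "NC (%k. ind (cell sg k) x * f x) = NC (%k. f x * ind {index sg x} k)" by(intro nn_integral_cong) (auto simp: indicator_def in_cell_iff)
  thus "NC (%k. ind (cell sg k) x * f x) = f x" by(simp add: nn_integral_cmult_indicator)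
 qed
 finally show ?thesis by simp
qed

lemma nn_integral_cell_function:
 assumes "!!i. sg $ i > 0"
 shows "NL (%x. F (index sg x)) = enn (vol sg) * NC (%k. F k)"
proof -
 have m: "(%x. F (index sg x)) : bmeas"
 proof -
  have "index sg : leb \<rightarrow>\<^sub>M count_space UNIV" by(subst measurable_count_space_eq_countable) (auto simp: vimage_def in_cell_iff[symmetric])
  thus ?thesis by(rule measurable_compose) simp
 qed
 have "NL (%x. F (index sg x)) = NC (%k. NL (%x. F k * ind (cell sg k) x))" unfolding nn_integral_cells[OF m, of sg]
  by(intro nn_integral_cong) (auto simp: indicator_def in_cell_iff)
 also have "... = NC (%k. enn (vol sg) * F k)" by(intro nn_integral_cong) (simp add: nn_integral_cmult_indicator emeasure_cell[OF assms] mult.commute)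
 also have "... = enn (vol sg) * NC (%k. F k)" by(rule nn_integral_cmult) simp
 finally show ?thesis .
qed

lemma proj_measurable: "proj sg u : bmeas"
proof -
 have "index sg : leb \<rightarrow>\<^sub>M count_space UNIV" by(subst measurable_count_space_eq_countable) (auto simp: vimage_def in_cell_iff[symmetric])
 thus ?thesis unfolding proj_def[abs_def] by(rule measurable_compose) simp
qed

lemma cell_integrable:
 fixes u :: fn
 assumes "loc_int u" "!!i. sg $ i > 0"
 shows "integ (%x. ind (cell sg k) x * u x)"
proof -
 have i: "integ (%x. ind (cbox (lo sg k) (hi sg k)) x * u x)" by(rule locally_integrable_indicator[OF assms(1)]) simp
 have "integ (%x. ind (cell sg k) x * (ind (cbox (lo sg k) (hi sg k)) x * u x))" using integrable_mult_indicator[OF cell_sets i, of sg k] by simp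
 moreover have "ind (cell sg k) x * (ind (cbox (lo sg k) (hi sg k)) x * u x) = ind (cell sg k) x * u x" for x
  using cell_box(2)[OF assms(2), of k] by(auto simp: indicator_def)
 ultimately show ?thesis by simp
qed

definition cell_energy :: "fn => real^3 => int^3 => enn" where
 "cell_energy g sg k = NL (%x. ind (cell sg k) x * enn ((g x)^2))"

lemma cell_abs_integral_le:
 fixes g :: fn
 assumes g: "loc_int g" and gm: "g : bmeas" and s: "!!i. sg $ i > 0"
 shows "enn (LI (%x. ind (cell sg k) x * abs (g x))^2) <= enn (vol sg) * cell_energy g sg k"
proof -
 have i: "integ (%x. ind (cell sg k) x * abs (g x))" using integrable_abs[OF cell_integrable[OF g s, of k]] by(simp add: abs_mult)
 have "enn (LI (%x. ind (cell sg k) x * abs (g x))) = NL (%x. enn (ind (cell sg k) x * abs (g x)))" by(rule nn_integral_eq_integral[symmetric, OF i]) simp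
 also have "... = NL (%x. ind (cell sg k) x * (ind (cell sg k) x * enn (abs (g x))))" by(intro nn_integral_cong) (auto simp: indicator_def)
 finally have "(enn (LI (%x. ind (cell sg k) x * abs (g x))))^2
   <= NL (%x. (ind (cell sg k) x)^2) * NL (%x. (ind (cell sg k) x * enn (abs (g x)))^2)"
  using gm by(auto intro!: Cauchy_Schwarz_nn_integral simp del: nn_integral_indicator)
 also have "NL (%x. (ind (cell sg k) x)^2) = NL (%x. ind (cell sg k) x)" by(intro nn_integral_cong) (auto simp: indicator_def)
 also have "... = enn (vol sg)" using emeasure_cell[OF s, of k] by simp
 also have "NL (%x. (ind (cell sg k) x * enn (abs (g x)))^2) = cell_energy g sg k"
  unfolding cell_energy_def by(intro nn_integral_cong) (auto simp: indicator_def ennreal_power)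
 finally show ?thesis by(simp add: ennreal_power)
qed

text \<open>\<open>box_difference\<close> bounds the difference of the integrals by an integral of
  the derivative over both cells; Cauchy--Schwarz on each cell turns it into the energy. The factor
  2 comes from (r + s)^2 <= 2 (r^2 + s^2).\<close>

lemma edge_estimate:
 fixes i :: 3
 assumes wg: "wgrad u G" and Gm: "(%x. G x $ i) : bmeas" and s: "!!i. sg $ i > 0"
 shows "enn ((avg sg u k - avg sg u (k + axis i 1))^2)
  <= enn (2 / ((sg $ i)^2 * vol sg)) * (cell_energy (%x. G x $ i) sg k + cell_energy (%x. G x $ i) sg (k + axis i 1))"
proof -
 let ?g = "%x. G x $ i" and ?k = "k + axis i 1"
 have gl: "loc_int ?g" using wg by(auto simp: has_weak_gradient_def intro: locally_integrable_component)
 have ul: "loc_int u" using wg by(auto simp: has_weak_gradient_def)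
 have V: "vol sg > 0" using vol_pos s by blast
 define a b where "a = lo sg k" and "b = hi sg k"
 define h where "h = axis i (b $ i - a $ i)"
 have bi: "b $ i - a $ i = 1 / sg $ i" by(simp add: a_def b_def lo_def hi_def add_divide_distrib)
 have ah: "a + h = lo sg ?k" "b + h = hi sg ?k" unfolding h_def bi by(auto simp: a_def b_def lo_def hi_def vec_eq_iff axis_def add_divide_distrib)
 have ab: "a $ l < b $ l" for l using s[of l] by(simp add: a_def b_def lo_def hi_def divide_strict_right_mono)
 have box: "abs (LI (%x. ind (box a b) x * u x) - LI (%x. ind (box (a + h) (b + h)) x * u x))
   <= (b $ i - a $ i) * LI (%x. ind (cbox a (b + h)) x * abs (?g x))" using box_difference[OF wg ab, of i] by(simp add: h_def)
 have e1: "LI (%x. ind (box (lo sg k) (hi sg k)) x * u x) = LI (%x. ind (cell sg k) x * u x)" for k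
 proof -
  have "integ (%x. ind (box (lo sg k) (hi sg k)) x * (ind (cell sg k) x * u x))"
   using integrable_mult_indicator[OF _ cell_integrable[OF ul s, of k], of "box (lo sg k) (hi sg k)"] by simp
  moreover have "ind (box (lo sg k) (hi sg k)) x * (ind (cell sg k) x * u x) = ind (box (lo sg k) (hi sg k)) x * u x" for x
   using cell_box(1)[OF s, of k] by(auto simp: indicator_def)
  ultimately have "integ (%x. ind (box (lo sg k) (hi sg k)) x * u x)" by simp
  thus ?thesis using AE_cell_box[OF s, of k] cell_integrable[OF ul s, of k] by(intro integral_cong_AE borel_measurable_integrable) (auto simp: indicator_def)
 qed
 define r where "r k = LI (%x. ind (cell sg k) x * abs (?g x))" for k
 have ri: "integ (%x. ind (cell sg k) x * abs (?g x))" for k using integrable_abs[OF cell_integrable[OF gl s, of k]] by(simp add: abs_mult)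
 have e2: "LI (%x. ind (cbox a (b + h)) x * abs (?g x)) <= r k + r ?k"
 proof -
  have "LI (%x. ind (cbox a (b + h)) x * abs (?g x))
    <= LI (%x. ind (cell sg k) x * abs (?g x) + ind (cell sg ?k) x * abs (?g x))"
  proof (rule integral_mono_AE')
   have "x : cell sg k | x : cell sg ?k" if x: "x : box a (b + h)" for x
   proof -
    have 1: "a $ l < x $ l" "x $ l < (b + h) $ l" for l using x by(auto simp: mem_box_cart)
    have 2: "real_of_int (k $ l) < sg $ l * x $ l" for l using 1(1)[of l] s[of l] by(simp add: a_def lo_def field_simps)
    have 3: "sg $ l * x $ l < real_of_int (k $ l) + 1" if "l ~= i" for l using 1(2)[of l] s[of l] that by(simp add: b_def hi_def h_def axis_def field_simps)
    have 4: "sg $ i * x $ i < real_of_int (k $ i) + 2" using 1(2)[of i] s[of i] unfolding ah(2) by(simp add: hi_def axis_def field_simps)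
    have 5: "floor (sg $ l * x $ l) = k $ l" if "l ~= i" for l using 2[of l] 3[OF that] by(simp add: floor_eq_iff)
    have 6: "floor (sg $ i * x $ i) = k $ i | floor (sg $ i * x $ i) = k $ i + 1" using 2[of i] 4 by(auto simp: floor_eq_iff)
    from 6 show ?thesis
    proof
     assume "floor (sg $ i * x $ i) = k $ i"
     hence "floor (sg $ l * x $ l) = k $ l" for l using 5[of l] by(cases "l = i") simp_all
     hence "x : cell sg k" by(simp add: cell_def)
     thus ?thesis ..
    next
     assume "floor (sg $ i * x $ i) = k $ i + 1"
     hence "floor (sg $ l * x $ l) = ?k $ l" for l using 5[of l] by(cases "l = i") (simp_all add: axis_def)
     hence "x : cell sg ?k" by(simp add: cell_def)
     thus ?thesis ..
    qed
   qed
   thus "AE x in leb. ind (cbox a (b + h)) x * abs (?g x) <= ind (cell sg k) x * abs (?g x) + ind (cell sg ?k) x * abs (?g x)"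
    using AE_box_cbox[of a "b + h"] by(auto simp: indicator_def elim!: eventually_mono)
  qed (use ri in auto)
  also have "... = r k + r ?k" unfolding r_def by(rule Lintegral_add[OF ri ri])
  finally show ?thesis .
 qed
 have "abs (avg sg u k - avg sg u ?k) = abs (LI (%x. ind (box a b) x * u x) - LI (%x. ind (box (a + h) (b + h)) x * u x)) / vol sg"
  unfolding avg_def ah unfolding a_def b_def e1 using V by(simp add: diff_divide_distrib[symmetric] abs_divide)
 also have "... <= ((1 / sg $ i) * (r k + r ?k)) / vol sg"
  using box e2 V s[of i] unfolding bi by(intro divide_right_mono order_trans[OF box[unfolded bi]] mult_left_mono) auto
 finally have "(avg sg u k - avg sg u ?k)^2 <= (((1 / sg $ i) * (r k + r ?k)) / vol sg)^2" by(metis abs_ge_zero power2_abs power_mono)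
 also have "... = 1 / ((sg $ i)^2 * (vol sg)^2) * (r k + r ?k)^2" by(simp add: power_divide power_mult_distrib)
 also have "... <= 1 / ((sg $ i)^2 * (vol sg)^2) * (2 * ((r k)^2 + (r ?k)^2))" using sum_squares_bound[of "r k" "r ?k"] by(intro mult_left_mono) (auto simp: power2_sum)
 finally have "enn ((avg sg u k - avg sg u ?k)^2) <= enn (2 / ((sg $ i)^2 * (vol sg)^2)) * (enn ((r k)^2) + enn ((r ?k)^2))"
  by(simp add: ennreal_mult[symmetric] ennreal_plus[symmetric] ennreal_leI del: ennreal_plus)
 also have "... <= enn (2 / ((sg $ i)^2 * (vol sg)^2)) * (enn (vol sg) * cell_energy ?g sg k + enn (vol sg) * cell_energy ?g sg ?k)"
  unfolding r_def by(intro mult_left_mono add_mono cell_abs_integral_le gl Gm s) auto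
 also have "... = enn (2 / ((sg $ i)^2 * (vol sg)^2)) * enn (vol sg) * (cell_energy ?g sg k + cell_energy ?g sg ?k)" by(simp add: distrib_left mult.assoc)
 also have "enn (2 / ((sg $ i)^2 * (vol sg)^2)) * enn (vol sg) = enn (2 / ((sg $ i)^2 * vol sg))"
  by(subst ennreal_mult[symmetric]) (use V in \<open>simp_all add: power2_eq_square mult.assoc[symmetric]\<close>)
 finally show ?thesis .
qed

section \<open>Dyadic refinement and convergence of averages\<close>

text \<open>Only one direction is halved at a time, so that a cell has two children whose averages
  are compared by an edge estimate; three halvings make one dyadic step
  (\<open>dy_Suc\<close>).\<close>

definition refine :: "real^3 => 3 => real^3" where
 "refine sg i = (\<chi> j. if j = i then 2 * sg $ j else sg $ j)"

definition child :: "3 => int^3 => int^3" where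
 "child i k = (\<chi> j. if j = i then 2 * k $ j else k $ j)"

lemma refine_pos: "(!!j. sg $ j > 0) ==> refine sg i $ j > 0" by(simp add: refine_def)

lemma vol_refine: "vol (refine sg i) = vol sg / 2"
proof -
 have "vol (refine sg i) = 1 / refine sg i $ i * (\<Prod>j\<in>UNIV - {i}. 1 / refine sg i $ j)" unfolding vol_def by(rule prod.remove) auto
 also have "(\<Prod>j\<in>UNIV - {i}. 1 / refine sg i $ j) = (\<Prod>j\<in>UNIV - {i}. 1 / sg $ j)" by(rule prod.cong) (auto simp: refine_def)
 also have "1 / refine sg i $ i * ... = (1 / sg $ i * (\<Prod>j\<in>UNIV - {i}. 1 / sg $ j)) / 2" by(simp add: refine_def)
 also have "1 / sg $ i * (\<Prod>j\<in>UNIV - {i}. 1 / sg $ j) = vol sg" unfolding vol_def by(rule prod.remove[symmetric]) auto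
 finally show ?thesis .
qed

lemma floor_double: "floor (2 * (t::real)) = 2 * floor (t) | floor (2 * t) = 2 * floor (t) + 1" by linarith

lemma floor_double_iff: "floor (2 * (t::real)) = 2 * n ==> floor (t) = n" "floor (2 * (t::real)) = 2 * n + 1 ==> floor (t) = n" by linarith+

lemma cell_split: "cell sg k = cell (refine sg i) (child i k) \<union> cell (refine sg i) (child i k + axis i 1)"
proof (intro Set.set_eqI iffI)
 fix x assume x: "x : cell sg k"
 hence f: "floor (sg $ j * x $ j) = k $ j" for j by(simp add: cell_def)
 have d: "floor (2 * (sg $ i * x $ i)) = 2 * k $ i | floor (2 * (sg $ i * x $ i)) = 2 * k $ i + 1" using floor_double[of "sg $ i * x $ i"] f[of i] by simp
 thus "x : cell (refine sg i) (child i k) \<union> cell (refine sg i) (child i k + axis i 1)" using f by(auto simp: cell_def refine_def child_def axis_def mult.assoc)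
next
 fix x assume x: "x : cell (refine sg i) (child i k) \<union> cell (refine sg i) (child i k + axis i 1)"
 have "floor (sg $ j * x $ j) = k $ j" for j
 proof (cases "j = i")
  case True
  have "floor (2 * (sg $ i * x $ i)) = 2 * k $ i | floor (2 * (sg $ i * x $ i)) = 2 * k $ i + 1"
   using x by(auto simp: cell_def refine_def child_def axis_def mult.assoc dest!: spec[of _ i])
  thus ?thesis using floor_double_iff True by blast
 next
  case False
  thus ?thesis using x by(auto simp: cell_def refine_def child_def axis_def dest!: spec[of _ j])
 qed
 thus "x : cell sg k" by(simp add: cell_def)
qed

lemma cell_children_disjoint: "cell (refine sg i) (child i k) \<inter> cell (refine sg i) (child i k + axis i 1) = {}"
 by(auto simp: cell_def axis_def dest!: spec[of _ i])

lemma indicator_cell_split: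
 "(ind (cell sg k) x :: 'a::semiring_1) = ind (cell (refine sg i) (child i k)) x + ind (cell (refine sg i) (child i k + axis i 1)) x"
 using cell_children_disjoint[of sg i k] by(auto simp: cell_split[of sg k i] indicator_def)

lemma avg_split:
 assumes "loc_int u" "!!j. sg $ j > 0"
 shows "avg sg u k = (avg (refine sg i) u (child i k) + avg (refine sg i) u (child i k + axis i 1)) / 2"
proof -
 have "LI (%x. ind (cell sg k) x * u x) = LI (%x. ind (cell (refine sg i) (child i k)) x * u x)
   + LI (%x. ind (cell (refine sg i) (child i k + axis i 1)) x * u x)" unfolding indicator_cell_split[of sg k _ i] distrib_right
  by(intro Lintegral_add cell_integrable assms(1) refine_pos assms(2))
 thus ?thesis unfolding avg_def vol_refine by(simp add: add_divide_distrib)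
qed

lemma proj_child:
 fixes i :: 3
 assumes "loc_int u" "!!j. sg $ j > 0"
 defines "A == %k. avg (refine sg i) u (child i k)" and "B == %k. avg (refine sg i) u (child i k + axis i 1)"
 shows "(proj (refine sg i) u x - proj sg u x)^2 = ((A (index sg x) - B (index sg x)) / 2)^2"
proof -
 define k where "k = index sg x"
 have "x : cell sg k" by(simp add: in_cell_iff k_def)
 hence "index (refine sg i) x = child i k | index (refine sg i) x = child i k + axis i 1" by(auto simp: cell_split[of sg k i] in_cell_iff)
 hence "proj (refine sg i) u x = A k | proj (refine sg i) u x = B k" by(auto simp: proj_def A_def B_def)
 moreover have p: "proj sg u x = (A k + B k) / 2" using avg_split[OF assms(1,2), of k i] by(simp add: proj_def k_def A_def B_def)
 ultimately show ?thesis unfolding k_def[symmetric] p by(auto simp: power2_eq_square field_simps)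
qed

text \<open>On either half the finer average differs from the coarser one by half the difference of
  the two halves, which \<open>edge_estimate\<close> at the finer scale bounds by the energy in the
  undivided cell.\<close>

lemma halving_estimate:
 fixes i :: 3
 assumes wg: "wgrad u G" and Gm: "(%x. G x $ i) : bmeas" and s: "!!j. sg $ j > 0"
 shows "NL (%x. enn ((proj (refine sg i) u x - proj sg u x)^2))
  <= enn (1 / (4 * (sg $ i)^2)) * NL (%x. enn ((G x $ i)^2))"
proof -
 let ?g = "%x. G x $ i" and ?s = "refine sg i"
 have ul: "loc_int u" using wg by(auto simp: has_weak_gradient_def)
 have V: "vol sg > 0" using vol_pos s by blast
 define A where "A k = avg ?s u (child i k)" for k
 define B where "B k = avg ?s u (child i k + axis i 1)" for k
 have sp: "?s $ j > 0" for j by(rule refine_pos[OF s])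
 have si: "?s $ i = 2 * sg $ i" by(simp add: refine_def)
 define c where "c = 2 / ((2 * sg $ i)^2 * (vol sg / 2))"
 have c0: "c >= 0" using V by(simp add: c_def)
 have H: "enn (((A k - B k) / 2)^2) <= enn (c / 4) * cell_energy ?g sg k" for k
 proof -
  have "enn ((A k - B k)^2) <= enn c * (cell_energy ?g ?s (child i k) + cell_energy ?g ?s (child i k + axis i 1))"
   using edge_estimate[OF wg Gm sp, of "child i k"] unfolding A_def B_def c_def si vol_refine .
  also have "cell_energy ?g ?s (child i k) + cell_energy ?g ?s (child i k + axis i 1) = cell_energy ?g sg k"
   unfolding cell_energy_def indicator_cell_split[of sg k _ i] distrib_right by(rule nn_integral_add[symmetric]) (use Gm in auto)
  finally have "enn (1/4) * enn ((A k - B k)^2) <= enn (1/4) * (enn c * cell_energy ?g sg k)" by(rule mult_left_mono) simp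
  moreover have "enn (1/4) * enn ((A k - B k)^2) = enn (((A k - B k) / 2)^2)" by(subst ennreal_mult[symmetric]) (auto simp: power_divide)
  moreover have "enn (1/4) * enn c = enn (c / 4)" by(subst ennreal_mult[symmetric]) (use c0 in auto)
  ultimately show ?thesis by(simp add: mult.assoc[symmetric])
 qed
 have "NL (%x. enn ((proj ?s u x - proj sg u x)^2)) = NL (%x. enn (((A (index sg x) - B (index sg x)) / 2)^2))" using proj_child[OF ul s, of i] by(simp add: A_def B_def)
 also have "... = enn (vol sg) * NC (%k. enn (((A k - B k) / 2)^2))" by(rule nn_integral_cell_function[OF s])
 also have "... <= enn (vol sg) * NC (%k. enn (c / 4) * cell_energy ?g sg k)" by(intro mult_left_mono nn_integral_mono H) auto
 also have "... = enn (vol sg) * enn (c / 4) * NC (%k. cell_energy ?g sg k)" by(simp add: nn_integral_cmult mult.assoc)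
 also have "NC (%k. cell_energy ?g sg k) = NL (%x. enn ((?g x)^2))" unfolding cell_energy_def by(rule nn_integral_cells[symmetric]) (use Gm in auto)
 also have "enn (vol sg) * enn (c / 4) = enn (1 / (4 * (sg $ i)^2))" by(subst ennreal_mult[symmetric]) (use V c0 in \<open>auto simp: c_def power2_eq_square\<close>)
 finally show ?thesis .
qed

definition dy :: "nat => real^3" where "dy j = (\<chi> i. 2 ^ j)"

lemma dy_pos: "dy j $ i > 0" by(simp add: dy_def)

lemma dy_Suc: "dy (Suc j) = refine (refine (refine (dy j) 1) 2) 3" by(auto simp: vec_eq_iff dy_def refine_def forall_3)

definition grad_energy :: "(real^3 => real^3) => enn" where
 "grad_energy G = NL (%x. enn ((norm (G x))^2))"

text \<open>Three halvings, each contributing 1 / (4 4^j) of the energy of one partial derivative;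
  squaring a sum of three terms costs a factor 3, and 3/4 <= 1.\<close>

lemma level_step:
 assumes wg: "wgrad u G" and Gm: "G : bmeas"
 shows "NL (%x. enn ((proj (dy (Suc j)) u x - proj (dy j) u x)^2)) <= enn (1 / 4 ^ j) * grad_energy G"
proof -
 have Gim: "(%x. G x $ i) : bmeas" for i using Gm by(rule measurable_compose[OF _ borel_measurable_continuous_onI]) (intro continuous_intros)
 define s0 where "s0 = dy j" define s1 where "s1 = refine s0 1" define s2 where "s2 = refine s1 2" define s3 where "s3 = refine s2 3"
 have p: "s0 $ i > 0" "s1 $ i > 0" "s2 $ i > 0" for i by(auto simp: s0_def s1_def s2_def intro!: refine_pos dy_pos)
 define I where "I i = NL (%x. enn ((G x $ i)^2))" for i
 let ?P = "%s x. proj s u x"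
 have e4: "(s0 $ 1)^2 = 4 ^ j" "(s1 $ 2)^2 = 4 ^ j" "(s2 $ 3)^2 = 4 ^ j"
 proof -
  have "((2::real) ^ j)^2 = 4 ^ j" by(simp add: power_mult[symmetric] mult.commute[of j] power_mult)
  thus "(s0 $ 1)^2 = 4 ^ j" "(s1 $ 2)^2 = 4 ^ j" "(s2 $ 3)^2 = 4 ^ j" by(simp_all add: s0_def s1_def s2_def refine_def dy_def)
 qed
 have h: "NL (%x. enn ((?P s1 x - ?P s0 x)^2)) <= enn (1 / (4 * 4 ^ j)) * I 1"
  "NL (%x. enn ((?P s2 x - ?P s1 x)^2)) <= enn (1 / (4 * 4 ^ j)) * I 2"
  "NL (%x. enn ((?P s3 x - ?P s2 x)^2)) <= enn (1 / (4 * 4 ^ j)) * I 3"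
  using halving_estimate[OF wg Gim p(1), of 1] halving_estimate[OF wg Gim p(2), of 2] halving_estimate[OF wg Gim p(3), of 3]
  unfolding I_def s3_def s2_def[symmetric] s1_def[symmetric] e4 .
 have m: "?P s : bmeas" for s by(rule proj_measurable)
 have "NL (%x. enn ((?P s3 x - ?P s0 x)^2))
  <= NL (%x. enn 3 * (enn ((?P s1 x - ?P s0 x)^2) + enn ((?P s2 x - ?P s1 x)^2) + enn ((?P s3 x - ?P s2 x)^2)))"
 proof (rule nn_integral_mono)
  fix x
  have e: "(d1 + d2 + d3)^2 <= 3 * (d1^2 + d2^2 + d3^2)" for d1 d2 d3 :: real
  proof -
   have "3 * (d1^2 + d2^2 + d3^2) - (d1 + d2 + d3)^2 = (d1 - d2)^2 + (d2 - d3)^2 + (d1 - d3)^2" by(simp add: power2_eq_square algebra_simps)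
   moreover have "... >= 0" by simp
   ultimately show ?thesis by linarith
  qed
  have "(?P s3 x - ?P s0 x)^2 <= 3 * ((?P s1 x - ?P s0 x)^2 + (?P s2 x - ?P s1 x)^2 + (?P s3 x - ?P s2 x)^2)"
   using e[of "?P s1 x - ?P s0 x" "?P s2 x - ?P s1 x" "?P s3 x - ?P s2 x"] by simp
  thus "enn ((?P s3 x - ?P s0 x)^2) <= enn 3 * (enn ((?P s1 x - ?P s0 x)^2) + enn ((?P s2 x - ?P s1 x)^2) + enn ((?P s3 x - ?P s2 x)^2))"
   by(simp add: ennreal_mult[symmetric] ennreal_plus[symmetric] ennreal_numeral[symmetric] ennreal_leI del: ennreal_plus ennreal_numeral)
 qed
 also have "... = enn 3 * (NL (%x. enn ((?P s1 x - ?P s0 x)^2)) + NL (%x. enn ((?P s2 x - ?P s1 x)^2)) + NL (%x. enn ((?P s3 x - ?P s2 x)^2)))"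
  using m by(simp add: nn_integral_cmult nn_integral_add)
 also have "... <= enn 3 * (enn (1 / (4 * 4 ^ j)) * I 1 + enn (1 / (4 * 4 ^ j)) * I 2 + enn (1 / (4 * 4 ^ j)) * I 3)" by(intro mult_left_mono add_mono h) auto
 also have "... = enn 3 * enn (1 / (4 * 4 ^ j)) * (I 1 + I 2 + I 3)" by(simp add: distrib_left mult.assoc)
 also have "I 1 + I 2 + I 3 = grad_energy G"
 proof -
  have "I 1 + I 2 + I 3 = NL (%x. enn ((G x $ 1)^2) + enn ((G x $ 2)^2) + enn ((G x $ 3)^2))" unfolding I_def using Gim by(simp add: nn_integral_add)
  also have "... = grad_energy G" unfolding grad_energy_def by(intro nn_integral_cong) (simp add: norm_vec_def L2_set_def sum_3 ennreal_plus[symmetric] del: ennreal_plus)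
  finally show ?thesis .
 qed
 also have "enn 3 * enn (1 / (4 * 4 ^ j)) * grad_energy G <= enn (1 / 4 ^ j) * grad_energy G"
  by(intro mult_right_mono) (auto simp: ennreal_mult[symmetric] ennreal_numeral[symmetric] field_simps intro!: ennreal_leI simp del: ennreal_numeral)
 finally show ?thesis by(simp add: s0_def s1_def s2_def s3_def dy_Suc)
qed

lemma nn_integral_square_add:
 fixes f g :: "'a => 'b::euclidean_space"
 assumes [measurable]: "f : borel_measurable M" "g : borel_measurable M"
 shows "nn_integral M (%x. enn ((norm (f x + g x))^2)) <= 2 * nn_integral M (%x. enn ((norm (f x))^2)) + 2 * nn_integral M (%x. enn ((norm (g x))^2))"
proof -
 have "(norm (f x + g x))^2 <= 2 * (norm (f x))^2 + 2 * (norm (g x))^2" for x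
 proof -
  have "(norm (f x + g x))^2 <= (norm (f x) + norm (g x))^2" by(intro power_mono norm_triangle_ineq) auto
  also have "... <= 2 * (norm (f x))^2 + 2 * (norm (g x))^2" using sum_squares_bound[of "norm (f x)" "norm (g x)"] by(simp add: power2_sum)
  finally show ?thesis .
 qed
 hence "nn_integral M (%x. enn ((norm (f x + g x))^2)) <= nn_integral M (%x. 2 * enn ((norm (f x))^2) + 2 * enn ((norm (g x))^2))"
  by(intro nn_integral_mono) (simp add: ennreal_leI ennreal_mult[symmetric] ennreal_plus[symmetric] ennreal_numeral[symmetric] del: ennreal_plus ennreal_numeral)
 also have "... = 2 * nn_integral M (%x. enn ((norm (f x))^2)) + 2 * nn_integral M (%x. enn ((norm (g x))^2))" by(simp add: nn_integral_add nn_integral_cmult)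
 finally show ?thesis .
qed

text \<open>The constant 4 reproduces itself under (r + s)^2 <= 2 r^2 + 2 s^2, since 2 / 4^j plus
  twice 4 / 4^(j+1) is again 4 / 4^j; so the bound is uniform in \<open>n\<close>.\<close>

lemma level_tail:
 assumes wg: "wgrad u G" and Gm: "G : bmeas"
 shows "NL (%x. enn ((proj (dy (j + n)) u x - proj (dy j) u x)^2)) <= enn (4 / 4 ^ j) * grad_energy G"
proof (induction n arbitrary: j)
 case (Suc n)
 let ?P = "%j x. proj (dy j) u x"
 have "NL (%x. enn ((?P (j + Suc n) x - ?P j x)^2))
   = NL (%x. enn ((norm ((?P (Suc j) x - ?P j x) + (?P (Suc j + n) x - ?P (Suc j) x)))^2))" by(intro nn_integral_cong) simp
 also have "... <= 2 * NL (%x. enn ((norm (?P (Suc j) x - ?P j x))^2))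
   + 2 * NL (%x. enn ((norm (?P (Suc j + n) x - ?P (Suc j) x))^2))" using proj_measurable by(intro nn_integral_square_add) auto
 also have "... <= 2 * (enn (1 / 4 ^ j) * grad_energy G) + 2 * (enn (4 / 4 ^ Suc j) * grad_energy G)"
  using level_step[OF wg Gm, of j] Suc.IH[of "Suc j"] by(intro add_mono mult_left_mono) auto
 also have "... = (2 * enn (1 / 4 ^ j) + 2 * enn (4 / 4 ^ Suc j)) * grad_energy G" by(simp add: distrib_right mult.assoc)
 also have "2 * enn (1 / 4 ^ j) + 2 * enn (4 / 4 ^ Suc j) = enn (4 / 4 ^ j)"
  by(simp add: ennreal_mult[symmetric] ennreal_plus[symmetric] ennreal_numeral[symmetric] del: ennreal_plus ennreal_numeral)
 finally show ?case .
qed simp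

lemma nn_integral_fatou_bound:
 fixes g :: "nat => 'a => real"
 assumes m: "!!n. g n : borel_measurable M" and lim: "AE x in M. (%n. g n x) ----> h x"
  and b: "!!n. n >= N ==> nn_integral M (%x. enn (g n x)) <= C"
 shows "nn_integral M (%x. enn (h x)) <= C"
proof -
 have "nn_integral M (%x. enn (h x)) <= nn_integral M (%x. liminf (%n. enn (g n x)))"
 proof (rule nn_integral_mono_AE, use lim in eventually_elim)
  case (elim x)
  from lim_imp_Liminf[OF _ tendsto_ennrealI[OF elim]] show ?case by simp
 qed
 also have "... <= liminf (%n. nn_integral M (%x. enn (g n x)))" by(rule nn_integral_liminf) (use m in simp)
 also have "... <= liminf (%n. C)" by(intro Liminf_mono eventually_sequentiallyI[of N] b)
 finally show ?thesis by(simp add: Liminf_const)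
qed

lemma convergent_of_summable_differences:
 fixes f :: "nat => 'a::banach"
 assumes "summable (%n. norm (f (Suc n) - f n))"
 shows "convergent f"
proof -
 from summable_LIMSEQ[OF summable_norm_cancel[OF assms]]
 have "convergent (%n. f n - f 0)" unfolding sum_lessThan_telescope convergent_def by blast
 from convergent_add[OF this convergent_const[of "f 0"]] show ?thesis by simp
qed

text \<open>Even with weights 2^n the squares have a finite total integral, so almost everywhere
  \<open>norm (f n x)\<close> is bounded by a constant times 2^(-n/2).\<close>

lemma AE_summable_of_geometric_squares:
 fixes f :: "nat => 'a => 'b::euclidean_space"
 assumes m [measurable]: "!!n. f n : borel_measurable M"
  and b: "!!n. nn_integral M (%x. enn ((norm (f n x))^2)) <= enn (1 / 4 ^ n) * C" and C: "C < \<infinity>"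
 shows "AE x in M. summable (%n. norm (f n x))"
proof -
 let ?t = "%n x. enn (2 ^ n * (norm (f n x))^2)"
 have "nn_integral M (%x. (suminf (%n. ?t n x))) = (suminf (%n. nn_integral M (%x. ?t n x)))" by(rule nn_integral_suminf) simp
 also have "... <= (suminf (%n. enn ((1 / 2) ^ n) * C))"
 proof (rule suminf_le)
  fix n
  have "nn_integral M (%x. ?t n x) = enn (2 ^ n) * nn_integral M (%x. enn ((norm (f n x))^2))" by(simp add: ennreal_mult nn_integral_cmult)
  also have "... <= enn (2 ^ n) * (enn (1 / 4 ^ n) * C)" by(intro mult_left_mono b) simp
  also have "... = enn ((1 / 2) ^ n) * C"
  proof -
   have "(4::real) ^ n = 2 ^ n * 2 ^ n" by(simp flip: power_mult_distrib)
   hence "(2::real) ^ n * (1 / 4 ^ n) = (1 / 2) ^ n" by(simp add: power_one_over field_simps)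
   hence "enn (2 ^ n) * enn (1 / 4 ^ n) = enn ((1 / 2) ^ n)" using ennreal_mult[of "2 ^ n" "1 / 4 ^ n"] by(simp only: zero_le_power zero_le_divide_1_iff zero_le_numeral)
   thus ?thesis by(simp only: mult.assoc[symmetric])
  qed
  finally show "nn_integral M (%x. ?t n x) <= enn ((1 / 2) ^ n) * C" .
 qed auto
 also have "... = (suminf (%n. enn ((1 / 2) ^ n))) * C" by simp
 also have "(suminf (%n. enn ((1 / 2) ^ n))) = enn 2" by(subst suminf_ennreal2) (auto simp: suminf_geometric)
 also have "enn 2 * C < \<infinity>" using C by(simp add: ennreal_mult_less_top)
 finally have fin: "nn_integral M (%x. (suminf (%n. ?t n x))) < \<infinity>" .
 have fn: "(%x. norm (f n x)) : borel_measurable M" for n by(rule measurable_compose[OF m borel_measurable_norm])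
 have "AE x in M. (suminf (%n. ?t n x)) ~= \<infinity>"
  by(rule nn_integral_PInf_AE[OF _ less_imp_neq[OF fin]]) (intro borel_measurable_suminf_order measurable_compose[OF _ measurable_ennreal] borel_measurable_times borel_measurable_power fn borel_measurable_const)
 thus ?thesis
 proof eventually_elim
  case (elim x)
  obtain B where B: "(suminf (%n. ?t n x)) = enn B" "B >= 0"
   by(rule ennreal_cases[of "suminf (%n. ?t n x)"]) (use elim in \<open>simp_all only: infinity_ennreal_def\<close>)
  have le: "norm (f n x) <= sqrt B * (1 / sqrt 2) ^ n" for n
  proof -
   have "?t n x <= enn B" unfolding B(1)[symmetric] using sum_le_suminf[of "%n. ?t n x" "{n}"]
    by(simp only: summableI finite.intros sum.insert sum.empty zero_le add_0_right insert_absorb empty_iff not_False_eq_True)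
   hence "2 ^ n * (norm (f n x))^2 <= B" using B(2) by simp
   hence "(norm (f n x))^2 <= B / 2 ^ n" by(simp add: field_simps)
   hence "norm (f n x) <= sqrt (B / 2 ^ n)" by(rule real_le_rsqrt)
   also have "... = sqrt B * (1 / sqrt 2) ^ n" by(simp add: real_sqrt_divide real_sqrt_power power_one_over divide_inverse power_inverse real_sqrt_mult real_sqrt_inverse)
   finally show ?thesis .
  qed
  have "summable (%n. sqrt B * (1 / sqrt 2) ^ n)" by(intro summable_mult summable_geometric) (simp add: real_less_lsqrt)
  thus ?case by(rule summable_comparison_test'[where N=0]) (use le in auto)
 qed
qed

lemma dyadic_cells_nested:
 assumes "i <= j" "x : cell (dy i) k" "x : cell (dy j) l"
 shows "cell (dy j) l \<subseteq> cell (dy i) k"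
proof -
 have f: "floor (2 ^ i * t) = floor (2 ^ j * t) div 2 ^ (j - i)" for t :: real
 proof -
  have "floor ((2 ^ j * t) / real_of_int (2 ^ (j - i))) = floor (2 ^ j * t) div 2 ^ (j - i)" by(rule floor_divide_real_eq_div) simp
  moreover have "(2 ^ j * t) / real_of_int (2 ^ (j - i)) = 2 ^ i * t"
  proof -
   have "(2::real) ^ j = 2 ^ i * 2 ^ (j - i)" using assms(1) by(simp flip: power_add)
   thus ?thesis by simp
  qed
  ultimately show ?thesis by simp
 qed
 show ?thesis
 proof
  fix y assume "y : cell (dy j) l"
  hence "floor (2 ^ j * y $ m) = floor (2 ^ j * x $ m)" for m using assms(3) by(simp add: cell_def dy_def)
  hence "floor (2 ^ i * y $ m) = floor (2 ^ i * x $ m)" for m using f by simp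
  thus "y : cell (dy i) k" using assms(2) by(simp add: cell_def dy_def)
 qed
qed

text \<open>Two dyadic cells are nested or disjoint; with the empty set added the family is closed
  under intersection.\<close>

definition dyadic :: "(real^3) set set" where
 "dyadic = insert {} {cell (dy j) k |j k. True}"

lemma countable_dyadic: "countable dyadic"
proof -
 have "dyadic = insert {} ((%(j, k). cell (dy j) k) ` UNIV)" by(auto simp: dyadic_def)
 moreover have "countable ((%(j, k). cell (dy j) k) ` UNIV)" by(intro countable_image countableI_type)
 ultimately show ?thesis using countable_insert by metis
qed

lemma Int_stable_dyadic: "Int_stable dyadic"
proof (rule Int_stableI)
 fix a b assume ab: "a : dyadic" "b : dyadic"
 show "a \<inter> b : dyadic"
 proof (cases "a \<inter> b = {}")
  case True
  thus ?thesis by(simp add: dyadic_def)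
 next
  case False
  then obtain x where x: "x : a" "x : b" by auto
  then obtain i k j l where e: "a = cell (dy i) k" "b = cell (dy j) l" using ab by(auto simp: dyadic_def)
  have "a \<subseteq> b | b \<subseteq> a" using dyadic_cells_nested[of i j x k l] dyadic_cells_nested[of j i x l k] x unfolding e by(cases "i <= j") auto
  hence "a \<inter> b = a | a \<inter> b = b" by blast
  thus ?thesis using ab by auto
 qed
qed

lemma open_dyadic_union:
 assumes "open U"
 shows "U = \<Union>{c : dyadic. c \<subseteq> U}"
proof (intro Set.set_eqI iffI)
 fix x assume "x : U"
 then obtain e where e: "e > 0" "ball x e \<subseteq> U" using assms openE by blast
 obtain j where j: "(1/2::real) ^ j < e / 3" using real_arch_pow_inv[of "e/3" "1/2"] e(1) by auto
 have "cell (dy j) (index (dy j) x) \<subseteq> U"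
 proof
  fix y assume "y : cell (dy j) (index (dy j) x)"
  hence "floor (2 ^ j * y $ m) = floor (2 ^ j * x $ m)" for m by(simp add: cell_def index_def dy_def)
  hence "abs (2 ^ j * y $ m - 2 ^ j * x $ m) < 1" for m
  proof -
   have "real_of_int (floor (2 ^ j * y $ m)) = real_of_int (floor (2 ^ j * x $ m))" using \<open>!!m. floor (2 ^ j * y $ m) = floor (2 ^ j * x $ m)\<close>[of m] by(rule arg_cong)
   thus ?thesis using floor_correct[of "2 ^ j * y $ m"] floor_correct[of "2 ^ j * x $ m"] by(simp only: abs_less_iff) linarith
  qed
  hence "2 ^ j * abs (y $ m - x $ m) < 1" for m by(simp add: abs_mult flip: right_diff_distrib)
  hence m: "abs ((y - x) $ m) < (1/2) ^ j" for m by(simp add: power_one_over field_simps)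
  have "norm (y - x) <= (\<Sum>m\<in>UNIV. abs ((y - x) $ m))" by(rule norm_le_l1_cart)
  also have "... < e" using m[of 1] m[of 2] m[of 3] j by(simp add: sum_3)
  finally show "y : U" using e(2) by(auto simp: dist_norm norm_minus_commute)
 qed
 moreover have "x : cell (dy j) (index (dy j) x)" by(simp add: in_cell_iff)
 ultimately show "x : \<Union>{c : dyadic. c \<subseteq> U}" unfolding dyadic_def by blast
qed auto

lemma borel_dyadic: "sets (borel :: (real^3) measure) = sigma_sets UNIV dyadic"
proof
 show "sets (borel :: (real^3) measure) \<subseteq> sigma_sets UNIV dyadic"
 proof -
  have "U : sigma_sets UNIV dyadic" if "open U" for U by(subst open_dyadic_union[OF that], rule sigma_sets_UNION)
    (auto intro: countable_subset[OF _ countable_dyadic])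
  hence "sigma_sets UNIV {U :: (real^3) set. open U} \<subseteq> sigma_sets UNIV dyadic" by(intro sigma_sets_mono) auto
  thus ?thesis by(simp add: borel_def)
 qed
 show "sigma_sets UNIV dyadic \<subseteq> sets borel"
 proof -
  have "sigma_sets (space borel) dyadic \<subseteq> sets (borel :: (real^3) measure)" by(rule sets.sigma_sets_subset) (auto simp: dyadic_def cell_lborel)
  thus ?thesis by simp
 qed
qed

text \<open>The positive and the negative part of \<open>w\<close> are densities of two measures
  that agree on the cells, hence on all Borel sets; so the two densities agree almost everywhere,
  which forces both to vanish.\<close>

lemma AE_zero_of_cell_integrals:
 fixes w :: fn
 assumes wm: "w : bmeas"
  and wi: "!!j k. integ (%x. ind (cell (dy j) k) x * w x)"
  and w0: "!!j k. LI (%x. ind (cell (dy j) k) x * w x) = 0"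
 shows "AE x in leb. w x = 0"
proof -
 obtain v where vm: "v : borel_measurable lborel" and vw: "AE x in lborel. w x = v x" using completion_ex_borel_measurable_real[OF wm] by blast
 have vwl: "AE x in leb. w x = v x" using vw by(rule AE_completion)
 let ?c = "%j k. cell (dy j) k"
 have vi: "integrable lborel (%x. ind (?c j k) x * v x)" and v0: "(LINT x|lborel. ind (?c j k) x * v x) = 0" for j k
 proof -
  have m: "(%x. ind (?c j k) x * v x) : borel_measurable lborel" using vm cell_lborel by simp
  have ae: "AE x in leb. ind (?c j k) x * w x = ind (?c j k) x * v x" using vwl by auto
  have "integ (%x. ind (?c j k) x * v x)" by(rule integrable_cong_AE_imp[OF wi[of j k] measurable_completion[OF m]]) (use ae in auto)
  thus "integrable lborel (%x. ind (?c j k) x * v x)" using integrable_completion[OF m] by simp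
  have "LI (%x. ind (?c j k) x * w x) = LI (%x. ind (?c j k) x * v x)" using ae by(intro integral_cong_AE borel_measurable_integrable[OF wi] measurable_completion[OF m])
  thus "(LINT x|lborel. ind (?c j k) x * v x) = 0" using w0[of j k] integral_completion[OF m] by simp
 qed
 define M where "M = density lborel (%x. enn (v x))"
 define N where "N = density lborel (%x. enn (- v x))"
 have em: "emeasure M (?c j k) = NB (%x. enn (ind (?c j k) x * v x))"
  and en: "emeasure N (?c j k) = NB (%x. enn (- (ind (?c j k) x * v x)))" for j k unfolding M_def N_def using vm cell_lborel
  by(simp_all add: emeasure_density, auto intro!: nn_integral_cong simp: indicator_def)
 have fin: "emeasure M (?c j k) ~= \<infinity>" "emeasure N (?c j k) ~= \<infinity>" for j k using vi[of j k] unfolding em en real_integrable_def by auto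
 have eq: "emeasure M (?c j k) = emeasure N (?c j k)" for j k
 proof -
  have "enn2real (emeasure M (?c j k)) = enn2real (emeasure N (?c j k))" using v0[of j k] unfolding em en real_lebesgue_integral_def[OF vi] by simp
  thus ?thesis using fin[of j k] by(metis ennreal_enn2real infinity_ennreal_def less_top)
 qed
 have "M = N"
 proof (rule measure_eqI_generator_eq_countable[where \<Omega>=UNIV and E=dyadic and A="range (?c 0)"])
  show "!!X. X : dyadic ==> emeasure M X = emeasure N X" using eq by(auto simp: dyadic_def)
  show "sets M = sigma_sets UNIV dyadic" "sets N = sigma_sets UNIV dyadic" by(simp_all add: M_def N_def borel_dyadic)
  show "range (?c 0) \<subseteq> dyadic" by(auto simp: dyadic_def)
  show "\<Union> (range (?c 0)) = UNIV" using in_cell_iff by blast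
  show "!!a. a : range (?c 0) ==> emeasure M a ~= \<infinity>" using fin by auto
  show "countable (range (?c 0))" by simp
 qed (auto simp: Int_stable_dyadic)
 hence "AE x in lborel. enn (v x) = enn (- v x)" unfolding M_def N_def using vm by(intro sigma_finite_measure.density_unique sigma_finite_lborel) auto
 hence "AE x in lborel. w x = 0" using vw
 proof eventually_elim
  case (elim x)
  thus ?case by(cases "v x >= 0") (auto simp: ennreal_neg ennreal_eq_0_iff)
 qed
 thus ?thesis by(rule AE_completion)
qed

lemma locally_integrable_of_power:
 fixes f :: "real^3 => 'b::euclidean_space"
 assumes fm: "f : bmeas" and fi: "integ (%x. norm (f x) ^ n)" and n: "n >= 1"
 shows "loc_int f" unfolding locally_integrable_def
proof (intro allI impI)
 fix K :: "(real^3) set" assume K: "compact K"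
 have Ks: "K : sets leb" "emeasure leb K < \<infinity>" using K emeasure_bounded_finite[OF compact_imp_bounded[OF K]] by(simp_all add: compact_imp_closed borel_closed)
 have "integ (%x. ind K x + norm (f x) ^ n)" using Ks fi by(intro Lintegrable_add) (auto simp: integrable_real_indicator)
 hence "integ (%x. ind K x *R f x)"
 proof (rule Lintegrable_bound)
  show "(%x. ind K x *R f x) : bmeas" by(intro borel_measurable_scaleR borel_measurable_indicator Ks(1) fm)
  show "AE x in leb. norm (ind K x *R f x) <= norm (ind K x + norm (f x) ^ n)"
  proof (rule AE_I2)
   fix x
   have "norm (f x) <= 1 + norm (f x) ^ n"
   proof (cases "norm (f x) <= 1")
    case True
    thus ?thesis by(smt (verit) zero_le_power norm_ge_zero)
   next
    case False
    hence "norm (f x) ^ 1 <= norm (f x) ^ n" by(intro power_increasing n) auto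
    thus ?thesis by simp
   qed
   thus "norm (ind K x *R f x) <= norm (ind K x + norm (f x) ^ n)" by(cases "x : K") (simp_all add: indicator_def)
  qed
 qed
 thus "f absolutely_integrable_on K" by(simp add: set_integrable_def)
qed

lemma integrable_square_iff:
 fixes f :: "real^3 => 'b::euclidean_space"
 assumes "f : bmeas"
 shows "integ (%x. (norm (f x))^2) <-> (NL (%x. enn ((norm (f x))^2))) < \<infinity>" using assms by(auto simp: integrable_iff_bounded)

text \<open>The tower property of conditional expectations, for \<open>ta\<close> finer than
  \<open>sg\<close>. Integrability is part of the notion so that the integrals over children can be
  added up when coarsening.\<close>

definition cell_average_preserved :: "fn => real^3 => real^3 => bool" where
 "cell_average_preserved u ta sg <-> (ALL k. integ (%x. ind (cell sg k) x * proj ta u x) &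
   (LI (%x. ind (cell sg k) x * proj ta u x)) = LI (%x. ind (cell sg k) x * u x))"

lemma cell_average_preserved_refl:
 assumes "!!i. sg $ i > 0"
 shows "cell_average_preserved u sg sg"
proof -
 have e: "ind (cell sg k) x * proj sg u x = avg sg u k * ind (cell sg k) x" for k x by(auto simp: indicator_def in_cell_iff proj_def)
 have v: "vol sg > 0" using vol_pos assms by blast
 have "measure leb (cell sg k) = vol sg" for k using emeasure_cell[OF assms, of k] v by(simp add: measure_def)
 thus ?thesis using v emeasure_cell[OF assms] by(auto simp: cell_average_preserved_def e avg_def integrable_real_indicator)
qed

lemma cell_average_preserved_coarsen:
 assumes "cell_average_preserved u ta (refine sg i)" "loc_int u" "!!i. sg $ i > 0"
 shows "cell_average_preserved u ta sg"
proof -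
 have s: "refine sg i $ j > 0" for j by(rule refine_pos[OF assms(3)])
 show ?thesis unfolding cell_average_preserved_def indicator_cell_split[of sg _ _ i] distrib_right
  using assms(1) cell_integrable[OF assms(2) s] unfolding cell_average_preserved_def by auto
qed

lemma dyadic_average_preserved:
 assumes u: "loc_int u"
 shows "cell_average_preserved u (dy (j + n)) (dy j)"
proof (induction n arbitrary: j)
 case 0
 show ?case using cell_average_preserved_refl[OF dy_pos] by simp
next
 case (Suc n)
 have "cell_average_preserved u (dy (j + Suc n)) (dy (Suc j))" using Suc[of "Suc j"] by simp
 hence 3: "cell_average_preserved u (dy (j + Suc n)) (refine (refine (refine (dy j) 1) 2) 3)" by(simp only: dy_Suc[of j])
 have p: "dy j $ i > 0" "refine (dy j) 1 $ i > 0" "refine (refine (dy j) 1) 2 $ i > 0" for i by(intro refine_pos dy_pos)+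
 show ?case by(rule cell_average_preserved_coarsen[OF cell_average_preserved_coarsen[OF cell_average_preserved_coarsen[OF 3 u p(3)] u p(2)] u p(1)])
qed

text \<open>Martingale convergence by hand: the increments between levels are geometrically small in
  L^2, so the averages converge almost everywhere to some \<open>v\<close>; by the tower property
  \<open>v\<close> and \<open>u\<close> have the same integral over each cell, hence agree.\<close>

lemma proj_tendsto_AE:
 assumes wg: "wgrad u G" and um: "u : bmeas"
  and Gm: "G : bmeas" and fin: "grad_energy G < \<infinity>"
 shows "AE x in leb. (%n. proj (dy n) u x) ----> u x"
  and "NL (%x. enn ((u x - proj (dy j) u x)^2)) <= enn (4 / 4 ^ j) * grad_energy G"
proof -
 let ?P = "%n x. proj (dy n) u x"
 have Pm [measurable]: "?P n : bmeas" for n by(rule proj_measurable)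
 have ul: "loc_int u" using wg by(auto simp: has_weak_gradient_def)
 define v where "v x = lim (%n. ?P n x)" for x
 have vm [measurable]: "v : bmeas" unfolding v_def by(rule borel_measurable_lim_metric) (rule Pm)
 have "AE x in leb. summable (%n. norm (?P (Suc n) x - ?P n x))" by(rule AE_summable_of_geometric_squares[where C="grad_energy G"]) (use level_step[OF wg Gm] fin in auto)
 hence Pv: "AE x in leb. (%n. ?P n x) ----> v x" by eventually_elim (simp add: v_def convergent_of_summable_differences flip: convergent_LIMSEQ_iff)
 have tail: "NL (%x. enn ((v x - ?P j x)^2)) <= enn (4 / 4 ^ j) * grad_energy G" for j
 proof (rule nn_integral_fatou_bound[where N=0])
  show "(%x. (?P (n + j) x - ?P j x)^2) : bmeas" for n by measurable
  show "AE x in leb. (%n. (?P (n + j) x - ?P j x)^2) ----> (v x - ?P j x)^2" using Pv by eventually_elim (intro tendsto_intros LIMSEQ_ignore_initial_segment)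
  show "NL (%x. enn ((?P (n + j) x - ?P j x)^2)) <= enn (4 / 4 ^ j) * grad_energy G" for n using level_tail[OF wg Gm, of j n] by(simp add: add.commute)
 qed
 have "AE x in leb. v x - u x = 0"
 proof (rule AE_zero_of_cell_integrals)
  show "(%x. v x - u x) : bmeas" using um by simp
  fix j k
  let ?i = "%x. ind (cell (dy j) k) x :: real"
  have ui: "integ (%x. ?i x * u x)" by(rule cell_integrable[OF ul dy_pos])
  have pi: "integ (%x. ?i x * ?P (j + n) x)"
   and pe: "LI (%x. ?i x * ?P (j + n) x) = LI (%x. ?i x * u x)" for n using dyadic_average_preserved[OF ul, of j n] by(auto simp: cell_average_preserved_def)
  have dm: "(%x. v x - ?P n x) : bmeas" for n by simp
  have dl: "loc_int (%x. v x - ?P n x)" for n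
  proof -
   have "NL (%x. enn ((norm (v x - ?P n x))^2)) < \<infinity>" using order_le_less_trans[OF tail[of n]] fin by(simp add: ennreal_mult_less_top)
   thus ?thesis using locally_integrable_of_power[OF dm[of n], of 2] integrable_square_iff[OF dm[of n]] by(simp only: one_le_numeral)
  qed
  have di: "integ (%x. ?i x * (v x - ?P n x))" for n by(rule cell_integrable[OF dl dy_pos])
  have vi: "integ (%x. ?i x * v x)" using Lintegrable_add[OF di[of j] pi[of 0]] by(simp add: algebra_simps)
  thus "integ (%x. ?i x * (v x - u x))" using Lintegrable_diff[OF vi ui] by(simp add: algebra_simps)
  define r where "r = LI (%x. ?i x * (v x - u x))"
  \<comment> \<open>\<open>r\<close> can be written with the averages of any finer level, whose
    distance to \<open>v\<close> tends to 0; hence \<open>r = 0\<close>.\<close>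
  have re: "r = LI (%x. ?i x * (v x - ?P (j + n) x))" for n unfolding r_def right_diff_distrib Lintegral_diff[OF vi ui] Lintegral_diff[OF vi pi] pe ..
  have rb: "enn (r^2) <= enn (vol (dy j)) * (enn (4 / 4 ^ (j + n)) * grad_energy G)" for n
  proof -
   let ?R = "LI (%x. ?i x * abs (v x - ?P (j + n) x))"
   have "abs r <= ?R"
   proof -
    have "abs (?i x * (v x - ?P (j + n) x)) = ?i x * abs (v x - ?P (j + n) x)" for x by(simp add: abs_mult)
    thus ?thesis using integral_abs_bound[of leb "%x. ?i x * (v x - ?P (j + n) x)"] unfolding re[of n] by(simp only:)
   qed
   hence "abs r^2 <= ?R^2" by(rule power_mono) simp
   hence "r^2 <= ?R^2" by(simp only: power2_abs)
   hence "enn (r^2) <= enn (?R^2)" by(rule ennreal_leI)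
   also have "... <= enn (vol (dy j)) * cell_energy (%x. v x - ?P (j + n) x) (dy j) k" by(rule cell_abs_integral_le[OF dl dm dy_pos])
   also have "cell_energy (%x. v x - ?P (j + n) x) (dy j) k <= NL (%x. enn ((v x - ?P (j + n) x)^2))"
    unfolding cell_energy_def by(intro nn_integral_mono) (auto simp: indicator_def)
   also have "... <= enn (4 / 4 ^ (j + n)) * grad_energy G" by(rule tail)
   finally show ?thesis by(simp add: mult_left_mono)
  qed
  obtain C where C: "grad_energy G = enn C" "C >= 0" by(rule ennreal_cases[of "grad_energy G"]) (use fin in auto)
  have v0: "vol (dy j) > 0" by(intro vol_pos dy_pos)
  have "r^2 <= (vol (dy j) * 4 * C / 4 ^ j) * (1/4) ^ n" for n
  proof -
   have "enn (r^2) <= enn (vol (dy j) * (4 / 4 ^ (j + n) * C))"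
    using rb[of n] C(2) v0 unfolding C(1) by(simp only: ennreal_mult[symmetric] less_imp_le zero_le_divide_iff zero_le_mult_iff zero_le_power zero_le_numeral simp_thms)
   hence "r^2 <= vol (dy j) * (4 / 4 ^ (j + n) * C)" using C v0 by(subst (asm) ennreal_le_iff) auto
   thus ?thesis by(simp add: power_add power_one_over field_simps)
  qed
  moreover have "(%n. (vol (dy j) * 4 * C / 4 ^ j) * (1/4::real) ^ n) ----> (vol (dy j) * 4 * C / 4 ^ j) * 0" by(intro tendsto_mult tendsto_const LIMSEQ_power_zero) simp
  ultimately have "r^2 <= (vol (dy j) * 4 * C / 4 ^ j) * 0" by(intro LIMSEQ_le_const) (use \<open>!!n. r^2 <= (vol (dy j) * 4 * C / 4 ^ j) * (1/4) ^ n\<close> in blast)+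
  thus "LI (%x. ?i x * (v x - u x)) = 0" by(simp add: r_def[symmetric])
 qed
 hence vu: "AE x in leb. v x = u x" by auto
 show "AE x in leb. (%n. ?P n x) ----> u x" using Pv vu by eventually_elim simp
 have "NL (%x. enn ((u x - proj (dy j) u x)^2)) = NL (%x. enn ((v x - proj (dy j) u x)^2))" by(rule nn_integral_cong_AE) (use vu in auto)
 thus "NL (%x. enn ((u x - proj (dy j) u x)^2)) <= enn (4 / 4 ^ j) * grad_energy G" using tail[of j] by simp
qed

section \<open>The Sobolev inequality\<close>

lemma sum_le_nn_integral_count_space:
 fixes f :: "'a => enn"
 assumes "finite A"
 shows "(\<Sum>a\<in>A. f a) <= NC (%a. f a)"
proof -
 have "(\<Sum>a\<in>A. f a) = nn_integral (count_space A) (%a. f a)" using assms by(simp add: nn_integral_count_space_finite)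
 also have "... = NC (%a. f a * ind A a)" by(rule nn_integral_count_space_indicator) simp
 also have "... <= NC (%a. f a)" by(intro nn_integral_mono) (auto simp: indicator_def)
 finally show ?thesis .
qed

lemma SUP_square_ennreal:
 fixes h :: "'a => enn"
 assumes "!!t. (h t)^2 <= a"
 shows "(SUP t. h t)^2 <= a"
proof -
 have hh: "h s * h t <= a" for s t
 proof (cases "h s <= h t")
  case True
  hence "h s * h t <= h t * h t" by(rule mult_right_mono) simp
  thus ?thesis using assms[of t] by(simp add: power2_eq_square)
 next
  case False
  hence "h s * h t <= h s * h s" by(intro mult_left_mono) auto
  thus ?thesis using assms[of s] by(simp add: power2_eq_square)
 qed
 have "(SUP s. h s) * (SUP t. h t) = (SUP t. (SUP s. h s) * h t)" by(rule SUP_mult_left_ennreal)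
 also have "... = (SUP t. SUP s. h t * h s)" by(simp add: SUP_mult_left_ennreal mult.commute[of "SUP s. h s"])
 also have "... <= a" by(intro SUP_least hh)
 finally show ?thesis by(simp add: power2_eq_square)
qed

text \<open>Summability of the sixth powers makes \<open>ph\<close> vanish at infinity, so the
  fourth power at \<open>t\<close> is a telescoping sum along the half-line to the right of
  \<open>t\<close>.\<close>

lemma telescoping_bound:
 fixes ph :: "int => real"
 assumes fin: "NC (%t. enn (abs (ph t) ^ 6)) < \<infinity>"
 shows "enn (abs (ph t) ^ 4) <= NC (%s. enn (abs (abs (ph s) ^ 4 - abs (ph (s + 1)) ^ 4)))" (is "_ <= ?S")
proof -
 define f where "f n = abs (ph (t + int n))" for n
 have "(suminf (%n. enn (f n ^ 6))) <= NC (%t. enn (abs (ph t) ^ 6))"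
 proof (rule suminf_le_const)
  fix n
  have "(\<Sum>i<n. enn (f i ^ 6)) = (\<Sum>s\<in>(%i. t + int i) ` {..<n}. enn (abs (ph s) ^ 6))" by(subst sum.reindex) (auto simp: inj_on_def f_def)
  also have "... <= NC (%t. enn (abs (ph t) ^ 6))" by(rule sum_le_nn_integral_count_space) simp
  finally show "(\<Sum>i<n. enn (f i ^ 6)) <= NC (%t. enn (abs (ph t) ^ 6))" .
 qed simp
 hence "(suminf (%n. enn (f n ^ 6))) ~= Orderings.top" using fin by auto
 hence "summable (%n. f n ^ 6)" by(intro summable_suminf_not_top) (auto simp: f_def)
 hence "(%n. f n ^ 6) ----> 0" by(rule summable_LIMSEQ_zero)
 hence "(%n. root 6 (f n ^ 6)) ----> root 6 0" by(rule tendsto_real_root)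
 moreover have "root 6 (f n ^ 6) = f n" for n by(rule real_root_power_cancel) (auto simp: f_def)
 ultimately have f0: "f ----> 0" by simp
 have step: "enn (f 0 ^ 4) <= ?S + enn (f n ^ 4)" for n
 proof -
  have "f 0 ^ 4 <= (\<Sum>i<n. abs (f i ^ 4 - f (Suc i) ^ 4)) + f n ^ 4"
  proof (induction n)
   case (Suc n)
   thus ?case by simp
  qed simp
  hence "enn (f 0 ^ 4) <= enn ((\<Sum>i<n. abs (f i ^ 4 - f (Suc i) ^ 4)) + f n ^ 4)" by(rule ennreal_leI)
  also have "... = (\<Sum>i<n. enn (abs (f i ^ 4 - f (Suc i) ^ 4))) + enn (f n ^ 4)" by(simp add: ennreal_plus sum_nonneg f_def)
  also have "(\<Sum>i<n. enn (abs (f i ^ 4 - f (Suc i) ^ 4)))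
    = (\<Sum>s\<in>(%i. t + int i) ` {..<n}. enn (abs (abs (ph s) ^ 4 - abs (ph (s + 1)) ^ 4)))" by(subst sum.reindex) (auto simp: inj_on_def f_def algebra_simps)
  also have "... <= ?S" by(rule sum_le_nn_integral_count_space) simp
  finally show ?thesis by(simp add: add_right_mono)
 qed
 have "(%n. ?S + enn (f n ^ 4)) ----> ?S + enn (0 ^ 4)" by(intro tendsto_add tendsto_const tendsto_ennrealI tendsto_power f0)
 hence "enn (f 0 ^ 4) <= ?S + enn (0 ^ 4)" by(rule LIMSEQ_le_const) (use step in auto)
 thus ?thesis by(simp add: f_def)
qed

lemma fourth_power_diff:
 fixes a b :: real
 assumes "a >= 0" "b >= 0"
 shows "abs (a ^ 4 - b ^ 4) <= 2 * abs (a - b) * (a ^ 3 + b ^ 3)"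
proof -
 have e: "a ^ 4 - b ^ 4 = (a - b) * (a ^ 3 + a^2 * b + a * b^2 + b ^ 3)" by(simp add: algebra_simps power2_eq_square power3_eq_cube power4_eq_xxxx)
 have "0 <= (a - b) * (a - b) * (a + b)" using assms by simp
 hence "a^2 * b + a * b^2 <= a ^ 3 + b ^ 3" by(simp add: algebra_simps power2_eq_square power3_eq_cube)
 hence "abs (a - b) * (a ^ 3 + a^2 * b + a * b^2 + b ^ 3) <= abs (a - b) * (2 * (a ^ 3 + b ^ 3))" by(intro mult_left_mono) auto
 moreover have "abs (a ^ 3 + a^2 * b + a * b^2 + b ^ 3) = a ^ 3 + a^2 * b + a * b^2 + b ^ 3" using assms by(intro abs_of_nonneg add_nonneg_nonneg) auto
 moreover have "2 * abs (a - b) * (a ^ 3 + b ^ 3) = abs (a - b) * (2 * (a ^ 3 + b ^ 3))" by simp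
 ultimately show ?thesis unfolding e abs_mult by(simp only:)
qed

text \<open>The supremum of |ph|^4 on a line is controlled by the sum of the increments times
  |ph|^3, and Cauchy--Schwarz splits this into energy and sixth powers. Both ends of an edge occur,
  whence \<open>W\<close> and \<open>W'\<close>; 16 is 4 from squaring the factor 2, times 4 from
  squaring their sum.\<close>

lemma line_sup_estimate:
 fixes ph :: "int => 'p::countable => real"
 defines "N == NC (%q. NC (%x. enn (abs (ph x q) ^ 6)))"
  and "D == NC (%q. NC (%x. enn ((ph x q - ph (x + 1) q)^2)))"
 assumes fin: "N < \<infinity>"
 shows "NC (%q. (SUP x. enn (abs (ph x q)^2))^2)^2 <= 16 * D * N"
proof -
 let ?a = "%x q. abs (ph x q)" and ?d = "%x q. abs (ph x q - ph (x + 1) q)"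
 define W where "W = NC (%q. NC (%x. enn (?d x q) * enn (?a x q ^ 3)))"
 define W' where "W' = NC (%q. NC (%x. enn (?d x q) * enn (?a (x + 1) q ^ 3)))"
 have pair: "NC (%q. NC (%x. f x q)) = NC (%z. f (snd z) (fst z))" for f :: "int => 'p => enn" using nn_integral_fst_count_space[of "%z. f (snd z) (fst z)"] by simp
 have CS: "NC (%q. NC (%x. enn (?d x q) * f x q))^2
   <= D * NC (%q. NC (%x. (f x q)^2))" for f :: "int => 'p => enn"
 proof -
  have "NC (%z. enn (?d (snd z) (fst z)) * f (snd z) (fst z))^2
   <= NC (%z. (enn (?d (snd z) (fst z)))^2) * NC (%z. (f (snd z) (fst z))^2)" by(rule Cauchy_Schwarz_nn_integral) auto
  thus ?thesis unfolding D_def pair by(simp add: ennreal_power)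
 qed
 have sh: "NC (%x. f (x + 1)) = NC (%x. f x)" for f :: "int => enn" by(rule nn_integral_bij_count_space) (rule bij_betwI[where g="%x. x - 1"], auto)
 have p6: "(enn (abs t ^ 3))^2 = enn (abs t ^ 6)" for t :: real by(simp add: ennreal_power power_mult[symmetric])
 have W2: "W^2 <= D * N" unfolding W_def N_def using CS[of "%x q. enn (?a x q ^ 3)"] by(simp only: p6)
 have W2': "W'^2 <= D * N" unfolding W'_def N_def using CS[of "%x q. enn (?a (x + 1) q ^ 3)"] sh[of "%x. enn (?a x q ^ 6)" for q] by(simp only: p6)
 have linefin: "NC (%x. enn (?a x q ^ 6)) < \<infinity>" for q
 proof -
  have "NC (%x. enn (?a x q ^ 6)) <= N" unfolding N_def using sum_le_nn_integral_count_space[of "{q}" "%q. NC (%x. enn (?a x q ^ 6))"] by simp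
  thus ?thesis using fin by(rule order_le_less_trans)
 qed
 let ?w = "%x q. enn (?d x q) * enn (?a x q ^ 3) + enn (?d x q) * enn (?a (x + 1) q ^ 3)"
 have "NC (%q. (SUP x. enn (abs (ph x q)^2))^2)
  <= NC (%q. NC (%x. 2 * ?w x q))"
 proof (intro nn_integral_mono SUP_square_ennreal)
  fix q t
  have "(enn (abs (ph t q)^2))^2 = enn (?a t q ^ 4)" by(simp add: ennreal_power power_mult[symmetric])
  also have "... <= NC (%s. enn (abs (?a s q ^ 4 - ?a (s + 1) q ^ 4)))" by(rule telescoping_bound[OF linefin])
  also have "... <= NC (%x. 2 * ?w x q)"
  proof (rule nn_integral_mono)
   fix s
   have "abs (?a s q ^ 4 - ?a (s + 1) q ^ 4) <= 2 * abs (?a s q - ?a (s + 1) q) * (?a s q ^ 3 + ?a (s + 1) q ^ 3)" by(rule fourth_power_diff) auto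
   also have "... <= 2 * ?d s q * (?a s q ^ 3 + ?a (s + 1) q ^ 3)" by(intro mult_right_mono mult_left_mono) auto
   also have "... = 2 * (?d s q * ?a s q ^ 3 + ?d s q * ?a (s + 1) q ^ 3)" by(simp add: algebra_simps)
   finally have "enn (abs (?a s q ^ 4 - ?a (s + 1) q ^ 4)) <= enn (2 * (?d s q * ?a s q ^ 3 + ?d s q * ?a (s + 1) q ^ 3))" by(rule ennreal_leI)
   also have "... = 2 * ?w s q" by(subst ennreal_mult, simp, simp, subst ennreal_plus, simp, simp) (simp add: ennreal_mult)
   finally show "enn (abs (?a s q ^ 4 - ?a (s + 1) q ^ 4)) <= 2 * ?w s q" .
  qed
  finally show "(enn (abs (ph t q)^2))^2 <= NC (%x. 2 * ?w x q)" .
 qed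
 also have "... = 2 * (W + W')" unfolding W_def W'_def by(simp add: nn_integral_cmult nn_integral_add)
 finally have "NC (%q. (SUP x. enn (abs (ph x q)^2))^2)^2 <= (2 * (W + W'))^2" by(rule power_mono) simp
 also have "... <= 16 * (D * N)"
 proof -
  have sq: "(W + W')^2 <= 4 * (D * N)"
  proof (cases rule: le_cases[of W W'])
   case le
   hence "(W + W')^2 <= (2 * W')^2" by(intro power_mono) (simp_all add: mult_2)
   thus ?thesis using W2' by(simp add: power_mult_distrib) (meson mult_left_mono order_trans zero_le)
  next
   case ge
   hence "(W + W')^2 <= (2 * W)^2" by(intro power_mono) (simp_all add: mult_2)
   thus ?thesis using W2 by(simp add: power_mult_distrib) (meson mult_left_mono order_trans zero_le)
  qed
  have "(2 * (W + W'))^2 = 4 * (W + W')^2" using power_mult_distrib[of "2 :: enn" "W + W'" 2] by simp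
  also have "... <= 4 * (4 * (D * N))" by(intro mult_left_mono sq) simp
  finally show ?thesis by(simp add: mult.assoc[symmetric])
 qed
 finally show ?thesis by(simp add: mult.assoc)
qed

text \<open>Each of the three functions ignores one coordinate. Cauchy--Schwarz is applied once over
  the pairs \<open>q\<close>, to separate \<open>ga\<close>, and once over \<open>z\<close>, after
  which \<open>al\<close> and \<open>be\<close> depend on different variables.\<close>

lemma loomis_whitney:
 fixes al be ga :: "'a::countable \<times> 'a => enn"
 shows "NC (%q. NC (%z. al (snd q, z) * be (fst q, z) * ga q))^2
  <= NC (%q. (al q)^2) * NC (%q. (be q)^2) * NC (%q. (ga q)^2)"
proof -
 define A where "A y = NC (%z. (al (y, z))^2)" for y
 define B where "B x = NC (%z. (be (x, z))^2)" for x
 have "NC (%q. NC (%z. al (snd q, z) * be (fst q, z) * ga q))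
   = NC (%q. NC (%z. al (snd q, z) * be (fst q, z)) * ga q)" by(simp add: nn_integral_multc)
 hence "NC (%q. NC (%z. al (snd q, z) * be (fst q, z) * ga q))^2
   <= NC (%q. NC (%z. al (snd q, z) * be (fst q, z))^2) * NC (%q. (ga q)^2)" by(simp only:) (rule Cauchy_Schwarz_nn_integral, auto)
 also have "... <= NC (%q. A (snd q) * B (fst q)) * NC (%q. (ga q)^2)" unfolding A_def B_def by(intro mult_right_mono nn_integral_mono Cauchy_Schwarz_nn_integral) auto
 also have "NC (%q. A (snd q) * B (fst q)) = NC (%x. NC (%y. A y * B x))" by(simp flip: nn_integral_fst_count_space)
 also have "... = NC (%y. A y) * NC (%x. B x)" by(simp add: nn_integral_multc nn_integral_cmult)
 also have "NC (%y. A y) = NC (%q. (al q)^2)" unfolding A_def using nn_integral_fst_count_space[of "%q. (al q)^2"] .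
 also have "NC (%y. B y) = NC (%q. (be q)^2)" unfolding B_def using nn_integral_fst_count_space[of "%q. (be q)^2"] .
 finally show ?thesis .
qed

definition vec3 :: "'a => 'a => 'a => 'a^3" where
 "vec3 x y z = (\<chi> i. if i = 1 then x else if i = 2 then y else z)"

lemma vec3_nth [simp]: "vec3 x y z $ 1 = x" "vec3 x y z $ 2 = y" "vec3 x y z $ 3 = z" by(simp_all add: vec3_def)

lemma vec3_collapse: "vec3 (v $ 1) (v $ 2) (v $ 3) = v" by(simp add: vec_eq_iff forall_3)

lemma vec3_axis: "vec3 x y z + axis 1 1 = vec3 (x + 1) y (z::int)" "vec3 x y z + axis 2 1 = vec3 x (y + 1) z"
 "vec3 x y z + axis 3 1 = vec3 x y (z + 1)" by(simp_all add: vec_eq_iff forall_3 axis_def)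

lemma nn_integral_vec3:
 fixes h :: "int^3 => enn"
 shows "NC (%k. h k) = NC (%q. NC (%x. h (vec3 x (fst q) (snd q))))"
  "NC (%k. h k) = NC (%q. NC (%y. h (vec3 (fst q) y (snd q))))"
  "NC (%k. h k) = NC (%q. NC (%z. h (vec3 (fst q) (snd q) z)))"
proof -
 have *: "NC (%k. h k) = NC (%q. NC (%x. h (T (q, x))))"
  if "bij T" for T :: "(int \<times> int) \<times> int => int^3" using nn_integral_fst_count_space[of "%z. h (T z)"] nn_integral_bij_count_space[OF that, of h] by simp
 have b: "bij (%(q, x). vec3 x (fst q) (snd q :: int))" "bij (%(q, y). vec3 (fst q) y (snd q :: int))" "bij (%(q, z). vec3 (fst q) (snd q) (z :: int))"
 proof -
  show "bij (%(q, x). vec3 x (fst q) (snd q :: int))" by(rule bij_betwI[where g="%v. ((v $ 2, v $ 3), v $ 1)"]) (auto simp: vec3_collapse)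
  show "bij (%(q, y). vec3 (fst q) y (snd q :: int))" by(rule bij_betwI[where g="%v. ((v $ 1, v $ 3), v $ 2)"]) (auto simp: vec3_collapse)
  show "bij (%(q, z). vec3 (fst q) (snd q) (z :: int))" by(rule bij_betwI[where g="%v. ((v $ 1, v $ 2), v $ 3)"]) (auto simp: vec3_collapse)
 qed
 show "NC (%k. h k) = NC (%q. NC (%x. h (vec3 x (fst q) (snd q))))"
  "NC (%k. h k) = NC (%q. NC (%y. h (vec3 (fst q) y (snd q))))"
  "NC (%k. h k) = NC (%q. NC (%z. h (vec3 (fst q) (snd q) z)))" using *[OF b(1)] *[OF b(2)] *[OF b(3)] by simp_all
qed

definition lattice_energy :: "(int^3 => real) => 3 => enn" where
 "lattice_energy f i = NC (%k. enn ((f k - f (k + axis i 1))^2))"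

text \<open>\<open>abs (f k) ^ 6\<close> is at most the product of the suprema of f^2 along the
  three axes through \<open>k\<close>, so Loomis--Whitney and \<open>line_sup_estimate\<close> give
  N^4 <= 16^3 D1 D2 D3 N^3. Finiteness of \<open>N\<close> permits division by N^3.\<close>

theorem discrete_sobolev:
 fixes f :: "int^3 => real"
 defines "N == NC (%k. enn (abs (f k) ^ 6))"
 assumes fin: "N < \<infinity>"
 shows "N <= 4096 * (lattice_energy f 1 * lattice_energy f 2 * lattice_energy f 3)"
proof -
 define al where "al q = (SUP x. enn (abs (f (vec3 x (fst q) (snd q)))^2))" for q
 define be where "be q = (SUP y. enn (abs (f (vec3 (fst q) y (snd q)))^2))" for q
 define ga where "ga q = (SUP z. enn (abs (f (vec3 (fst q) (snd q) z))^2))" for q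
 define X where "X = NC (%q. (al q)^2)"
 define Y where "Y = NC (%q. (be q)^2)"
 define Z where "Z = NC (%q. (ga q)^2)"
 let ?D = "lattice_energy f"
 have X: "X^2 <= 16 * ?D 1 * N" using line_sup_estimate[of "%x q. f (vec3 x (fst q) (snd q))"] fin
  unfolding X_def al_def N_def lattice_energy_def nn_integral_vec3(1) vec3_axis by simp
 have Y: "Y^2 <= 16 * ?D 2 * N" using line_sup_estimate[of "%y q. f (vec3 (fst q) y (snd q))"] fin
  unfolding Y_def be_def N_def lattice_energy_def nn_integral_vec3(2) vec3_axis by simp
 have Z: "Z^2 <= 16 * ?D 3 * N" using line_sup_estimate[of "%z q. f (vec3 (fst q) (snd q) z)"] fin
  unfolding Z_def ga_def N_def lattice_energy_def nn_integral_vec3(3) vec3_axis by simp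
 have "N <= NC (%q. NC (%z. al (snd q, z) * be (fst q, z) * ga q))" unfolding N_def nn_integral_vec3(3)
 proof (intro nn_integral_mono)
  fix q z
  let ?t = "enn (abs (f (vec3 (fst q) (snd q) z))^2)"
  have "enn (abs (f (vec3 (fst q) (snd q) z)) ^ 6) = ?t * ?t * ?t" by(simp add: ennreal_mult[symmetric] power_add[symmetric] del: power2_abs)
  also have "... <= al (snd q, z) * be (fst q, z) * ga q"
  proof (intro mult_mono)
   show "?t <= al (snd q, z)" unfolding al_def by(rule SUP_upper2[of "fst q"]) auto
   show "?t <= be (fst q, z)" unfolding be_def by(rule SUP_upper2[of "snd q"]) auto
   show "?t <= ga q" unfolding ga_def by(rule SUP_upper2[of z]) auto
  qed auto
  finally show "enn (abs (f (vec3 (fst q) (snd q) z)) ^ 6) <= al (snd q, z) * be (fst q, z) * ga q" .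
 qed
 hence "N^2 <= NC (%q. NC (%z. al (snd q, z) * be (fst q, z) * ga q))^2" by(rule power_mono) simp
 also have "... <= X * Y * Z" unfolding X_def Y_def Z_def by(rule loomis_whitney)
 finally have "(N^2)^2 <= (X * Y * Z)^2" by(rule power_mono) simp
 also have "... = X^2 * Y^2 * Z^2" by(simp add: power_mult_distrib)
 also have "... <= (16 * ?D 1 * N) * (16 * ?D 2 * N) * (16 * ?D 3 * N)" by(intro mult_mono X Y Z) auto
 finally have 4: "N ^ 4 <= (4096 * (?D 1 * ?D 2 * ?D 3)) * N ^ 3" by(simp add: power_mult[symmetric] power3_eq_cube mult_ac)
 show ?thesis
 proof (cases "N = 0")
  case False
  hence n3: "N ^ 3 ~= 0" "N ^ 3 ~= Orderings.top" using fin by(auto simp: power_eq_top_ennreal)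
  have "N * N ^ 3 <= (4096 * (?D 1 * ?D 2 * ?D 3)) * N ^ 3" using 4 by(simp add: power4_eq_xxxx power3_eq_cube mult_ac)
  hence "N * N ^ 3 / N ^ 3 <= (4096 * (?D 1 * ?D 2 * ?D 3)) * N ^ 3 / N ^ 3" by(rule divide_right_mono_ennreal)
  thus ?thesis using n3 by(simp add: ennreal_mult_divide_eq)
 qed simp
qed

text \<open>The tangent of t^6 at \<open>m\<close>; with \<open>m\<close> the average it yields
  Jensen's inequality in \<open>avg_sixth_power\<close>.\<close>

lemma sixth_power_tangent: "6 * m ^ 5 * t - 5 * m ^ 6 <= (t::real) ^ 6"
proof -
 have "t ^ 6 - (6 * m ^ 5 * t - 5 * m ^ 6) = (t - m)^2 * ((t^2 + t * m)^2 + 2 * (t * m + m^2)^2 + 3 * m ^ 4)"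
  by(simp add: algebra_simps power2_eq_square power4_eq_xxxx eval_nat_numeral)
 also have "... >= 0" by(intro mult_nonneg_nonneg add_nonneg_nonneg) auto
 finally show ?thesis by simp
qed

lemma avg_sixth_power:
 assumes u: "loc_int u" and u6: "integ (%x. abs (u x) ^ 6)" and s: "!!i. sg $ i > 0"
 shows "enn (abs (avg sg u k) ^ 6) <= enn (1 / vol sg) * NL (%x. ind (cell sg k) x * enn (abs (u x) ^ 6))"
proof -
 let ?i = "%x. ind (cell sg k) x :: real" and ?m = "avg sg u k"
 let ?I = "LI (%x. ?i x * abs (u x) ^ 6)" and ?N = "NL (%x. ind (cell sg k) x * enn (abs (u x) ^ 6))"
 have v: "vol sg > 0" using vol_pos s by blast
 have ii: "integ ?i" "integral\<^sup>L leb ?i = vol sg" using emeasure_cell[OF s, of k] v by(auto simp: integrable_real_indicator measure_def)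
 have ui: "integ (%x. ?i x * u x)" by(rule cell_integrable[OF u s])
 have u6i: "integ (%x. ?i x * abs (u x) ^ 6)" using integrable_mult_indicator[OF cell_sets u6, of sg k] by simp
 have mean: "LI (%x. ?i x * u x) = vol sg * ?m" using v by(simp add: avg_def)
 have i1: "integ (%x. 6 * ?m ^ 5 * (?i x * u x))" and i2: "integ (%x. 5 * ?m ^ 6 * ?i x)" using ui ii by auto
 have "vol sg * abs ?m ^ 6 = LI (%x. 6 * ?m ^ 5 * (?i x * u x)) - LI (%x. 5 * ?m ^ 6 * ?i x)"
 proof -
  have "LI (%x. 6 * ?m ^ 5 * (?i x * u x)) = 6 * ?m ^ 5 * (vol sg * ?m)" by(simp only: integral_mult_right_zero mean)
  moreover have "LI (%x. 5 * ?m ^ 6 * ?i x) = 5 * ?m ^ 6 * vol sg" by(simp only: integral_mult_right_zero ii)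
  moreover have "abs ?m ^ 6 = ?m ^ 6" "?m ^ 6 = ?m ^ 5 * ?m" by(simp_all add: eval_nat_numeral)
  ultimately show ?thesis by(simp only:) (simp add: mult_ac)
 qed
 also have "... = LI (%x. 6 * ?m ^ 5 * (?i x * u x) - 5 * ?m ^ 6 * ?i x)" by(rule Lintegral_diff[symmetric, OF i1 i2])
 also have "... <= LI (%x. ?i x * abs (u x) ^ 6)"
 proof (rule integral_mono[OF Lintegrable_diff[OF i1 i2] u6i])
  fix x show "6 * ?m ^ 5 * (?i x * u x) - 5 * ?m ^ 6 * ?i x <= ?i x * abs (u x) ^ 6" using sixth_power_tangent[of ?m "u x"] by(auto simp: indicator_def power_even_abs)
 qed
 finally have le: "abs ?m ^ 6 <= 1 / vol sg * ?I" using v by(simp add: field_simps)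
 have "enn ?I = NL (%x. enn (?i x * abs (u x) ^ 6))" by(rule nn_integral_eq_integral[symmetric, OF u6i]) simp
 also have "... = ?N" by(intro nn_integral_cong) (auto simp: indicator_def)
 finally have e: "enn ?I = ?N" .
 have "enn (abs ?m ^ 6) <= enn (1 / vol sg * ?I)" using le by(rule ennreal_leI)
 also have "... = enn (1 / vol sg) * enn ?I" by(rule ennreal_mult) (use v in \<open>auto intro!: integral_nonneg_AE\<close>)
 finally show ?thesis unfolding e .
qed

lemma lattice_energy_avg:
 assumes wg: "wgrad u G" and Gm: "(%x. G x $ i) : bmeas" and s: "!!i. sg $ i > 0"
 shows "lattice_energy (avg sg u) i <= enn (4 / ((sg $ i)^2 * vol sg)) * NL (%x. enn ((G x $ i)^2))"
proof -
 let ?e = "cell_energy (%x. G x $ i) sg"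
 define c where "c = 2 / ((sg $ i)^2 * vol sg)"
 have v: "vol sg > 0" using vol_pos s by blast
 have c0: "c >= 0" using v by(simp add: c_def)
 have tot: "NC (%k. ?e k) = NL (%x. enn ((G x $ i)^2))" unfolding cell_energy_def by(rule nn_integral_cells[symmetric]) (use Gm in auto)
 have sh: "NC (%k. ?e (k + axis i 1)) = NC (%k. ?e k)" by(rule nn_integral_bij_count_space) (rule bij_betwI[where g="%x. x - axis i 1"], auto)
 have "lattice_energy (avg sg u) i <= NC (%k. enn c * (?e k + ?e (k + axis i 1)))" unfolding lattice_energy_def c_def by(intro nn_integral_mono edge_estimate[OF wg Gm s])
 also have "... = (enn c + enn c) * NC (%k. ?e k)" by(simp add: nn_integral_cmult nn_integral_add sh distrib_left distrib_right)
 also have "enn c + enn c = enn (4 / ((sg $ i)^2 * vol sg))" using c0 by(simp add: ennreal_plus[symmetric] del: ennreal_plus) (simp add: c_def)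
 finally show ?thesis by(simp only: tot)
qed

text \<open>The discrete inequality is applied to the averages at level \<open>j\<close>, where the
  mesh size cancels: 262144 is 4096 times 4^3, with 4 from \<open>lattice_energy_avg\<close>.
  Membership in L^6 makes the discrete sums finite, and Fatou's lemma passes to
  \<open>u\<close>.\<close>

theorem sobolev_inequality:
 assumes wg: "wgrad u G" and um: "u : bmeas" and u6: "integ (%x. abs (u x) ^ 6)"
  and Gm: "G : bmeas" and fin: "grad_energy G < \<infinity>"
 shows "NL (%x. enn (abs (u x) ^ 6)) <= 262144 * (grad_energy G) ^ 3"
proof -
 have ul: "loc_int u" using wg by(auto simp: has_weak_gradient_def)
 have Gim: "(%x. G x $ i) : bmeas" for i using Gm by(rule measurable_compose[OF _ borel_measurable_continuous_onI]) (intro continuous_intros)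
 define I where "I i = NL (%x. enn ((G x $ i)^2))" for i
 have IG: "I i <= grad_energy G" for i unfolding I_def grad_energy_def
 proof (intro nn_integral_mono ennreal_leI)
  fix x
  have "abs (G x $ i)^2 <= (norm (G x))^2" using component_le_norm_cart[of "G x" i] by(intro power_mono) auto
  thus "(G x $ i)^2 <= (norm (G x))^2" by simp
 qed
 have level: "NL (%x. enn (abs (proj (dy j) u x) ^ 6)) <= 262144 * (grad_energy G) ^ 3" for j
 proof -
  let ?f = "avg (dy j) u"
  define w where "w = vol (dy j)"
  have w: "w = 1 / (2 ^ j) ^ 3" by(simp add: w_def vol_def dy_def power_divide)
  have w0: "w > 0" by(simp add: w)
  define N where "N = NC (%k. enn (abs (?f k) ^ 6))"
  have "N <= NC (%k. enn (1 / vol (dy j)) * NL (%x. ind (cell (dy j) k) x * enn (abs (u x) ^ 6)))" unfolding N_def by(intro nn_integral_mono avg_sixth_power ul u6 dy_pos)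
  also have "... = enn (1 / vol (dy j)) * NL (%x. enn (abs (u x) ^ 6))"
  proof -
   have "NC (%k. NL (%x. ind (cell (dy j) k) x * enn (abs (u x) ^ 6))) = NL (%x. enn (abs (u x) ^ 6))" by(rule nn_integral_cells[symmetric]) (use um in simp)
   thus ?thesis by(subst nn_integral_cmult) (simp_all only: borel_measurable_count_space)
  qed
  also have "... < \<infinity>" using u6 by(auto simp: ennreal_mult_less_top integrable_iff_bounded)
  finally have Nfin: "N < \<infinity>" .
  define c where "c = 4 / ((2 ^ j)^2 * w)"
  have c0: "c >= 0" using w0 by(simp add: c_def)
  have L: "lattice_energy ?f i <= enn c * grad_energy G" for i
   using order_trans[OF lattice_energy_avg[OF wg Gim dy_pos, of j i] mult_left_mono[OF IG[of i], unfolded I_def]] by(simp add: c_def w_def dy_def)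
  have "N <= 4096 * (lattice_energy ?f 1 * lattice_energy ?f 2 * lattice_energy ?f 3)" using discrete_sobolev[of ?f] Nfin unfolding N_def by simp
  also have "... <= 4096 * ((enn c * grad_energy G) * (enn c * grad_energy G) * (enn c * grad_energy G))" by(intro mult_left_mono mult_mono L) auto
  also have "... = (4096 * (enn c) ^ 3) * grad_energy G ^ 3" by(simp add: power3_eq_cube mult_ac)
  also have "4096 * (enn c) ^ 3 = enn (4096 * c ^ 3)" using c0 by(simp add: ennreal_mult ennreal_power)
  finally have NN: "N <= enn (4096 * c ^ 3) * grad_energy G ^ 3" .
  have "NL (%x. enn (abs (proj (dy j) u x) ^ 6)) = enn w * N"
   unfolding proj_def N_def w_def by(rule nn_integral_cell_function[OF dy_pos, where F="%k. enn (abs (?f k) ^ 6)"])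
  also have "... <= enn w * (enn (4096 * c ^ 3) * grad_energy G ^ 3)" by(intro mult_left_mono NN) simp
  also have "... = enn (w * (4096 * c ^ 3)) * grad_energy G ^ 3" using w0 c0 by(simp only: ennreal_mult' mult.assoc less_imp_le)
  also have "w * (4096 * c ^ 3) = 262144" by(simp add: c_def w power_divide power_mult_distrib eval_nat_numeral)
  finally show ?thesis by simp
 qed
 have "NL (%x. enn (abs (u x) ^ 6)) <= NL (%x. liminf (%n. enn (abs (proj (dy n) u x) ^ 6)))"
 proof (rule nn_integral_mono_AE, use proj_tendsto_AE(1)[OF wg um Gm fin] in eventually_elim)
  case (elim x)
  hence "(%n. enn (abs (proj (dy n) u x) ^ 6)) ----> enn (abs (u x) ^ 6)" by(intro tendsto_ennrealI tendsto_intros)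
  from lim_imp_Liminf[OF _ this] show ?case by simp
 qed
 also have "... <= liminf (%n. NL (%x. enn (abs (proj (dy n) u x) ^ 6)))" by(rule nn_integral_liminf) (use proj_measurable in auto)
 also have "... <= liminf (%n. 262144 * (grad_energy G) ^ 3)" by(intro Liminf_mono always_eventually allI level)
 finally show ?thesis by(simp add: Liminf_const)
qed

section \<open>The Coulomb energy\<close>

lemma nn_integral_exp_square:
 fixes c :: real
 assumes "c > 0"
 shows "NB (%t. enn (exp (- (c * t^2)))) = enn (sqrt (pi / c))"
proof -
 define sg where "sg = sqrt (1 / (2 * c))"
 have sg: "sg^2 = 1 / (2 * c)" using assms by(simp add: sg_def)
 have e: "exp (- (c * t^2)) = sqrt (pi / c) * normal_density 0 sg t" for t
 proof -
  have "sqrt (pi / c) > 0" using assms by simp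
  moreover have "2 * pi * sg^2 = pi / c" "- ((t - 0)^2) / (2 * sg^2) = - (c * t^2)" using assms by(simp_all add: sg)
  ultimately show ?thesis unfolding normal_density_def using assms by simp
 qed
 have sg0: "sg > 0" using assms by(simp add: sg_def)
 have "NB (%t. enn (exp (- (c * t^2)))) = NB (%t. enn (sqrt (pi / c)) * enn (normal_density 0 sg t))"
  unfolding e using assms by(intro nn_integral_cong) (simp add: ennreal_mult')
 also have "... = enn (sqrt (pi / c)) * NB (%t. enn (normal_density 0 sg t))" by(rule nn_integral_cmult) simp
 also have "NB (%t. enn (normal_density 0 sg t)) = enn (LINT t|lborel. normal_density 0 sg t)" using sg0 by(intro nn_integral_eq_integral) auto
 also have "... = 1" using sg0 by simp
 finally show ?thesis by simp
qed

lemma nn_integral_exp_norm_square: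
 fixes c :: real
 assumes "c > 0"
 shows "NB (%z. enn (exp (- (c * (norm (z :: real^3))^2)))) = enn ((sqrt (pi / c)) ^ 3)"
proof -
 have e: "enn (exp (- (c * (norm z)^2))) = (\<Prod>b\<in>Basis. enn (exp (- (c * (z \<bullet> b)^2))))" for z :: "real^3"
 proof -
  have "(norm z)^2 = (\<Sum>b\<in>Basis. (z \<bullet> b)^2)" unfolding power2_norm_eq_inner by(subst euclidean_inner) (simp add: power2_eq_square)
  hence "exp (- (c * (norm z)^2)) = (\<Prod>b\<in>Basis. exp (- (c * (z \<bullet> b)^2)))" by(simp add: exp_sum sum_distrib_left sum_negf[symmetric] del: sum_negf)
  thus ?thesis by(simp add: prod_ennreal)
 qed
 have "NB (%z. enn (exp (- (c * (norm (z :: real^3))^2)))) = (\<Prod>b\<in>(Basis :: (real^3) set). NB (%t. enn (exp (- (c * t^2)))))"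
  unfolding e by(rule nn_integral_lborel_prod) auto
 also have "... = enn ((sqrt (pi / c)) ^ 3)" unfolding nn_integral_exp_square[OF assms] using assms by(simp add: ennreal_power)
 finally show ?thesis .
qed

text \<open>Gaussians scaled so that, with \<open>heat_weight\<close> as normalisation, the product
  of those centred at \<open>x\<close> and \<open>y\<close> integrates over \<open>z\<close> to
  exp(-s^2 |x - y|^2); up to parametrisation these are heat kernels.\<close>

definition heat :: "real => real^3 => real^3 => enn" where
 "heat s x z = enn (exp (- (2 * s^2 * (norm (x - z))^2)))"

definition heat_weight :: "real => enn" where
 "heat_weight s = enn (1 / (sqrt (pi / (4 * s^2))) ^ 3)"

lemma heat_measurable [measurable (raw)]:
 assumes [measurable]: "f : borel_measurable M" "g : borel_measurable M" "h : borel_measurable M"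
 shows "(%w. heat (f w) (g w) (h w)) : borel_measurable M" unfolding heat_def by measurable

lemma heat_weight_measurable [measurable]: "heat_weight : borel_measurable borel" unfolding heat_weight_def[abs_def] by measurable

lemma nn_integral_translate:
 fixes h :: "'a::euclidean_space => enn"
 assumes "h : borel_measurable borel"
 shows "NB (%z. h (c + z)) = NB (%z. h z)"
proof -
 have "NB (%z. h z) = nn_integral (distr lborel borel ((+) c)) (%z. h z)" by(simp only: lborel_distr_plus)
 also have "... = NB (%z. h (c + z))" using assms by(subst nn_integral_distr) auto
 finally show ?thesis by simp
qed

text \<open>The parallelogram law about the midpoint \<open>m\<close> separates the dependence on
  \<open>z\<close> from that on \<open>x - y\<close> and leaves a single Gaussian integral.\<close>

lemma heat_convolution:
 assumes "s ~= 0"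
 shows "NB (%z. heat_weight s * (heat s x z * heat s y z)) = enn (exp (- ((norm (x - y))^2 * s^2)))"
proof -
 define m where "m = (1/2 :: real) *R (x + y)"
 have id: "2 * (norm (x - z))^2 + 2 * (norm (y - z))^2 = (norm (x - y))^2 + 4 * (norm (- m + z))^2" for z
  unfolding m_def by(simp add: power2_norm_eq_inner inner_simps inner_commute algebra_simps)
 have h: "heat s x z * heat s y z = enn (exp (- ((norm (x - y))^2 * s^2))) * enn (exp (- ((4 * s^2) * (norm (- m + z))^2)))" for z
 proof -
  have "- (2 * s^2 * (norm (x - z))^2) + - (2 * s^2 * (norm (y - z))^2) = - (s^2 * (2 * (norm (x - z))^2 + 2 * (norm (y - z))^2))" by(simp add: algebra_simps)
  also have "... = - ((norm (x - y))^2 * s^2) + - ((4 * s^2) * (norm (- m + z))^2)" unfolding id by(simp add: algebra_simps)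
  finally show ?thesis unfolding heat_def by(simp add: ennreal_mult[symmetric] exp_add[symmetric])
 qed
 define K where "K = sqrt (pi / (4 * s^2)) ^ 3"
 have K: "K > 0" using assms by(simp add: K_def)
 have "NB (%z. enn (exp (- ((4 * s^2) * (norm (- m + z))^2)))) = enn K"
  unfolding K_def using nn_integral_translate[of "%z. enn (exp (- ((4 * s^2) * (norm z)^2)))" "- m"] nn_integral_exp_norm_square[of "4 * s^2"] assms by simp
 hence "NB (%z. heat_weight s * (heat s x z * heat s y z)) = enn (1 / K) * (enn (exp (- ((norm (x - y))^2 * s^2))) * enn K)"
  unfolding h heat_weight_def K_def[symmetric] by(simp add: nn_integral_cmult)
 also have "... = enn (1 / K * (exp (- ((norm (x - y))^2 * s^2)) * K))" using K by(simp only: ennreal_mult zero_le_divide_1_iff exp_ge_zero less_imp_le mult_nonneg_nonneg)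
 also have "... = enn (exp (- ((norm (x - y))^2 * s^2)))" using K by simp
 finally show ?thesis .
qed

lemma AE_lborel_ne: "AE t in lborel. t ~= (c :: 'a::euclidean_space)" by(rule AE_lborel_singleton)

text \<open>After \<open>heat_convolution\<close> the integrand is a Gaussian in \<open>s\<close>
  whose width is inversely proportional to |x - y|, and so is its integral.\<close>

lemma coulomb_kernel_heat:
 assumes "x ~= y"
 shows "NB (%s. NB (%z. heat_weight s * (heat s x z * heat s y z))) = enn (sqrt pi) * enn (1 / norm (x - y))"
proof -
 have "NB (%s. NB (%z. heat_weight s * (heat s x z * heat s y z))) = NB (%s. enn (exp (- ((norm (x - y))^2 * s^2))))"
  by(rule nn_integral_cong_AE) (use AE_lborel_ne[of "0::real"] heat_convolution in auto)
 also have "... = enn (sqrt (pi / (norm (x - y))^2))" by(rule nn_integral_exp_square) (use assms in simp)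
 also have "sqrt (pi / (norm (x - y))^2) = sqrt pi * (1 / norm (x - y))" by(simp add: real_sqrt_divide)
 also have "enn ... = enn (sqrt pi) * enn (1 / norm (x - y))" by(rule ennreal_mult) auto
 finally show ?thesis .
qed

lemma nn_integral_swap_lborel:
 fixes f :: "'a::euclidean_space => 'b::euclidean_space => enn"
 assumes "case_prod f : borel_measurable (borel \<Otimes>\<^sub>M borel)"
 shows "NB (%x. NB (%y. f x y)) = NB (%y. NB (%x. f x y))"
proof (rule pair_sigma_finite.Fubini')
 show "pair_sigma_finite (lborel :: 'b measure) (lborel :: 'a measure)" by(intro pair_sigma_finite.intro sigma_finite_lborel)
 have "(%(y, x). f x y) = (%z. case_prod f (snd z, fst z))" by auto
 moreover have "(%z. case_prod f (snd z, fst z)) : borel_measurable (borel \<Otimes>\<^sub>M borel)" by(rule measurable_compose[OF _ assms]) measurable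
 ultimately show "(%(y, x). f x y) : borel_measurable (lborel \<Otimes>\<^sub>M lborel)" by(simp cong: measurable_cong_sets sets_pair_measure_cong)
qed

definition coulomb_borel :: "(real^3 => enn) => (real^3 => enn) => enn" where
 "coulomb_borel f g = NB (%x. NB (%y. f x * g y * enn (1 / norm (x - y))))"

text \<open>Tonelli's theorem moves the variables \<open>s\<close> and \<open>z\<close> of the
  kernel representation outside; the pairing becomes an integral of a positive weight times the
  product of heat averages of \<open>f\<close> and of \<open>g\<close>, which exhibits it as
  positive definite.\<close>

lemma coulomb_borel_heat:
 assumes [measurable]: "f : borel_measurable borel" "g : borel_measurable borel"
 shows "enn (sqrt pi) * coulomb_borel f g
  = NB (%s. NB (%z. heat_weight s * (NB (%x. f x * heat s x z) * NB (%y. g y * heat s y z))))"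
proof -
 let ?h = "%x y s z. f x * g y * (heat_weight s * (heat s x z * heat s y z))"
 have [measurable]: "(%(x, y, s, z). ?h x y s z) : borel_measurable (borel \<Otimes>\<^sub>M borel \<Otimes>\<^sub>M borel \<Otimes>\<^sub>M borel)" by measurable
 have "enn (sqrt pi) * coulomb_borel f g
   = NB (%x. NB (%y. enn (sqrt pi) * (f x * g y * enn (1 / norm (x - y)))))" unfolding coulomb_borel_def by(simp add: nn_integral_cmult)
 also have "... = NB (%x. NB (%y. NB (%s. NB (%z. ?h x y s z))))"
 proof (rule nn_integral_cong)
  fix x
  show "NB (%y. enn (sqrt pi) * (f x * g y * enn (1 / norm (x - y)))) = NB (%y. NB (%s. NB (%z. ?h x y s z)))"
  proof (rule nn_integral_cong_AE, use AE_lborel_ne[of x] in eventually_elim)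
   case (elim y)
   have "NB (%s. NB (%z. ?h x y s z)) = f x * g y * NB (%s. NB (%z. heat_weight s * (heat s x z * heat s y z)))" by(simp add: nn_integral_cmult)
   also have "... = f x * g y * (enn (sqrt pi) * enn (1 / norm (x - y)))" using elim by(subst coulomb_kernel_heat) auto
   finally show ?case by(simp add: mult_ac)
  qed
 qed
 also have "... = NB (%x. NB (%s. NB (%y. NB (%z. ?h x y s z))))" by(intro nn_integral_cong nn_integral_swap_lborel) measurable
 also have "... = NB (%s. NB (%x. NB (%y. NB (%z. ?h x y s z))))" by(intro nn_integral_swap_lborel) measurable
 also have "... = NB (%s. NB (%x. NB (%z. NB (%y. ?h x y s z))))" by(intro nn_integral_cong nn_integral_swap_lborel) measurable
 also have "... = NB (%s. NB (%z. NB (%x. NB (%y. ?h x y s z))))" by(intro nn_integral_cong nn_integral_swap_lborel) measurable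
 also have "... = NB (%s. NB (%z. heat_weight s * (NB (%x. f x * heat s x z) * NB (%y. g y * heat s y z))))"
 proof (intro nn_integral_cong)
  fix s z
  have "NB (%x. NB (%y. ?h x y s z)) = NB (%x. (heat_weight s * (f x * heat s x z)) * NB (%y. g y * heat s y z))"
  proof (rule nn_integral_cong)
   fix x
   have "NB (%y. ?h x y s z) = NB (%y. (heat_weight s * (f x * heat s x z)) * (g y * heat s y z))" by(intro nn_integral_cong) (simp add: mult_ac)
   thus "NB (%y. ?h x y s z) = (heat_weight s * (f x * heat s x z)) * NB (%y. g y * heat s y z)" by(simp add: nn_integral_cmult)
  qed
  also have "... = heat_weight s * NB (%x. f x * heat s x z) * NB (%y. g y * heat s y z)" by(simp add: nn_integral_multc nn_integral_cmult)
  finally show "NB (%x. NB (%y. ?h x y s z)) = heat_weight s * (NB (%x. f x * heat s x z) * NB (%y. g y * heat s y z))" by(simp add: mult.assoc)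
 qed
 finally show ?thesis .
qed

lemma ennreal_two_mult_le: "2 * (a * b) <= a * a + b * (b :: enn)"
proof (cases a; cases b)
 fix r s assume rs: "a = enn r" "0 <= r" "b = enn s" "0 <= s"
 have "2 * (r * s) <= r * r + s * s" using sum_squares_bound[of r s] by(simp add: power2_eq_square)
 hence "enn (2 * (r * s)) <= enn (r * r + s * s)" by(rule ennreal_leI)
 thus ?thesis using rs by(simp add: ennreal_mult ennreal_plus)
qed (auto simp: ennreal_top_mult ennreal_mult_top)

text \<open>In the heat representation the inequality holds pointwise, by 2 P Q <= P^2 + Q^2. In
  this additive form it makes sense for infinite energies, and finiteness of mixed pairings is
  deduced from it in \<open>cfin_pair\<close>.\<close>

lemma coulomb_borel_amgm:
 assumes [measurable]: "f : borel_measurable borel" "g : borel_measurable borel"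
 shows "2 * coulomb_borel f g <= coulomb_borel f f + coulomb_borel g g"
proof -
 let ?P = "%f s z. NB (%x. f x * heat s x z)"
 have [measurable]: "(%(s, z). ?P f s z) : borel_measurable (borel \<Otimes>\<^sub>M borel)" "(%(s, z). ?P g s z) : borel_measurable (borel \<Otimes>\<^sub>M borel)"
  by measurable
 let ?c = "enn (sqrt pi)"
 have "?c * (2 * coulomb_borel f g) = 2 * (?c * coulomb_borel f g)" by(simp add: mult_ac)
 also have "... = NB (%s. NB (%z. heat_weight s * (2 * (?P f s z * ?P g s z))))"
 proof -
  have "2 * NB (%s. NB (%z. heat_weight s * (?P f s z * ?P g s z))) = NB (%s. NB (%z. 2 * (heat_weight s * (?P f s z * ?P g s z))))"
   by(subst (1 2) nn_integral_cmult) measurable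
  thus ?thesis unfolding coulomb_borel_heat[OF assms] by(simp only: mult.left_commute[of 2])
 qed
 also have "... <= NB (%s. NB (%z. heat_weight s * (?P f s z * ?P f s z + ?P g s z * ?P g s z)))" by(intro nn_integral_mono mult_left_mono ennreal_two_mult_le) simp
 also have "... = ?c * coulomb_borel f f + ?c * coulomb_borel g g"
  unfolding coulomb_borel_heat[OF assms(1,1)] coulomb_borel_heat[OF assms(2,2)] by(simp add: distrib_left nn_integral_add)
 also have "... = ?c * (coulomb_borel f f + coulomb_borel g g)" by(simp add: distrib_left)
 finally have "?c * (2 * coulomb_borel f g) <= ?c * (coulomb_borel f f + coulomb_borel g g)" .
 thus ?thesis by(subst (asm) ennreal_mult_le_mult_iff) auto
qed

lemma sigma_finite_lebesgue: "sigma_finite_measure (leb :: (real^3) measure)"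
proof
 have "emeasure leb a ~= \<infinity>" if "a : range (cell (dy 0))" for a using that emeasure_cell[OF dy_pos, of 0] by(metis ennreal_neq_top imageE infinity_ennreal_def)
 moreover have "\<Union> (range (cell (dy 0))) = UNIV" using in_cell_iff by blast
 moreover have "range (cell (dy 0)) \<subseteq> sets leb" using cell_sets by blast
 moreover have "countable (range (cell (dy 0)))" by(intro countable_image countableI_type)
 ultimately show "EX A. countable A & A \<subseteq> sets (leb :: (real^3) measure) & \<Union> A = space leb & (ALL a:A. emeasure leb a ~= \<infinity>)"
  by(metis space_completion space_lborel space_borel)
qed

interpretation lebesgue3: sigma_finite_measure "leb :: (real^3) measure" by(rule sigma_finite_lebesgue)

interpretation lebesgue3_pair: pair_sigma_finite "leb :: (real^3) measure" "leb :: (real^3) measure" by(intro pair_sigma_finite.intro sigma_finite_lebesgue)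

abbreviation LL :: "((real^3) \<times> (real^3)) measure" where "LL == leb \<Otimes>\<^sub>M leb"

definition pdens :: "fn => fn => (real^3) \<times> (real^3) => real" where
 "pdens f g z = f (fst z) * g (snd z) / norm (fst z - snd z)"

lemma measurable_id_lebesgue: "(%x. x) : leb \<rightarrow>\<^sub>M (borel :: (real^3) measure)" by(rule measurable_completion) simp

lemma norm_diff_measurable_LL [measurable]: "(%z. norm (fst z - snd z)) : borel_measurable LL"
 by(intro borel_measurable_norm[THEN measurable_compose[rotated]] borel_measurable_diff
   measurable_compose[OF measurable_fst measurable_id_lebesgue] measurable_compose[OF measurable_snd measurable_id_lebesgue])

lemma pdens_measurable:
 assumes "f : bmeas" "g : bmeas"
 shows "pdens f g : borel_measurable LL" unfolding pdens_def by(intro borel_measurable_divide borel_measurable_times norm_diff_measurable_LL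
   measurable_compose[OF measurable_fst assms(1)] measurable_compose[OF measurable_snd assms(2)])

text \<open>Bridge from Lebesgue measurable functions to the Borel setting in which Tonelli's
  theorem was applied; in its uses \<open>F\<close> and \<open>G\<close> are Borel representatives
  of \<open>f\<close> and \<open>g\<close>.\<close>

lemma nn_integral_pdens:
 assumes f: "f : bmeas" and g: "g : bmeas"
  and nn: "!!x. 0 <= f x" "!!x. 0 <= g x"
  and F: "AE x in lborel. f x = F x" and G: "AE x in lborel. g x = G x"
 shows "nn_integral LL (%z. enn (pdens f g z)) = coulomb_borel (%x. enn (F x)) (%x. enn (G x))"
proof -
 have pm: "(%z. enn (pdens f g z)) : borel_measurable LL" by(intro measurable_compose[OF pdens_measurable[OF f g] measurable_ennreal])
 have e: "enn (pdens f g (x, y)) = enn (f x) * enn (g y) * enn (1 / norm (x - y))" for x y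
 proof -
  have "pdens f g (x, y) = f x * g y * (1 / norm (x - y))" by(simp add: pdens_def)
  thus ?thesis using nn by(simp only: ennreal_mult mult_nonneg_nonneg zero_le_divide_1_iff norm_ge_zero)
 qed
 have "nn_integral LL (%z. enn (pdens f g z)) = NL (%x. NL (%y. enn (f x) * enn (g y) * enn (1 / norm (x - y))))"
  unfolding lebesgue3.nn_integral_fst[OF pm, symmetric] e ..
 also have "... = NB (%x. NB (%y. enn (f x) * enn (g y) * enn (1 / norm (x - y))))" by(simp only: nn_integral_completion)
 also have "... = NB (%x. NB (%y. enn (F x) * enn (G y) * enn (1 / norm (x - y))))"
 proof (rule nn_integral_cong_AE, use F in eventually_elim)
  case (elim x)
  show ?case by(rule nn_integral_cong_AE, use G in eventually_elim) (simp add: elim)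
 qed
 finally show ?thesis by(simp add: coulomb_borel_def)
qed

lemma nn_integral_pdens_amgm:
 assumes f: "f : bmeas" and g: "g : bmeas"
  and nn: "!!x. 0 <= f x" "!!x. 0 <= g x"
 shows "2 * nn_integral LL (%z. enn (pdens f g z)) <= nn_integral LL (%z. enn (pdens f f z)) + nn_integral LL (%z. enn (pdens g g z))"
proof -
 obtain F where F: "F : borel_measurable lborel" "AE x in lborel. f x = F x" using completion_ex_borel_measurable_real[OF f] by blast
 obtain G where G: "G : borel_measurable lborel" "AE x in lborel. g x = G x" using completion_ex_borel_measurable_real[OF g] by blast
 show ?thesis unfolding nn_integral_pdens[OF f g nn F(2) G(2)] nn_integral_pdens[OF f f nn(1,1) F(2) F(2)] nn_integral_pdens[OF g g nn(2,2) G(2) G(2)]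
  using F(1) G(1) by(intro coulomb_borel_amgm) auto
qed

section \<open>The Coulomb pairing of functions of either sign\<close>

text \<open>Finite energy is asked of the absolute value, which makes the class stable under
  domination (\<open>cfin_mono\<close>) and all mixed pairings absolutely convergent.\<close>

definition cfin :: "fn => bool" where
 "cfin f <-> f : bmeas & integrable LL (pdens (%x. abs (f x)) (%x. abs (f x)))"

definition coulomb :: "fn => fn => real" where
 "coulomb f g = (LINT z|LL. pdens f g z)"

lemma cfin_measurable: "cfin f ==> f : bmeas" by(simp add: cfin_def)

lemma abs_pdens: "abs (pdens f g z) = pdens (%x. abs (f x)) (%x. abs (g x)) z" by(simp add: pdens_def abs_mult)

lemma pdens_nonneg: "(!!x. 0 <= f x) ==> (!!x. 0 <= g x) ==> 0 <= pdens f g z" by(simp add: pdens_def)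

lemma pdens_mono:
 assumes "!!x. 0 <= f x" "!!x. f x <= f' x" "!!x. 0 <= g x" "!!x. g x <= g' x"
 shows "pdens f g z <= pdens f' g' z" unfolding pdens_def by(intro divide_right_mono mult_mono assms order_trans[OF assms(1) assms(2)]) auto

lemma cfin_pair:
 assumes "cfin f" "cfin g"
 shows "integrable LL (pdens f g)"
proof (rule integrableI_bounded)
 show "pdens f g : borel_measurable LL" using assms by(intro pdens_measurable cfin_measurable)
 let ?f = "%x. abs (f x)" and ?g = "%x. abs (g x)"
 have m: "?f : bmeas" "?g : bmeas" using assms by(auto dest!: cfin_measurable)
 have fin: "nn_integral LL (%z. enn (pdens (%x. abs (h x)) (%x. abs (h x)) z)) < \<infinity>" if "cfin h" for h
  using that by(simp add: cfin_def integrable_iff_bounded pdens_nonneg)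
 have "2 * nn_integral LL (%z. enn (pdens ?f ?g z)) <= nn_integral LL (%z. enn (pdens ?f ?f z)) + nn_integral LL (%z. enn (pdens ?g ?g z))"
  by(rule nn_integral_pdens_amgm[OF m]) auto
 also have "... < \<infinity>" using fin assms by simp
 finally have 2: "2 * nn_integral LL (%z. enn (pdens ?f ?g z)) < \<infinity>" .
 hence "nn_integral LL (%z. enn (pdens ?f ?g z)) < \<infinity>" by(auto simp: ennreal_mult_less_top)
 thus "nn_integral LL (%z. enn (norm (pdens f g z))) < \<infinity>" by(simp add: abs_pdens)
qed

lemma cfin_mono:
 assumes "cfin g" "f : bmeas" "!!x. abs (f x) <= abs (g x)"
 shows "cfin f" unfolding cfin_def
proof
 have fm: "(%x. abs (f x)) : bmeas" using assms(2) by simp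
 have "integrable LL (pdens (%x. abs (g x)) (%x. abs (g x)))" using assms(1) by(simp add: cfin_def)
 thus "integrable LL (pdens (%x. abs (f x)) (%x. abs (f x)))"
 proof (rule Lintegrable_bound[OF _ pdens_measurable[OF fm fm]], intro AE_I2)
  fix z
  have "pdens (%x. abs (f x)) (%x. abs (f x)) z <= pdens (%x. abs (g x)) (%x. abs (g x)) z" by(intro pdens_mono assms(3)) auto
  thus "norm (pdens (%x. abs (f x)) (%x. abs (f x)) z) <= norm (pdens (%x. abs (g x)) (%x. abs (g x)) z)" by(simp add: pdens_nonneg)
 qed
qed (rule assms(2))

lemma cfin_abs: "cfin f ==> cfin (%x. abs (f x))" by(rule cfin_mono[of f]) (auto dest: cfin_measurable)

lemma pdens_add_left: "pdens (%x. f x + f' x) g z = pdens f g z + pdens f' g z"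
 and pdens_add_right: "pdens g (%x. f x + f' x) z = pdens g f z + pdens g f' z"
 and pdens_scale_left: "pdens (%x. t * f x) g z = t * pdens f g z"
 and pdens_scale_right: "pdens g (%x. t * f x) z = t * pdens g f z" by(simp_all add: pdens_def algebra_simps add_divide_distrib)

lemma cfin_add:
 assumes "cfin f" "cfin g"
 shows "cfin (%x. f x + g x)"
proof (rule cfin_mono)
 let ?f = "%x. abs (f x)" and ?g = "%x. abs (g x)"
 have m: "?f : bmeas" "?g : bmeas" using assms by(auto dest!: cfin_measurable)
 have i: "integrable LL (pdens ?f ?f)" "integrable LL (pdens ?f ?g)" "integrable LL (pdens ?g ?f)" "integrable LL (pdens ?g ?g)"
  using assms by(auto intro!: cfin_pair cfin_abs)
 have "pdens (%x. ?f x + ?g x) (%x. ?f x + ?g x) = (%z. (pdens ?f ?f z + pdens ?f ?g z) + (pdens ?g ?f z + pdens ?g ?g z))"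
  by(simp add: fun_eq_iff pdens_add_left pdens_add_right)
 hence "integrable LL (pdens (%x. ?f x + ?g x) (%x. ?f x + ?g x))" using i by(simp only:) (intro Lintegrable_add)
 thus "cfin (%x. ?f x + ?g x)" using m by(simp add: cfin_def)
 show "(%x. f x + g x) : bmeas" using assms by(auto dest!: cfin_measurable)
 show "abs (f x + g x) <= abs (abs (f x) + abs (g x))" for x by linarith
qed

lemma cfin_scale:
 assumes "cfin f"
 shows "cfin (%x. t * f x)"
proof -
 have "pdens (%x. abs (t * f x)) (%x. abs (t * f x)) = (%z. t^2 * pdens (%x. abs (f x)) (%x. abs (f x)) z)"
  by(simp add: fun_eq_iff pdens_def abs_mult power2_eq_square flip: abs_mult[of t t])
 thus ?thesis using assms unfolding cfin_def by(auto intro: borel_measurable_times)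
qed

lemma cfin_diff: "cfin f ==> cfin g ==> cfin (%x. f x - g x)" using cfin_add[OF _ cfin_scale[of g "-1"], of f] by simp

lemma cfin_product:
 assumes "cfin (%x. (u x)^2)" "cfin (%x. (v x)^2)"
  "u : bmeas" "v : bmeas"
 shows "cfin (%x. u x * v x)"
proof (rule cfin_mono[OF cfin_add[OF assms(1,2)]])
 show "(%x. u x * v x) : bmeas" using assms by simp
 fix x
 have "2 * (abs (u x) * abs (v x)) <= (u x)^2 + (v x)^2" using sum_squares_bound[of "abs (u x)" "abs (v x)"] by simp
 thus "abs (u x * v x) <= abs ((u x)^2 + (v x)^2)" unfolding abs_mult by(smt (verit) abs_ge_zero mult_nonneg_nonneg)
qed

lemma coulomb_add_left: "cfin f ==> cfin f' ==> cfin g ==> coulomb (%x. f x + f' x) g = coulomb f g + coulomb f' g"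
 and coulomb_add_right: "cfin f ==> cfin f' ==> cfin g ==> coulomb g (%x. f x + f' x) = coulomb g f + coulomb g f'" unfolding coulomb_def pdens_add_left pdens_add_right
 by(intro Lintegral_add cfin_pair; assumption)+

lemma coulomb_scale_left: "coulomb (%x. t * f x) g = t * coulomb f g"
 and coulomb_scale_right: "coulomb g (%x. t * f x) = t * coulomb g f" by(simp_all add: coulomb_def pdens_scale_left pdens_scale_right)

lemma coulomb_diff_left: "cfin f ==> cfin f' ==> cfin g ==> coulomb (%x. f x - f' x) g = coulomb f g - coulomb f' g"
 and coulomb_diff_right: "cfin f ==> cfin f' ==> cfin g ==> coulomb g (%x. f x - f' x) = coulomb g f - coulomb g f'"
 using coulomb_add_left[OF _ cfin_scale[of f' "-1"], of f g] coulomb_add_right[OF _ cfin_scale[of f' "-1"], of f g]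
  coulomb_scale_left[of "-1" f' g] coulomb_scale_right[of g "-1" f'] by simp_all

lemma coulomb_commute:
 assumes "cfin f" "cfin g"
 shows "coulomb f g = coulomb g f"
proof -
 have "coulomb f g = (LINT z|LL. pdens f g (prod.swap z))" unfolding coulomb_def
  using lebesgue3_pair.integral_product_swap[of "pdens f g"] pdens_measurable assms[THEN cfin_measurable] by(simp add: prod.swap_def case_prod_unfold)
 also have "... = coulomb g f" unfolding coulomb_def by(intro Bochner_Integration.integral_cong) (auto simp: pdens_def norm_minus_commute)
 finally show ?thesis .
qed

lemma coulomb_nonneg: "(!!x. 0 <= f x) ==> (!!x. 0 <= g x) ==> 0 <= coulomb f g" unfolding coulomb_def by(intro integral_nonneg_AE AE_I2 pdens_nonneg)

lemma coulomb_amgm_nonneg: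
 assumes f: "cfin f" and g: "cfin g" and nn: "!!x. 0 <= f x" "!!x. 0 <= g x"
 shows "2 * coulomb f g <= coulomb f f + coulomb g g"
proof -
 have e: "enn (coulomb h k) = nn_integral LL (%z. enn (pdens h k z))"
  if "cfin h" "cfin k" "!!x. 0 <= h x" "!!x. 0 <= k x" for h k unfolding coulomb_def using that by(intro nn_integral_eq_integral[symmetric] cfin_pair AE_I2 pdens_nonneg)
 have "2 * enn (coulomb f g) <= enn (coulomb f f) + enn (coulomb g g)" unfolding e[OF f g nn] e[OF f f nn(1,1)] e[OF g g nn(2,2)]
  by(intro nn_integral_pdens_amgm nn cfin_measurable f g)
 hence "enn (2 * coulomb f g) <= enn (coulomb f f + coulomb g g)"
  using coulomb_nonneg[of f g] coulomb_nonneg[of f f] coulomb_nonneg[of g g] nn by(simp add: ennreal_mult ennreal_plus)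
 thus ?thesis using coulomb_nonneg[of f f] coulomb_nonneg[of g g] nn by(subst (asm) ennreal_le_iff) simp_all
qed

text \<open>The inequality for nonnegative functions is applied to the positive and the negative
  part of \<open>f\<close>; the mixed term is exactly what it absorbs.\<close>

lemma coulomb_pos:
 assumes f: "cfin f"
 shows "0 <= coulomb f f"
proof -
 let ?p = "%x. max (f x) 0" and ?n = "%x. max (- f x) 0"
 have fm: "f : bmeas" using f by(rule cfin_measurable)
 have p: "cfin ?p" and n: "cfin ?n" using fm by(auto intro!: cfin_mono[OF f])
 have "f = (%x. ?p x - ?n x)" by(auto simp: fun_eq_iff)
 hence "coulomb f f = coulomb (%x. ?p x - ?n x) (%x. ?p x - ?n x)" by simp
 also have "... = coulomb ?p ?p - coulomb ?p ?n - (coulomb ?n ?p - coulomb ?n ?n)" using p n cfin_diff[OF p n] by(simp add: coulomb_diff_left coulomb_diff_right)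
 also have "... = coulomb ?p ?p + coulomb ?n ?n - 2 * coulomb ?p ?n" using coulomb_commute[OF p n] by simp
 also have "... >= 0" using coulomb_amgm_nonneg[OF p n] by simp
 finally show ?thesis .
qed

lemma coulomb_amgm:
 assumes f: "cfin f" and g: "cfin g"
 shows "2 * coulomb f g <= coulomb f f + coulomb g g"
proof -
 have "0 <= coulomb (%x. f x - g x) (%x. f x - g x)" by(intro coulomb_pos cfin_diff f g)
 also have "... = coulomb f f - coulomb f g - (coulomb g f - coulomb g g)" using f g cfin_diff[OF f g] by(simp add: coulomb_diff_left coulomb_diff_right)
 finally show ?thesis using coulomb_commute[OF f g] by simp
qed

lemma cball_sets_borel [measurable]: "cball a r : sets (borel :: 'a::metric_space measure)" by(simp add: borel_closed)

text \<open>1 / |w| is dominated by the sum of 2 / r_j over the concentric balls of radius r_j = R /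
  2^j that contain \<open>w\<close>; volumes of order r_j^3 make the series of integrals
  geometric.\<close>

lemma nn_integral_inverse_norm_ball:
 assumes R: "R > 0"
 shows "NB (%w. ind (cball 0 R) w * enn (1 / norm (w :: real^3))) < \<infinity>"
proof -
 define r where "r j = R * (1/2) ^ j" for j :: nat
 define V where "V = unit_ball_vol (real DIM(real^3))"
 have V: "V >= 0" by(simp add: V_def)
 have r0: "r j > 0" for j using R by(simp add: r_def)
 let ?b = "%j (w :: real^3). enn (2 / r j) * ind (cball 0 (r j)) w"
 have pw: "ind (cball 0 R) w * enn (1 / norm w) <= (suminf (%j. ?b j w))" for w :: "real^3"
 proof (cases "w : cball 0 R & w ~= 0")
  case True
  hence w: "norm w > 0" "norm w <= R" by auto
  obtain n where "(1/2::real) ^ n < norm w / R" using real_arch_pow_inv[of "norm w / R" "1/2"] w R by auto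
  hence n: "r n < norm w" using R by(simp add: r_def field_simps)
  define m where "m = (LEAST n. r n < norm w)"
  have m: "r m < norm w" unfolding m_def by(rule LeastI[of _ n]) (rule n)
  have "m ~= 0" using m w by(intro notI) (simp add: r_def)
  then obtain j where j: "m = Suc j" by(cases m) auto
  have "~ r j < norm w" using not_less_Least[of j "%n. r n < norm w"] j unfolding m_def by simp
  hence wj: "w : cball 0 (r j)" by simp
  have "r j = 2 * r m" by(simp add: j r_def)
  hence "1 / norm w <= 2 / r j" using m w r0[of m] by(simp add: field_simps)
  hence "ind (cball 0 R) w * enn (1 / norm w) <= ?b j w" using True wj by(simp add: ennreal_leI)
  also have "... <= (suminf (%j. ?b j w))" using sum_le_suminf[of "%j. ?b j w" "{j}"] by(simp del: mem_cball sum_mult_indicator)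
  finally show ?thesis .
 qed auto
 have "NB (%w. ind (cball 0 R) w * enn (1 / norm (w :: real^3)))
   <= NB (%w. (suminf (%j. ?b j w)))" by(intro nn_integral_mono pw)
 also have "... = (suminf (%j. enn (2 / r j) * emeasure lborel (cball (0 :: real^3) (r j))))"
  by(subst nn_integral_suminf) (simp_all add: nn_integral_cmult_indicator borel_closed)
 also have "... = (suminf (%j. enn (2 * V * R^2 * (1/4) ^ j)))"
 proof (intro suminf_cong)
  fix j
  have "enn (2 / r j) * emeasure lborel (cball (0 :: real^3) (r j)) = enn (2 / r j * (V * r j ^ 3))"
  proof -
   have "emeasure lborel (cball (0 :: real^3) (r j)) = enn (V * r j ^ 3)" using r0[of j] by(subst emeasure_cball) (simp_all add: V_def)
   thus ?thesis using r0[of j] V by(simp only: ennreal_mult[symmetric] zero_le_divide_iff mult_nonneg_nonneg zero_le_power less_imp_le zero_le_numeral simp_thms)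
  qed
  also have "2 / r j * (V * r j ^ 3) = 2 * V * (r j)^2" using r0[of j] by(simp add: power2_eq_square power3_eq_cube)
  also have "(r j)^2 = R^2 * (1/4) ^ j"
  proof -
   have "((1/2::real) ^ j)^2 = ((1/2)^2) ^ j" by(simp only: power_mult[symmetric] mult.commute)
   thus ?thesis by(simp add: r_def power_mult_distrib power_divide)
  qed
  finally show "enn (2 / r j) * emeasure lborel (cball (0 :: real^3) (r j)) = enn (2 * V * R^2 * (1/4) ^ j)" by(simp add: mult_ac)
 qed
 also have "... < \<infinity>" using V by(subst suminf_ennreal2) (auto intro!: summable_mult summable_geometric)
 finally show ?thesis .
qed

lemma cfin_bounded:
 assumes fm: "f : bmeas" and b: "!!x. abs (f x) <= M * ind (cball 0 R) x" and R: "R > 0"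
 shows "cfin f"
proof (rule cfin_mono[OF _ fm])
 let ?i = "ind (cball 0 R) :: fn"
 have im: "?i : bmeas" by(intro borel_measurable_indicator) (simp add: borel_closed)
 show "cfin (%x. M * ?i x)"
 proof (rule cfin_scale)
  have "nn_integral LL (%z. enn (pdens ?i ?i z)) = coulomb_borel (%x. enn (?i x)) (%x. enn (?i x))" by(rule nn_integral_pdens[OF im im]) auto
  also have "... <= NB (%x. ind (cball 0 R) (x :: real^3) * NB (%w. ind (cball 0 (2 * R)) w * enn (1 / norm (w :: real^3))))" unfolding coulomb_borel_def
  proof (rule nn_integral_mono)
   fix x :: "real^3"
   have "NB (%y. enn (?i x) * enn (?i y) * enn (1 / norm (x - y)))
     <= NB (%y. ind (cball 0 R) x * (ind (cball 0 (2 * R)) (- x + y) * enn (1 / norm (- x + y))))"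
   proof (rule nn_integral_mono)
    fix y :: "real^3"
    have "norm (- x + y) <= 2 * R" if "norm x <= R" "norm y <= R" using norm_triangle_ineq[of "- x" y] that by simp
    thus "enn (?i x) * enn (?i y) * enn (1 / norm (x - y)) <= ind (cball 0 R) x * (ind (cball 0 (2 * R)) (- x + y) * enn (1 / norm (- x + y)))"
     using norm_minus_commute[of x y] by(auto simp: indicator_def)
   qed
   also have "... = ind (cball 0 R) x * NB (%y. ind (cball 0 (2 * R)) (- x + y) * enn (1 / norm (- x + y)))" by(rule nn_integral_cmult) measurable
   also have "NB (%y. ind (cball 0 (2 * R)) (- x + y) * enn (1 / norm (- x + y))) = NB (%w. ind (cball 0 (2 * R)) w * enn (1 / norm (w :: real^3)))"
    by(rule nn_integral_translate[where h="%w. ind (cball 0 (2 * R)) w * enn (1 / norm w)"]) measurable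
   finally show "NB (%y. enn (?i x) * enn (?i y) * enn (1 / norm (x - y)))
    <= ind (cball 0 R) x * NB (%w. ind (cball 0 (2 * R)) w * enn (1 / norm (w :: real^3)))" .
  qed
  also have "... = emeasure lborel (cball (0 :: real^3) R) * NB (%w. ind (cball 0 (2 * R)) w * enn (1 / norm (w :: real^3)))" by(subst nn_integral_multc) auto
  also have "... < \<infinity>"
   using nn_integral_inverse_norm_ball[of "2 * R"] R emeasure_bounded_finite[OF bounded_cball, of "0 :: real^3" R] by(simp add: ennreal_mult_less_top)
  finally have "nn_integral LL (%z. enn (pdens ?i ?i z)) < \<infinity>" .
  thus "cfin ?i" unfolding cfin_def using pdens_measurable[OF im im] im by(simp add: integrable_iff_bounded pdens_nonneg)
 qed
 show "abs (f x) <= abs (M * ?i x)" for x using b[of x] by linarith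
qed

section \<open>Weak gradients and the space \<open>E\<close>\<close>

lemma locally_integrable_measurable:
 fixes f :: "real^3 => 'b::euclidean_space"
 assumes "loc_int f"
 shows "f : bmeas"
proof (rule borel_measurable_LIMSEQ_metric)
 show "(%x. ind (cball 0 (real n)) x *R f x) : bmeas" for n using assms by(intro borel_measurable_integrable) (simp add: locally_integrable_def set_integrable_def)
 fix x :: "real^3"
 obtain N where N: "norm x <= real N" using real_arch_simple by blast
 have "eventually (%n. ind (cball 0 (real n)) x *R f x = f x) sequentially" using eventually_ge_at_top[of N] by eventually_elim (use N in auto)
 thus "(%n. ind (cball 0 (real n)) x *R f x) ----> f x" by(rule tendsto_eventually)
qed

lemma component_measurable:
 fixes G :: "real^3 => real^3"
 assumes "G : bmeas"
 shows "(%x. G x $ i) : bmeas" using assms by(rule measurable_compose[OF _ borel_measurable_continuous_onI]) (intro continuous_intros)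

lemma bump_prod_test: "(%x. bumps m a b x) : test_functions" for a b :: "real^3"
 by(rule test_function_prod[where a=a and b=b and f="%l. bump m (a $ l) (b $ l)"]) (auto simp: bump_smooth bump_zero simp del: smooth_upto.simps)

lemma test_function_continuous: "ph : test_functions ==> continuous_on UNIV ph" by(auto simp: test_functions_def dest: spec[of _ 0])

lemma test_function_partial_continuous:
 assumes "ph : test_functions"
 shows "continuous_on UNIV (pd i ph)"
proof -
 have "Ck (Suc 0) ph" using assms unfolding test_functions_def by blast
 hence "Ck 0 (pd i ph)" by(simp only: Ck.simps)
 thus ?thesis by simp
qed

lemma test_function_support:
 assumes "ph : test_functions"
 obtains K where "compact K" "!!x. x ~: K ==> ph x = 0" "!!x i. x ~: K ==> pd i ph x = 0"
proof
 let ?K = "closure {x. ph x ~= 0}"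
 show "compact ?K" using assms by(auto simp: test_functions_def)
 show z: "ph x = 0" if "x ~: ?K" for x using that closure_subset[of "{x. ph x ~= 0}"] by blast
 show "pd i ph x = 0" if "x ~: ?K" for x i
 proof -
  have "(ph has_derivative (%h. 0)) (at x)"
  proof (rule has_derivative_transform_within_open)
   show "((%x. 0) has_derivative (%h. 0)) (at x)" by(rule has_derivative_const)
   show "open (- ?K)" by(rule open_Compl[OF closed_closure])
   show "x : - ?K" using that by(simp only: Compl_iff not_False_eq_True)
   show "0 = ph y" if "y : - ?K" for y using z[of y] that by simp
  qed
  thus ?thesis by(simp add: partial_deriv_def frechet_derivative_at[symmetric])
 qed
qed

lemma continuous_compact_support_bounded:
 fixes h :: "real^3 => 'b::euclidean_space"
 assumes "continuous_on UNIV h" "compact K" "!!x. x ~: K ==> h x = 0"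
 obtains M where "M >= 0" "!!x. norm (h x) <= M * ind K x"
proof -
 have "bounded (h ` K)" using assms by(intro compact_imp_bounded compact_continuous_image continuous_on_subset[OF assms(1)]) auto
 then obtain M where M: "!!x. x : K ==> norm (h x) <= M" by(auto simp: bounded_iff)
 show ?thesis
 proof (rule that[of "max M 0"])
  show "norm (h x) <= max M 0 * ind K x" for x using M[of x] assms(3)[of x] by(cases "x : K") auto
 qed simp
qed

lemma locally_integrable_times:
 fixes f :: fn
 assumes f: "loc_int f" and h: "continuous_on UNIV h" and K: "compact K" "!!x. x ~: K ==> h x = 0"
 shows "integ (%x. f x * h x)"
proof -
 obtain M where M: "M >= 0" "!!x. norm (h x) <= M * ind K x" using continuous_compact_support_bounded[OF h K] by blast
 show ?thesis
 proof (rule Lintegrable_bound[OF integrable_mult_right[OF locally_integrable_indicator[OF f K(1)], of M]])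
  show "(%x. f x * h x) : bmeas" by(intro borel_measurable_times locally_integrable_measurable f continuous_borel_lebesgue h)
  have "norm (f x * h x) <= norm (M * (ind K x * f x))" for x
   using mult_left_mono[OF M(2)[of x] abs_ge_zero[of "f x"]] M(1) by(cases "x : K") (auto simp: abs_mult mult_ac)
  thus "AE x in leb. norm (f x * h x) <= norm (M * (ind K x * f x))" by simp
 qed
qed

lemma weak_gradient_test_integrable:
 assumes "wgrad u G" "ph : test_functions"
 shows "integ (%x. u x * pd i ph x)" "integ (%x. G x $ i * ph x)"
proof -
 obtain K where K: "compact K" "!!x. x ~: K ==> ph x = 0" "!!x i. x ~: K ==> pd i ph x = 0" using test_function_support[OF assms(2)] by metis
 show "integ (%x. u x * pd i ph x)"
  by(rule locally_integrable_times[OF _ test_function_partial_continuous[OF assms(2)] K(1) K(3)]) (use assms in \<open>auto simp: has_weak_gradient_def\<close>)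
 show "integ (%x. G x $ i * ph x)" by(rule locally_integrable_times[OF _ test_function_continuous[OF assms(2)] K(1) K(2)])
   (use assms in \<open>auto simp: has_weak_gradient_def intro: locally_integrable_component\<close>)
qed

lemma box_integral_zero_of_tests:
 fixes w :: fn
 assumes w: "loc_int w" and t: "!!ph. ph : test_functions ==> LI (%x. w x * ph x) = 0"
 shows "LI (%x. ind (box a b) x * w x) = 0"
proof -
 let ?ph = "%m x. bumps m a b x"
 have wi: "integ (%x. ind (cbox a b) x * w x)" by(rule locally_integrable_indicator[OF w]) simp
 have wm: "w : bmeas" by(rule locally_integrable_measurable[OF w])
 have "(%m. LI (%x. w x * ?ph m x)) ----> LI (%x. w x * ind (box a b) x)"
 proof (rule integral_dominated_convergence[where w="%x. norm (ind (cbox a b) x * w x)"])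
  show "integ (%x. norm (ind (cbox a b) x * w x))" by(rule integrable_norm[OF wi])
  show "(%x. w x * ind (box a b) x) : bmeas" by(intro borel_measurable_times wm borel_measurable_indicator) auto
  show "(%x. w x * ?ph m x) : bmeas" for m by(intro borel_measurable_times wm continuous_borel_lebesgue test_function_continuous bump_prod_test)
  show "AE x in leb. (%m. w x * ?ph m x) ----> w x * ind (box a b) x" by(intro AE_I2 tendsto_mult tendsto_const bump_prod_tendsto)
  show "AE x in leb. norm (w x * ?ph m x) <= norm (ind (cbox a b) x * w x)" for m
  proof (rule AE_I2)
   fix x
   have "abs (w x) * abs (?ph m x) <= abs (w x) * ind (cbox a b) x" by(intro mult_left_mono bump_prod_le box_subset_cbox) auto
   thus "norm (w x * ?ph m x) <= norm (ind (cbox a b) x * w x)" by(simp add: abs_mult mult.commute del: prod_zero_iff)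
  qed
 qed
 hence "(%m::nat. 0::real) ----> LI (%x. w x * ind (box a b) x)" unfolding t[OF bump_prod_test] .
 hence "LI (%x. w x * ind (box a b) x) = 0" by(simp only: LIMSEQ_const_iff)
 thus ?thesis by(simp only: mult.commute)
qed

text \<open>The fundamental lemma of the calculus of variations: bumps tend to indicators of boxes,
  boxes fill cells up to null sets, and integrals over cells determine the function.\<close>

lemma AE_zero_of_tests:
 fixes w :: fn
 assumes w: "loc_int w" and t: "!!ph. ph : test_functions ==> LI (%x. w x * ph x) = 0"
 shows "AE x in leb. w x = 0"
proof (rule AE_zero_of_cell_integrals)
 show wm: "w : bmeas" by(rule locally_integrable_measurable[OF w])
 fix j k
 show ci: "integ (%x. ind (cell (dy j) k) x * w x)" by(rule cell_integrable[OF w dy_pos])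
 have "LI (%x. ind (cell (dy j) k) x * w x) = LI (%x. ind (box (lo (dy j) k) (hi (dy j) k)) x * w x)" using AE_cell_box[OF dy_pos, of j k] wm
  by(intro integral_cong_AE borel_measurable_integrable[OF ci] borel_measurable_times borel_measurable_indicator) (auto simp: indicator_def)
 thus "LI (%x. ind (cell (dy j) k) x * w x) = 0" by(simp only: box_integral_zero_of_tests[OF w t])
qed

lemma locally_integrable_add:
 fixes f g :: "real^3 => 'b::euclidean_space"
 shows "loc_int f ==> loc_int g ==> loc_int (%x. f x + g x)" by(auto simp: locally_integrable_def intro: set_integral_add(1))

lemma locally_integrable_scale:
 fixes f :: "real^3 => 'b::euclidean_space"
 shows "loc_int f ==> loc_int (%x. t *R f x)" by(auto simp: locally_integrable_def intro: absolutely_integrable_scaleR_left)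

text \<open>Licenses replacing the chosen \<open>weak_grad\<close> inside integrals by any weak
  gradient at hand.\<close>

lemma weak_gradient_unique:
 assumes G: "wgrad u G" and H: "wgrad u H"
 shows "AE x in leb. G x = H x"
proof -
 have "AE x in leb. G x $ i - H x $ i = 0" for i
 proof (rule AE_zero_of_tests)
  have l: "loc_int (%x. G x $ i)" "loc_int (%x. H x $ i)" using G H by(auto simp: has_weak_gradient_def intro: locally_integrable_component)
  from locally_integrable_add[OF l(1) locally_integrable_scale[OF l(2), of "-1"]]
  show "loc_int (%x. G x $ i - H x $ i)" by simp
  fix ph assume ph: "ph : test_functions"
  have "LI (%x. (G x $ i - H x $ i) * ph x) = LI (%x. G x $ i * ph x) - LI (%x. H x $ i * ph x)"
   unfolding left_diff_distrib by(intro Lintegral_diff weak_gradient_test_integrable[OF G ph] weak_gradient_test_integrable[OF H ph])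
  also have "... = 0" using G H ph by(simp add: has_weak_gradient_def)
  finally show "LI (%x. (G x $ i - H x $ i) * ph x) = 0" .
 qed
 hence "AE x in leb. ALL i:UNIV. G x $ i - H x $ i = 0" by(intro AE_finite_allI) auto
 thus ?thesis by eventually_elim (simp add: vec_eq_iff)
qed

lemma has_weak_gradient_add:
 assumes u: "wgrad u G" and v: "wgrad v H"
 shows "wgrad (%x. u x + v x) (%x. G x + H x)" unfolding has_weak_gradient_def
proof (intro conjI ballI allI)
 show "loc_int (%x. u x + v x)" "loc_int (%x. G x + H x)" using u v by(auto simp: has_weak_gradient_def intro: locally_integrable_add)
 fix ph i assume ph: "ph : test_functions"
 note I = weak_gradient_test_integrable[OF u ph, of i] weak_gradient_test_integrable[OF v ph, of i]
 have "LI (%x. (u x + v x) * pd i ph x) = LI (%x. u x * pd i ph x) + LI (%x. v x * pd i ph x)" unfolding distrib_right by(intro Lintegral_add I)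
 also have "... = - (LI (%x. G x $ i * ph x) + LI (%x. H x $ i * ph x))" using u v ph by(simp add: has_weak_gradient_def)
 also have "LI (%x. G x $ i * ph x) + LI (%x. H x $ i * ph x) = LI (%x. (G x + H x) $ i * ph x)"
  unfolding vector_add_component distrib_right by(intro Lintegral_add[symmetric] I)
 finally show "LI (%x. (u x + v x) * pd i ph x) = - LI (%x. (G x + H x) $ i * ph x)" .
qed

lemma has_weak_gradient_scale:
 assumes u: "wgrad u G"
 shows "wgrad (%x. t * u x) (%x. t *R G x)" unfolding has_weak_gradient_def
proof (intro conjI ballI allI)
 show "loc_int (%x. t * u x)" "loc_int (%x. t *R G x)" using u locally_integrable_scale[of u t] by(auto simp: has_weak_gradient_def intro: locally_integrable_scale)
 fix ph i assume ph: "ph : test_functions"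
 show "LI (%x. (t * u x) * pd i ph x) = - LI (%x. (t *R G x) $ i * ph x)" using u ph by(simp add: has_weak_gradient_def mult.assoc)
qed

lemma Lp6_iff: "u : Lp 6 <-> u : bmeas & integ (%x. abs (u x) ^ 6)" for u :: fn
proof -
 have "norm (u x) powr 6 = abs (u x) ^ 6" for x by(cases "u x = 0") (simp_all add: powr_numeral)
 thus ?thesis by(simp add: Lp_def)
qed

lemma Lp2_iff: "G : Lp 2 <-> G : bmeas & integ (%x. (norm (G x))^2)" for G :: "real^3 => real^3"
proof -
 have "norm (G x) powr 2 = (norm (G x))^2" for x by(cases "G x = 0") (simp_all add: powr_numeral)
 thus ?thesis by(simp add: Lp_def)
qed

lemma weak_grad_AE:
 assumes "wgrad u G"
 shows "wgrad u (weak_grad u)" "AE x in leb. weak_grad u x = G x"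
proof -
 show "wgrad u (weak_grad u)" unfolding weak_grad_def by(rule someI[of _ G]) (rule assms)
 thus "AE x in leb. weak_grad u x = G x" using assms by(rule weak_gradient_unique)
qed

lemma D12_intro:
 assumes "u : bmeas" "integ (%x. abs (u x) ^ 6)" "wgrad u G" "integ (%x. (norm (G x))^2)"
 shows "u : D12"
proof -
 note w = weak_grad_AE[OF assms(3)]
 have m: "weak_grad u : bmeas" using w(1) by(auto simp: has_weak_gradient_def intro: locally_integrable_measurable)
 have "integ (%x. (norm (weak_grad u x))^2)" by(rule integrable_cong_AE_imp[OF assms(4)]) (use m w(2) in auto)
 thus ?thesis using assms m by(auto simp: D12_def Lp6_iff Lp2_iff)
qed

lemma D12_dest:
 assumes "u : D12"
 shows "u : bmeas" "integ (%x. abs (u x) ^ 6)" "wgrad u (weak_grad u)"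
  "weak_grad u : bmeas" "integ (%x. (norm (weak_grad u x))^2)" using assms weak_grad_AE(1) by(auto simp: D12_def Lp6_iff Lp2_iff)

lemma coulomb_energy_density_eq: "coulomb_energy_density u = pdens (%x. (u x)^2) (%x. (u x)^2)" by(auto simp: coulomb_energy_density_def pdens_def fun_eq_iff)

lemma E_iff: "u : E <-> u : D12 & cfin (%x. (u x)^2)" using D12_dest(1)[of u] by(auto simp: E_def cfin_def coulomb_energy_density_eq)

lemma abs_add_power6_le: "abs (a + b) ^ 6 <= 64 * (abs a ^ 6 + abs (b :: real) ^ 6)"
proof -
 have "abs (a + b) <= 2 * max (abs a) (abs b)" by linarith
 hence "abs (a + b) ^ 6 <= (2 * max (abs a) (abs b)) ^ 6" by(rule power_mono) simp
 also have "... = 64 * max (abs a) (abs b) ^ 6" by(simp add: power_mult_distrib)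
 also have "max (abs a) (abs b) ^ 6 <= abs a ^ 6 + abs b ^ 6" by(cases "abs a <= abs b") (auto simp: max_def)
 finally show ?thesis by simp
qed

lemma integrable_sixth_add:
 fixes u v :: "'a => real"
 assumes "u : borel_measurable M" "integrable M (%x. abs (u x) ^ 6)" "v : borel_measurable M" "integrable M (%x. abs (v x) ^ 6)"
 shows "integrable M (%x. abs (u x + v x) ^ 6)"
proof (rule Lintegrable_bound)
 show "integrable M (%x. 64 * (abs (u x) ^ 6 + abs (v x) ^ 6))" using assms by simp
 show "(%x. abs (u x + v x) ^ 6) : borel_measurable M" using assms by simp
 show "AE x in M. norm (abs (u x + v x) ^ 6) <= norm (64 * (abs (u x) ^ 6 + abs (v x) ^ 6))" using abs_add_power6_le by(intro AE_I2) (simp add: abs_of_nonneg)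
qed

lemma integrable_norm_square_add:
 fixes f g :: "'a => 'b::euclidean_space"
 assumes "f : borel_measurable M" "integrable M (%x. (norm (f x))^2)" "g : borel_measurable M" "integrable M (%x. (norm (g x))^2)"
 shows "integrable M (%x. (norm (f x + g x))^2)"
proof (rule Lintegrable_bound)
 show "integrable M (%x. 2 * (norm (f x))^2 + 2 * (norm (g x))^2)" using assms by simp
 show "(%x. (norm (f x + g x))^2) : borel_measurable M" using assms by simp
 show "AE x in M. norm ((norm (f x + g x))^2) <= norm (2 * (norm (f x))^2 + 2 * (norm (g x))^2)"
 proof (rule AE_I2)
  fix x
  have "(norm (f x + g x))^2 <= (norm (f x) + norm (g x))^2" by(intro power_mono norm_triangle_ineq) auto
  also have "... <= 2 * (norm (f x))^2 + 2 * (norm (g x))^2" using sum_squares_bound[of "norm (f x)" "norm (g x)"] by(simp add: power2_sum)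
  finally show "norm ((norm (f x + g x))^2) <= norm (2 * (norm (f x))^2 + 2 * (norm (g x))^2)" by simp
 qed
qed

lemma D12_add: "u : D12 ==> v : D12 ==> (%x. u x + v x) : D12" by(rule D12_intro[where G="%x. weak_grad u x + weak_grad v x"])
  (intro borel_measurable_add integrable_sixth_add has_weak_gradient_add integrable_norm_square_add D12_dest; assumption)+

lemma D12_scale:
 assumes "u : D12"
 shows "(%x. t * u x) : D12"
proof (rule D12_intro[where G="%x. t *R weak_grad u x"])
 show "(%x. t * u x) : bmeas" using D12_dest(1)[OF assms] by simp
 show "integ (%x. abs (t * u x) ^ 6)" using D12_dest(2)[OF assms] by(simp add: abs_mult power_mult_distrib)
 show "integ (%x. (norm (t *R weak_grad u x))^2)" using D12_dest(5)[OF assms] by(simp add: power_mult_distrib)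
qed (intro has_weak_gradient_scale D12_dest assms)

lemma E_add:
 assumes "u : E" "v : E"
 shows "(%x. u x + v x) : E" unfolding E_iff
proof
 have m: "u : bmeas" "v : bmeas" using assms D12_dest(1) by(auto simp: E_iff)
 show "(%x. u x + v x) : D12" using assms by(auto simp: E_iff intro: D12_add)
 have "cfin (%x. 2 * ((u x)^2 + (v x)^2))" using assms by(intro cfin_scale cfin_add) (auto simp: E_iff)
 thus "cfin (%x. (u x + v x)^2)"
 proof (rule cfin_mono)
  fix x
  have "(u x + v x)^2 <= 2 * ((u x)^2 + (v x)^2)" using sum_squares_bound[of "u x" "v x"] by(simp add: power2_sum)
  thus "abs ((u x + v x)^2) <= abs (2 * ((u x)^2 + (v x)^2))" by simp
 qed (use m in simp)
qed

lemma E_scale: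
 assumes "u : E"
 shows "(%x. t * u x) : E" using assms cfin_scale[of "%x. (u x)^2" "t^2"] by(auto simp: E_iff power_mult_distrib intro: D12_scale)

section \<open>Compactness and completeness\<close>

lemma fast_subsequence:
 assumes "!!m::nat. EX N. ALL n>=N. Q m n"
 obtains r :: "nat => nat" where "strict_mono r" "!!m n. n >= r m ==> Q m n"
proof -
 obtain N where N: "!!m n. n >= N m ==> Q m n" using assms by metis
 define r where "r m = m + (\<Sum>i\<le>m. N i)" for m
 have sm: "strict_mono r" by(rule strict_monoI_Suc) (simp add: r_def)
 have le: "N m <= r m" for m unfolding r_def by(rule trans_le_add2) (rule member_le_sum, auto)
 show ?thesis
 proof (rule that[OF sm])
  fix m n assume "n >= r m"
  thus "Q m n" using le[of m] by(intro N) simp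
 qed
qed

lemma diagonal_convergent:
 fixes a :: "nat => nat => real"
 assumes b: "!!m n. abs (a m n) <= b m"
 shows "EX s. strict_mono (s :: nat => nat) & (ALL m. convergent (%n. a m (s n)))"
proof -
 define P where "P m s <-> convergent (%n. a m (s n))" for m and s :: "nat => nat"
 have P_iff: "P m s <-> convergent (%n. a m (s n))" for m s by(simp add: P_def)
 have "subseqs P"
 proof
  fix m s assume "strict_mono (s :: nat => nat)"
  have "bounded (range (%n. a m (s n)))" using b by(auto simp: bounded_iff intro!: exI[of _ "b m"])
  then obtain l r where "strict_mono r" "((%n. a m (s n)) \<circ> r) ----> l" using bounded_imp_convergent_subsequence by blast
  thus "EX r'. strict_mono r' & P m (s \<circ> r')" unfolding P_def convergent_def by(auto simp: o_def)
 qed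
 then interpret subseqs P .
 have "P m diagseq" for m
 proof -
  have "P m (diagseq \<circ> (+) (Suc m))"
  proof (rule diagseq_holds)
   fix n and r s :: "nat => nat" assume "strict_mono r" "P n s"
   thus "P n (s \<circ> r)" unfolding P_def convergent_def using LIMSEQ_subseq_LIMSEQ[of "%i. a n (s i)" _ r] by(auto simp: o_def)
  qed
  hence "convergent (%n. a m (diagseq (n + Suc m)))" by(simp only: P_iff o_def add.commute)
  hence "convergent (%n. a m (diagseq n))" by(simp only: convergent_ignore_initial_segment[of "%n. a m (diagseq n)" "Suc m"])
  thus ?thesis by(simp only: P_iff)
 qed
 hence "convergent (%n. a m (diagseq n))" for m by(simp only: P_iff)
 thus ?thesis using subseq_diagseq by blast
qed

text \<open>A diagonal subsequence makes the averages over all dyadic cells converge, and the limits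
  \<open>Q j\<close> at level \<open>j\<close> converge almost everywhere by the geometric
  increments. A second subsequence \<open>t\<close> picks for level \<open>j\<close> an index at
  which the averages near the origin are within 2^(-j) of their limits; the remaining error is of
  order 2^(-j) in L^2, hence summable almost everywhere.\<close>

theorem rellich_AE:
 fixes u :: "nat => fn"
 assumes wg: "!!n. wgrad (u n) (G n)" and um: "!!n. u n : bmeas"
  and Gm: "!!n. G n : bmeas" and Gb: "!!n. grad_energy (G n) <= enn C"
  and u6: "!!n. integ (%x. abs (u n x) ^ 6)" and u6b: "!!n. NL (%x. enn (abs (u n x) ^ 6)) <= enn S"
 obtains r where "strict_mono r" "AE x in leb. convergent (%n. u (r n) x)"
proof -
 define ix where "ix = (from_nat :: nat => nat \<times> (int^3))"
 define a where "a m n = avg (dy (fst (ix m))) (u n) (snd (ix m))" for m n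
 have ab: "abs (a m n) <= 1 + max S 0 / vol (dy (fst (ix m)))" for m n
 proof -
  let ?sg = "dy (fst (ix m))"
  have v: "vol ?sg > 0" by(intro vol_pos dy_pos)
  have "enn (abs (a m n) ^ 6) <= enn (1 / vol ?sg) * NL (%x. ind (cell ?sg (snd (ix m))) x * enn (abs (u n x) ^ 6))"
   unfolding a_def using wg[of n] by(intro avg_sixth_power u6 dy_pos) (auto simp: has_weak_gradient_def)
  also have "... <= enn (1 / vol ?sg) * NL (%x. enn (abs (u n x) ^ 6))" by(intro mult_left_mono nn_integral_mono) (auto simp: indicator_def)
  also have "... <= enn (1 / vol ?sg) * enn (max S 0)" by(intro mult_left_mono order_trans[OF u6b] ennreal_leI) auto
  also have "... = enn (1 / vol ?sg * max S 0)" using v by(intro ennreal_mult[symmetric]) auto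
  finally have "abs (a m n) ^ 6 <= max S 0 / vol ?sg" using v by(simp add: ennreal_le_iff)
  moreover have "abs (a m n) <= 1 + abs (a m n) ^ 6"
  proof (cases "abs (a m n) <= 1")
   case False
   hence "abs (a m n) ^ 1 <= abs (a m n) ^ 6" by(intro power_increasing) auto
   thus ?thesis by simp
  qed (simp add: add_increasing2)
  ultimately show ?thesis by linarith
 qed
 obtain s where s: "strict_mono s" "!!m. convergent (%n. a m (s n))" using diagonal_convergent[of a, OF ab] by blast
 let ?P = "%j n x. proj (dy j) (u (s n)) x"
 define Q where "Q j x = lim (%n. ?P j n x)" for j x
 have PQ: "(%n. ?P j n x) ----> Q j x" for j x
 proof -
  have "ix (to_nat (j, index (dy j) x)) = (j, index (dy j) x)" by(simp add: ix_def)
  hence "convergent (%n. ?P j n x)" using s(2)[of "to_nat (j, index (dy j) x)"] by(simp add: a_def proj_def)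
  thus ?thesis by(simp add: Q_def convergent_LIMSEQ_iff)
 qed
 have Pm: "?P j n : bmeas" for j n by(rule proj_measurable)
 have Qm: "Q j : bmeas" for j by(rule borel_measurable_LIMSEQ_metric[OF Pm PQ])
 have Gfin: "grad_energy (G n) < \<infinity>" for n using Gb[of n] by(rule order_le_less_trans) simp
 have Qstep: "NL (%x. enn ((norm (Q (Suc j) x - Q j x))^2)) <= enn (1 / 4 ^ j) * enn C" for j
 proof (rule nn_integral_fatou_bound[where N=0])
  show "(%x. (norm (?P (Suc j) n x - ?P j n x))^2) : bmeas" for n using Pm by simp
  show "AE x in leb. (%n. (norm (?P (Suc j) n x - ?P j n x))^2) ----> (norm (Q (Suc j) x - Q j x))^2" by(intro AE_I2 tendsto_intros PQ)
  show "NL (%x. enn ((norm (?P (Suc j) n x - ?P j n x))^2)) <= enn (1 / 4 ^ j) * enn C" for n using order_trans[OF level_step[OF wg Gm] mult_left_mono[OF Gb]] by simp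
 qed
 have "AE x in leb. summable (%j. norm (Q (Suc j) x - Q j x))" by(rule AE_summable_of_geometric_squares[OF _ Qstep]) (use Qm in auto)
 hence Qconv: "AE x in leb. convergent (%j. Q j x)" by eventually_elim (rule convergent_of_summable_differences)
 define I where "I j = {k :: int^3. ALL i. k $ i : {- (int j * 2 ^ j) - 1..int j * 2 ^ j}}" for j
 have I: "finite (I j)" for j
  unfolding I_def by(rule finite_subset[OF _ finite_imageI[OF finite_PiE[of UNIV "%_. {- (int j * 2 ^ j) - 1..int j * 2 ^ j}"], of vec_lambda]])
   (auto intro!: image_eqI[of _ _ "vec_nth _"])
 let ?e = "%j n k. abs (avg (dy j) (u (s n)) k - lim (%n. avg (dy j) (u (s n)) k))"
 have "EX N. ALL n>=N. ALL k:I j. ?e j n k <= (1/2) ^ j" for j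
 proof -
  have "eventually (%n. ?e j n k < (1/2) ^ j) sequentially" for k
  proof -
   have "(%n. avg (dy j) (u (s n)) k) ----> lim (%n. avg (dy j) (u (s n)) k)" using s(2)[of "to_nat (j, k)"] by(simp add: a_def ix_def flip: convergent_LIMSEQ_iff)
   from tendstoD[OF this, of "(1/2) ^ j"] show ?thesis by(simp add: dist_real_def)
  qed
  hence "eventually (%n. ALL k:I j. ?e j n k < (1/2) ^ j) sequentially" by(intro eventually_ball_finite[OF I] ballI)
  thus ?thesis by(auto simp: eventually_sequentially intro: less_imp_le)
 qed
 then obtain t where t: "strict_mono t" "!!j n. n >= t j ==> ALL k:I j. ?e j n k <= (1/2) ^ j"
  using fast_subsequence[of "%j n. ALL k:I j. ?e j n k <= (1/2) ^ j"] by metis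
 have PQ0: "(%j. ?P j (t j) x - Q j x) ----> 0" for x
 proof (rule Lim_null_comparison)
  show "eventually (%j. norm (?P j (t j) x - Q j x) <= (1/2) ^ j) sequentially"
  proof (rule eventually_sequentiallyI[of "nat \<lceil>norm x\<rceil>"])
   fix j assume j: "nat \<lceil>norm x\<rceil> <= j"
   have "index (dy j) x $ i : {- (int j * 2 ^ j) - 1..int j * 2 ^ j}" for i
   proof -
    have "abs (x $ i) <= j" using component_le_norm_cart[of x i] j by linarith
    hence "abs (2 ^ j * x $ i) <= 2 ^ j * real j" unfolding abs_mult by(intro mult_mono) auto
    hence "abs (2 ^ j * x $ i) <= of_int (int j * 2 ^ j)" by(simp add: mult.commute)
    moreover have "floor (t) : {- b - 1..b}" if "abs t <= of_int b" for t :: real and b using that by simp linarith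
    ultimately show ?thesis unfolding index_def dy_def by simp
   qed
   hence "index (dy j) x : I j" by(simp add: I_def)
   from t(2)[OF order_refl, THEN bspec, OF this] show "norm (?P j (t j) x - Q j x) <= (1/2) ^ j" by(simp add: Q_def proj_def)
  qed
 qed (simp add: LIMSEQ_power_zero)
 have "AE x in leb. summable (%j. norm (u (s (t j)) x - ?P j (t j) x))"
 proof (rule AE_summable_of_geometric_squares[where C="4 * enn C"])
  show "(%x. u (s (t j)) x - ?P j (t j) x) : bmeas" for j using um Pm by simp
  fix j
  have "NL (%x. enn ((u (s (t j)) x - ?P j (t j) x)^2)) <= enn (4 / 4 ^ j) * grad_energy (G (s (t j)))" by(rule proj_tendsto_AE(2)[OF wg um Gm Gfin])
  also have "... <= enn (4 / 4 ^ j) * enn C" by(intro mult_left_mono Gb) simp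
  also have "enn (4 / 4 ^ j) = enn (1 / 4 ^ j) * 4"
  proof -
   have "enn (4 / 4 ^ j) = enn (1 / 4 ^ j * 4)" by simp
   also have "... = enn (1 / 4 ^ j) * enn 4" by(rule ennreal_mult) auto
   finally show ?thesis by simp
  qed
  finally show "NL (%x. enn ((norm (u (s (t j)) x - ?P j (t j) x))^2)) <= enn (1 / 4 ^ j) * (4 * enn C)" by(simp add: mult.assoc)
 qed (simp add: ennreal_mult_less_top)
 hence UP: "AE x in leb. (%j. u (s (t j)) x - ?P j (t j) x) ----> 0" by eventually_elim (rule tendsto_norm_zero_cancel, rule summable_LIMSEQ_zero)
 have "AE x in leb. convergent (%j. u ((s \<circ> t) j) x)" using Qconv UP
 proof eventually_elim
  case (elim x)
  obtain l where "(%j. Q j x) ----> l" using elim(1) by(auto simp: convergent_def)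
  hence "(%j. (u (s (t j)) x - ?P j (t j) x) + ((?P j (t j) x - Q j x) + Q j x)) ----> 0 + (0 + l)" by(intro tendsto_add elim PQ0)
  thus ?case by(auto simp: convergent_def)
 qed
 thus ?thesis using that[of "s \<circ> t"] s(1) t(1) by(simp add: strict_mono_o)
qed

lemma AE_LL:
 assumes "AE x in leb. P x"
 shows "AE z in LL. P (fst z) & P (snd z)"
proof -
 obtain N where N: "{x : space leb. ~ P x} \<subseteq> N" "emeasure leb N = 0" "N : sets leb" using assms by(rule AE_E)
 have "emeasure LL (N \<times> space leb) = 0" "emeasure LL (space leb \<times> N) = 0"
  using N by(simp_all only: lebesgue3.emeasure_pair_measure_Times sets.top mult_zero_left mult_zero_right)
 moreover have "N \<times> space leb : sets LL" "space leb \<times> N : sets LL" using N(3) by(auto intro!: pair_measureI)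
 ultimately have "(N \<times> space leb) \<union> (space leb \<times> N) : null_sets LL" by(intro null_sets.Un null_setsI)
 thus ?thesis by(rule AE_I') (use N(1) in \<open>auto simp: space_pair_measure\<close>)
qed

lemma fatou_integral_le:
 fixes g :: "nat => 'a => real"
 assumes gi: "!!n. integrable M (g n)" and g0: "!!n x. 0 <= g n x" and hm: "h : borel_measurable M" and h0: "!!x. 0 <= h x"
  and lim: "AE x in M. (%n. g n x) ----> h x" and N: "!!n. n >= N ==> (LINT x|M. g n x) <= e"
 shows "integrable M h" "(LINT x|M. h x) <= e"
proof -
 have le: "nn_integral M (%x. enn (h x)) <= enn e"
 proof (rule nn_integral_fatou_bound[OF borel_measurable_integrable[OF gi] lim])
  show "nn_integral M (%x. enn (g n x)) <= enn e" if "n >= N" for n unfolding nn_integral_eq_integral[OF gi AE_I2[OF g0]] using N that by(intro ennreal_leI) simp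
 qed
 thus "integrable M h" by(intro integrableI_nonneg hm AE_I2 h0) (auto intro: order_le_less_trans)
 moreover have "0 <= (LINT x|M. g N x)" by(intro integral_nonneg_AE AE_I2 g0)
 hence "0 <= e" using N[of N] by simp
 ultimately show "(LINT x|M. h x) <= e" using le h0 by(simp add: nn_integral_eq_integral)
qed

text \<open>Fatou's lemma in the first index turns a Cauchy condition in the mean into convergence
  to the pointwise limit. It is used for gradients, sixth powers and Coulomb energies alike.\<close>

lemma integral_tendsto_zero_of_cauchy:
 fixes d :: "nat => nat => 'a => real"
 assumes di: "!!i n. integrable M (d i n)" and d0: "!!i n x. 0 <= d i n x"
  and hm: "!!n. h n : borel_measurable M" and h0: "!!n x. 0 <= h n x"
  and lim: "!!n. AE x in M. (%i. d i n x) ----> h n x"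
  and c: "!!e. e > 0 ==> EX N. ALL i>=N. ALL n>=N. (LINT x|M. d i n x) <= e"
 shows "(%n. LINT x|M. h n x) ----> 0 & (EX n. integrable M (h n))"
proof
 have b: "integrable M (h n) & (LINT x|M. h n x) <= e" if "ALL i>=N. (LINT x|M. d i n x) <= e" for N n e
  using fatou_integral_le[OF di d0 hm h0 lim, of N n e] that by blast
 show "(%n. LINT x|M. h n x) ----> 0"
 proof (rule tendstoI)
  fix e :: real assume e: "e > 0"
  then obtain N where N: "ALL i>=N. ALL n>=N. (LINT x|M. d i n x) <= e / 2" using c[of "e / 2"] by auto
  have "dist (LINT x|M. h n x) 0 < e" if "n >= N" for n
  proof -
   have "(LINT x|M. h n x) <= e / 2" using b[of N n "e / 2"] N that by blast
   moreover have "0 <= (LINT x|M. h n x)" by(intro integral_nonneg_AE AE_I2 h0)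
   ultimately show ?thesis using e by(simp add: dist_real_def)
  qed
  thus "eventually (%n. dist (LINT x|M. h n x) 0 < e) sequentially" by(auto simp: eventually_sequentially)
 qed
 obtain N where "ALL i>=N. ALL n>=N. (LINT x|M. d i n x) <= 1" using c[of 1] by auto
 hence "integrable M (h N)" using b[of N N 1] by blast
 thus "EX n. integrable M (h n)" ..
qed

text \<open>The elementary bound |t| <= dl + |t|^q / dl^(q-1) with small \<open>dl\<close> controls
  the pairing by a small constant plus a multiple of the vanishing integral.\<close>

lemma test_integral_tendsto_zero:
 fixes f :: "nat => fn"
 assumes q: "q >= (1::nat)" and fi: "!!n. integ (%x. abs (f n x) ^ q)" and fh: "!!n. integ (%x. f n x * h x)"
  and f0: "(%n. LI (%x. abs (f n x) ^ q)) ----> 0"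
  and h: "continuous_on UNIV h" and K: "compact K" "!!x. x ~: K ==> h x = 0"
 shows "(%n. LI (%x. f n x * h x)) ----> 0"
proof (rule tendstoI)
 fix e :: real assume e: "e > 0"
 obtain M where M: "M >= 0" "!!x. norm (h x) <= M * ind K x" using continuous_compact_support_bounded[OF h K] by blast
 have Ki: "integ (%x. M * ind K x :: real)" using K(1) emeasure_bounded_finite[OF compact_imp_bounded[OF K(1)]]
  by(intro integrable_mult_right integrable_real_indicator) (simp_all add: compact_imp_closed borel_closed)
 define c where "c = LI (%x. M * ind K x)"
 have c: "c >= 0" unfolding c_def using M(1) by(intro integral_nonneg_AE AE_I2) simp
 define dl where "dl = e / (c + 1)"
 have dl: "dl > 0" using e c by(simp add: dl_def)
 have "dl * c = e - dl" using c by(simp add: dl_def field_simps)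
 hence dlc: "dl * c < e" using dl by simp
 have t: "abs t <= dl + abs t ^ q / dl ^ (q - 1)" for t :: real
 proof (cases "abs t <= dl")
  case False
  hence "abs t * dl ^ (q - 1) <= abs t * abs t ^ (q - 1)" using dl by(intro mult_left_mono power_mono) auto
  also have "... = abs t ^ q" using q by(simp add: power_Suc[symmetric] del: power_Suc)
  finally have "abs t <= abs t ^ q / dl ^ (q - 1)" using dl by(simp add: pos_le_divide_eq)
  thus ?thesis using dl by simp
 qed (use dl in \<open>simp add: add_increasing2\<close>)
 have le: "abs (LI (%x. f n x * h x)) <= dl * c + M / dl ^ (q - 1) * LI (%x. abs (f n x) ^ q)" for n
 proof -
  have "abs (LI (%x. f n x * h x)) <= LI (%x. abs (f n x * h x))" by(rule integral_abs_bound)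
  also have "... <= LI (%x. dl * (M * ind K x) + M / dl ^ (q - 1) * abs (f n x) ^ q)"
  proof (rule integral_mono[OF integrable_abs[OF fh]])
   show "integ (%x. dl * (M * ind K x) + M / dl ^ (q - 1) * abs (f n x) ^ q)" by(intro Lintegrable_add integrable_mult_right Ki fi)
   fix x
   have "abs (f n x * h x) <= (dl + abs (f n x) ^ q / dl ^ (q - 1)) * (M * ind K x)" unfolding abs_mult using t M(2)[of x] dl by(intro mult_mono) auto
   also have "... <= dl * (M * ind K x) + M / dl ^ (q - 1) * abs (f n x) ^ q" using M(1) dl by(cases "x : K") (simp_all add: algebra_simps)
   finally show "abs (f n x * h x) <= dl * (M * ind K x) + M / dl ^ (q - 1) * abs (f n x) ^ q" .
  qed
  also have "... = dl * c + M / dl ^ (q - 1) * LI (%x. abs (f n x) ^ q)"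
   unfolding c_def by(subst Lintegral_add[OF integrable_mult_right[OF Ki] integrable_mult_right[OF fi]]) (simp only: integral_mult_right_zero)
  finally show ?thesis .
 qed
 have "(%n. dl * c + M / dl ^ (q - 1) * LI (%x. abs (f n x) ^ q)) ----> dl * c + M / dl ^ (q - 1) * 0" by(intro tendsto_add tendsto_mult tendsto_const f0)
 hence "eventually (%n. dl * c + M / dl ^ (q - 1) * LI (%x. abs (f n x) ^ q) < e) sequentially" by(rule order_tendstoD(2)) (use dlc in simp)
 thus "eventually (%n. dist (LI (%x. f n x * h x)) 0 < e) sequentially" by eventually_elim (simp add: dist_real_def order_le_less_trans[OF le])
qed

definition gform :: "fn => fn => real" where
 "gform u v = LI (%x. weak_grad u x \<bullet> weak_grad v x)"

definition coulomb_energy :: "fn => real" where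
 "coulomb_energy u = coulomb (%x. (u x)^2) (%x. (u x)^2)"

lemma gform_AE:
 assumes "wgrad u G" "wgrad v H"
 shows "gform u v = LI (%x. G x \<bullet> H x)"
proof -
 have m: "F : bmeas" if "wgrad w F" for w F using that by(auto simp: has_weak_gradient_def intro: locally_integrable_measurable)
 show ?thesis unfolding gform_def
  by(intro integral_cong_AE borel_measurable_inner m[OF weak_grad_AE(1)[OF assms(1)]] m[OF weak_grad_AE(1)[OF assms(2)]] m[OF assms(1)] m[OF assms(2)])
   (use weak_grad_AE(2)[OF assms(1)] weak_grad_AE(2)[OF assms(2)] in auto)
qed

lemma ennreal_gform:
 assumes "wgrad u G" "integ (%x. (norm (G x))^2)"
 shows "enn (gform u u) = grad_energy G"
proof -
 have "enn (LI (%x. (norm (G x))^2)) = grad_energy G" unfolding grad_energy_def by(rule nn_integral_eq_integral[symmetric, OF assms(2)]) simp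
 thus ?thesis unfolding gform_AE[OF assms(1,1)] by(simp add: power2_norm_eq_inner)
qed

lemma gform_nonneg: "gform u u >= 0" unfolding gform_def by(intro integral_nonneg_AE AE_I2) simp

lemma D12_diff:
 assumes "u : D12" "v : D12"
 shows "(%x. u x - v x) : D12" "wgrad (%x. u x - v x) (%x. weak_grad u x - weak_grad v x)"
  "integ (%x. (norm (weak_grad u x - weak_grad v x))^2)"
proof -
 show "(%x. u x - v x) : D12" using D12_add[OF assms(1) D12_scale[OF assms(2), of "-1"]] by simp
 show "wgrad (%x. u x - v x) (%x. weak_grad u x - weak_grad v x)"
  using has_weak_gradient_add[OF D12_dest(3)[OF assms(1)] has_weak_gradient_scale[OF D12_dest(3)[OF assms(2)], of "-1"]] by simp
 show "integ (%x. (norm (weak_grad u x - weak_grad v x))^2)"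
  using integrable_norm_square_add[of "weak_grad u" leb "%x. - weak_grad v x"] D12_dest(4,5)[OF assms(1)] D12_dest(4,5)[OF assms(2)] by simp
qed

lemma E_diff: "u : E ==> v : E ==> (%x. u x - v x) : E" using E_add[OF _ E_scale[of v "-1"], of u] by simp

lemma sobolev_D12:
 assumes "u : D12"
 shows "LI (%x. abs (u x) ^ 6) <= 262144 * gform u u ^ 3"
proof -
 note d = D12_dest[OF assms]
 have g: "grad_energy (weak_grad u) = enn (gform u u)" by(rule ennreal_gform[OF d(3,5), symmetric])
 have "enn (LI (%x. abs (u x) ^ 6)) = NL (%x. enn (abs (u x) ^ 6))" by(rule nn_integral_eq_integral[symmetric, OF d(2)]) simp
 also have "... <= 262144 * (enn (gform u u)) ^ 3" using sobolev_inequality[OF d(3,1,2,4)] by(simp add: g)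
 also have "... = enn (262144 * gform u u ^ 3)" using gform_nonneg[of u] by(simp add: ennreal_mult ennreal_power)
 finally show ?thesis using gform_nonneg[of u] by(subst (asm) ennreal_le_iff) auto
qed

text \<open>The limit function is prescribed by convergence almost everywhere, which
  \<open>rellich_AE\<close> supplies. Its weak gradient is built from a rapidly convergent
  subsequence of gradients, and the sixth powers are Cauchy by the Sobolev inequality.\<close>

theorem E_complete:
 assumes u: "!!n. u n : E" and conv: "AE x in leb. convergent (%n. u n x)"
  and A: "!!e. e > 0 ==> EX N. ALL m>=N. ALL n>=N. gform (%x. u m x - u n x) (%x. u m x - u n x) <= e"
  and B: "!!e. e > 0 ==> EX N. ALL m>=N. ALL n>=N. coulomb_energy (%x. u m x - u n x) <= e"
 obtains w where "w : E" "(%n. gform (%x. u n x - w x) (%x. u n x - w x)) ----> 0"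
  "(%n. coulomb_energy (%x. u n x - w x)) ----> 0"
proof -
 let ?A = "%m n. gform (%x. u m x - u n x) (%x. u m x - u n x)"
 have uD: "u n : D12" for n using u by(simp add: E_iff)
 note d = D12_dest[OF uD] and dd = D12_diff[OF uD uD]
 define w where "w x = lim (%n. u n x)" for x
 have wm: "w : bmeas" unfolding w_def by(rule borel_measurable_lim_metric) (rule d(1))
 have uw: "AE x in leb. (%n. u n x) ----> w x" using conv by eventually_elim (simp add: w_def convergent_LIMSEQ_iff)
 define G where "G n = weak_grad (u n)" for n
 have Gm: "G n : bmeas" for n unfolding G_def by(rule d(4))
 have Gi: "integ (%x. (norm (G m x - G n x))^2)" for m n unfolding G_def by(rule dd(3))
 have AG: "LI (%x. (norm (G m x - G n x))^2) = ?A m n" for m n unfolding gform_AE[OF dd(2) dd(2)] by(simp add: G_def power2_norm_eq_inner)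
 obtain r where r: "strict_mono r" "!!k n. n >= r k ==> (ALL i>=n. ?A i n <= 1 / 4 ^ k)"
 proof -
  have ex: "EX N. ALL n>=N. ALL i>=n. ?A i n <= 1 / 4 ^ k" for k :: nat
  proof -
   obtain N where N: "ALL m>=N. ALL n>=N. ?A m n <= 1 / 4 ^ k" using A[of "1 / 4 ^ k"] by auto
   hence "ALL n>=N. ALL i>=n. ?A i n <= 1 / 4 ^ k" by(meson order_trans)
   thus ?thesis ..
  qed
  show ?thesis by(rule fast_subsequence[of "%k n. ALL i>=n. ?A i n <= 1 / 4 ^ k"]) (use ex that in blast)+
 qed
 have "AE x in leb. summable (%k. norm (G (r (Suc k)) x - G (r k) x))"
 proof (rule AE_summable_of_geometric_squares[where C=1])
  show "(%x. G (r (Suc k)) x - G (r k) x) : bmeas" for k using Gm by simp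
  show "NL (%x. enn ((norm (G (r (Suc k)) x - G (r k) x))^2)) <= enn (1 / 4 ^ k) * 1" for k
   using r(2)[of k "r k"] strict_mono_leD[OF r(1), of k "Suc k"] by(simp add: nn_integral_eq_integral[OF Gi] AG ennreal_leI)
 qed simp
 hence Gconv: "AE x in leb. convergent (%k. G (r k) x)" by eventually_elim (rule convergent_of_summable_differences)
 define H where "H x = lim (%k. G (r k) x)" for x
 have Hm: "H : bmeas" unfolding H_def by(rule borel_measurable_lim_metric) (rule Gm)
 have GH: "AE x in leb. (%k. G (r k) x) ----> H x" using Gconv by eventually_elim (simp add: H_def convergent_LIMSEQ_iff)
 have rk: "k <= r k" for k using r(1) by(rule strict_mono_imp_increasing)
 have A': "EX N. ALL i>=N. ALL n>=N. ?A (r i) n <= e" if "e > 0" for e using A[OF that] rk by(meson order_trans)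
 have grad: "(%n. LI (%x. (norm (H x - G n x))^2)) ----> 0 & (EX n. integ (%x. (norm (H x - G n x))^2))"
 proof (rule integral_tendsto_zero_of_cauchy[where d="%i n x. (norm (G (r i) x - G n x))^2", OF Gi])
  show "AE x in leb. (%i. (norm (G (r i) x - G n x))^2) ----> (norm (H x - G n x))^2" for n using GH by eventually_elim (intro tendsto_intros)
  show "EX N. ALL i>=N. ALL n>=N. LI (%x. (norm (G (r i) x - G n x))^2) <= e" if "e > 0" for e unfolding AG by(rule A'[OF that])
 qed (use Hm Gm in simp_all)
 have six: "(%n. LI (%x. abs (w x - u n x) ^ 6)) ----> 0 & (EX n. integ (%x. abs (w x - u n x) ^ 6))"
 proof (rule integral_tendsto_zero_of_cauchy[where d="%i n x. abs (u i x - u n x) ^ 6", OF D12_dest(2)[OF dd(1)]])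
  show "(%x. abs (w x - u n x) ^ 6) : bmeas" for n using wm d(1) by simp
  show "AE x in leb. (%i. abs (u i x - u n x) ^ 6) ----> abs (w x - u n x) ^ 6" for n using uw by eventually_elim (intro tendsto_intros)
  fix e :: real assume e: "e > 0"
  define e' where "e' = min 1 (e / 262144)"
  have e': "e' > 0" "e' <= 1" "262144 * e' <= e" using e by(auto simp: e'_def min_def)
  have "e' ^ 3 <= e' ^ 1" using e' by(intro power_decreasing) auto
  hence le: "262144 * e' ^ 3 <= e" using e' by simp
  obtain N where N: "ALL m>=N. ALL n>=N. ?A m n <= e'" using A[OF e'(1)] by auto
  have "LI (%x. abs (u i x - u n x) ^ 6) <= e" if "i >= N" "n >= N" for i n
  proof -
   have "?A i n ^ 3 <= e' ^ 3" using N that by(intro power_mono gform_nonneg) auto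
   thus ?thesis using sobolev_D12[OF dd(1), of i n] le by linarith
  qed
  thus "EX N. ALL i>=N. ALL n>=N. LI (%x. abs (u i x - u n x) ^ 6) <= e" by blast
 qed simp_all
 let ?d = "%v. pdens (%x. (v x)^2) (%x. (v x)^2)"
 have cf: "cfin (%x. (u i x - u n x)^2)" for i n using E_diff[OF u u, of i n] by(simp add: E_iff)
 have coul: "(%n. LINT z|LL. ?d (%x. u n x - w x) z) ----> 0 & (EX n. integrable LL (?d (%x. u n x - w x)))"
 proof (rule integral_tendsto_zero_of_cauchy[where d="%i n. ?d (%x. u n x - u i x)", OF cfin_pair[OF cf cf]])
  show "?d (%x. u n x - w x) : borel_measurable LL" for n by(intro pdens_measurable) (use d(1) wm in simp_all)
  show "AE z in LL. (%i. ?d (%x. u n x - u i x) z) ----> ?d (%x. u n x - w x) z" for n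
   using AE_LL[OF uw] unfolding pdens_def divide_inverse by eventually_elim (intro tendsto_intros; simp)
  show "EX N. ALL i>=N. ALL n>=N. (LINT z|LL. ?d (%x. u n x - u i x) z) <= e" if "e > 0" for e using B[OF that] unfolding coulomb_energy_def coulomb_def by blast
 qed (simp_all add: pdens_nonneg)
 have w6: "integ (%x. abs (w x) ^ 6)"
 proof -
  obtain n where n: "integ (%x. abs (w x - u n x) ^ 6)" using six by blast
  from integrable_sixth_add[OF _ n d(1)[of n] d(2)[of n]] wm d(1)[of n] show ?thesis by simp
 qed
 have H2: "integ (%x. (norm (H x))^2)"
 proof -
  obtain n where n: "integ (%x. (norm (H x - G n x))^2)" using grad by blast
  from integrable_norm_square_add[OF _ n Gm[of n]] d(5)[of n] Hm Gm[of n] show ?thesis by(simp add: G_def)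
 qed
 have HG: "integ (%x. (norm (H x - G n x))^2)" for n using integrable_norm_square_add[of H leb "%x. - G n x"] Gm Hm H2 d(5)[of n] by(simp add: G_def)
 have wu6: "integ (%x. abs (w x - u n x) ^ 6)" for n using integrable_sixth_add[OF wm w6, of "%x. - u n x"] d(1,2)[of n] by simp
 have wl: "loc_int w" using locally_integrable_of_power[OF wm, of 6] w6 by simp
 have Hl: "loc_int H" using locally_integrable_of_power[OF Hm, of 2] H2 by simp
 have wH: "wgrad w H" unfolding has_weak_gradient_def
 proof (intro conjI wl Hl ballI allI)
  fix ph i assume ph: "ph : test_functions"
  obtain K where K: "compact K" "!!x. x ~: K ==> ph x = 0" "!!x i. x ~: K ==> pd i ph x = 0" using test_function_support[OF ph] by metis
  note cont = test_function_continuous[OF ph] test_function_partial_continuous[OF ph, of i]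
  have wi: "integ (%x. w x * pd i ph x)" by(rule locally_integrable_times[OF wl cont(2) K(1) K(3)])
  have Hi: "integ (%x. H x $ i * ph x)" by(rule locally_integrable_times[OF locally_integrable_component[OF Hl] cont(1) K(1) K(2)])
  have ui: "integ (%x. u n x * pd i ph x)" "integ (%x. G n x $ i * ph x)" for n using weak_gradient_test_integrable[OF d(3) ph] by(simp_all add: G_def)
  have 1: "(%n. LI (%x. (w x - u n x) * pd i ph x)) ----> 0" by(rule test_integral_tendsto_zero[OF _ wu6 _ six[THEN conjunct1] cont(2) K(1) K(3)])
    (use Lintegrable_diff[OF wi ui(1)] in \<open>simp_all add: left_diff_distrib\<close>)
  have cle: "abs (H x $ i - G n x $ i) ^ 2 <= (norm (H x - G n x))^2" for n x using component_le_norm_cart[of "H x - G n x" i] by(intro power_mono) auto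
  have ci: "integ (%x. abs (H x $ i - G n x $ i) ^ 2)" for n by(rule Lintegrable_bound[OF HG[of n]])
    (use cle in \<open>auto intro!: borel_measurable_power borel_measurable_diff component_measurable Hm Gm\<close>)
  have 2: "(%n. LI (%x. (H x $ i - G n x $ i) * ph x)) ----> 0"
  proof (rule test_integral_tendsto_zero[OF _ ci _ _ cont(1) K(1) K(2)])
   show "integ (%x. (H x $ i - G n x $ i) * ph x)" for n using Lintegrable_diff[OF Hi ui(2)] by(simp add: left_diff_distrib)
   show "(%n. LI (%x. abs (H x $ i - G n x $ i) ^ 2)) ----> 0" by(rule tendsto_sandwich[OF _ _ tendsto_const grad[THEN conjunct1]])
     (use integral_mono[OF ci HG cle] in \<open>auto intro!: always_eventually integral_nonneg_AE\<close>)
  qed simp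
  have "LI (%x. (w x - u n x) * pd i ph x) + LI (%x. (H x $ i - G n x $ i) * ph x)
    = LI (%x. w x * pd i ph x) + LI (%x. H x $ i * ph x)" for n
  proof -
   have "LI (%x. u n x * pd i ph x) = - LI (%x. G n x $ i * ph x)" using d(3)[of n] ph by(simp add: has_weak_gradient_def G_def)
   thus ?thesis unfolding left_diff_distrib by(subst Lintegral_diff[OF wi ui(1)], subst Lintegral_diff[OF Hi ui(2)]) simp
  qed
  hence "LI (%x. w x * pd i ph x) + LI (%x. H x $ i * ph x) = 0" using tendsto_add[OF 1 2] by(simp add: LIMSEQ_const_iff)
  thus "LI (%x. w x * pd i ph x) = - LI (%x. H x $ i * ph x)" by linarith
 qed
 have wE: "w : E"
 proof -
  obtain n where "integrable LL (?d (%x. u n x - w x))" using coul by blast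
  hence cf: "cfin (%x. (u n x - w x)^2)" using d(1) wm by(simp add: cfin_def)
  have cu: "cfin (%x. (u n x)^2)" using u by(simp add: E_iff)
  have "cfin (%x. (w x)^2)"
  proof (rule cfin_mono[OF cfin_scale[OF cfin_add[OF cu cf], of 2]])
   show "(%x. (w x)^2) : bmeas" using wm by simp
   fix x
   have "2 * ((u n x)^2 + (u n x - w x)^2) = (w x)^2 + (2 * u n x - w x)^2" by(simp add: power2_eq_square algebra_simps)
   hence "(w x)^2 <= 2 * ((u n x)^2 + (u n x - w x)^2)" by simp
   thus "abs ((w x)^2) <= abs (2 * ((u n x)^2 + (u n x - w x)^2))" by simp
  qed
  thus ?thesis using D12_intro[OF wm w6 wH H2] by(simp add: E_iff)
 qed
 have hg: "wgrad (%x. u n x - w x) (%x. G n x - H x)" for n using has_weak_gradient_add[OF d(3) has_weak_gradient_scale[OF wH, of "-1"]] by(simp add: G_def)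
 have "(%n. gform (%x. u n x - w x) (%x. u n x - w x)) ----> 0" using grad by(simp add: gform_AE[OF hg hg] norm_minus_commute flip: power2_norm_eq_inner)
 moreover have "(%n. coulomb_energy (%x. u n x - w x)) ----> 0" using coul unfolding coulomb_energy_def coulomb_def by blast
 ultimately show ?thesis by(rule that[OF wE])
qed

section \<open>The forms of the energy functional\<close>

text \<open>By Young's inequality the set where \<open>f u u <= 1\<close> is convex, and the k-th
  root of \<open>f u u\<close> is its gauge.\<close>

lemma root_seminorm:
 fixes E :: "'v::real_vector set" and f :: "'v => 'v => real"
 assumes E: "subspace E" and k: "k > 1"
  and add: "!!u v w. u : E ==> v : E ==> w : E ==> f u (v + w) = f u v + f u w"
  and scale: "!!u v t. u : E ==> v : E ==> f u (t *R v) = t * f u v"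
  and young: "!!u w. u : E ==> w : E ==> k * f u w <= (k - 1) * f u u + f w w"
  and hom: "!!u t. u : E ==> f (t *R u) (t *R u) = abs t powr k * f u u"
  and nonneg: "!!u. u : E ==> 0 <= f u u"
 shows "u : E ==> v : E ==> f (u + v) (u + v) powr (1 / k) <= f u u powr (1 / k) + f v v powr (1 / k)"
  and "u : E ==> f (t *R u) (t *R u) powr (1 / k) = abs t * f u u powr (1 / k)"
proof -
 assume u: "u : E" and v: "v : E"
 define al where "al = f u u powr (1 / k)"
 define be where "be = f v v powr (1 / k)"
 have le: "f (u + v) (u + v) powr (1 / k) <= al' + be'" if "al' > al" "be' > be" for al' be'
 proof -
  have pos: "al' > 0" "be' > 0" using that by(auto simp: al_def be_def intro: le_less_trans[OF powr_ge_zero])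
  have Fle: "f (inverse s *R w) (inverse s *R w) <= 1" if w: "w : E" and s: "f w w powr (1 / k) < s" "s > 0" for w s
  proof -
   have "f w w = (f w w powr (1 / k)) powr k" using nonneg[OF w] k by(simp add: powr_powr)
   also have "... <= s powr k" using s k by(intro powr_mono2) auto
   finally have "f w w <= s powr k" .
   moreover have "inverse s powr k * s powr k = 1" using s by(simp add: powr_mult[symmetric])
   ultimately show ?thesis using mult_left_mono[of "f w w" "s powr k" "inverse s powr k"] s by(simp add: hom[OF w])
  qed
  \<comment> \<open>The scales \<open>al'\<close> and \<open>be'\<close> exceed the two roots
    strictly, so that normalisation is possible even when one of the roots is 0.\<close>
  define x where "x = inverse al' *R u"
  define y where "y = inverse be' *R v"
  define sg where "sg = al' / (al' + be')"
  define ta where "ta = be' / (al' + be')"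
  have st: "sg >= 0" "ta >= 0" "sg + ta = 1" using pos by(auto simp: sg_def ta_def add_divide_distrib[symmetric])
  define m where "m = sg *R x + ta *R y"
  have xE: "x : E" "y : E" using u v E by(auto simp: x_def y_def subspace_scale)
  have mE: "m : E" using xE E by(auto simp: m_def subspace_scale subspace_add)
  have fx: "f x x <= 1" "f y y <= 1" unfolding x_def y_def by(rule Fle; use u v that pos in \<open>simp add: al_def be_def\<close>)+
  have "k * f m m = k * f m (sg *R x + ta *R y)" by(simp add: m_def[symmetric])
  also have "... = sg * (k * f m x) + ta * (k * f m y)" using mE xE E by(simp add: add scale subspace_scale algebra_simps)
  also have "... <= sg * ((k - 1) * f m m + 1) + ta * ((k - 1) * f m m + 1)" using young[OF mE xE(1)] young[OF mE xE(2)] fx st by(intro add_mono mult_left_mono) auto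
  also have "... = (sg + ta) * ((k - 1) * f m m + 1)" by(simp add: distrib_right)
  also have "... = (k - 1) * f m m + 1" using st by simp
  finally have fm: "f m m <= 1" by(simp add: algebra_simps)
  have "u + v = (al' + be') *R m"
  proof -
   have "(al' + be') *R m = (((al' + be') * sg) * inverse al') *R u + (((al' + be') * ta) * inverse be') *R v"
    by(simp add: m_def x_def y_def scaleR_right_distrib mult.assoc)
   moreover have "((al' + be') * sg) * inverse al' = 1" "((al' + be') * ta) * inverse be' = 1" using pos add_pos_pos[OF pos] by(simp_all add: sg_def ta_def)
   ultimately show ?thesis by simp
  qed
  hence "f (u + v) (u + v) = (al' + be') powr k * f m m" using hom[OF mE, of "al' + be'"] pos by simp
  also have "... <= (al' + be') powr k * 1" by(intro mult_left_mono fm) simp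
  finally have "f (u + v) (u + v) powr (1 / k) <= ((al' + be') powr k) powr (1 / k)" using k nonneg[of "u + v"] u v E by(intro powr_mono2) (auto simp: subspace_add)
  thus ?thesis using k pos by(simp add: powr_powr)
 qed
 have "f (u + v) (u + v) powr (1 / k) <= al + be"
 proof (rule field_le_epsilon)
  fix e :: real assume "e > 0"
  thus "f (u + v) (u + v) powr (1 / k) <= al + be + e" using le[of "al + e/2" "be + e/2"] by simp
 qed
 thus "f (u + v) (u + v) powr (1 / k) <= f u u powr (1 / k) + f v v powr (1 / k)" by(simp add: al_def be_def)
next
 assume u: "u : E"
 have "(abs t powr k * f u u) powr (1 / k) = (abs t powr k) powr (1 / k) * f u u powr (1 / k)" by(rule powr_mult)
 thus "f (t *R u) (t *R u) powr (1 / k) = abs t * f u u powr (1 / k)" using k by(simp add: hom[OF u] powr_powr)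
qed

text \<open>The odd power |t|^(q-2) t, that is, 1/q times the derivative of |t|^q.\<close>

definition spow :: "real => real => real" where
 "spow q t = abs t powr (q - 2) * t"

lemma abs_spow: "q > 2 ==> abs (spow q t) = abs t powr (q - 1)" using powr_mult_base[of "abs t" "q - 2"] by(simp add: spow_def abs_mult mult.commute)

lemma spow_self: "spow q t * t = abs t powr q"
proof -
 have "spow q t * t = abs t * (abs t * abs t powr (q - 2))" by(simp add: spow_def mult.assoc[symmetric])
 also have "... = abs t powr (1 + (1 + (q - 2)))" by(simp only: powr_mult_base abs_ge_zero)
 finally show ?thesis by simp
qed

lemma spow_young:
 assumes q: "q > 2"
 shows "q * abs (spow q s * t) <= (q - 1) * abs s powr q + abs t powr q"
proof -
 have "abs s powr (q - 1) * abs t <= (abs s powr (q - 1)) powr (q / (q - 1)) / (q / (q - 1)) + abs t powr q / q"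
  using q by(intro Youngs_inequality) (auto simp: field_simps)
 also have "(abs s powr (q - 1)) powr (q / (q - 1)) = abs s powr q" using q by(simp add: powr_powr)
 finally have "q * (abs s powr (q - 1) * abs t) <= q * (abs s powr q / (q / (q - 1)) + abs t powr q / q)" using q by(intro mult_left_mono) auto
 also have "... = (q - 1) * abs s powr q + abs t powr q" using q by(simp add: field_simps)
 finally show ?thesis using q by(simp add: abs_mult abs_spow)
qed

lemma abs_add_powr_le:
 fixes a b :: real
 assumes "q > 0"
 shows "abs (a + b) powr q <= 2 powr q * (abs a powr q + abs b powr q)"
proof -
 have "abs (a + b) powr q <= (2 * max (abs a) (abs b)) powr q" using assms by(intro powr_mono2) auto
 also have "... = 2 powr q * max (abs a) (abs b) powr q" by(simp add: powr_mult)
 also have "max (abs a) (abs b) powr q <= abs a powr q + abs b powr q" by(cases "abs a <= abs b") (auto simp: max_def)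
 finally show ?thesis by simp
qed

lemma spow_tendsto:
 assumes q: "q > 2" and t: "(f ---> t) F"
 shows "((%x. spow q (f x)) ---> spow q t) F" unfolding spow_def using q by(intro tendsto_mult t tendsto_powr' tendsto_rabs tendsto_const) auto

text \<open>Powers of a function integrated against a weight. The weights used below are \<open>lam * g\<close> with
 exponent \<open>p\<close> and \<open>1\<close> with exponent \<open>6\<close>.\<close>

definition power_form :: "fn => real => fn => fn => real" where
 "power_form w q u v = LI (%x. w x * (spow q (u x) * v x))"

definition power_finite :: "fn => real => fn => bool" where
 "power_finite w q u <-> u : bmeas & integ (%x. w x * abs (u x) powr q)"

locale power_weight =
 fixes w :: fn and q :: real
 assumes q: "q > 2" and wm: "w : bmeas" and w0: "!!x. 0 <= w x"
begin

lemma spow_measurable: "u : bmeas ==> (%x. spow q (u x)) : bmeas" unfolding spow_def by(intro borel_measurable_times measurable_abs_powr)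

lemma integrable_form:
 assumes "power_finite w q u" "power_finite w q v"
 shows "integ (%x. w x * (spow q (u x) * v x))"
proof (rule Lintegrable_bound)
 show "integ (%x. (q - 1) * (w x * abs (u x) powr q) + w x * abs (v x) powr q)" using assms by(simp add: power_finite_def)
 show "(%x. w x * (spow q (u x) * v x)) : bmeas" using assms wm by(intro borel_measurable_times spow_measurable) (auto simp: power_finite_def)
 show "AE x in leb. norm (w x * (spow q (u x) * v x)) <= norm ((q - 1) * (w x * abs (u x) powr q) + w x * abs (v x) powr q)"
 proof (rule AE_I2)
  fix x
  have "1 * abs (spow q (u x) * v x) <= q * abs (spow q (u x) * v x)" using q by(intro mult_right_mono) auto
  also have "... <= (q - 1) * abs (u x) powr q + abs (v x) powr q" by(rule spow_young[OF q])
  finally have "w x * abs (spow q (u x) * v x) <= w x * ((q - 1) * abs (u x) powr q + abs (v x) powr q)" using w0[of x] by(intro mult_left_mono) auto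
  also have "... = (q - 1) * (w x * abs (u x) powr q) + w x * abs (v x) powr q" by(simp add: algebra_simps)
  finally have le: "w x * abs (spow q (u x) * v x) <= (q - 1) * (w x * abs (u x) powr q) + w x * abs (v x) powr q" .
  have "norm (w x * (spow q (u x) * v x)) = w x * abs (spow q (u x) * v x)" using w0[of x] by(simp only: real_norm_def abs_mult abs_of_nonneg)
  thus "norm (w x * (spow q (u x) * v x)) <= norm ((q - 1) * (w x * abs (u x) powr q) + w x * abs (v x) powr q)" unfolding real_norm_def using le by linarith
 qed
qed

lemma finite_add:
 assumes "power_finite w q u" "power_finite w q v"
 shows "power_finite w q (%x. abs (u x) + abs (v x))" "power_finite w q (%x. u x + v x)"
proof -
 have *: "power_finite w q h" if hm: "h : bmeas" and h: "!!x. abs (h x) <= abs (u x) + abs (v x)" for h unfolding power_finite_def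
 proof (rule conjI[OF hm], rule Lintegrable_bound)
  show "integ (%x. 2 powr q * (w x * abs (u x) powr q + w x * abs (v x) powr q))" using assms by(simp add: power_finite_def)
  show "(%x. w x * abs (h x) powr q) : bmeas" by(intro borel_measurable_times wm measurable_abs_powr hm)
  show "AE x in leb. norm (w x * abs (h x) powr q) <= norm (2 powr q * (w x * abs (u x) powr q + w x * abs (v x) powr q))"
  proof (rule AE_I2)
   fix x
   have "abs (h x) powr q <= abs (abs (u x) + abs (v x)) powr q" using h[of x] q by(intro powr_mono2) auto
   also have "... <= 2 powr q * (abs (u x) powr q + abs (v x) powr q)" using abs_add_powr_le[of q "abs (u x)" "abs (v x)"] q by simp
   finally have "w x * abs (h x) powr q <= w x * (2 powr q * (abs (u x) powr q + abs (v x) powr q))" by(intro mult_left_mono w0)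
   also have "... = 2 powr q * (w x * abs (u x) powr q + w x * abs (v x) powr q)" by(simp add: algebra_simps)
   finally have le: "w x * abs (h x) powr q <= 2 powr q * (w x * abs (u x) powr q + w x * abs (v x) powr q)" .
   have "norm (w x * abs (h x) powr q) = w x * abs (h x) powr q" using w0[of x] by simp
   thus "norm (w x * abs (h x) powr q) <= norm (2 powr q * (w x * abs (u x) powr q + w x * abs (v x) powr q))" unfolding real_norm_def using le by linarith
  qed
 qed
 have m: "u : bmeas" "v : bmeas" using assms by(auto simp: power_finite_def)
 show "power_finite w q (%x. abs (u x) + abs (v x))" by(rule *) (use m in simp_all)
 show "power_finite w q (%x. u x + v x)" by(rule *) (use m in \<open>simp_all add: abs_triangle_ineq\<close>)
qed

lemma form_add:
 assumes "power_finite w q u" "power_finite w q v" "power_finite w q h"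
 shows "power_form w q u (%x. v x + h x) = power_form w q u v + power_form w q u h" unfolding power_form_def distrib_left by(intro Lintegral_add integrable_form assms)

lemma form_scale: "power_form w q u (%x. t * v x) = t * power_form w q u v"
proof -
 have "power_form w q u (%x. t * v x) = LI (%x. t * (w x * (spow q (u x) * v x)))" unfolding power_form_def by(simp only: mult.left_commute)
 thus ?thesis by(simp add: power_form_def)
qed

lemma form_hom:
 assumes "t > 0"
 shows "power_form w q (%x. t * u x) v = t powr (q - 1) * power_form w q u v"
proof -
 have hs: "spow q (t * s) = t powr (q - 1) * spow q s" for s using assms powr_mult_base[of t "q - 2"] by(simp add: spow_def abs_mult powr_mult mult_ac)
 hence "power_form w q (%x. t * u x) v = LI (%x. t powr (q - 1) * (w x * (spow q (u x) * v x)))" unfolding power_form_def hs by(simp only: mult_ac)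
 thus ?thesis by(simp add: power_form_def)
qed

lemma form_odd: "power_form w q (%x. - u x) v = - power_form w q u v" by(simp add: power_form_def spow_def)

lemma form_self: "power_form w q u u = LI (%x. w x * abs (u x) powr q)" by(simp add: power_form_def spow_self)

lemma form_nonneg: "0 <= power_form w q u u" unfolding form_self using w0 by(intro integral_nonneg_AE AE_I2) simp

lemma form_young:
 assumes u: "power_finite w q u" and v: "power_finite w q v"
 shows "q * power_form w q u v <= (q - 1) * power_form w q u u + power_form w q v v"
proof -
 have i: "integ (%x. w x * abs (u x) powr q)" "integ (%x. w x * abs (v x) powr q)" using u v by(auto simp: power_finite_def)
 have "q * power_form w q u v = LI (%x. q * (w x * (spow q (u x) * v x)))" by(simp add: power_form_def)
 also have "... <= LI (%x. (q - 1) * (w x * abs (u x) powr q) + w x * abs (v x) powr q)"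
 proof (rule integral_mono)
  show "integ (%x. q * (w x * (spow q (u x) * v x)))" using integrable_form[OF u v] by simp
  show "integ (%x. (q - 1) * (w x * abs (u x) powr q) + w x * abs (v x) powr q)" using i by simp
  fix x
  have "q * (spow q (u x) * v x) <= q * abs (spow q (u x) * v x)" using q by(intro mult_left_mono) auto
  also have "... <= (q - 1) * abs (u x) powr q + abs (v x) powr q" by(rule spow_young[OF q])
  finally have "w x * (q * (spow q (u x) * v x)) <= w x * ((q - 1) * abs (u x) powr q + abs (v x) powr q)" using w0[of x] by(intro mult_left_mono)
  thus "q * (w x * (spow q (u x) * v x)) <= (q - 1) * (w x * abs (u x) powr q) + w x * abs (v x) powr q" by(simp add: algebra_simps)
 qed
 also have "... = (q - 1) * power_form w q u u + power_form w q v v" unfolding form_self using i by simp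
 finally show ?thesis .
qed

lemma form_line:
 assumes u: "power_finite w q u" and v: "power_finite w q v"
 shows "((%t. power_form w q (%x. u x + t * v x) v) ---> power_form w q u v) (at_right 0)"
proof (rule tendsto_at_right_sequentially[of 0 1])
 fix S :: "nat => real" assume S: "!!n. 0 < S n" "!!n. S n < 1" "S ----> 0"
 have m: "u : bmeas" "v : bmeas" using u v by(auto simp: power_finite_def)
 show "(%n. power_form w q (%x. u x + S n * v x) v) ----> power_form w q u v" unfolding power_form_def
 proof (rule integral_dominated_convergence[where w="%x. w x * abs (abs (u x) + abs (v x)) powr q"])
  show "integ (%x. w x * abs (abs (u x) + abs (v x)) powr q)" using finite_add(1)[OF u v] by(simp add: power_finite_def)
  show "(%x. w x * (spow q (u x) * v x)) : bmeas" by(intro borel_measurable_times wm spow_measurable m)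
  show "(%x. w x * (spow q (u x + S n * v x) * v x)) : bmeas" for n by(intro borel_measurable_times wm spow_measurable borel_measurable_add m borel_measurable_const)
  show "AE x in leb. (%n. w x * (spow q (u x + S n * v x) * v x)) ----> w x * (spow q (u x) * v x)"
  proof (rule AE_I2)
   fix x
   have "(%n. u x + S n * v x) ----> u x + 0 * v x" by(intro tendsto_intros S)
   thus "(%n. w x * (spow q (u x + S n * v x) * v x)) ----> w x * (spow q (u x) * v x)" by(intro tendsto_mult tendsto_const spow_tendsto q) simp
  qed
  show "AE x in leb. norm (w x * (spow q (u x + S n * v x) * v x)) <= w x * abs (abs (u x) + abs (v x)) powr q" for n
  proof (rule AE_I2)
   fix x
   define s where "s = abs (u x) + abs (v x)"
   have "abs (S n * v x) <= 1 * abs (v x)" unfolding abs_mult using S(1,2)[of n] by(intro mult_right_mono) auto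
   hence le: "abs (u x + S n * v x) <= s" using abs_triangle_ineq[of "u x" "S n * v x"] by(simp add: s_def)
   have "abs (spow q (u x + S n * v x) * v x) <= s powr (q - 1) * s" unfolding abs_mult abs_spow[OF q] using le q by(intro mult_mono powr_mono2) (auto simp: s_def)
   also have "... = abs s powr q" using powr_mult_base[of s "q - 1"] by(simp add: s_def mult.commute)
   finally have "w x * abs (spow q (u x + S n * v x) * v x) <= w x * abs s powr q" by(intro mult_left_mono w0)
   thus "norm (w x * (spow q (u x + S n * v x) * v x)) <= w x * abs (abs (u x) + abs (v x)) powr q" using w0[of x] by(simp add: abs_mult s_def)
  qed
 qed
qed simp

end

section \<open>The vector space of functions, the gradient form and the Coulomb form\<close>

instantiation "fun" :: (type, real_vector) real_vector
begin

definition scaleR_fun :: "real => ('a => 'b) => 'a => 'b" where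
 "scaleR_fun t f = (%x. t *R f x)"

instance by standard (auto simp: scaleR_fun_def fun_eq_iff scaleR_add_right scaleR_add_left)

end

lemma fun_ops:
 fixes u v :: fn
 shows "u + v = (%x. u x + v x)" "u - v = (%x. u x - v x)" "- u = (%x. - u x)" "t *R u = (%x. t * u x)" "0 = (%x. 0 :: real)" by(auto simp: fun_eq_iff scaleR_fun_def)

lemma has_weak_gradient_zero: "wgrad (%x. 0) (%x. 0)" by(auto simp: has_weak_gradient_def locally_integrable_def)

lemma zero_in_E: "(%x. 0) : E"
proof -
 have "(%x. 0) : D12" by(rule D12_intro[OF _ _ has_weak_gradient_zero]) auto
 moreover have "cfin (%x. 0^2)" by(rule cfin_bounded[of _ 0 1]) auto
 ultimately show ?thesis by(simp add: E_iff)
qed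

lemma E_subspace: "subspace E" unfolding subspace_def fun_ops using zero_in_E E_add E_scale by auto

lemma E_uminus: "u : E ==> (%x. - u x) : E" using E_scale[of u "-1"] by simp

lemma E_D12: "u : E ==> u : D12" and E_coulomb: "u : E ==> cfin (%x. (u x)^2)" by(auto simp: E_iff)

lemma E_measurable: "u : E ==> u : bmeas" by(intro D12_dest(1) E_D12)

lemma E_coulomb_product: "u : E ==> v : E ==> cfin (%x. u x * v x)" by(intro cfin_product E_coulomb E_measurable)

lemma integrable_inner_L2:
 fixes f g :: "'a => 'b::euclidean_space"
 assumes "f : borel_measurable M" "integrable M (%x. (norm (f x))^2)" "g : borel_measurable M" "integrable M (%x. (norm (g x))^2)"
 shows "integrable M (%x. f x \<bullet> g x)"
proof (rule Lintegrable_bound)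
 show "integrable M (%x. (norm (f x))^2 + (norm (g x))^2)" using assms by simp
 show "(%x. f x \<bullet> g x) : borel_measurable M" using assms by simp
 show "AE x in M. norm (f x \<bullet> g x) <= norm ((norm (f x))^2 + (norm (g x))^2)"
 proof (rule AE_I2)
  fix x
  have "abs (f x \<bullet> g x) <= norm (f x) * norm (g x)" by(rule Cauchy_Schwarz_ineq2)
  moreover have "2 * (norm (f x) * norm (g x)) <= (norm (f x))^2 + (norm (g x))^2" using sum_squares_bound[of "norm (f x)" "norm (g x)"] by simp
  moreover have "0 <= norm (f x) * norm (g x)" by simp
  ultimately have "abs (f x \<bullet> g x) <= (norm (f x))^2 + (norm (g x))^2" by linarith
  thus "norm (f x \<bullet> g x) <= norm ((norm (f x))^2 + (norm (g x))^2)" by simp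
 qed
qed

lemma gform_commute: "gform u v = gform v u" by(simp add: gform_def inner_commute)

lemma gform_add:
 assumes "u : E" "v : E" "w : E"
 shows "gform u (%x. v x + w x) = gform u v + gform u w"
proof -
 note d = assms[THEN E_D12]
 have "gform u (%x. v x + w x) = LI (%x. weak_grad u x \<bullet> (weak_grad v x + weak_grad w x))" by(intro gform_AE has_weak_gradient_add D12_dest d)
 also have "... = gform u v + gform u w" unfolding inner_add_right gform_def by(intro Lintegral_add integrable_inner_L2 D12_dest d)
 finally show ?thesis .
qed

lemma gform_scale:
 assumes "u : E" "v : E"
 shows "gform u (%x. t * v x) = t * gform u v"
proof -
 note d = assms[THEN E_D12]
 have "gform u (%x. t * v x) = LI (%x. weak_grad u x \<bullet> (t *R weak_grad v x))" by(intro gform_AE has_weak_gradient_scale D12_dest d)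
 thus ?thesis by(simp add: gform_def)
qed

lemma gform_scale_left: "u : E ==> v : E ==> gform (%x. t * u x) v = t * gform u v" using gform_scale[of v u t] by(simp add: gform_commute)

lemma gform_add_left: "u : E ==> v : E ==> w : E ==> gform (%x. v x + w x) u = gform v u + gform w u" using gform_add[of u v w] by(simp add: gform_commute)

lemma gform_young:
 assumes u: "u : E" and w: "w : E"
 shows "2 * gform u w <= gform u u + gform w w"
proof -
 let ?m = "%x. -1 * w x"
 have m: "?m : E" by(rule E_scale[OF w])
 have d: "(%x. u x + ?m x) : E" by(rule E_add[OF u m])
 have "0 <= gform (%x. u x + ?m x) (%x. u x + ?m x)" by(rule gform_nonneg)
 also have "... = gform (%x. u x + ?m x) u + gform (%x. u x + ?m x) ?m" by(rule gform_add[OF d u m])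
 also have "... = (gform u u + gform ?m u) + (gform u ?m + gform ?m ?m)" by(simp only: gform_add_left[OF u u m] gform_add_left[OF m u m])
 also have "... = gform u u - gform w u + (- gform u w + gform w w)"
  by(simp only: gform_scale_left[OF w u] gform_scale[OF u w] gform_scale[OF m w] gform_scale_left[OF w w]; simp)
 finally show ?thesis by(simp add: gform_commute[of w u])
qed

text \<open>With the factor 1 / (4 pi), \<open>cform u u / 4\<close> is the Coulomb part of the
  energy and \<open>cform u v\<close> that of the weak equation.\<close>

definition cform :: "fn => fn => real" where
 "cform u v = coulomb (%x. (u x)^2) (%x. u x * v x) / (4 * pi)"

lemma coulomb_mono_right:
 assumes "cfin f" "cfin g" "cfin g'" "!!x. 0 <= f x" "!!x. g x <= g' x"
 shows "coulomb f g <= coulomb f g'" unfolding coulomb_def by(intro integral_mono cfin_pair assms) (auto simp: pdens_def intro!: divide_right_mono mult_left_mono assms)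

lemma cform_self: "cform u u = coulomb_energy u / (4 * pi)" by(simp add: cform_def coulomb_energy_def power2_eq_square)

lemma coulomb_energy_nonneg: "0 <= coulomb_energy u" unfolding coulomb_energy_def by(intro coulomb_nonneg) auto

lemma cform_nonneg: "0 <= cform u u" by(simp add: cform_self coulomb_energy_nonneg)

lemma cform_add:
 assumes "u : E" "v : E" "w : E"
 shows "cform u (%x. v x + w x) = cform u v + cform u w" unfolding cform_def distrib_left
 by(subst coulomb_add_right) (auto intro: E_coulomb_product E_coulomb assms simp: add_divide_distrib)

lemma cform_scale: "cform u (%x. t * v x) = t * cform u v" using coulomb_scale_right[of "%x. (u x)^2" t "%x. u x * v x"] by(simp add: cform_def mult.left_commute)

lemma cform_hom: "cform (%x. t * u x) v = t ^ 3 * cform u v"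
proof -
 have "coulomb (%x. (t * u x)^2) (%x. t * u x * v x) = coulomb (%x. t^2 * (u x)^2) (%x. t * (u x * v x))" by(simp add: power_mult_distrib mult.assoc)
 thus ?thesis by(simp add: cform_def coulomb_scale_left coulomb_scale_right power2_eq_square power3_eq_cube)
qed

text \<open>Pointwise u w <= (u^2 + w^2) / 2 reduces the claim to the pairing of u^2 with w^2, where
  the Coulomb form is positive definite; the coefficients are 4 (1/2 + 1/4) = 3 and 4 / 4 =
  1.\<close>

lemma cform_young:
 assumes u: "u : E" and w: "w : E"
 shows "4 * cform u w <= 3 * cform u u + cform w w"
proof -
 let ?u = "%x. (u x)^2" and ?w = "%x. (w x)^2"
 note cu = E_coulomb[OF u] and cw = E_coulomb[OF w]
 have "coulomb ?u (%x. u x * w x) <= coulomb ?u (%x. 1/2 * ?u x + 1/2 * ?w x)"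
 proof (rule coulomb_mono_right[OF cu E_coulomb_product[OF u w] cfin_add[OF cfin_scale[OF cu] cfin_scale[OF cw]]])
  show "u x * w x <= 1/2 * ?u x + 1/2 * ?w x" for x using sum_squares_bound[of "u x" "w x"] by simp
 qed simp
 also have "... = 1/2 * coulomb ?u ?u + 1/2 * coulomb ?u ?w" by(simp only: coulomb_add_right[OF cfin_scale[OF cu] cfin_scale[OF cw] cu] coulomb_scale_right)
 also have "... <= 1/2 * coulomb ?u ?u + 1/4 * (coulomb ?u ?u + coulomb ?w ?w)" using coulomb_amgm[OF cu cw] by simp
 finally have "4 * coulomb ?u (%x. u x * w x) <= 3 * coulomb ?u ?u + coulomb ?w ?w" by(simp add: field_simps)
 hence "4 * coulomb ?u (%x. u x * w x) / (4 * pi) <= (3 * coulomb ?u ?u + coulomb ?w ?w) / (4 * pi)" by(rule divide_right_mono) simp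
 thus ?thesis by(simp add: cform_self coulomb_energy_def add_divide_distrib; simp add: cform_def)
qed

lemma coulomb_square_left:
 assumes u: "u : E" and v: "v : E" and f: "cfin f"
 shows "coulomb (%x. (u x + t * v x)^2) f = coulomb (%x. (u x)^2) f + 2 * t * coulomb (%x. u x * v x) f + t^2 * coulomb (%x. (v x)^2) f"
proof -
 note c = E_coulomb[OF u] cfin_scale[OF E_coulomb_product[OF u v], of "2 * t"] cfin_scale[OF E_coulomb[OF v], of "t^2"]
 have "(%x. (u x + t * v x)^2) = (%x. (u x)^2 + (2 * t * (u x * v x) + t^2 * (v x)^2))" by(simp add: fun_eq_iff power2_eq_square algebra_simps)
 thus ?thesis by(simp only: coulomb_add_left[OF c(1) cfin_add[OF c(2,3)] f] coulomb_add_left[OF c(2,3) f] coulomb_scale_left; simp)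
qed

lemma cform_line:
 assumes u: "u : E" and v: "v : E"
 shows "((%t. cform (%x. u x + t * v x) v) ---> cform u v) (at_right 0)"
proof -
 let ?uv = "%x. u x * v x" and ?u2 = "%x. (u x)^2" and ?v2 = "%x. (v x)^2"
 note c = E_coulomb[OF u] E_coulomb_product[OF u v] E_coulomb[OF v]
 have e: "coulomb (%x. (u x + t * v x)^2) (%x. (u x + t * v x) * v x)
   = (coulomb ?u2 ?uv + t * coulomb ?u2 ?v2) + 2 * t * (coulomb ?uv ?uv + t * coulomb ?uv ?v2) + t^2 * (coulomb ?v2 ?uv + t * coulomb ?v2 ?v2)" for t
 proof -
  have r: "(%x. (u x + t * v x) * v x) = (%x. ?uv x + t * ?v2 x)" by(simp add: fun_eq_iff power2_eq_square algebra_simps)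
  note s = cfin_scale[OF c(3), of t]
  have R: "coulomb f (%x. ?uv x + t * ?v2 x) = coulomb f ?uv + t * coulomb f ?v2" if "cfin f" for f by(simp only: coulomb_add_right[OF c(2) s that] coulomb_scale_right)
  show ?thesis unfolding r coulomb_square_left[OF u v cfin_add[OF c(2) s]] R[OF c(1)] R[OF c(2)] R[OF c(3)] ..
 qed
 have "((%t. ((coulomb ?u2 ?uv + t * coulomb ?u2 ?v2) + 2 * t * (coulomb ?uv ?uv + t * coulomb ?uv ?v2) + t^2 * (coulomb ?v2 ?uv + t * coulomb ?v2 ?v2)) / (4 * pi))
  ---> ((coulomb ?u2 ?uv + 0 * coulomb ?u2 ?v2) + 2 * 0 * (coulomb ?uv ?uv + 0 * coulomb ?uv ?v2) + 0^2 * (coulomb ?v2 ?uv + 0 * coulomb ?v2 ?v2)) / (4 * pi)) (at_right 0)"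
  by(intro tendsto_intros) auto
 thus ?thesis unfolding cform_def e by simp
qed

text \<open>The quadratic remainder of the Coulomb energy: the terms of second and higher order in the
 expansion of \<open>(u + h)^2 (x) (u + h)^2 (y)\<close> are dominated by \<open>u^2 \<otimes> h^2\<close> and \<open>h^2 \<otimes> h^2\<close>.\<close>

lemma coulomb_energy_taylor:
 assumes u: "u : E" and h: "h : E"
 shows "coulomb_energy (%x. u x + h x) <= coulomb_energy u + 4 * coulomb (%x. (u x)^2) (%x. u x * h x)
   + 8 * coulomb (%x. (u x)^2) (%x. (h x)^2) + 3 * coulomb_energy h"
proof -
 let ?uh = "%x. u x * h x" and ?u2 = "%x. (u x)^2" and ?h2 = "%x. (h x)^2"
 note c = E_coulomb[OF u] E_coulomb_product[OF u h] E_coulomb[OF h]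
 let ?s = "%x. (u x + 1 * h x)^2"
 have s: "cfin ?s" using E_coulomb[OF E_add[OF u h]] by simp
 have L: "coulomb ?s f = coulomb ?u2 f + 2 * coulomb ?uh f + coulomb ?h2 f" if "cfin f" for f using coulomb_square_left[OF u h that, of 1] by simp
 have "coulomb_energy (%x. u x + h x) = coulomb ?s ?s" by(simp add: coulomb_energy_def)
 also have "... = coulomb ?u2 ?s + 2 * coulomb ?uh ?s + coulomb ?h2 ?s" by(rule L[OF s])
 also have "... = coulomb ?s ?u2 + 2 * coulomb ?s ?uh + coulomb ?s ?h2" by(simp only: coulomb_commute[OF c(1) s] coulomb_commute[OF c(2) s] coulomb_commute[OF c(3) s])
 also have "... = coulomb ?u2 ?u2 + 4 * coulomb ?u2 ?uh + 2 * coulomb ?u2 ?h2 + 4 * coulomb ?uh ?uh + 4 * coulomb ?h2 ?uh + coulomb ?h2 ?h2"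
  unfolding L[OF c(1)] L[OF c(2)] L[OF c(3)] coulomb_commute[OF c(2) c(1)] coulomb_commute[OF c(3) c(1)] coulomb_commute[OF c(2) c(3)] by simp
 finally have e: "coulomb_energy (%x. u x + h x) = coulomb ?u2 ?u2 + 4 * coulomb ?u2 ?uh + 2 * coulomb ?u2 ?h2 + 4 * coulomb ?uh ?uh + 4 * coulomb ?h2 ?uh + coulomb ?h2 ?h2" .
 have 1: "coulomb ?uh ?uh <= coulomb ?u2 ?h2"
 proof -
  have "coulomb ?uh ?uh = (LINT z|LL. pdens ?uh ?uh z)" by(simp add: coulomb_def)
  also have "... <= (LINT z|LL. 1/2 * pdens ?u2 ?h2 z + 1/2 * pdens ?h2 ?u2 z)"
  proof (rule integral_mono)
   show "integrable LL (pdens ?uh ?uh)" by(rule cfin_pair[OF c(2,2)])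
   show "integrable LL (%z. 1/2 * pdens ?u2 ?h2 z + 1/2 * pdens ?h2 ?u2 z)" using cfin_pair[OF c(1,3)] cfin_pair[OF c(3,1)] by simp
   fix z
   have "2 * ((u (fst z) * h (snd z)) * (h (fst z) * u (snd z))) <= (u (fst z) * h (snd z))^2 + (h (fst z) * u (snd z))^2"
    using sum_squares_bound[of "u (fst z) * h (snd z)" "h (fst z) * u (snd z)"] by simp
   hence "2 * (?uh (fst z) * ?uh (snd z)) <= ?u2 (fst z) * ?h2 (snd z) + ?h2 (fst z) * ?u2 (snd z)" by(simp add: power_mult_distrib mult_ac)
   hence "2 * (?uh (fst z) * ?uh (snd z)) / norm (fst z - snd z) <= (?u2 (fst z) * ?h2 (snd z) + ?h2 (fst z) * ?u2 (snd z)) / norm (fst z - snd z)"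
    by(rule divide_right_mono) simp
   thus "pdens ?uh ?uh z <= 1/2 * pdens ?u2 ?h2 z + 1/2 * pdens ?h2 ?u2 z" by(simp add: pdens_def add_divide_distrib)
  qed
  also have "... = 1/2 * coulomb ?u2 ?h2 + 1/2 * coulomb ?h2 ?u2" using cfin_pair[OF c(1,3)] cfin_pair[OF c(3,1)] by(simp add: coulomb_def)
  finally show ?thesis using coulomb_commute[OF c(3,1)] by simp
 qed
 have 2: "2 * coulomb ?h2 ?uh <= coulomb ?u2 ?h2 + coulomb ?h2 ?h2"
 proof -
  have "coulomb ?h2 (%x. 2 * ?uh x) <= coulomb ?h2 (%x. ?u2 x + ?h2 x)" by(rule coulomb_mono_right[OF c(3) cfin_scale[OF c(2)] cfin_add[OF c(1,3)]])
    (use sum_squares_bound in \<open>auto simp: mult.assoc[symmetric]\<close>)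
  thus ?thesis by(simp only: coulomb_add_right[OF c(1,3,3)] coulomb_scale_right coulomb_commute[OF c(3,1)])
 qed
 show ?thesis unfolding e coulomb_energy_def using 1 2 by linarith
qed

text \<open>In terms of s = u + v and h = u - v, the right side is, up to the factor 1 / (4 pi), the
  pairing of s^2 with h^2, plus twice that of s h with itself, plus that of h^2 with itself. The
  first is an integral of a nonnegative function, the second is nonnegative by positivity of the
  Coulomb energy, and the third is the left side.\<close>

lemma cform_monotone:
 assumes u: "u : E" and v: "v : E"
 shows "cform (%x. u x - v x) (%x. u x - v x) <= 4 * (cform u (%x. u x - v x) - cform v (%x. u x - v x))"
proof -
 define s where "s = (%x. u x + v x)"
 define h where "h = (%x. u x - v x)"
 have sE: "s : E" and hE: "h : E" using E_add[OF u v] E_diff[OF u v] by(simp_all add: s_def h_def)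
 let ?s2 = "%x. (s x)^2" and ?sh = "%x. s x * h x" and ?h2 = "%x. (h x)^2"
 note c = E_coulomb[OF sE] E_coulomb_product[OF sE hE] E_coulomb[OF hE]
 have E1: "coulomb (%x. (s x + t * h x)^2) (%x. (s x + t * h x) * h x)
   = (coulomb ?s2 ?sh + t * coulomb ?s2 ?h2) + 2 * t * (coulomb ?sh ?sh + t * coulomb ?sh ?h2) + t^2 * (coulomb ?h2 ?sh + t * coulomb ?h2 ?h2)" for t
 proof -
  have r: "(%x. (s x + t * h x) * h x) = (%x. ?sh x + t * ?h2 x)" by(simp add: fun_eq_iff power2_eq_square algebra_simps)
  note sc = cfin_scale[OF c(3), of t]
  have R: "coulomb f (%x. ?sh x + t * ?h2 x) = coulomb f ?sh + t * coulomb f ?h2" if "cfin f" for f by(simp only: coulomb_add_right[OF c(2) sc that] coulomb_scale_right)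
  show ?thesis unfolding r coulomb_square_left[OF sE hE cfin_add[OF c(2) sc]] R[OF c(1)] R[OF c(2)] R[OF c(3)] ..
 qed
 have uv: "u = (%x. (1/2) * (s x + 1 * h x))" "v = (%x. (1/2) * (s x + (-1) * h x))" by(auto simp: s_def h_def)
 have U: "cform u h = 1/8 * cform (%x. s x + 1 * h x) h" by(subst uv(1), subst cform_hom) (simp add: power3_eq_cube)
 have V: "cform v h = 1/8 * cform (%x. s x + (-1) * h x) h" by(subst uv(2), subst cform_hom) (simp add: power3_eq_cube)
 have e: "cform u h - cform v h = 1/4 * (coulomb ?s2 ?h2 + 2 * coulomb ?sh ?sh + coulomb ?h2 ?h2) / (4 * pi)"
  unfolding U V unfolding cform_def E1 by(simp add: field_simps)
 have "0 <= coulomb ?s2 ?h2" by(intro coulomb_nonneg) auto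
 moreover have "0 <= coulomb ?sh ?sh" by(rule coulomb_pos[OF c(2)])
 ultimately have le: "coulomb ?h2 ?h2 <= coulomb ?s2 ?h2 + 2 * coulomb ?sh ?sh + coulomb ?h2 ?h2" by simp
 have "4 * (1/4 * y / (4 * pi)) = y / (4 * pi)" for y by(simp add: field_simps)
 hence d: "4 * (cform u h - cform v h) = (coulomb ?s2 ?h2 + 2 * coulomb ?sh ?sh + coulomb ?h2 ?h2) / (4 * pi)" unfolding e .
 have "coulomb ?h2 ?h2 / (4 * pi) <= 4 * (cform u h - cform v h)" unfolding d using le by(intro divide_right_mono) auto
 thus ?thesis by(simp add: cform_self coulomb_energy_def h_def[symmetric])
qed

lemma powr_numeral_nonneg: "0 <= x ==> x powr numeral n = (x :: real) ^ numeral n" by(cases "x = 0") (auto simp: powr_numeral)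

text \<open>Equivalent to the customary norm of the space, but written as a sum of two roots, to
  each of which \<open>root_seminorm\<close> applies separately.\<close>

definition E_norm :: "fn => real" where
 "E_norm u = gform u u powr (1/2) + cform u u powr (1/4)"

lemma gform_le_norm: "gform u u <= (E_norm u)^2"
proof -
 have "gform u u = (gform u u powr (1/2)) ^ 2" using gform_nonneg[of u] by(simp add: powr_half_sqrt)
 also have "... <= (E_norm u)^2" unfolding E_norm_def by(intro power_mono) auto
 finally show ?thesis .
qed

lemma cform_le_norm: "cform u u <= (E_norm u) ^ 4"
proof -
 have "cform u u = (cform u u powr (1/4)) ^ 4" using cform_nonneg[of u] by(simp add: powr_powr flip: powr_numeral_nonneg)
 also have "... <= (E_norm u) ^ 4" unfolding E_norm_def by(intro power_mono) auto
 finally show ?thesis .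
qed

lemma E_norm_ge_0: "0 <= E_norm u" by(simp add: E_norm_def)

lemma seminormed_E: "seminormed_carrier E E_norm"
proof
 show "subspace E" by(rule E_subspace)
 have ghom: "gform (t *R u) (t *R u) = abs t powr 2 * gform u u" if "u : E" for u t
 proof -
  have "gform (t *R u) (t *R u) = t^2 * gform u u"
   unfolding fun_ops by(simp only: gform_scale[OF E_scale[OF that] that] gform_scale_left[OF that that]; simp add: power2_eq_square)
  moreover have "abs t powr 2 = t^2" by(cases "t = 0") (auto simp: powr_numeral)
  ultimately show ?thesis by simp
 qed
 have chom: "cform (t *R u) (t *R u) = abs t powr 4 * cform u u" for u t
 proof -
  have "cform (t *R u) (t *R u) = t ^ 4 * cform u u" unfolding fun_ops by(simp only: cform_scale cform_hom; simp add: power3_eq_cube power4_eq_xxxx)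
  moreover have "abs t powr 4 = t ^ 4" by(cases "t = 0") (auto simp: powr_numeral)
  ultimately show ?thesis by simp
 qed
 note g = root_seminorm[of E 2 gform, OF E_subspace]
 note c = root_seminorm[of E 4 cform, OF E_subspace]
 have g1: "u : E ==> v : E ==> w : E ==> gform u (v + w) = gform u v + gform u w"
  and g2: "u : E ==> v : E ==> gform u (t *R v) = t * gform u v"
  and g3: "u : E ==> w : E ==> 2 * gform u w <= (2 - 1) * gform u u + gform w w"
  and c1: "u : E ==> v : E ==> w : E ==> cform u (v + w) = cform u v + cform u w"
  and c2: "cform u (t *R v) = t * cform u v"
  and c3: "u : E ==> w : E ==> 4 * cform u w <= (4 - 1) * cform u u + cform w w"
  for u v w t unfolding fun_ops using gform_add gform_scale gform_young cform_add cform_scale cform_young by auto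
 fix u v :: fn and t :: real assume u: "u : E"
 have gt: "gform (t *R u) (t *R u) powr (1/2) = abs t * gform u u powr (1/2)" by(rule g(2)) (use g1 g2 g3 ghom gform_nonneg u in auto)
 have ct: "cform (t *R u) (t *R u) powr (1/4) = abs t * cform u u powr (1/4)" by(rule c(2)) (use c1 c2 c3 chom cform_nonneg u in auto)
 show "E_norm (t *R u) = abs t * E_norm u" unfolding E_norm_def gt ct by(simp add: distrib_left)
 assume v: "v : E"
 have "gform (u + v) (u + v) powr (1/2) <= gform u u powr (1/2) + gform v v powr (1/2)" by(rule g(1)) (use g1 g2 g3 ghom gform_nonneg u v in auto)
 moreover have "cform (u + v) (u + v) powr (1/4) <= cform u u powr (1/4) + cform v v powr (1/4)" by(rule c(1)) (use c1 c2 c3 chom cform_nonneg u v in auto)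
 ultimately show "E_norm (u + v) <= E_norm u + E_norm v" unfolding E_norm_def by linarith
qed

lemma convex_homogeneous_grad: "convex_homogeneous E E_norm 2 gform"
proof (intro convex_homogeneous.intro seminormed_E, unfold_locales)
 fix u v w :: fn and t :: real assume u: "u : E"
 show "0 <= gform u u" by(rule gform_nonneg)
 assume v: "v : E"
 show "gform u (t *R v) = t * gform u v" unfolding fun_ops by(rule gform_scale[OF u v])
 show "gform (- u) v = - gform u v" using gform_scale_left[OF u v, of "-1"] by(simp add: fun_ops)
 show "gform (t *R u) v = t powr (2 - 1) * gform u v" if "t > 0" using gform_scale_left[OF u v, of t] that by(simp add: fun_ops)
 show "2 * gform u v <= (2 - 1) * gform u u + gform v v" using gform_young[OF u v] by simp
 show "gform u (v + w) = gform u v + gform u w" if "w : E" unfolding fun_ops by(rule gform_add[OF u v that])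
 have "gform (u + t *R v) v = gform u v + t * gform v v" for t unfolding fun_ops by(simp only: gform_add_left[OF v u E_scale[OF v]] gform_scale_left[OF v v])
 moreover have "((%t. gform u v + t * gform v v) ---> gform u v + 0 * gform v v) (at_right 0)" by(intro tendsto_intros)
 ultimately show "((%t. gform (u + t *R v) v) ---> gform u v) (at_right 0)" by simp
next
 show "EX M>=0. ALL u:E. gform u u <= M * E_norm u powr 2" using gform_le_norm E_norm_ge_0 by(intro exI[of _ 1]) (auto simp: powr_numeral_nonneg)
qed simp

lemma convex_homogeneous_coulomb: "convex_homogeneous E E_norm 4 cform"
proof (intro convex_homogeneous.intro seminormed_E, unfold_locales)
 fix u v w :: fn and t :: real assume u: "u : E"
 show "0 <= cform u u" by(rule cform_nonneg)
 assume v: "v : E"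
 show "cform u (t *R v) = t * cform u v" unfolding fun_ops by(rule cform_scale)
 show "cform (- u) v = - cform u v" using cform_hom[of "-1" u v] by(simp add: fun_ops)
 show "cform (t *R u) v = t powr (4 - 1) * cform u v" if "t > 0" using cform_hom[of t u v] that by(simp add: fun_ops powr_numeral)
 show "4 * cform u v <= (4 - 1) * cform u u + cform v v" using cform_young[OF u v] by simp
 show "cform u (v + w) = cform u v + cform u w" if "w : E" unfolding fun_ops by(rule cform_add[OF u v that])
 show "((%t. cform (u + t *R v) v) ---> cform u v) (at_right 0)" using cform_line[OF u v] by(simp add: fun_ops)
next
 show "EX M>=0. ALL u:E. cform u u <= M * E_norm u powr 4" using cform_le_norm E_norm_ge_0 by(intro exI[of _ 1]) (auto simp: powr_numeral_nonneg)
qed simp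

text \<open>A pointwise form of Hoelder's inequality: according to the size of \<open>t\<close>, the
  product is bounded by a small multiple of the critical power or by a multiple of the integrable
  power of the weight.\<close>

lemma weighted_power_dichotomy:
 assumes g: "0 <= ga" and t: "0 <= t" and p: "0 < p" "p < 6" and e: "(e::real) > 0"
 shows "ga * t powr p <= e * t ^ 6 | ga * t powr p <= e powr (- (p / (6 - p))) * ga powr (6 / (6 - p))"
proof (cases "t = 0 | ga <= e * t powr (6 - p)")
 case True
 show ?thesis
 proof (cases "t = 0")
  case False
  hence "ga * t powr p <= (e * t powr (6 - p)) * t powr p" using True by(intro mult_right_mono) auto
  also have "... = e * t ^ 6"
  proof -
   have "t powr (6 - p) * t powr p = t powr 6" by(simp add: powr_add[symmetric])
   also have "... = t ^ 6" using t False by(simp add: powr_numeral)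
   finally show ?thesis by(simp add: mult.assoc)
  qed
  finally show ?thesis ..
 qed (use e in simp)
next
 case False
 hence t0: "t > 0" and lt: "t powr (6 - p) < ga / e" using t e by(auto simp: field_simps)
 hence g0: "ga > 0" using e by(smt (verit) divide_nonpos_pos powr_ge_zero)
 have "t powr p = (t powr (6 - p)) powr (p / (6 - p))" using p by(simp add: powr_powr)
 also have "... <= (ga / e) powr (p / (6 - p))" using lt p by(intro powr_mono2) auto
 also have "... = e powr (- (p / (6 - p))) * ga powr (p / (6 - p))" using g0 e by(simp add: powr_divide powr_minus_divide)
 finally have "ga * t powr p <= ga * (e powr (- (p / (6 - p))) * ga powr (p / (6 - p)))" using g by(rule mult_left_mono)
 also have "... = e powr (- (p / (6 - p))) * ga powr (1 + p / (6 - p))" using g0 by(simp add: powr_add mult.left_commute)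
 also have "1 + p / (6 - p) = 6 / (6 - p)" using p by(simp add: field_simps)
 finally show ?thesis ..
qed

section \<open>The subcritical and critical terms of the equation\<close>

locale schroedinger =
 fixes p lam :: real and g :: fn
 assumes p4: "4 < p" and p6: "p < 6" and g_Lp: "g : Lp (6 / (6 - p))" and g_nonneg: "ALL x. g x >= 0" and lam_pos: "lam > 0"
begin

definition W :: fn where "W x = lam * g x"

definition Wq :: fn where "Wq x = W x powr (6 / (6 - p))"

lemma W_nonneg: "0 <= W x" using g_nonneg lam_pos by(simp add: W_def)

lemma W_measurable: "W : bmeas" using g_Lp by(auto simp: W_def[abs_def] Lp_def intro!: borel_measurable_times)

lemma Wq_nonneg: "0 <= Wq x" by(simp add: Wq_def)

lemma Wq_integrable: "integ Wq"
proof -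
 have "Wq = (%x. lam powr (6 / (6 - p)) * (norm (g x) powr (6 / (6 - p))))" using g_nonneg lam_pos by(simp add: fun_eq_iff Wq_def W_def powr_mult)
 moreover have "integ (%x. lam powr (6 / (6 - p)) * (norm (g x) powr (6 / (6 - p))))" using g_Lp by(simp add: Lp_def)
 ultimately show ?thesis by simp
qed

sublocale G: power_weight W p by standard (use p4 W_measurable W_nonneg in auto)

sublocale C: power_weight "%x. 1" 6 by standard auto

lemma crude: "e > 0 ==> W x * abs t powr p <= e * abs t ^ 6 + e powr (- (p / (6 - p))) * Wq x"
 using weighted_power_dichotomy[OF W_nonneg, of "abs t" p e x] p4 p6 Wq_nonneg[of x] by(auto simp: Wq_def add_increasing add_increasing2)

lemma power_finite_C: "power_finite (%x. 1) 6 u <-> u : bmeas & integ (%x. abs (u x) ^ 6)"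
proof -
 have "abs t powr 6 = abs t ^ 6" for t :: real by(cases "t = 0") (simp_all add: powr_numeral)
 thus ?thesis by(simp add: power_finite_def)
qed

lemma power_finite_G:
 assumes "u : bmeas" "integ (%x. abs (u x) ^ 6)"
 shows "power_finite W p u" unfolding power_finite_def
proof (rule conjI[OF assms(1)], rule Lintegrable_bound)
 show "integ (%x. 1 * abs (u x) ^ 6 + 1 powr (- (p / (6 - p))) * Wq x)" using assms Wq_integrable by simp
 show "(%x. W x * abs (u x) powr p) : bmeas" by(intro borel_measurable_times W_measurable measurable_abs_powr assms(1))
 show "AE x in leb. norm (W x * abs (u x) powr p) <= norm (1 * abs (u x) ^ 6 + 1 powr (- (p / (6 - p))) * Wq x)"
 proof (rule AE_I2)
  fix x
  have "0 <= W x * abs (u x) powr p" using W_nonneg by simp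
  thus "norm (W x * abs (u x) powr p) <= norm (1 * abs (u x) ^ 6 + 1 powr (- (p / (6 - p))) * Wq x)" using crude[of 1 x "u x"] by simp
 qed
qed

lemma E_finite_C: "u : E ==> power_finite (%x. 1) 6 u" and E_finite_G: "u : E ==> power_finite W p u"
 using D12_dest(1,2)[OF E_D12] power_finite_C power_finite_G by blast+

abbreviation gF where "gF == power_form W p"
abbreviation cF where "cF == power_form (%x. 1) 6"

lemma cF_self: "cF u u = LI (%x. abs (u x) ^ 6)"
proof -
 have "abs t powr 6 = abs t ^ 6" for t :: real by(cases "t = 0") (simp_all add: powr_numeral)
 thus ?thesis by(simp add: C.form_self)
qed

lemma sobolev_cF: "u : E ==> cF u u <= 262144 * (gform u u) ^ 3" unfolding cF_self by(intro sobolev_D12 E_D12)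

text \<open>One constant for both Sobolev bounds of the \<open>nehari\<close> locale; the integral
  of \<open>Wq\<close> is the share of the weight.\<close>

definition KG :: real where "KG = 262144 + LI (%x. Wq x)"

lemma KG_ge: "KG >= 262144" using Wq_nonneg by(simp add: KG_def)

lemma cF_zero_AE:
 assumes "u : E" "cF u u = 0"
 shows "AE x in leb. u x = 0"
proof -
 have "AE x in leb. abs (u x) ^ 6 = 0" using integral_nonneg_eq_0_iff_AE[of leb "%x. abs (u x) ^ 6"] D12_dest(2)[OF E_D12[OF assms(1)]] assms(2) by(simp add: cF_self)
 thus ?thesis by simp
qed

lemma gform_zero_AE:
 assumes u: "u : E" and a: "gform u u = 0"
 shows "AE x in leb. u x = 0"
proof (rule cF_zero_AE[OF u])
 show "cF u u = 0" using sobolev_cF[OF u] C.form_nonneg[of u] a by simp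
qed

text \<open>By homogeneity it suffices to consider gradient energy 1, where \<open>crude\<close>
  with \<open>e = 1\<close> and the Sobolev inequality bound the term by \<open>KG\<close>.\<close>

lemma sobolev_gF:
 assumes u: "u : E"
 shows "gF u u <= KG * gform u u powr (p / 2)"
proof (cases "gform u u = 0")
 case True
 have "AE x in leb. W x * abs (u x) powr p = 0" using gform_zero_AE[OF u True] by eventually_elim simp
 hence "gF u u = 0" unfolding G.form_self by(rule integral_eq_zero_AE)
 thus ?thesis using True by simp
next
 case False
 hence A: "gform u u > 0" using gform_nonneg[of u] by simp
 define s where "s = sqrt (gform u u)"
 have s: "s > 0" "s^2 = gform u u" using A by(auto simp: s_def)
 let ?v = "%x. inverse s * u x"
 have v: "?v : E" by(rule E_scale[OF u])
 have "gform ?v ?v = inverse s * (inverse s * gform u u)" by(simp only: gform_scale[OF v u] gform_scale_left[OF u u])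
 also have "... = 1" unfolding s(2)[symmetric] using s(1) by(simp add: power2_eq_square field_simps)
 finally have Av: "gform ?v ?v = 1" .
 have "gF ?v ?v = LI (%x. W x * abs (?v x) powr p)" by(rule G.form_self)
 also have "... <= LI (%x. abs (?v x) ^ 6 + Wq x)"
 proof (rule integral_mono)
  show "integ (%x. W x * abs (?v x) powr p)" using E_finite_G[OF v] by(simp add: power_finite_def)
  show "integ (%x. abs (?v x) ^ 6 + Wq x)" by(intro Lintegrable_add D12_dest(2)[OF E_D12[OF v]] Wq_integrable)
  show "W x * abs (?v x) powr p <= abs (?v x) ^ 6 + Wq x" for x using crude[of 1 x "?v x"] by simp
 qed
 also have "... = cF ?v ?v + LI (%x. Wq x)" unfolding cF_self by(intro Lintegral_add D12_dest(2)[OF E_D12[OF v]] Wq_integrable)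
 also have "... <= KG" using sobolev_cF[OF v] by(simp add: KG_def Av)
 finally have gv: "gF ?v ?v <= KG" .
 have "u = (%x. s * ?v x)" using s by(auto simp: fun_eq_iff)
 hence "gF u u = gF (%x. s * ?v x) (%x. s * ?v x)" by simp
 also have "... = s * (s powr (p - 1) * gF ?v ?v)" unfolding G.form_scale[of _ s ?v] G.form_hom[OF s(1), of ?v] ..
 also have "... = s powr p * gF ?v ?v" using powr_mult_base[of s "p - 1"] s by simp
 also have "... <= s powr p * KG" using gv by(intro mult_left_mono) auto
 also have "s powr p = gform u u powr (p / 2)"
 proof -
  have "gform u u = s powr 2" using s by(simp add: powr_numeral)
  thus ?thesis by(simp add: powr_powr)
 qed
 finally show ?thesis by(simp add: mult.commute)
qed

lemma convex_homogeneous_form: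
 assumes q: "power_weight w q" and fin: "!!u. u : E ==> power_finite w q u"
  and growth: "EX M>=0. ALL u:E. power_form w q u u <= M * E_norm u powr q"
 shows "convex_homogeneous E E_norm q (power_form w q)"
proof (intro convex_homogeneous.intro seminormed_E, unfold_locales)
 interpret q: power_weight w q by(rule q)
 show "1 < q" using q.q by simp
 fix u v h :: fn and t :: real assume u: "u : E"
 show "0 <= power_form w q u u" by(rule q.form_nonneg)
 assume v: "v : E"
 show "power_form w q u (t *R v) = t * power_form w q u v" unfolding fun_ops by(rule q.form_scale)
 show "power_form w q (- u) v = - power_form w q u v" unfolding fun_ops by(rule q.form_odd)
 show "power_form w q (t *R u) v = t powr (q - 1) * power_form w q u v" if "t > 0" unfolding fun_ops by(rule q.form_hom[OF that])
 show "q * power_form w q u v <= (q - 1) * power_form w q u u + power_form w q v v" by(intro q.form_young fin u v)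
 show "power_form w q u (v + h) = power_form w q u v + power_form w q u h" if "h : E" unfolding fun_ops by(intro q.form_add fin u v that)
 show "((%t. power_form w q (u + t *R v) v) ---> power_form w q u v) (at_right 0)" unfolding fun_ops by(intro q.form_line fin u v)
qed (rule growth)

lemma convex_homogeneous_gF: "convex_homogeneous E E_norm p gF"
proof (rule convex_homogeneous_form[OF G.power_weight_axioms E_finite_G])
 have "gF u u <= KG * E_norm u powr p" if u: "u : E" for u
 proof -
  have "gform u u powr (p / 2) <= ((E_norm u)^2) powr (p / 2)" using gform_le_norm gform_nonneg p4 by(intro powr_mono2) auto
  also have "((E_norm u)^2) powr (p / 2) = E_norm u powr p" by(simp only: powr_numeral_nonneg[OF E_norm_ge_0, symmetric] powr_powr) simp
  finally have "KG * gform u u powr (p / 2) <= KG * E_norm u powr p" using KG_ge by(intro mult_left_mono) auto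
  thus ?thesis using sobolev_gF[OF u] by simp
 qed
 thus "EX M>=0. ALL u:E. gF u u <= M * E_norm u powr p" using KG_ge by(intro exI[of _ KG]) auto
qed

lemma convex_homogeneous_cF: "convex_homogeneous E E_norm 6 cF"
proof (rule convex_homogeneous_form[OF C.power_weight_axioms E_finite_C])
 have "cF u u <= 262144 * E_norm u powr 6" if u: "u : E" for u
 proof -
  have "gform u u ^ 3 <= ((E_norm u)^2) ^ 3" using gform_le_norm gform_nonneg by(intro power_mono) auto
  also have "((E_norm u)^2) ^ 3 = E_norm u powr 6" by(simp only: powr_numeral_nonneg[OF E_norm_ge_0] power_mult[symmetric]) simp
  finally show ?thesis using sobolev_cF[OF u] by simp
 qed
 thus "EX M>=0. ALL u:E. cF u u <= M * E_norm u powr 6" by(intro exI[of _ 262144]) auto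
qed

text \<open>Scaling h^2 by 1 / s in \<open>coulomb_amgm\<close> gives D <= s R^4 + n^2 / s, with n
  the squared norm of \<open>h\<close>; choosing s near n makes the bound linear in n. The shift
  \<open>d\<close> covers n = 0.\<close>

lemma coulomb_cross_le:
 assumes u: "u : E" and h: "h : E" and R: "E_norm u <= R"
 shows "2 * coulomb (%x. (u x)^2) (%x. (h x)^2) / (4 * pi) <= (E_norm h)^2 * (R ^ 4 + 1)"
proof -
 let ?u = "%x. (u x)^2" and ?h = "%x. (h x)^2"
 define D where "D = 2 * coulomb ?u ?h / (4 * pi)"
 define n where "n = (E_norm h)^2"
 have n0: "n >= 0" by(simp add: n_def)
 have bu: "cform u u <= R ^ 4" using cform_le_norm[of u] power_mono[OF R E_norm_ge_0, of 4] by linarith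
 have bh: "cform h h <= n^2" using cform_le_norm[of h] by(simp add: n_def flip: power_mult)
 have s: "D <= s * R ^ 4 + n^2 / s" if s: "s > 0" for s
 proof -
  have "2 * coulomb ?u (%x. inverse s * ?h x) <= coulomb ?u ?u + coulomb (%x. inverse s * ?h x) (%x. inverse s * ?h x)" by(intro coulomb_amgm cfin_scale E_coulomb u h)
  hence "2 * (inverse s * coulomb ?u ?h) <= coulomb ?u ?u + inverse s * (inverse s * coulomb ?h ?h)" by(simp only: coulomb_scale_right coulomb_scale_left)
  hence "s * (2 * (inverse s * coulomb ?u ?h)) <= s * (coulomb ?u ?u + inverse s * (inverse s * coulomb ?h ?h))" using s by(intro mult_left_mono) auto
  also have "s * (2 * (inverse s * coulomb ?u ?h)) = 2 * coulomb ?u ?h" using s by simp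
  also have "s * (coulomb ?u ?u + inverse s * (inverse s * coulomb ?h ?h)) = s * coulomb ?u ?u + coulomb ?h ?h / s"
   using s by(simp add: distrib_left divide_inverse mult.commute)
  finally have "D <= (s * coulomb ?u ?u + coulomb ?h ?h / s) / (4 * pi)" unfolding D_def by(intro divide_right_mono) auto
  also have "... = s * cform u u + cform h h / s" by(simp add: cform_self coulomb_energy_def add_divide_distrib)
  also have "... <= s * R ^ 4 + n^2 / s" using bu bh s by(intro add_mono mult_left_mono divide_right_mono) auto
  finally show ?thesis .
 qed
 have "D <= n * (R ^ 4 + 1)"
 proof (rule field_le_epsilon)
  fix e :: real assume e: "e > 0"
  define d where "d = e / (R ^ 4 + 1)"
  have R1: "R ^ 4 + 1 > 0" by(simp add: add_nonneg_pos)
  have d: "d > 0" using e R1 by(simp add: d_def)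
  have "d * R ^ 4 <= d * (R ^ 4 + 1)" using d by simp
  also have "... = e" using R1 by(simp add: d_def)
  finally have de: "d * R ^ 4 <= e" .
  have "n^2 / (n + d) <= n" using n0 d by(simp add: pos_divide_le_eq power2_eq_square distrib_left)
  thus "D <= n * (R ^ 4 + 1) + e" using s[of "n + d"] n0 d de by(simp add: distrib_left distrib_right)
 qed
 thus ?thesis by(simp add: D_def n_def)
qed

lemma taylor:
 assumes u: "u : E" and h: "h : E" and R: "E_norm u <= R" and h1: "E_norm h <= 1"
 shows "gform (u + h) (u + h) / 2 + cform (u + h) (u + h) / 4
   <= gform u u / 2 + cform u u / 4 + gform u h + cform u h + (R ^ 4 + 3) * (E_norm h)^2"
proof -
 note uh = E_add[OF u h]
 have A: "gform (u + h) (u + h) = gform u u + 2 * gform u h + gform h h"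
  unfolding fun_ops by(simp only: gform_add[OF uh u h] gform_add_left[OF u u h] gform_add_left[OF h u h] gform_commute[of h u]; simp)
 have ah: "gform h h <= (E_norm h)^2" by(rule gform_le_norm)
 have n4: "(E_norm h) ^ 4 <= (E_norm h)^2" using E_norm_ge_0[of h] h1 by(intro power_decreasing) auto
 have bh: "cform h h <= (E_norm h)^2" using cform_le_norm[of h] n4 by linarith
 let ?D = "coulomb (%x. (u x)^2) (%x. (h x)^2) / (4 * pi)"
 have cr: "2 * ?D <= (E_norm h)^2 * (R ^ 4 + 1)" using coulomb_cross_le[OF u h R] by simp
 have "coulomb_energy (%x. u x + h x) / (4 * pi) <= (coulomb_energy u + 4 * coulomb (%x. (u x)^2) (%x. u x * h x)
   + 8 * coulomb (%x. (u x)^2) (%x. (h x)^2) + 3 * coulomb_energy h) / (4 * pi)" by(intro divide_right_mono coulomb_energy_taylor u h) simp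
 hence B: "cform (u + h) (u + h) <= cform u u + 4 * cform u h + 8 * ?D + 3 * cform h h" unfolding cform_self fun_ops by(simp add: cform_def add_divide_distrib)
 have gen: "a1 / 2 + b1 / 4 <= a0 / 2 + b0 / 4 + ah + bh + (y + 2 * n)"
  if "a1 = a0 + 2 * ah + hh" "b1 <= b0 + 4 * bh + 8 * d + 3 * bb" "hh <= n" "bb <= n" "2 * d <= y" "0 <= n"
  for a0 a1 ah hh b0 b1 bh d bb n y :: real using that by linarith
 have "(R ^ 4 + 3) * (E_norm h)^2 = (E_norm h)^2 * (R ^ 4 + 1) + 2 * (E_norm h)^2" by(simp add: algebra_simps)
 thus ?thesis using gen[OF A B ah bh cr] by simp
qed

lemma nehari_E: "nehari E E_norm gform cform gF cF p KG"
proof -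
 have "nehari_axioms E E_norm gform cform gF cF p KG"
 proof
  show "4 < p" "p < 6" by(rule p4 p6)+
  fix R :: real and u :: fn
  show "EX Q>=0. ALL u:E. ALL h:E. E_norm u <= R --> E_norm h <= 1 -->
    gform (u + h) (u + h) / 2 + cform (u + h) (u + h) / 4
     <= gform u u / 2 + cform u u / 4 + gform u h + cform u h + Q * (E_norm h)^2" using taylor by(intro exI[of _ "R ^ 4 + 3"]) auto
  show "EX R'. ALL u:E. gform u u <= R --> cform u u <= R --> E_norm u <= R'" unfolding E_norm_def using gform_nonneg cform_nonneg
   by(intro exI[of _ "R powr (1/2) + R powr (1/4)"] ballI impI add_mono powr_mono2) auto
  assume u: "u : E"
  have "262144 * gform u u ^ 3 <= KG * gform u u ^ 3" using KG_ge gform_nonneg by(intro mult_right_mono) auto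
  thus "cF u u <= KG * gform u u ^ 3" using sobolev_cF[OF u] by simp
  show "gF u u <= KG * gform u u powr (p / 2)" by(rule sobolev_gF[OF u])
  assume "cF u u = 0"
  hence z: "AE x in leb. u x = 0" by(rule cF_zero_AE[OF u])
  have "wgrad u (%x. 0)" unfolding has_weak_gradient_def
  proof (intro conjI ballI allI)
   show "loc_int u" "loc_int (%x. 0 :: real^3)" using D12_dest(3)[OF E_D12[OF u]] by(auto simp: has_weak_gradient_def locally_integrable_def)
   fix ph i
   show "LI (%x. u x * pd i ph x) = - LI (%x. (0 :: real^3) $ i * ph x)"
   proof -
    have "AE x in leb. u x * pd i ph x = 0" using z by eventually_elim simp
    hence "LI (%x. u x * pd i ph x) = 0" by(rule integral_eq_zero_AE)
    thus ?thesis by simp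
   qed
  qed
  from gform_AE[OF this this] show "gform u u = 0" by simp
 next
  show "0 <= KG" using KG_ge by simp
 qed
 thus ?thesis by(intro nehari.intro seminormed_E convex_homogeneous_grad convex_homogeneous_coulomb convex_homogeneous_gF convex_homogeneous_cF)
qed

end

section \<open>Palais--Smale sequences\<close>

text \<open>If h^2 <= ta x^2 the first term dominates, otherwise the second. The free parameter is
  balanced in \<open>cF_difference\<close>.\<close>

lemma quartic_square_split:
 fixes x h :: real
 assumes ta: "ta > 0"
 shows "x ^ 4 * h^2 <= ta * abs x ^ 6 + abs h ^ 6 / ta^2"
proof (cases "h^2 <= ta * x^2")
 case True
 hence "x ^ 4 * h^2 <= x ^ 4 * (ta * x^2)" by(intro mult_left_mono) auto
 also have "... = ta * abs x ^ 6" by(simp add: power_add[symmetric] mult.left_commute)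
 finally show ?thesis by(simp add: add_increasing2)
next
 case False
 hence "x^2 <= h^2 / ta" using ta by(simp add: field_simps)
 hence "(x^2)^2 <= (h^2 / ta)^2" by(intro power_mono) auto
 hence "(x^2)^2 * h^2 <= (h^2 / ta)^2 * h^2" by(intro mult_right_mono) auto
 moreover have "(h^2 / ta)^2 * h^2 = abs h ^ 6 / ta^2" by(simp add: power_divide power_add[symmetric] flip: power_mult)
 moreover have "(x^2)^2 = x ^ 4" by(simp flip: power_mult)
 ultimately show ?thesis using ta by(simp add: add_increasing)
qed

text \<open>x^5 - y^5 is x - y times a quartic form, and that form is at most 5/2 (x^4 + y^4)
  because the difference is a sum of nonnegative terms.\<close>

lemma quintic_monotone_bound:
 fixes x y :: real
 assumes ta: "ta > 0"
 shows "(x ^ 5 - y ^ 5) * (x - y) <= 5/2 * (ta * abs x ^ 6 + ta * abs y ^ 6 + 2 * (abs (x - y) ^ 6 / ta^2))"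
proof -
 have id: "5/2 * (x ^ 4 + y ^ 4) - (x ^ 4 + x ^ 3 * y + x^2 * y^2 + x * y ^ 3 + y ^ 4)
   = (x - y)^2 * ((x^2 + y^2 + (x + y)^2) / 2) + (x^2 - y^2)^2 / 2" by(simp add: power2_eq_square power3_eq_cube power4_eq_xxxx field_simps)
 have "0 <= (x - y)^2 * ((x^2 + y^2 + (x + y)^2) / 2) + (x^2 - y^2)^2 / 2" by(intro add_nonneg_nonneg mult_nonneg_nonneg divide_nonneg_nonneg) auto
 hence "x ^ 4 + x ^ 3 * y + x^2 * y^2 + x * y ^ 3 + y ^ 4 <= 5/2 * (x ^ 4 + y ^ 4)" using id by linarith
 hence "(x ^ 4 + x ^ 3 * y + x^2 * y^2 + x * y ^ 3 + y ^ 4) * (x - y)^2 <= 5/2 * (x ^ 4 + y ^ 4) * (x - y)^2" by(intro mult_right_mono) auto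
 moreover have "(x ^ 5 - y ^ 5) * (x - y) = (x ^ 4 + x ^ 3 * y + x^2 * y^2 + x * y ^ 3 + y ^ 4) * (x - y)^2" by(simp add: eval_nat_numeral algebra_simps)
 moreover have "5/2 * (x ^ 4 + y ^ 4) * (x - y)^2 = 5/2 * (x ^ 4 * (x - y)^2 + y ^ 4 * (x - y)^2)" by(simp add: distrib_right)
 moreover have "l <= 5/2 * (a + b + 2 * c)" if "l <= m" "m = 5/2 * (q + r)" "q <= a + c" "r <= b + c" for l m q r a b c :: real
 proof -
  have "q + r <= a + b + 2 * c" using that by simp
  hence "5/2 * (q + r) <= 5/2 * (a + b + 2 * c)" by(rule mult_left_mono) simp
  thus ?thesis using that by simp
 qed
 ultimately show ?thesis using quartic_square_split[OF ta, of x "x - y"] quartic_square_split[OF ta, of y "x - y"] by metis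
qed

context schroedinger
begin

definition DIf where "DIf u v = gform u v + cform u v - gF u v - cF u v"

text \<open>The Sobolev inequality bounds the integrals from \<open>quintic_monotone_bound\<close>
  by cubes of gradient energies. The choice \<open>ta = A / M\<close> balances both parts to A M^2
  each, and \<open>small\<close> says precisely that the total is at most A / 2.\<close>

lemma cF_difference:
 assumes u: "u : E" and v: "v : E" and A: "gform u u <= M" "gform v v <= M" and M: "M > 0"
  and small: "20 * 262144 * M^2 <= 1"
 shows "cF u (%x. u x - v x) - cF v (%x. u x - v x) <= gform (%x. u x - v x) (%x. u x - v x) / 2"
proof -
 define h where "h = (%x. u x - v x)"
 define A where "A = gform h h"
 have h: "h : E" unfolding h_def by(rule E_diff[OF u v])
 have A0: "A >= 0" unfolding A_def by(rule gform_nonneg)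
 have sp: "spow 6 t = t ^ 5" for t
 proof -
  have "abs t powr 4 = t ^ 4" by(cases "t = 0") (auto simp: powr_numeral)
  thus ?thesis by(simp add: spow_def eval_nat_numeral mult.commute)
 qed
 have S: "LI (%x. abs (w x) ^ 6) <= 262144 * t ^ 3" if "w : E" "gform w w <= t" for w t
  using sobolev_D12[OF E_D12[OF that(1)]] power_mono[OF that(2) gform_nonneg, of 3] by linarith
 note i6 = D12_dest(2)[OF E_D12]
 have bound: "cF u h - cF v h <= 5 * 262144 * (ta * M ^ 3 + A ^ 3 / ta^2)" if ta: "ta > 0" for ta
 proof -
  have "cF u h - cF v h = LI (%x. 1 * (spow 6 (u x) * h x) - 1 * (spow 6 (v x) * h x))"
   unfolding power_form_def by(intro Lintegral_diff[symmetric] C.integrable_form E_finite_C u v h)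
  also have "... <= LI (%x. 5/2 * (ta * abs (u x) ^ 6 + ta * abs (v x) ^ 6 + 2 * (abs (h x) ^ 6 / ta^2)))"
  proof (rule integral_mono)
   show "integ (%x. 1 * (spow 6 (u x) * h x) - 1 * (spow 6 (v x) * h x))" by(intro Lintegrable_diff C.integrable_form E_finite_C u v h)
   show "integ (%x. 5/2 * (ta * abs (u x) ^ 6 + ta * abs (v x) ^ 6 + 2 * (abs (h x) ^ 6 / ta^2)))"
    by(intro integrable_mult_right Lintegrable_add integrable_divide i6 u v h)
   show "1 * (spow 6 (u x) * h x) - 1 * (spow 6 (v x) * h x) <= 5/2 * (ta * abs (u x) ^ 6 + ta * abs (v x) ^ 6 + 2 * (abs (h x) ^ 6 / ta^2))" for x
    using quintic_monotone_bound[OF ta, of "u x" "v x"] unfolding sp h_def by(simp only: left_diff_distrib mult_1)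
  qed
  also have "... = 5/2 * (ta * LI (%x. abs (u x) ^ 6) + ta * LI (%x. abs (v x) ^ 6) + 2 * (LI (%x. abs (h x) ^ 6) / ta^2))" using i6[OF u] i6[OF v] i6[OF h] by simp
  also have "... <= 5/2 * (ta * (262144 * M ^ 3) + ta * (262144 * M ^ 3) + 2 * ((262144 * A ^ 3) / ta^2))"
   using S[OF u assms(3)] S[OF v assms(4)] S[OF h, of A] ta by(intro mult_left_mono add_mono divide_right_mono) (auto simp: A_def)
  finally show ?thesis by(simp add: algebra_simps)
 qed
 have "cF u h - cF v h <= A / 2"
 proof (cases "A = 0")
  case True
  have "cF u h - cF v h <= 0"
  proof (rule field_le_epsilon)
   fix e :: real assume e: "e > 0"
   thus "cF u h - cF v h <= 0 + e" using bound[of "e / (5 * 262144 * M ^ 3)"] M True by simp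
  qed
  thus ?thesis using True by simp
 next
  case False
  hence "A > 0" using A0 by simp
  moreover have "A / M * M ^ 3 = A * M^2" using M by(simp add: power2_eq_square power3_eq_cube)
  moreover have "A ^ 3 / (A / M)^2 = A * M^2" using M \<open>A > 0\<close> by(simp add: power2_eq_square power3_eq_cube)
  ultimately have "cF u h - cF v h <= 5 * 262144 * (A * M^2 + A * M^2)" using bound[of "A / M"] M by simp
  also have "... = (20 * 262144 * M^2) * (A / 2)" by simp
  also have "... <= 1 * (A / 2)" using small A0 by(intro mult_right_mono) auto
  finally show ?thesis by simp
 qed
 thus ?thesis by(simp add: h_def A_def)
qed

text \<open>Young's inequality with \<open>h\<close> scaled by \<open>s\<close>: a large
  \<open>s\<close> makes the contribution of \<open>u\<close> small, and that of \<open>h\<close> is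
  left to compactness.\<close>

lemma gF_abs_le:
 assumes u: "u : E" and h: "h : E" and s: "s > 0"
 shows "abs (gF u h) <= gF u u / s + s powr (p - 1) * gF h h"
proof -
 have *: "gF u k <= gF u u / s + s powr (p - 1) * gF h h" if k: "k : E" and kk: "gF k k = gF h h" for k
 proof -
  have "p * gF u (%x. s * k x) <= (p - 1) * gF u u + gF (%x. s * k x) (%x. s * k x)" by(intro G.form_young E_finite_G u E_scale k)
  also have "gF (%x. s * k x) (%x. s * k x) = s * (s powr (p - 1) * gF h h)" using G.form_hom[OF s] by(simp only: G.form_scale kk)
  also have "(p - 1) * gF u u <= p * gF u u" using G.form_nonneg[of u] by(intro mult_right_mono) auto
  also have "s * (s powr (p - 1) * gF h h) <= p * (s * (s powr (p - 1) * gF h h))"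
   using p4 s G.form_nonneg[of h] mult_right_mono[of 1 p "s * (s powr (p - 1) * gF h h)"] by simp
  finally have "p * (s * gF u k) <= p * (gF u u + s * (s powr (p - 1) * gF h h))" by(simp add: G.form_scale distrib_left)
  hence "s * gF u k <= gF u u + s * (s powr (p - 1) * gF h h)" using p4 by simp
  thus ?thesis using s by(simp add: field_simps)
 qed
 have n: "(%x. -1 * h x) : E" by(rule E_scale[OF h])
 have "gF (%x. -1 * h x) (%x. -1 * h x) = gF h h" by(simp add: G.form_self)
 from *[OF n this] have "- gF u h <= gF u u / s + s powr (p - 1) * gF h h" by(simp only: G.form_scale; simp)
 thus ?thesis using *[OF h refl] by(simp add: abs_le_iff)
qed

text \<open>Truncation at \<open>c * Wq\<close> gives a dominated part that tends to 0; the excess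
  is at most \<open>e\<close> times the sixth power, small uniformly in \<open>n\<close>.\<close>

lemma subcritical_integral_tendsto_zero:
 fixes v :: "nat => fn"
 assumes vm: "!!n. v n : bmeas" and v0: "AE x in leb. (%n. v n x) ----> 0"
  and vi: "!!n. integ (%x. abs (v n x) ^ 6)" and vb: "!!n. LI (%x. abs (v n x) ^ 6) <= M"
 shows "(%n. LI (%x. W x * abs (v n x) powr p)) ----> 0"
proof (rule tendstoI)
 fix ep :: real assume ep: "ep > 0"
 have M: "M >= 0" by(rule order_trans[OF _ vb[of 0]], rule integral_nonneg_AE) simp
 define e where "e = ep / (2 * (M + 1))"
 have e: "e > 0" using ep M by(simp add: e_def)
 have "e * M <= e * (M + 1)" using e by simp
 also have "... = ep / 2"
 proof -
  have "2 * (M + 1) ~= 0" using M by simp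
  thus ?thesis by(simp add: e_def del: distrib_left_numeral)
 qed
 finally have eM: "e * M <= ep / 2" .
 define c where "c = e powr (- (p / (6 - p)))"
 define F where "F n x = min (W x * abs (v n x) powr p) (c * Wq x)" for n x
 have Fm: "F n : bmeas" for n
  unfolding F_def by(intro borel_measurable_min borel_measurable_times W_measurable measurable_abs_powr vm borel_measurable_const borel_measurable_integrable[OF Wq_integrable])
 have Fb: "abs (F n x) <= c * Wq x" "0 <= F n x" for n x using W_nonneg[of x] Wq_nonneg[of x] by(auto simp: F_def c_def)
 have ci: "integ (%x. c * Wq x)" using Wq_integrable by simp
 have F0: "(%n. LI (%x. F n x)) ----> (LINT x|(leb :: (real^3) measure). 0)"
 proof (rule integral_dominated_convergence[OF _ Fm ci])
  show "AE x in leb. (%n. F n x) ----> 0" using v0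
  proof eventually_elim
   case (elim x)
   have "(%n. W x * abs (v n x) powr p) ----> W x * abs 0 powr p" using p4 by(intro tendsto_mult tendsto_const tendsto_powr' tendsto_rabs elim) auto
   hence "(%n. W x * abs (v n x) powr p) ----> 0" by simp
   thus ?case by(rule tendsto_sandwich[OF _ _ tendsto_const, rotated 2]) (use Fb(2) in \<open>auto simp: F_def\<close>)
  qed
  show "AE x in leb. norm (F n x) <= c * Wq x" for n using Fb(1) by simp
 qed simp
 hence "(%n. LI (%x. F n x)) ----> 0" by simp
 hence "eventually (%n. LI (%x. F n x) < ep / 2) sequentially" by(rule order_tendstoD) (use ep in simp)
 thus "eventually (%n. dist (LI (%x. W x * abs (v n x) powr p)) 0 < ep) sequentially"
 proof eventually_elim
  case (elim n)
  have Fi: "integ (F n)" by(rule Lintegrable_bound[OF ci Fm]) (use Fb(1) in \<open>auto intro!: AE_I2 intro: order_trans[OF _ abs_ge_self]\<close>)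
  have "LI (%x. W x * abs (v n x) powr p) <= LI (%x. e * abs (v n x) ^ 6 + F n x)"
  proof (rule integral_mono)
   show "integ (%x. W x * abs (v n x) powr p)" using power_finite_G[OF vm vi] by(simp add: power_finite_def)
   show "integ (%x. e * abs (v n x) ^ 6 + F n x)" by(intro Lintegrable_add integrable_mult_right vi Fi)
   fix x
   have "e * abs (v n x) ^ 6 >= 0" using e by simp
   moreover have "c * Wq x >= 0" using Fb(1)[of n x] by(rule order_trans[OF abs_ge_zero])
   moreover have "W x * abs (v n x) powr p <= e * abs (v n x) ^ 6 | W x * abs (v n x) powr p <= c * Wq x"
    unfolding c_def Wq_def by(rule weighted_power_dichotomy[OF W_nonneg]) (use p4 p6 e in simp_all)
   moreover have "w <= a + min w b" if "a >= 0" "b >= 0" "w <= a | w <= b" for a b w :: real using that by(auto simp: min_def)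
   ultimately show "W x * abs (v n x) powr p <= e * abs (v n x) ^ 6 + F n x" unfolding F_def by blast
  qed
  also have "... = e * LI (%x. abs (v n x) ^ 6) + LI (%x. F n x)" by(subst Lintegral_add[OF integrable_mult_right[OF vi] Fi]) simp
  also have "... < ep" 
  proof -
   have "e * LI (%x. abs (v n x) ^ 6) <= e * M" using e by(intro mult_left_mono vb) simp
   hence "e * LI (%x. abs (v n x) ^ 6) + LI (%x. F n x) < ep / 2 + ep / 2" using eM elim by(intro add_le_less_mono) auto
   thus ?thesis by simp
  qed
  finally have "LI (%x. W x * abs (v n x) powr p) < ep" .
  moreover have "0 <= LI (%x. W x * abs (v n x) powr p)" using W_nonneg by(intro integral_nonneg_AE AE_I2) simp
  ultimately show ?case by(simp add: dist_real_def)
 qed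
qed

text \<open>Testing the difference of two derivatives with the difference \<open>h\<close> of the two functions: below
 the level given by the smallness condition half of the gradient term absorbs the critical term,
 the Coulomb term is strongly monotone, and only the subcritical term needs compactness. So
 Palais--Smale sequences are Cauchy without passing to weak limits.\<close>

theorem palais_smale:
 assumes u: "!!n. u n : E" and R: "!!n. E_norm (u n) <= R" and A: "!!n. gform (u n) (u n) <= M" and M: "M > 0"
  and small: "20 * 262144 * M^2 <= 1" and e: "e ----> 0"
  and d: "!!n v. v : E ==> abs (DIf (u n) v) <= e n * E_norm v"
 shows "EX r w. strict_mono (r :: nat => nat) & w : E & (%n. E_norm (u (r n) - w)) ----> 0"
proof -
 interpret S: seminormed_carrier E E_norm by(rule seminormed_E)
 have R0: "R >= 0" using R[of 0] E_norm_ge_0[of "u 0"] by linarith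
 define S where "S = 262144 * M ^ 3"
 note D = D12_dest[OF E_D12[OF u]]
 have six: "LI (%x. abs (u n x) ^ 6) <= S" for n using sobolev_D12[OF E_D12[OF u], of n] power_mono[OF A[of n] gform_nonneg, of 3] by(simp add: S_def)
 have six': "NL (%x. enn (abs (u n x) ^ 6)) <= enn S" for n using nn_integral_eq_integral[OF D(2)[of n]] six[of n] by(simp add: ennreal_leI)
 have gb: "grad_energy (weak_grad (u n)) <= enn M" for n using ennreal_gform[OF D(3,5), of n] A[of n] by(metis ennreal_leI)
 obtain r where r: "strict_mono r" "AE x in leb. convergent (%n. u (r n) x)" by(rule rellich_AE[of u "%n. weak_grad (u n)" M S, OF D(3) D(1) D(4) gb D(2) six'])
 define x where "x n = u (r n)" for n
 have xE: "x n : E" for n by(simp add: x_def u)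
 have xm: "x n : bmeas" for n by(rule E_measurable[OF xE])
 have x6: "integ (%y. abs (x n y) ^ 6)" for n by(rule D12_dest(2)[OF E_D12[OF xE]])
 define w where "w y = lim (%n. x n y)" for y
 have xw: "AE y in leb. (%n. x n y) ----> w y" using r(2) by eventually_elim (simp add: w_def x_def convergent_LIMSEQ_iff)
 have wm: "w : bmeas" unfolding w_def by(rule borel_measurable_lim_metric) (rule xm)
 have w6: "integ (%y. abs (w y) ^ 6)" and w6b': "LI (%y. abs (w y) ^ 6) <= S"
 proof -
  have xw6: "AE y in leb. (%n. abs (x n y) ^ 6) ----> abs (w y) ^ 6" using xw by eventually_elim (intro tendsto_intros)
  show "integ (%y. abs (w y) ^ 6)" "LI (%y. abs (w y) ^ 6) <= S"
   by(rule fatou_integral_le[OF x6 _ _ _ xw6, where N=0 and e=S]; use six wm in \<open>simp add: x_def del: power_even_abs_numeral\<close>)+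
 qed
 define v where "v n y = x n y + (- 1) * w y" for n y
 have vm: "v n : bmeas" for n using xm wm by(simp add: v_def[abs_def])
 have nw6: "integ (%y. abs (- 1 * w y) ^ 6)" using w6 by simp
 have v6: "integ (%y. abs (v n y) ^ 6)" for n unfolding v_def by(rule integrable_sixth_add[OF xm x6 _ nw6]) (use wm in simp)
 have T0: "(%n. LI (%y. W y * abs (v n y) powr p)) ----> 0"
 proof (rule subcritical_integral_tendsto_zero[OF vm _ v6, where M="128 * S"])
  show "AE y in leb. (%n. v n y) ----> 0" using xw
  proof eventually_elim
   case (elim y)
   have "(%n. v n y) ----> w y + (- 1) * w y" unfolding v_def by(intro tendsto_intros elim)
   thus ?case by simp
  qed
  fix n
  have "LI (%y. abs (v n y) ^ 6) <= LI (%y. 64 * (abs (x n y) ^ 6 + abs (w y) ^ 6))"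
  proof (rule integral_mono[OF v6])
   show "integ (%y. 64 * (abs (x n y) ^ 6 + abs (w y) ^ 6))" by(intro integrable_mult_right Lintegrable_add x6 w6)
   show "abs (v n y) ^ 6 <= 64 * (abs (x n y) ^ 6 + abs (w y) ^ 6)" for y using abs_add_power6_le[of "x n y" "- 1 * w y"] unfolding v_def by simp
  qed
  also have "... = 64 * (LI (%y. abs (x n y) ^ 6) + LI (%y. abs (w y) ^ 6))" by(subst integral_mult_right_zero, subst Lintegral_add[OF x6 w6]) simp
  also have "... <= 128 * S" using six[of "r n"] w6b' by(simp add: x_def)
  finally show "LI (%y. abs (v n y) ^ 6) <= 128 * S" .
 qed
 let ?h = "%m n y. x m y - x n y"
 have hE: "?h m n : E" for m n by(rule E_diff[OF xE xE])
 have gh: "gF (?h m n) (?h m n) <= 2 powr p * (LI (%y. W y * abs (v m y) powr p) + LI (%y. W y * abs (v n y) powr p))" for m n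
 proof -
  have pf: "integ (%y. W y * abs (v k y) powr p)" for k using power_finite_G[OF vm v6, of k] by(simp add: power_finite_def)
  have "gF (?h m n) (?h m n) <= LI (%y. 2 powr p * (W y * abs (v m y) powr p + W y * abs (v n y) powr p))" unfolding G.form_self
  proof (rule integral_mono)
   show "integ (%y. W y * abs (?h m n y) powr p)" using E_finite_G[OF hE] by(simp add: power_finite_def)
   show "integ (%y. 2 powr p * (W y * abs (v m y) powr p + W y * abs (v n y) powr p))" by(intro integrable_mult_right Lintegrable_add pf)
   fix y
   have "abs (?h m n y) powr p <= 2 powr p * (abs (v m y) powr p + abs (v n y) powr p)"
    using abs_add_powr_le[of p "v m y" "- v n y"] p4 by(simp add: v_def abs_minus_commute[of "w y" "x n y"])
   from mult_left_mono[OF this W_nonneg[of y]]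
   show "W y * abs (?h m n y) powr p <= 2 powr p * (W y * abs (v m y) powr p + W y * abs (v n y) powr p)" by(simp add: algebra_simps)
  qed
  also have "... = 2 powr p * (LI (%y. W y * abs (v m y) powr p) + LI (%y. W y * abs (v n y) powr p))"
   by(subst integral_mult_right_zero, subst Lintegral_add[OF pf pf]) simp
  finally show ?thesis .
 qed
 define GR where "GR = KG * R powr p"
 have gx: "gF (x n) (x n) <= GR" for n
 proof -
  have "gform (x n) (x n) powr (p / 2) <= (R^2) powr (p / 2)" using gform_le_norm[of "x n"] power_mono[OF R[of "r n"] E_norm_ge_0, of 2] gform_nonneg p4
   by(intro powr_mono2) (auto simp: x_def)
  also have "(R^2) powr (p / 2) = R powr p" by(simp only: powr_numeral_nonneg[OF R0, symmetric] powr_powr) simp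
  finally have "KG * gform (x n) (x n) powr (p / 2) <= GR" unfolding GR_def using KG_ge by(intro mult_left_mono) auto
  thus ?thesis using sobolev_gF[OF xE, of n] by linarith
 qed
 let ?g = "%m n. gform (?h m n) (?h m n)" and ?c = "%m n. cform (?h m n) (?h m n)"
 have main: "?g m n / 2 + ?c m n / 4
   <= (abs (e (r m)) + abs (e (r n))) * (2 * R) + abs (gF (x m) (?h m n)) + abs (gF (x n) (?h m n))" for m n
 proof -
  have N2: "E_norm (?h m n) <= 2 * R" using S.N_diff_le[OF xE xE, of m n] R[of "r m"] R[of "r n"] by(simp add: fun_ops x_def)
  have DI: "abs (DIf (x k) (?h m n)) <= abs (e (r k)) * (2 * R)" for k
  proof -
   have "abs (DIf (x k) (?h m n)) <= e (r k) * E_norm (?h m n)" unfolding x_def by(rule d[OF hE[unfolded x_def]])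
   also have "... <= abs (e (r k)) * (2 * R)" using N2 E_norm_ge_0 by(intro mult_mono) auto
   finally show ?thesis .
  qed
  have a: "?g m n = gform (x m) (?h m n) - gform (x n) (?h m n)"
  proof -
   have "?h m n = (%y. x m y + (- 1) * x n y)" by auto
   hence "?g m n = gform (%y. x m y + (- 1) * x n y) (?h m n)" by simp
   also have "... = gform (x m) (?h m n) - gform (x n) (?h m n)" by(simp only: gform_add_left[OF hE xE E_scale[OF xE]] gform_scale_left[OF xE hE]; simp)
   finally show ?thesis .
  qed
  have b: "?c m n / 4 <= cform (x m) (?h m n) - cform (x n) (?h m n)" using cform_monotone[OF xE xE, of m n] by simp
  have c: "cF (x m) (?h m n) - cF (x n) (?h m n) <= ?g m n / 2" by(rule cF_difference[OF xE xE _ _ M small]) (use A in \<open>auto simp: x_def\<close>)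
  have "DIf (x m) (?h m n) - DIf (x n) (?h m n) = ?g m n + (cform (x m) (?h m n) - cform (x n) (?h m n))
    - (gF (x m) (?h m n) - gF (x n) (?h m n)) - (cF (x m) (?h m n) - cF (x n) (?h m n))" unfolding DIf_def a by simp
  moreover have "(abs (e (r m)) + abs (e (r n))) * (2 * R) = abs (e (r m)) * (2 * R) + abs (e (r n)) * (2 * R)" by(rule distrib_right)
  moreover have "a / 2 + B <= Z + abs g1 + abs g2"
   if "abs d1 <= X" "abs d2 <= Y" "d1 - d2 = a + b - (g1 - g2) - c" "Z = X + Y" "B <= b" "c <= a / 2" for a b c d1 d2 g1 g2 B X Y Z :: real using that by linarith
  ultimately show ?thesis using DI[of m] DI[of n] b c by blast
 qed
 have cauchy: "EX N. ALL m>=N. ALL n>=N. ?g m n / 2 + ?c m n / 4 <= dl" if dl: "dl > 0" for dl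
 proof -
  define s where "s = 8 * (GR + 1) / dl"
  have GR0: "GR >= 0" using KG_ge by(simp add: GR_def)
  have s: "s > 0" using dl GR0 by(simp add: s_def)
  have "GR * dl <= (GR + 1) * dl" using dl by simp
  hence Gs: "GR / s <= dl / 8" using dl GR0 s by(simp add: s_def field_simps)
  have "(%n. s powr (p - 1) * (2 powr p * LI (%y. W y * abs (v n y) powr p))) ----> s powr (p - 1) * (2 powr p * 0)" by(intro tendsto_intros T0)
  hence "eventually (%n. s powr (p - 1) * (2 powr p * LI (%y. W y * abs (v n y) powr p)) < dl / 16) sequentially" by(rule order_tendstoD) (use dl in simp)
  moreover have "(%n. abs (e (r n)) * (2 * R)) ----> abs 0 * (2 * R)" using LIMSEQ_subseq_LIMSEQ[OF e r(1)] by(intro tendsto_intros) (simp add: o_def)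
  hence "eventually (%n. abs (e (r n)) * (2 * R) < dl / 8) sequentially" by(rule order_tendstoD) (use dl in simp)
  ultimately have "eventually (%n. s powr (p - 1) * (2 powr p * LI (%y. W y * abs (v n y) powr p)) < dl / 16 & abs (e (r n)) * (2 * R) < dl / 8) sequentially"
   by(rule eventually_conj)
  then obtain N where N: "!!n. n >= N ==> s powr (p - 1) * (2 powr p * LI (%y. W y * abs (v n y) powr p)) < dl / 16"
   "!!n. n >= N ==> abs (e (r n)) * (2 * R) < dl / 8" by(auto simp: eventually_sequentially)
  have "?g m n / 2 + ?c m n / 4 <= dl" if mn: "m >= N" "n >= N" for m n
  proof -
   have "s powr (p - 1) * gF (?h m n) (?h m n) <= s powr (p - 1) * (2 powr p * (LI (%y. W y * abs (v m y) powr p) + LI (%y. W y * abs (v n y) powr p)))"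
    by(intro mult_left_mono gh) auto
   also have "... <= dl / 8" using N(1)[OF mn(1)] N(1)[OF mn(2)] by(simp add: distrib_left)
   finally have hs: "s powr (p - 1) * gF (?h m n) (?h m n) <= dl / 8" .
   have g: "abs (gF (x k) (?h m n)) <= dl / 4" for k
   proof -
    have "gF (x k) (x k) / s <= GR / s" using gx[of k] s by(intro divide_right_mono) auto
    thus ?thesis using gF_abs_le[OF xE hE s, of k m n] Gs hs by linarith
   qed
   show ?thesis using main[of m n] g[of m] g[of n] N(2)[OF mn(1)] N(2)[OF mn(2)] unfolding distrib_right by linarith
  qed
  thus ?thesis by blast
 qed
 \<comment> \<open>The earlier \<open>w\<close> is a limit almost everywhere and served the
   subcritical term; the limit in \<open>E\<close> now comes from completeness.\<close>
 obtain w where w: "w : E" "(%n. gform (%y. x n y - w y) (%y. x n y - w y)) ----> 0"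
  "(%n. coulomb_energy (%y. x n y - w y)) ----> 0"
 proof (rule E_complete[OF xE])
  show "AE y in leb. convergent (%n. x n y)" using r(2) by(simp add: x_def)
  show "EX N. ALL m>=N. ALL n>=N. ?g m n <= dl" if dl: "dl > 0" for dl
  proof -
   obtain N where N: "ALL m>=N. ALL n>=N. ?g m n / 2 + ?c m n / 4 <= dl / 2" using cauchy[of "dl / 2"] dl by auto
   have "?g m n <= dl" if "m >= N" "n >= N" for m n using N[rule_format, OF that] cform_nonneg[of "?h m n"] by linarith
   thus ?thesis by blast
  qed
  show "EX N. ALL m>=N. ALL n>=N. coulomb_energy (?h m n) <= dl" if dl: "dl > 0" for dl
  proof -
   have "dl / (16 * pi) > 0" using dl by simp
   then obtain N where N: "ALL m>=N. ALL n>=N. ?g m n / 2 + ?c m n / 4 <= dl / (16 * pi)" using cauchy[of "dl / (16 * pi)"] by auto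
   have "coulomb_energy (?h m n) <= dl" if "m >= N" "n >= N" for m n
   proof -
    have "?c m n <= 4 * (dl / (16 * pi))" using N[rule_format, OF that] gform_nonneg[of "?h m n"] by linarith
    thus ?thesis by(simp add: cform_self field_simps)
   qed
   thus ?thesis by blast
  qed
 qed
 have "(%n. gform (%y. x n y - w y) (%y. x n y - w y) powr (1/2) + (coulomb_energy (%y. x n y - w y) / (4 * pi)) powr (1/4))
   ----> 0 powr (1/2) + (0 / (4 * pi)) powr (1/4)" using gform_nonneg coulomb_energy_nonneg by(intro tendsto_add tendsto_powr' tendsto_divide w tendsto_const) auto
 hence "(%n. E_norm (u (r n) - w)) ----> 0" by(simp add: E_norm_def cform_self fun_ops x_def)
 thus ?thesis using r(1) w(1) by blast
qed

end

lemma continuous_compact_support_integrable: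
 fixes h :: "real^3 => 'b::euclidean_space"
 assumes h: "continuous_on UNIV h" and K: "compact K" "!!x. x ~: K ==> h x = 0"
 shows "integ h"
proof -
 obtain M where M: "M >= 0" "!!x. norm (h x) <= M * ind K x" using continuous_compact_support_bounded[OF h K] by blast
 have Ks: "K : sets leb" "emeasure leb K < \<infinity>"
  using K(1) emeasure_bounded_finite[OF compact_imp_bounded[OF K(1)]] by(simp_all add: compact_imp_closed borel_closed)
 have i: "integ (%x. M * ind K x :: real)" using Ks by(intro integrable_mult_right) (simp add: integrable_real_indicator)
 show ?thesis
 proof (rule Lintegrable_bound[OF i])
  show "h : bmeas" by(rule continuous_borel_lebesgue[OF h])
  show "AE x in leb. norm (h x) <= norm (M * ind K x :: real)" using M by(intro AE_I2) (auto intro: order_trans[OF _ abs_ge_self])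
 qed
qed

section \<open>Critical points\<close>

lemma integral_translate_lebesgue:
 fixes f :: fn
 assumes "continuous_on UNIV f"
 shows "LI (%x. f (c + x)) = LI (%x. f x)"
proof -
 have m: "f : borel_measurable borel" by(rule borel_measurable_continuous_onI[OF assms])
 hence m': "(%x. f (c + x)) : borel_measurable borel" by simp
 have "(LINT x|lborel. f x) = (LINT x|distr lborel borel ((+) c). f x)" by(simp only: lborel_distr_plus)
 also have "... = (LINT x|lborel. f (c + x))" using m by(subst integral_distr) auto
 finally show ?thesis using m m' by(simp add: integral_completion)
qed

lemma partial_deriv_along_line:
 assumes "f differentiable at (x + s *R axis i 1)"
 shows "((%s. f (x + s *R axis i 1)) has_real_derivative pd i f (x + s *R axis i 1)) (at s)"
proof -
 let ?y = "x + s *R axis i 1"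
 let ?D = "frechet_derivative f (at ?y)"
 have D: "(f has_derivative ?D) (at ?y)" using assms by(simp add: frechet_derivative_works)
 have g: "((%s. x + s *R axis i 1) has_derivative (%h. h *R axis i 1)) (at s)" by(auto intro!: derivative_eq_intros)
 have "((%s. f (x + s *R axis i 1)) has_derivative (%h. ?D (h *R axis i 1))) (at s)" by(rule has_derivative_compose[OF g D])
 moreover have "?D (h *R axis i 1) = pd i f ?y * h" for h using linear_cmul[OF has_derivative_linear[OF D]] by(simp add: partial_deriv_def)
 ultimately show ?thesis unfolding has_field_derivative_def by simp
qed

text \<open>Difference quotients have integral 0 by translation invariance, and dominated
  convergence passes to the derivative. Applied to a product of test functions it gives integration
  by parts.\<close>

lemma integral_partial_deriv_zero:
 assumes ps: "ps : test_functions"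
 shows "LI (%x. pd i ps x) = 0"
proof -
 obtain K where K: "compact K" "!!x. x ~: K ==> ps x = 0" "!!x i. x ~: K ==> pd i ps x = 0" using test_function_support[OF ps] by metis
 note c = test_function_continuous[OF ps] and pc = test_function_partial_continuous[OF ps, of i]
 have diff: "ps differentiable at x" for x
 proof -
  have "Ck (Suc 0) ps" using ps unfolding test_functions_def by blast
  hence "ps differentiable_on UNIV" by(simp only: Ck.simps)
  thus ?thesis by(simp add: differentiable_on_def)
 qed
 obtain M where M: "M >= 0" "!!x. norm (pd i ps x) <= M * ind K x" using continuous_compact_support_bounded[OF pc K(1) K(3)] by blast
 obtain R where R: "!!x. x : K ==> norm x <= R" using compact_imp_bounded[OF K(1)] by(auto simp: bounded_iff)
 let ?e = "axis i (1::real)"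
 define t where "t n = inverse (real (Suc n))" for n
 have t: "0 < t n" "t n <= 1" for n unfolding t_def by(auto simp: field_simps)
 have t0: "t ----> 0" unfolding t_def by(rule LIMSEQ_inverse_real_of_nat)
 define D where "D n x = (ps (t n *R ?e + x) - ps x) / t n" for n x
 have mvt: "EX z. 0 < z & z < t n & D n x = pd i ps (x + z *R ?e)" for n x
 proof -
  have "EX z. 0 < z & z < t n & ps (x + t n *R ?e) - ps (x + 0 *R ?e) = (t n - 0) * pd i ps (x + z *R ?e)" by(rule MVT2[OF t(1)]) (rule partial_deriv_along_line[OF diff])
  thus ?thesis using t(1)[of n] by(auto simp: D_def add.commute)
 qed
 obtain z where z: "!!n x. 0 < z n x" "!!n x. z n x < t n" "!!n x. D n x = pd i ps (x + z n x *R ?e)" using mvt by metis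
 have Dm: "D n : bmeas" for n unfolding D_def by(intro continuous_borel_lebesgue continuous_intros continuous_on_compose2[OF c]) (use t(1)[of n] in auto)
 have lim: "(%n. LI (%x. D n x)) ----> LI (%x. pd i ps x)"
 proof (rule integral_dominated_convergence[where w="%x. M * ind (cball 0 (R + 1)) x"])
  have fin: "emeasure leb (cball (0 :: real^3) (R + 1)) < \<infinity>"
   using emeasure_bounded_finite[OF bounded_cball, of "0 :: real^3" "R + 1"] by(simp add: borel_closed)
  show "integ (%x :: real^3. M * ind (cball 0 (R + 1)) x)" by(intro integrable_mult_right integrable_real_indicator fin) (simp add: borel_closed)
  show "AE x in leb. (%n. D n x) ----> pd i ps x"
  proof (rule AE_I2)
   fix x
   have "(%n. z n x) ----> 0" by(rule tendsto_sandwich[OF _ _ tendsto_const t0]) (use z in \<open>auto simp: less_imp_le\<close>)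
   hence "(%n. x + z n x *R ?e) ----> x + 0 *R ?e" by(intro tendsto_intros)
   hence "(%n. pd i ps (x + z n x *R ?e)) ----> pd i ps (x + 0 *R ?e)" by(rule continuous_on_tendsto_compose[OF pc]) auto
   thus "(%n. D n x) ----> pd i ps x" unfolding z(3) by simp
  qed
  show "AE x in leb. norm (D n x) <= M * ind (cball 0 (R + 1)) x" for n :: nat
  proof (rule AE_I2)
   fix x
   show "norm (D n x) <= M * ind (cball 0 (R + 1)) x"
   proof (cases "x + z n x *R ?e : K")
    case True
    have "norm x <= norm (x + z n x *R ?e) + norm (z n x *R ?e)" using norm_triangle_ineq4[of "x + z n x *R ?e" "z n x *R ?e"] by simp
    also have "... <= R + 1" using R[OF True] z(1,2)[of n x] t(2)[of n] by(intro add_mono) (auto simp: norm_axis_1)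
    finally show ?thesis using M(2)[of "x + z n x *R ?e"] True unfolding z(3) by simp
   next
    case False
    thus ?thesis using M(1) unfolding z(3) by(simp add: K(3))
   qed
  qed
 qed (use Dm continuous_borel_lebesgue[OF pc] in auto)
 have "LI (%x. D n x) = 0" for n
 proof -
  have i1: "integ ps" by(rule continuous_compact_support_integrable[OF c K(1,2)])
  have i2: "integ (%x. ps (t n *R ?e + x))"
  proof (rule continuous_compact_support_integrable[where K="(%x. x - t n *R ?e) ` K"])
   show "continuous_on UNIV (%x. ps (t n *R ?e + x))" by(intro continuous_on_compose2[OF c] continuous_intros) auto
   show "compact ((%x. x - t n *R ?e) ` K)" by(intro compact_continuous_image K continuous_intros)
   fix x assume "x ~: (%x. x - t n *R ?e) ` K"
   hence "t n *R ?e + x ~: K" by(metis add_diff_cancel_left' image_eqI)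
   thus "ps (t n *R ?e + x) = 0" by(rule K(2))
  qed
  have "LI (%x. D n x) = (LI (%x. ps (t n *R ?e + x)) - LI (%x. ps x)) / t n" unfolding D_def by(subst integral_divide_zero, subst Lintegral_diff[OF i2 i1]) simp
  thus ?thesis unfolding integral_translate_lebesgue[OF c] by simp
 qed
 hence "(%n::nat. 0) ----> LI (%x. pd i ps x)" using lim by simp
 thus ?thesis by(simp only: LIMSEQ_const_iff)
qed

lemma test_functions_mult:
 assumes "ph : test_functions" "ps : test_functions"
 shows "(%x. ph x * ps x) : test_functions"
proof -
 have "closure {x. ph x * ps x ~= 0} \<subseteq> closure {x. ph x ~= 0}" by(intro closure_mono) auto
 hence "closure {x. ph x * ps x ~= 0} = closure {x. ph x ~= 0} \<inter> closure {x. ph x * ps x ~= 0}" by blast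
 moreover have "compact (closure {x. ph x ~= 0} \<inter> closure {x. ph x * ps x ~= 0})"
  using assms(1) by(intro compact_Int_closed closed_closure) (simp add: test_functions_def)
 ultimately have "compact (closure {x. ph x * ps x ~= 0})" by metis
 thus ?thesis using assms by(simp add: test_functions_def Ck_mult)
qed

lemma locally_integrable_of_integrable:
 fixes f :: "real^3 => 'b::euclidean_space"
 assumes "integ f"
 shows "loc_int f" unfolding locally_integrable_def set_integrable_def using assms by(auto intro!: integrable_mult_indicator simp: compact_imp_closed borel_closed)

lemma test_function_weak_gradient:
 assumes e: "e : test_functions"
 shows "wgrad e (%x. \<chi> i. pd i e x)"
  and "integ (%x. (norm (\<chi> i. pd i e x))^2)"
proof -
 obtain K where K: "compact K" "!!x. x ~: K ==> e x = 0" "!!x i. x ~: K ==> pd i e x = 0" using test_function_support[OF e] by metis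
 let ?G = "%x. \<chi> i. pd i e x"
 have Gc: "continuous_on UNIV ?G" by(intro continuous_on_vec_lambda test_function_partial_continuous[OF e])
 have Gz: "?G x = 0" if "x ~: K" for x using K(3)[OF that] by(simp add: vec_eq_iff)
 show "integ (%x. (norm (?G x))^2)"
  by(rule continuous_compact_support_integrable[OF _ K(1)]) (use Gz in \<open>auto intro!: continuous_on_power continuous_on_norm Gc\<close>)
 show "wgrad e ?G" unfolding has_weak_gradient_def
 proof (intro conjI ballI allI)
  show "loc_int e" by(intro locally_integrable_of_integrable continuous_compact_support_integrable[OF test_function_continuous[OF e] K(1,2)])
  show "loc_int ?G" by(intro locally_integrable_of_integrable continuous_compact_support_integrable[OF Gc K(1) Gz])
  fix ph i assume ph: "ph : test_functions"
  have d: "f differentiable at x" if "f : test_functions" for f x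
  proof -
   have "Ck (Suc 0) f" using that unfolding test_functions_def by blast
   hence "f differentiable_on UNIV" by(simp only: Ck.simps)
   thus ?thesis by(simp add: differentiable_on_def)
  qed
  have i1: "integ (%x. e x * pd i ph x)"
   by(rule continuous_compact_support_integrable[OF continuous_on_mult[OF test_function_continuous[OF e] test_function_partial_continuous[OF ph]] K(1)]) (simp add: K(2))
  have i2: "integ (%x. pd i e x * ph x)"
   by(rule continuous_compact_support_integrable[OF continuous_on_mult[OF test_function_partial_continuous[OF e] test_function_continuous[OF ph]] K(1)]) (simp add: K(3))
  have "0 = LI (%x. pd i (%x. e x * ph x) x)" by(rule integral_partial_deriv_zero[OF test_functions_mult[OF e ph], symmetric])
  also have "... = LI (%x. e x * pd i ph x + pd i e x * ph x)" by(simp only: partial_deriv_mult[OF d[OF e] d[OF ph]])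
  also have "... = LI (%x. e x * pd i ph x) + LI (%x. pd i e x * ph x)" by(rule Lintegral_add[OF i1 i2])
  finally show "LI (%x. e x * pd i ph x) = - LI (%x. ?G x $ i * ph x)" by simp
 qed
qed

lemma test_function_in_E:
 assumes e: "e : test_functions"
 shows "e : E"
proof -
 obtain K where K: "compact K" "!!x. x ~: K ==> e x = 0" "!!x i. x ~: K ==> pd i e x = 0" using test_function_support[OF e] by metis
 note c = test_function_continuous[OF e]
 have m: "e : bmeas" by(rule continuous_borel_lebesgue[OF c])
 have "integ (%x. abs (e x) ^ 6)"
  by(rule continuous_compact_support_integrable[OF _ K(1)]) (use K(2) in \<open>auto intro!: continuous_on_power continuous_on_rabs c\<close>)
 hence D: "e : D12" by(intro D12_intro[OF m _ test_function_weak_gradient[OF e]])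
 obtain M where M: "M >= 0" "!!x. norm ((e x)^2) <= M * ind K x"
  by(rule continuous_compact_support_bounded[of "%x. (e x)^2" K]) (use K in \<open>auto intro!: continuous_on_power c\<close>)
 obtain R where R: "!!x. x : K ==> norm x <= R" using compact_imp_bounded[OF K(1)] by(auto simp: bounded_iff)
 have "cfin (%x. (e x)^2)"
 proof (rule cfin_bounded[where M=M and R="max R 1"])
  show "abs ((e x)^2) <= M * ind (cball 0 (max R 1)) x" for x
  proof (cases "x : K")
   case True
   thus ?thesis using M(2)[of x] R[OF True] by(simp add: le_max_iff_disj)
  qed (use M(1) K(2) in simp)
 qed (use m in auto)
 thus ?thesis using D by(simp add: E_iff)
qed

text \<open>A cube inside \<open>U\<close> is cut into \<open>n + 1\<close> slabs along the first
  axis, with one bump on each. Slabs with larger index continue the stack beyond the cube, so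
  inclusion in \<open>U\<close> is claimed up to \<open>n\<close>.\<close>

lemma disjoint_bumps:
 assumes U: "open U" "U ~= {}"
 shows "EX (e :: nat => real^3 => real) V. (ALL j. e j : test_functions) & (ALL j x. e j x ~= 0 --> x : V j) &
  (ALL j x. x : V j --> e j x > 0) & (ALL j. open (V j)) & (ALL j. V j ~= {}) & (ALL j<=n. V j \<subseteq> U) & (ALL i j. i ~= j --> V i \<inter> V j = {})"
proof -
 obtain x0 d where x0: "d > 0" "ball x0 d \<subseteq> U" using U open_contains_ball by blast
 \<comment> \<open>A cube of half side \<open>r\<close> has l1 radius \<open>3 * r\<close>, which is
   less than \<open>d\<close>.\<close>
 define r where "r = d / 4"
 have r: "r > 0" using x0 by(simp add: r_def)
 define h where "h = 2 * r / real (Suc n)"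
 have h: "h > 0" using r by(simp add: h_def)
 define a where "a j = (\<chi> l. if l = 1 then x0 $ 1 - r + real j * h else x0 $ l - r)" for j :: nat
 define b where "b j = (\<chi> l. if l = 1 then x0 $ 1 - r + (real j + 1) * h else x0 $ l + r)" for j :: nat
 define e where "e j x = (\<Prod>l\<in>UNIV. bump 0 (a j $ l) (b j $ l) (x $ l))" for j and x :: "real^3"
 define V where "V j = box (a j) (b j)" for j
 have ab: "a j $ l < b j $ l" for j l using h r by(simp add: a_def b_def distrib_right)
 show ?thesis
 proof (intro exI[of _ e] exI[of _ V] conjI allI impI)
  show "e j : test_functions" for j unfolding e_def by(rule bump_prod_test)
  show "x : V j" if "e j x ~= 0" for j x
  proof -
   have "bump 0 (a j $ l) (b j $ l) (x $ l) ~= 0" for l using that by(auto simp: e_def)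
   hence "a j $ l < x $ l & x $ l < b j $ l" for l using bump_zero by blast
   thus ?thesis by(simp add: V_def mem_box_cart)
  qed
  show "e j x > 0" if "x : V j" for j x unfolding e_def using that by(intro prod_pos ballI bump_pos) (auto simp: V_def mem_box_cart)
  show "open (V j)" for j by(simp add: V_def open_box)
  show "V j ~= {}" for j using ab by(auto simp: V_def open_box interval_ne_empty_cart)
  show "V j \<subseteq> U" if j: "j <= n" for j
  proof
   fix x assume "x : V j"
   hence x: "a j $ l < x $ l" "x $ l < b j $ l" for l by(auto simp: V_def mem_box_cart)
   have "(real j + 1) * h <= real (Suc n) * h" using j h by(intro mult_right_mono) auto
   also have "... = 2 * r" by(simp add: h_def)
   finally have jh: "(real j + 1) * h <= 2 * r" .
   have jh0: "real j * h >= 0" using h by simp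
   have "abs (x $ l - x0 $ l) <= r" for l
   proof (cases "l = 1")
    case True
    have "x0 $ 1 - r + real j * h < x $ 1" "x $ 1 < x0 $ 1 - r + (real j + 1) * h" using x[of 1] by(simp_all add: a_def b_def)
    thus ?thesis using jh jh0 True by(simp add: abs_le_iff)
   next
    case False
    thus ?thesis using x[of l] by(simp add: a_def b_def abs_le_iff)
   qed
   hence c: "abs ((x - x0) $ l) <= r" for l by simp
   have "norm (x - x0) <= (\<Sum>l\<in>UNIV. abs ((x - x0) $ l))" by(rule norm_le_l1_cart)
   also have "... <= 3 * r" using c[of 1] c[of 2] c[of 3] by(simp add: sum_3)
   also have "... < d" using x0 by(simp add: r_def)
   finally show "x : U" using x0(2) by(auto simp: dist_norm norm_minus_commute)
  qed
  have dis: "V i \<inter> V j = {}" if "i < j" for i j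
  proof -
   have "(real i + 1) * h <= real j * h" using that h by(intro mult_right_mono) auto
   hence "b i $ 1 <= a j $ 1" by(simp add: a_def b_def)
   thus ?thesis unfolding V_def by(auto simp: mem_box_cart) (meson less_le_trans less_asym not_less)
  qed
  show "V i \<inter> V j = {}" if "i ~= j" for i j using that dis[of i j] dis[of j i] by(cases "i < j") (auto simp: not_less)
 qed
qed

section \<open>The level of the sphere of bumps and the count of solutions\<close>

text \<open>For small \<open>t\<close> the two positive terms together stay below \<open>c\<close>;
  from the threshold \<open>ta\<close> on, t^p >= t^4 ta^(p-4) because \<open>p > 4\<close>, and a
  large \<open>l\<close> makes the negative term outweigh both. This is the origin of the threshold
  for lambda.\<close>

lemma fibre_level_bound:
 fixes R ka p c :: real
 assumes R: "R >= 0" and ka: "ka > 0" and p: "p > 4" and c: "c > 0"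
 shows "EX La>0. ALL l>=La. ALL t>0. R^2 * (t^2 / 2) + R ^ 4 * (t ^ 4 / 4) - l * ka * (t powr p / p) <= c"
proof -
 define dl where "dl = min 1 c"
 have dl: "dl > 0" "dl <= 1" "dl <= c" using c by(auto simp: dl_def)
 define ta where "ta = dl / (R + 1)"
 have ta: "ta > 0" using dl R by(simp add: ta_def)
 have Rta: "R * ta <= dl"
 proof -
  have "R * ta = dl * (R / (R + 1))" by(simp add: ta_def)
  also have "... <= dl * 1" using dl R by(intro mult_left_mono) auto
  finally show ?thesis by simp
 qed
 define B where "B = R^2 / (2 * ta^2) + R ^ 4 / 4"
 have B: "B >= 0" by(simp add: B_def)
 define q where "q = ka * ta powr (p - 4) / p"
 have q: "q > 0" using ka ta p by(simp add: q_def)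
 show ?thesis
 proof (intro exI[of _ "B / q + 1"] conjI allI impI)
  show "0 < B / q + 1" using B q by(simp add: add_nonneg_pos)
  fix l t :: real assume l: "B / q + 1 <= l" and t: "0 < t"
  have "B / q >= 0" using B q by simp
  hence l0: "l > 0" using l by linarith
  have "B / q <= l" using l by linarith
  hence Bq: "B <= l * q" using q by(simp add: pos_divide_le_eq)
  show "R^2 * (t^2 / 2) + R ^ 4 * (t ^ 4 / 4) - l * ka * (t powr p / p) <= c"
  proof (cases "t <= ta")
   case True
   have "R * t <= dl" using Rta mult_left_mono[OF True R] by linarith
   hence 2: "(R * t)^2 <= dl^2" and 4: "(R * t) ^ 4 <= dl ^ 4" using R t by(auto intro!: power_mono)
   have "dl^2 <= dl" "dl ^ 4 <= dl" using dl power_decreasing[of 1 2 dl] power_decreasing[of 1 4 dl] by auto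
   hence "R^2 * t^2 <= c" "R ^ 4 * t ^ 4 <= c" using 2 4 dl by(auto simp: power_mult_distrib)
   moreover have "0 <= l * ka * (t powr p / p)" using l0 ka p by simp
   moreover have "A * (t^2 / 2) + B * (t ^ 4 / 4) - C <= c" if "A * t^2 <= c" "B * t ^ 4 <= c" "0 <= C" for A B C using that c by simp
   ultimately show ?thesis by blast
  next
   case False
   hence "ta^2 <= t^2" using ta by(intro power_mono) auto
   hence "t^2 * ta^2 <= t ^ 4" using mult_left_mono[of "ta^2" "t^2" "t^2"] by(simp flip: power_add)
   hence "t^2 <= t ^ 4 / ta^2" using ta by(simp add: pos_le_divide_eq)
   hence "R^2 * (t^2 / 2) <= R^2 * (t ^ 4 / ta^2 / 2)" by(intro mult_left_mono divide_right_mono) auto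
   hence s: "R^2 * (t^2 / 2) + R ^ 4 * (t ^ 4 / 4) <= B * t ^ 4" by(simp add: B_def distrib_right)
   have "t powr p = t powr 4 * t powr (p - 4)" by(simp flip: powr_add)
   also have "... >= t powr 4 * ta powr (p - 4)" using False ta p by(intro mult_left_mono powr_mono2) auto
   finally have "t ^ 4 * ta powr (p - 4) <= t powr p" using t by(simp add: powr_numeral)
   hence "(l * ka / p) * (t ^ 4 * ta powr (p - 4)) <= (l * ka / p) * t powr p" using l0 ka p by(intro mult_left_mono) auto
   moreover have "(l * ka / p) * (t ^ 4 * ta powr (p - 4)) = (l * q) * t ^ 4" by(simp add: q_def)
   moreover have "B * t ^ 4 <= (l * q) * t ^ 4" using Bq by(intro mult_right_mono) auto
   moreover have "l * ka * (t powr p / p) = (l * ka / p) * t powr p" by simp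
   ultimately have "B * t ^ 4 <= l * ka * (t powr p / p)" by simp
   hence "R^2 * (t^2 / 2) + R ^ 4 * (t ^ 4 / 4) <= l * ka * (t powr p / p)" by(rule order_trans[OF s])
   thus ?thesis using c by(simp only: diff_le_eq add_increasing less_imp_le)
  qed
 qed
qed

context schroedinger
begin

lemma cF_nonneg: "0 <= cF u u" by(rule C.form_nonneg)

text \<open>Links equality almost everywhere with distance 0, so that pairs at positive distance are
  distinct in the sense of \<open>same_pair\<close>.\<close>

lemma E_norm_zero_of_AE:
 assumes u: "u : E" and z: "AE x in leb. u x = 0"
 shows "E_norm u = 0"
proof -
 interpret nehari E E_norm gform cform gF cF p "1" KG by(rule nehari_E)
 have "AE x in leb. abs (u x) ^ 6 = 0" using z by eventually_elim simp
 hence "cF u u = 0" unfolding cF_self by(rule integral_eq_zero_AE)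
 hence "gform u u = 0" by(rule c_zero[OF u])
 moreover have "cform u u = 0"
 proof -
  have "AE z in LL. pdens (%x. (u x)^2) (%x. (u x)^2) z = 0" using AE_LL[OF z] by eventually_elim (simp add: pdens_def)
  hence "coulomb_energy u = 0" unfolding coulomb_energy_def coulomb_def by(rule integral_eq_zero_AE)
  thus ?thesis by(simp add: cform_self)
 qed
 ultimately show ?thesis by(simp add: E_norm_def)
qed

lemma is_solution_iff: "is_solution p lam g u <-> u : E & (ALL v:E. DIf u v = 0)"
proof -
 have c: "cform u v = 1 / (4 * pi) * (LINT (x, y)|(leb \<Otimes>\<^sub>M leb). (u x)^2 * u y * v y / norm (x - y))" for v
  unfolding cform_def coulomb_def pdens_def by(simp add: case_prod_unfold mult.assoc)
 have gg: "gF u v = lam * LI (%x. g x * abs (u x) powr (p - 2) * u x * v x)" for v unfolding power_form_def spow_def W_def by(simp add: mult.assoc)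
 have cc: "cF u v = LI (%x. abs (u x) ^ 4 * u x * v x)" for v
 proof -
  have "abs t powr 4 = abs t ^ 4" for t :: real by(simp add: powr_numeral_nonneg)
  thus ?thesis unfolding power_form_def spow_def by(simp del: power_even_abs_numeral)
 qed
 show ?thesis unfolding is_solution_def DIf_def c gg cc gform_def ..
qed

lemma Phi_eq: "Phi p lam g u = gform u u / 2 + cform u u / 4 - gF u u / p - cF u u / 6"
proof -
 have "cform u u = 1 / (4 * pi) * (LINT z|(leb \<Otimes>\<^sub>M leb). coulomb_energy_density u z)"
  by(simp add: cform_self coulomb_energy_def coulomb_def coulomb_energy_density_eq)
 moreover have "gF u u = lam * LI (%x. g x * abs (u x) powr p)" unfolding G.form_self W_def by(simp add: mult.assoc)
 moreover have "gform u u = LI (%x. (norm (weak_grad u x))^2)" by(simp add: gform_def power2_norm_eq_inner)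
 ultimately show ?thesis unfolding Phi_def cF_self by simp
qed

text \<open>If the \<open>k\<close> pairs found so far were all, they would satisfy the assumptions
  of \<open>nehari_descent\<close> with \<open>k <= m\<close>, against
  \<open>too_few_critical_pairs\<close>. So there is another pair, at positive distance from the old
  ones.\<close>

lemma enough_critical_points:
 assumes h0: "seminormed_carrier.ncont E E_norm (SS m) h0" "!!x. x : SS m ==> gform (h0 x) (h0 x) > 0"
  "!!x. x : SS m ==> h0 (%i. - x i) = - h0 x"
  and c1: "c1 > 0" "20 * 262144 * (4 * c1)^2 <= 1"
  and level: "!!x t. x : SS m ==> t > 0 ==>
   gform (h0 x) (h0 x) * (t^2 / 2) + cform (h0 x) (h0 x) * (t ^ 4 / 4) - gF (h0 x) (h0 x) * (t powr p / p) - cF (h0 x) (h0 x) * (t ^ 6 / 6) <= c1"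
  and k: "k <= m"
 shows "EX us :: nat => real^3 => real. (ALL i<k. us i : E & gform (us i) (us i) > 0 & (ALL v:E. DIf (us i) v = 0)) &
  (ALL i<k. ALL j<k. i ~= j --> E_norm (us i - us j) > 0 & E_norm (us i + us j) > 0)" using k
proof (induction k)
 case 0
 thus ?case by simp
next
 case (Suc k)
 interpret nehari E E_norm gform cform gF cF p c1 KG by(rule nehari_E)
 have DI: "DI u v = DIf u v" for u v by(simp add: DI_def DIf_def)
 have "k <= m" using Suc.prems by simp
 from Suc.IH[OF this] obtain us where us': "ALL i<k. us i : E & gform (us i) (us i) > 0 & (ALL v:E. DIf (us i) v = 0)"
  "ALL i<k. ALL j<k. i ~= j --> E_norm (us i - us j) > 0 & E_norm (us i + us j) > 0" by(elim exE conjE)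
 have us: "us i : E" "gform (us i) (us i) > 0" "v : E ==> DIf (us i) v = 0" if "i < k" for i v using us'(1) that by auto
 note us4 = us'(2)[rule_format]
 have "EX w. critical w & (ALL i<k. E_norm (w - us i) ~= 0 & E_norm (w + us i) ~= 0)"
 proof (rule ccontr)
  assume no: "\<nexists>w. critical w & (ALL i<k. E_norm (w - us i) ~= 0 & E_norm (w + us i) ~= 0)"
  interpret nehari_descent E E_norm gform cform gF cF p c1 KG us k
  proof
   fix u :: "nat => fn" and e :: "nat => real"
   assume u: "!!n. u n : E" "EX R. ALL n. E_norm (u n) <= R" "!!n. gform (u n) (u n) <= 4 * c1" "e ----> 0"
    "!!n v. v : E ==> abs (DI (u n) v) <= e n * E_norm v"
   obtain R where R: "!!n. E_norm (u n) <= R" using u(2) by blast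
   show "EX r w. strict_mono (r :: nat => nat) & w : E & (%n. E_norm (u (r n) - w)) ----> 0"
    by(rule palais_smale[OF u(1) R u(3) _ c1(2) u(4)]) (use c1(1) u(5) in \<open>simp_all add: DI\<close>)
  next
   show "us i : E" if "i < k" for i by(rule us(1)[OF that])
   show "EX i<k. E_norm (w - us i) = 0 | E_norm (w + us i) = 0" if "critical w" for w using no that by blast
   show "0 < E_norm (us i)" if "i < k" for i
   proof -
    have "E_norm (us i) ~= 0" using gform_le_norm[of "us i"] us(2)[OF that] by auto
    thus ?thesis using E_norm_ge_0[of "us i"] by simp
   qed
   show "0 < E_norm (us i - us j) & 0 < E_norm (us i + us j)" if "i < k" "j < k" "i ~= j" for i j by(rule us4[OF that])
  qed
  show False
  proof (rule too_few_critical_pairs[where n=m])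
   show "k <= m" using Suc.prems by simp
   show "ncont (SS m) h0" by(rule h0(1))
   show "0 < gform (h0 x) (h0 x)" if "x : SS m" for x by(rule h0(2)[OF that])
   show "h0 (%i. - x i) = - h0 x" if "x : SS m" for x by(rule h0(3)[OF that])
   show "I (t *R h0 x) <= c1" if "x : SS m" "0 < t" for x t using level[OF that] I_hom[OF ncont_E[OF h0(1) that(1)] that(2)] by simp
  qed
 qed
 then obtain w where w: "critical w" "!!i. i < k ==> E_norm (w - us i) ~= 0 & E_norm (w + us i) ~= 0" by blast
 have wE: "w : E" using w(1) by(simp add: critical_def)
 define vs where "vs = us(k := w)"
 have w1: "E_norm (w - us i) > 0" "E_norm (w + us i) > 0" "E_norm (us i - w) > 0" "E_norm (us i + w) > 0" if "i < k" for i
  using w(2)[OF that] E_norm_ge_0[of "w - us i"] E_norm_ge_0[of "w + us i"] N_minus_commute[OF wE us(1)[OF that]] by(auto simp: add.commute)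
 show ?case
 proof (intro exI[of _ vs] conjI allI impI)
  fix i assume i: "i < Suc k"
  show "vs i : E" "gform (vs i) (vs i) > 0" using i us(1,2)[of i] w(1) by(auto simp: vs_def critical_def less_Suc_eq)
  show "ALL v:E. DIf (vs i) v = 0" using i us(3)[of i] w(1) by(auto simp: vs_def critical_def less_Suc_eq DI)
  fix j assume j: "j < Suc k" "i ~= j"
  show "E_norm (vs i - vs j) > 0" "E_norm (vs i + vs j) > 0" using i j us4[of i j] w1[of i] w1[of j] by(auto simp: vs_def less_Suc_eq)
 qed
qed

end

theorem theorem1p1:
  fixes p :: real and g :: "real^3 \<Rightarrow> real"
  assumes "4 < p" and "p < 6"
    and "g \<in> Lp (6 / (6 - p))"
    and "\<forall>x. g x \<ge> 0"
    and "open {x. g x > 0}" and "{x. g x > 0} \<noteq> {}"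
  shows "\<forall>m::nat. \<exists>lam_m>0. \<forall>lam\<ge>lam_m. \<exists>u :: nat \<Rightarrow> real^3 \<Rightarrow> real.
           (\<forall>j\<in>{1..m}. is_solution p lam g (u j) \<and> is_solution p lam g (\<lambda>x. - u j x)
                        \<and> Phi p lam g (u j) > 0) \<and>
           (\<forall>i\<in>{1..m}. \<forall>j\<in>{1..m}. i \<noteq> j \<longrightarrow> \<not> same_pair (u i) (u j))"
proof (rule allI, goal_cases)
 case (1 m)
 obtain e :: "nat => fn" and V where eV: "ALL j. e j : test_functions" "ALL j x. e j x ~= 0 --> x : V j"
   "ALL j x. x : V j --> e j x > 0" "ALL j. open (V j)" "ALL j. V j ~= {}" "ALL j<=m. V j \<subseteq> {x. g x > 0}" "ALL i j. i ~= j --> V i \<inter> V j = {}"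
  using disjoint_bumps[OF assms(5,6), of m] by(elim exE conjE)
 note e = eV[rule_format]
 have eE: "e j : E" for j by(rule test_function_in_E[OF e(1)])
 interpret S: seminormed_carrier E E_norm by(rule seminormed_E)
 \<comment> \<open>Integrability against \<open>g\<close> is the same for every lambda; it is read
   off at lambda = 1, before the threshold is known.\<close>
 interpret one: schroedinger p 1 g using assms(1-4) by unfold_locales auto
 define ga where "ga j = LI (%x. g x * abs (e j x) powr p)" for j
 have gi: "integ (%x. g x * abs (u x) powr p)" if "u : E" for u using one.E_finite_G[OF that] by(simp add: power_finite_def one.W_def)
 have ga: "ga j > 0" if j: "j <= m" for j
 proof -
  have nn: "0 <= g x * abs (e j x) powr p" for x using assms(4) by simp
  have "ga j ~= 0"
  proof
   assume "ga j = 0"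
   hence "AE x in leb. g x * abs (e j x) powr p = 0" using integral_nonneg_eq_0_iff_AE[OF gi[OF eE]] nn by(simp add: ga_def)
   hence "AE x in leb. x ~: V j"
   proof eventually_elim
    case (elim x)
    show ?case
    proof
     assume "x : V j"
     hence "g x > 0" "e j x > 0" using e(6)[OF j] e(3) by auto
     thus False using elim by simp
    qed
   qed
   hence "V j : null_sets leb" using e(4)[of j] by(subst AE_iff_null_sets) auto
   hence "negligible (V j)" by(simp add: negligible_iff_null_sets)
   thus False using open_not_negligible[OF e(4) e(5)] by blast
  qed
  moreover have "ga j >= 0" unfolding ga_def using nn by(intro integral_nonneg_AE AE_I2) auto
  ultimately show ?thesis by simp
 qed
 define ga0 where "ga0 = Min (ga ` {..m})"
 have ga0: "ga0 > 0" "!!j. j <= m ==> ga0 <= ga j" unfolding ga0_def using ga by(auto simp: Min_gr_iff)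
 \<comment> \<open>Lower bound for the weighted integral on the whole sphere: a point of
   \<open>SS m\<close> has a coordinate of size at least 1 / (m + 1), and since the supports are
   disjoint that bump alone contributes at least \<open>ka\<close>.\<close>
 define ka where "ka = (1 / real (Suc m)) powr p * ga0"
 have ka: "ka > 0" using ga0 by(simp add: ka_def)
 define R where "R = (\<Sum>i\<le>m. E_norm (e i))"
 have R: "R >= 0" unfolding R_def by(intro sum_nonneg E_norm_ge_0)
 \<comment> \<open>Small enough for the smallness condition of \<open>palais_smale\<close> with M =
   4 c1 = 1 / 10000: 20 times 262144 divided by 10^8 is about 0.05.\<close>
 define c1 :: real where "c1 = 1 / 40000"
 have c1: "c1 > 0" "20 * 262144 * (4 * c1)^2 <= 1" by(simp_all add: c1_def power2_eq_square)
 obtain La where La: "La > 0" "!!lam t. lam >= La ==> t > 0 ==> R^2 * (t^2 / 2) + R ^ 4 * (t ^ 4 / 4) - lam * ka * (t powr p / p) <= c1"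
  using fibre_level_bound[OF R ka assms(1) c1(1)] by blast
 define h0 where "h0 x = (\<Sum>i\<le>m. x i *R e i)" for x :: "nat => real"
 have h0E: "h0 x : E" for x unfolding h0_def by(intro S.E_sum S.E_scale eE)
 have h0c: "S.ncont (SS m) h0"
  unfolding h0_def by(intro S.ncont_sum S.ncont_scale S.ncont_const eE continuous_on_subset[OF continuous_on_product_coordinates subset_UNIV])
 have h0odd: "h0 (%i. - x i) = - h0 x" for x by(simp add: h0_def sum_negf)
 have h0N: "E_norm (h0 x) <= R" if x: "x : SS m" for x
 proof -
  have "E_norm (h0 x) <= (\<Sum>i\<le>m. E_norm (x i *R e i))" unfolding h0_def by(intro S.N_sum_le S.E_scale eE)
  also have "... <= R" unfolding R_def
  proof (rule sum_mono)
   fix i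
   have "abs (x i) * E_norm (e i) <= 1 * E_norm (e i)" using SS_le1[OF x] E_norm_ge_0 by(intro mult_right_mono) auto
   thus "E_norm (x i *R e i) <= E_norm (e i)" by(simp add: S.N_scale[OF eE])
  qed
  finally show ?thesis .
 qed
 have h0g: "ka <= LI (%y. g y * abs (h0 x y) powr p)" if x: "x : SS m" for x
 proof -
  obtain j where j: "j <= m" "abs (x j) >= 1 / real (Suc m)"
  proof (rule ccontr)
   assume "~ thesis"
   hence small: "abs (x j) < 1 / real (Suc m)" if "j <= m" for j using that \<open>!!j. j <= m ==> 1 / real (Suc m) <= abs (x j) ==> thesis\<close> by force
   have "(x j)^2 < 1 / real (Suc m)" if "j <= m" for j
   proof -
    have "(x j)^2 = abs (x j) * abs (x j)" by(simp add: power2_eq_square)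
    also have "... <= 1 * abs (x j)" using SS_le1[OF x] by(intro mult_right_mono) auto
    finally show ?thesis using small[OF that] by linarith
   qed
   hence "(\<Sum>j\<le>m. (x j)^2) < (\<Sum>j\<le>m. 1 / real (Suc m))" by(intro sum_strict_mono) auto
   thus False using x by(simp add: SS_def)
  qed
  have "(1 / real (Suc m)) powr p * ga0 <= abs (x j) powr p * ga j" using j ga0 assms(1) by(intro mult_mono powr_mono2) auto
  also have "... = LI (%y. abs (x j) powr p * (g y * abs (e j y) powr p))" by(simp add: ga_def)
  also have "... <= LI (%y. g y * abs (h0 x y) powr p)"
  proof (rule integral_mono)
   show "integ (%y. abs (x j) powr p * (g y * abs (e j y) powr p))" using gi[OF eE, of j] by simp
   show "integ (%y. g y * abs (h0 x y) powr p)" by(rule gi[OF h0E])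
   fix y
   show "abs (x j) powr p * (g y * abs (e j y) powr p) <= g y * abs (h0 x y) powr p"
   proof (cases "e j y = 0")
    case True
    thus ?thesis using assms(4) by simp
   next
    case False
    hence "y : V j" using e(2) by blast
    hence z: "e i y = 0" if "i <= m" "i ~= j" for i using e(2)[of i y] e(7)[OF that(2)] by blast
    have "h0 x y = (\<Sum>i\<le>m. x i * e i y)"
    proof -
     have "(\<Sum>i\<in>A. x i *R e i) y = (\<Sum>i\<in>A. x i * e i y)" for A by(induction A rule: infinite_finite_induct) (auto simp: fun_ops(4))
     thus ?thesis by(simp add: h0_def)
    qed
    also have "... = (\<Sum>i\<in>{j}. x i * e i y)" by(rule sum.mono_neutral_right) (use j z in auto)
    finally have "abs (h0 x y) powr p = abs (x j) powr p * abs (e j y) powr p" by(simp add: abs_mult powr_mult)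
    thus ?thesis by(simp add: mult.left_commute)
   qed
  qed
  finally show ?thesis by(simp add: ka_def)
 qed
 show ?case
 proof (intro exI[of _ La] conjI allI impI La(1), goal_cases)
  case lam: (1 lam)
  interpret schroedinger p lam g using assms(1-4) lam La(1) by unfold_locales auto
  have gh0: "lam * ka <= gF (h0 x) (h0 x)" if "x : SS m" for x
  proof -
   have "gF (h0 x) (h0 x) = lam * LI (%y. g y * abs (h0 x y) powr p)" unfolding G.form_self W_def by(simp add: mult.assoc)
   thus ?thesis using h0g[OF that] lam_pos by simp
  qed
  \<comment> \<open>A positive subcritical term excludes a vanishing gradient, by
    \<open>sobolev_gF\<close>.\<close>
  have ah0: "gform (h0 x) (h0 x) > 0" if "x : SS m" for x
  proof -
   have "gF (h0 x) (h0 x) > 0" using gh0[OF that] lam_pos ka by(meson less_le_trans mult_pos_pos)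
   hence "gform (h0 x) (h0 x) ~= 0" using sobolev_gF[OF h0E, of x] by auto
   thus ?thesis using gform_nonneg[of "h0 x"] by simp
  qed
  have level: "gform (h0 x) (h0 x) * (t^2 / 2) + cform (h0 x) (h0 x) * (t ^ 4 / 4) - gF (h0 x) (h0 x) * (t powr p / p) - cF (h0 x) (h0 x) * (t ^ 6 / 6) <= c1"
   if x: "x : SS m" and t: "t > 0" for x t
  proof -
   have "gform (h0 x) (h0 x) <= R^2" using gform_le_norm[of "h0 x"] power_mono[OF h0N[OF x] E_norm_ge_0, of 2] by linarith
   hence 1: "gform (h0 x) (h0 x) * (t^2 / 2) <= R^2 * (t^2 / 2)" by(intro mult_right_mono) auto
   have "cform (h0 x) (h0 x) <= R ^ 4" using cform_le_norm[of "h0 x"] power_mono[OF h0N[OF x] E_norm_ge_0, of 4] by linarith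
   hence 2: "cform (h0 x) (h0 x) * (t ^ 4 / 4) <= R ^ 4 * (t ^ 4 / 4)" by(intro mult_right_mono) auto
   have 3: "lam * ka * (t powr p / p) <= gF (h0 x) (h0 x) * (t powr p / p)" using gh0[OF x] assms(1) by(intro mult_right_mono) auto
   have 4: "0 <= cF (h0 x) (h0 x) * (t ^ 6 / 6)" using cF_nonneg[of "h0 x"] t by(intro mult_nonneg_nonneg) auto
   show ?thesis using 1 2 3 4 La(2)[OF lam t] by linarith
  qed
  have "EX us :: nat => real^3 => real. (ALL i<m. us i : E & gform (us i) (us i) > 0 & (ALL v:E. DIf (us i) v = 0)) &
   (ALL i<m. ALL j<m. i ~= j --> E_norm (us i - us j) > 0 & E_norm (us i + us j) > 0)"
   by(rule enough_critical_points[OF h0c _ _ c1 _ order_refl]) (erule ah0, rule h0odd, erule (1) level)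
  then obtain us :: "nat => fn" where us': "ALL i<m. us i : E & gform (us i) (us i) > 0 & (ALL v:E. DIf (us i) v = 0)"
   "ALL i<m. ALL j<m. i ~= j --> E_norm (us i - us j) > 0 & E_norm (us i + us j) > 0" by(elim exE conjE)
  interpret N: nehari E E_norm gform cform gF cF p c1 KG by(rule nehari_E)
  have DI: "N.DI u v = DIf u v" for u v by(simp add: N.DI_def DIf_def)
  have sol: "is_solution p lam g (us i)" "is_solution p lam g (%x. - us i x)" "Phi p lam g (us i) > 0" if i: "i < m" for i
  proof -
   have u: "us i : E" "gform (us i) (us i) > 0" "!!v. v : E ==> DIf (us i) v = 0" using us'(1) i by auto
   show "is_solution p lam g (us i)" using u by(simp add: is_solution_iff)
   show "is_solution p lam g (%x. - us i x)" using u N.DI_odd[OF u(1)] E_uminus[OF u(1)] by(simp add: is_solution_iff DI fun_ops)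
   have Neh: "us i : N.Neh" using u by(simp add: N.Neh_def DI)
   have "Phi p lam g (us i) = gform (us i) (us i) / 4 + gF (us i) (us i) * (1 / 4 - 1 / p) + cF (us i) (us i) / 12" using N.Neh_I[OF Neh] by(simp add: Phi_eq N.I_def)
   moreover have "0 <= gF (us i) (us i) * (1 / 4 - 1 / p)" using G.form_nonneg[of "us i"] assms(1) by(intro mult_nonneg_nonneg) (auto simp: field_simps)
   ultimately show "Phi p lam g (us i) > 0" using u(2) cF_nonneg[of "us i"] by simp
  qed
  have dist: "~ same_pair (us i) (us j)" if ij: "i < m" "j < m" "i ~= j" for i j
  proof
   have u: "us i : E" "us j : E" using us'(1) ij by auto
   assume "same_pair (us i) (us j)"
   then consider "AE x in leb. us i x = us j x" | "AE x in leb. us i x = - us j x" by(auto simp: same_pair_def)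
   thus False
   proof cases
    case 1
    hence "AE x in leb. (us i - us j) x = 0" by eventually_elim simp
    thus False using E_norm_zero_of_AE[of "us i - us j"] S.E_diff[OF u] us'(2)[rule_format, OF ij] by simp
   next
    case 2
    hence "AE x in leb. (us i + us j) x = 0" by eventually_elim simp
    thus False using E_norm_zero_of_AE[of "us i + us j"] S.E_add[OF u] us'(2)[rule_format, OF ij] by simp
   qed
  qed
  show ?case
  proof (intro exI[of _ "%j. us (j - 1)"] conjI ballI impI)
   fix j assume j: "j : {1..m}"
   hence "j - 1 < m" by auto
   thus "is_solution p lam g (us (j - 1))" "is_solution p lam g (%x. - us (j - 1) x)" "Phi p lam g (us (j - 1)) > 0" by(rule sol)+
  next
   fix i j assume "i : {1..m}" "j : {1..m}" "i ~= j"
   thus "~ same_pair (us (i - 1)) (us (j - 1))" by(intro dist) auto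
  qed
 qed
qed

end
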